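(* Let $d\ge2$, $k\ge2$, and let $\mathcal T_h$ be a conforming triangulation of a polyhedral domain $\Omega\subset\mathbb R^d$. For $T\in\mathcal T_h$ let $$\Sigma_{k,\phi}^{\operatorname{div}}(T;\mathbb S)=\mathbb P_k(T;\mathbb S)\oplus\bigoplus_{\ell=0}^{d-2}\bigoplus_{f\in\Delta_\ell(T)}\mathbb B_k\Phi^f(\mathbb S)=\mathbb B_k(\operatorname{div},T;\mathbb S)\oplus\bigoplus_{\ell=0}^{d-1}\bigoplus_{f\in\Delta_\ell(T)}\big(\mathbb B_k\mathscr N^f(\mathbb S)\oplus\mathbb B_k\Phi^f(\mathbb S)\big),$$ and let $\Sigma_{k,\phi}^{\operatorname{div}}(\mathcal T_h;\mathbb S)=\{\boldsymbol\tau_h\in H(\operatorname{div},\Omega;\mathbb S):\boldsymbol\tau_h|_T\in\Sigma_{k,\phi}^{\operatorname{div}}(T;\mathbb S)\text{ for }T\in\mathcal T_h\}$. Then $$\dim\Sigma_{k,\phi}^{\operatorname{div}}(T;\mathbb S)=\tfrac12d(d+1)\binom{k+d}{d}+\tfrac12d(d+1)\binom{k+d-2}{d-2},$$ and the following degrees of freedom uniquely determine $\Sigma_{k,\phi}^{\operatorname{div}}(\mathcal T_h;\mathbb S)$: $$\int_F\boldsymbol\tau\boldsymbol n_F\cdot\boldsymbol q\,\mathrm ds,\quad F\in\Delta_{d-1}(\mathcal T_h),\ \boldsymbol q\in\mathbb P_k(F;\mathbb R^d);\qquad\int_T\boldsymbol\tau:\boldsymbol q\,\mathrm dx,\quad T\in\mathcal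 T_h,\ \boldsymbol q\in\mathbb P_{k-2}(T;\mathbb S).$$
   Context: $\mathbb S$: real symmetric $d\times d$ matrices; $\operatorname{sym}\boldsymbol\tau=(\boldsymbol\tau+\boldsymbol\tau^{\intercal})/2$. $H(\operatorname{div},D;\mathbb S)$: $L^2$ symmetric tensor fields with row-wise divergence in $L^2$; $H_0(\operatorname{div},D;\mathbb S)$: those with $\boldsymbol\tau\boldsymbol n|_{\partial D}=0$. $\Delta_\ell(\cdot)$: set of $\ell$-dimensional subsimplices; $\boldsymbol n_F$: fixed unit normal of a $(d-1)$-face $F$. $T$ has vertices $\texttt v_0,\dots,\texttt v_d$, barycenter $\texttt v_c$; $T_i$ is the simplex obtained from $T$ by replacing $\texttt v_i$ by $\texttt v_c$; $T^{\rm R}=\{T_0,\dots,T_d\}$. Subsimplices $f$ of $T$ are identified with subsets of $\{0,\dots,d\}$, $f^*=\{0,\dots,d\}\setminus f$, $f(0)$ is a fixed (say first) vertex of $f$. $\boldsymbol t_{i,j}=\texttt v_j-\texttt v_i$ for $i,j\in\{0,\dots,d,c\}$. $\mathscr T^f$ is the tangent space of $f$, $\mathscr N^f$ its orthogonal complement, $\mathscr N^f(\mathbb S)=\operatorname{sym}(\mathscr N^f\otimes\mathscr N^f)\oplus\operatorname{sym}(\mathscr T^f\otimes\mathscr N^f)$. $\lambda_i$: barycentric coordinates of $T$; $\lambda_i^{\rm R}$: continuous piecewise linear function on $T^{\rm R}$ with $\lambda_i^{\rm R}(\texttt v_j)=\delta_{ij}$ ($i,j\in\{0,\dots,d,c\}$).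 $\mathbb P_r(f)=\{0\}$ for $r<0$, $\mathbb P_r(f)=\mathbb R$ for a vertex $f$ and $r\ge0$. For $f\in\Delta_\ell(T)$: $\mathbb B_k\mathscr N^f(\mathbb S)=b_f\mathbb P_{k-\ell-1}(f)\otimes\mathscr N^f(\mathbb S)$, where $b_f=\prod_{i\in f}\lambda_i$ and $\mathbb P_r(f)$ is extended to $T$ as homogeneous polynomials of degree $r$ in $\lambda_i$, $i\in f$; and $\mathbb B_k\Phi^f(\mathbb S)=\mathbb P_{k-\ell-1}(f)\otimes\operatorname{span}\{b_f^{\rm R}\boldsymbol\phi^f_{ij}:i,j\in f^*,i<j\}$, where $b_f^{\rm R}=\prod_{i\in f}\lambda_i^{\rm R}$, $\mathbb P_r(f)$ is extended as homogeneous polynomials of degree $r$ in $\lambda_i^{\rm R}$, $i\in f$, and $$\boldsymbol\phi^f_{ij}=\chi_{T_i}\operatorname{sym}(\boldsymbol t_{f(0),c}\otimes\boldsymbol t_{f(0),j})-\chi_{T_j}\operatorname{sym}(\boldsymbol t_{f(0),c}\otimes\boldsymbol t_{f(0),i})$$ ($\chi$: characteristic function; $\mathbb B_k\Phi^F(\mathbb S)=\{0\}$ for $F\in\Delta_{d-1}(T)$). $\mathbb B_k(\operatorname{div},T;\mathbb S)=H_0(\operatorname{div},T;\mathbb S)\cap\mathbb P_k(T;\mathbb S)$. *)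

theory Defs
  imports "HOL-Analysis.Analysis" "HOL-Library.Function_Algebras"
begin

text \<open>The space dimension is \<open>d = CARD('n)\<close>; vectors have type \<open>real^'n\<close>, tensors have type
  \<open>real^'n^'n\<close>, whose inner product \<open>\<bullet>\<close> is the Frobenius product.\<close>

section \<open>Functions as a real vector space, direct sums\<close>

instantiation "fun" :: (type, real_vector) real_vector
begin

definition scaleR_fun :: "real \<Rightarrow> ('a \<Rightarrow> 'b) \<Rightarrow> 'a \<Rightarrow> 'b"
  where "scaleR_fun c f = (\<lambda>x. c *\<^sub>R f x)"

instance
  by standard (auto simp: scaleR_fun_def fun_eq_iff scaleR_add_right scaleR_add_left)

end

definition internal_direct_sum :: "'a::real_vector set \<Rightarrow> 'i set \<Rightarrow> ('i \<Rightarrow> 'a set) \<Rightarrow> bool"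
  where "internal_direct_sum W I V \<longleftrightarrow>
    (\<forall>i\<in>I. subspace (V i)) \<and>
    W = {\<Sum>i\<in>I. x i | x. \<forall>i\<in>I. x i \<in> V i} \<and>
    (\<forall>x. (\<forall>i\<in>I. x i \<in> V i) \<and> (\<Sum>i\<in>I. x i) = 0 \<longrightarrow> (\<forall>i\<in>I. x i = 0))"

section \<open>The spaces H(div)\<close>

primrec Ck :: "nat \<Rightarrow> (real^'n \<Rightarrow> real^'n) \<Rightarrow> bool"
  where
    "Ck 0 \<phi> \<longleftrightarrow> continuous_on UNIV \<phi>"
  | "Ck (Suc m) \<phi> \<longleftrightarrow> (\<forall>x. \<phi> differentiable (at x)) \<and>
       (\<forall>i. Ck m (\<lambda>x. frechet_derivative \<phi> (at x) (axis i 1)))"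

definition smooth :: "(real^'n \<Rightarrow> real^'n) \<Rightarrow> bool"
  where "smooth \<phi> \<longleftrightarrow> (\<forall>m. Ck m \<phi>)"

definition test_fun :: "(real^'n) set \<Rightarrow> (real^'n \<Rightarrow> real^'n) \<Rightarrow> bool"
  where "test_fun D \<phi> \<longleftrightarrow> smooth \<phi> \<and>
    compact (closure {x. \<phi> x \<noteq> 0}) \<and> closure {x. \<phi> x \<noteq> 0} \<subseteq> interior D"

definition L2_on :: "(real^'n) set \<Rightarrow> (real^'n \<Rightarrow> 'b::euclidean_space) \<Rightarrow> bool"
  where "L2_on D f \<longleftrightarrow> set_borel_measurable lebesgue D f \<and>
    set_integrable lebesgue D (\<lambda>x. (norm (f x))\<^sup>2)"

text \<open>Row-wise divergence in the sense of distributions; \<open>jacobian \<phi> (at x) $ i $ j\<close> is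
  the derivative of the component \<open>\<phi> $ i\<close> in direction \<open>j\<close>.\<close>

definition is_weak_div ::
    "(real^'n) set \<Rightarrow> (real^'n \<Rightarrow> real^'n^'n) \<Rightarrow> (real^'n \<Rightarrow> real^'n) \<Rightarrow> bool"
  where "is_weak_div D \<tau> g \<longleftrightarrow>
    (\<forall>\<phi>. test_fun D \<phi> \<longrightarrow>
      (LINT x:D|lebesgue. \<tau> x \<bullet> jacobian \<phi> (at x)) = - (LINT x:D|lebesgue. g x \<bullet> \<phi> x))"

definition Hdiv :: "(real^'n) set \<Rightarrow> (real^'n \<Rightarrow> real^'n^'n) set"
  where "Hdiv D = {\<tau>. L2_on D \<tau> \<and>
    (AE x in lebesgue. x \<in> D \<longrightarrow> transpose (\<tau> x) = \<tau> x) \<and>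
    (\<exists>g. L2_on D g \<and> is_weak_div D \<tau> g)}"

text \<open>The normal trace of a field in H(div) is the functional
  \<open>\<phi> \<mapsto> \<integral>\<^sub>D (\<tau> : \<nabla>\<phi> + div \<tau> \<cdot> \<phi>)\<close> on boundary values of \<open>\<phi>\<close>. On a bounded Lipschitz set (here: a
  simplex) the restrictions of smooth functions on the whole space are dense in \<open>H\<^sup>1\<close>, so the
  trace vanishes iff the functional vanishes on them. No support condition is put on \<open>\<phi>\<close>.\<close>

definition Hdiv0 :: "(real^'n) set \<Rightarrow> (real^'n \<Rightarrow> real^'n^'n) set"
  where "Hdiv0 D = {\<tau> \<in> Hdiv D.
    \<forall>g. L2_on D g \<and> is_weak_div D \<tau> g \<longrightarrow>
      (\<forall>\<phi>. smooth \<phi> \<longrightarrow>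
        (LINT x:D|lebesgue. \<tau> x \<bullet> jacobian \<phi> (at x) + g x \<bullet> \<phi> x) = 0)}"

section \<open>Tensors\<close>

definition outer :: "real^'n \<Rightarrow> real^'n \<Rightarrow> real^'n^'n"
  where "outer a b = (\<chi> i j. a $ i * b $ j)"

definition sym_part :: "real^'n^'n \<Rightarrow> real^'n^'n"
  where "sym_part \<tau> = (1/2) *\<^sub>R (\<tau> + transpose \<tau>)"

section \<open>The simplex and its barycentric (Alfeld) split\<close>

text \<open>A simplex \<open>T\<close> is given by an enumeration \<open>v 0, \<dots>, v d\<close> of its vertices; subsimplices are
  sets of indices.\<close>

definition simplex_hull :: "(nat \<Rightarrow> real^'n) \<Rightarrow> (real^'n) set"
  where "simplex_hull v = convex hull (v ` {..CARD('n)})"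

definition barycenter :: "(nat \<Rightarrow> real^'n) \<Rightarrow> real^'n"
  where "barycenter v = (1 / (real CARD('n) + 1)) *\<^sub>R (\<Sum>i\<le>CARD('n). v i)"

definition subT :: "(nat \<Rightarrow> real^'n) \<Rightarrow> nat \<Rightarrow> (real^'n) set"
  where "subT v i = simplex_hull (v(i := barycenter v))"

text \<open>Tensor fields on \<open>T\<close> that are piecewise polynomial on the split are elements of \<open>L\<^sup>2\<close>. Each
  class modulo null sets is represented by its member vanishing outside the union of the open
  subsimplices and continuous on each of them. For such representatives, equality almost everywhere
  is equality of functions, so that dimensions and direct sums may be computed for functions.
  Accordingly the characteristic functions below are those of the open subsimplices.\<close>

definition split_interior :: "(nat \<Rightarrow> real^'n) \<Rightarrow> (real^'n) set"
  where "split_interior v = (\<Union>i\<le>CARD('n). interior (subT v i))"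

definition on_split :: "(nat \<Rightarrow> real^'n) \<Rightarrow> (real^'n \<Rightarrow> 'b::real_vector) \<Rightarrow> real^'n \<Rightarrow> 'b"
  where "on_split v p = (\<lambda>x. indicat_real (split_interior v) x *\<^sub>R p x)"

definition subsimplices :: "nat \<Rightarrow> nat \<Rightarrow> nat set set"
  where "subsimplices d l = {f. f \<subseteq> {..d} \<and> card f = l + 1}"

definition tangent_space :: "(nat \<Rightarrow> real^'n) \<Rightarrow> nat set \<Rightarrow> (real^'n) set"
  where "tangent_space v f = span {v j - v i | i j. i \<in> f \<and> j \<in> f}"

definition normal_space :: "(nat \<Rightarrow> real^'n) \<Rightarrow> nat set \<Rightarrow> (real^'n) set"
  where "normal_space v f = orthogonal_comp (tangent_space v f)"

definition normal_tensors :: "(nat \<Rightarrow> real^'n) \<Rightarrow> nat set \<Rightarrow> (real^'n^'n) set"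
  where "normal_tensors v f = span
    ({sym_part (outer a b) | a b. a \<in> normal_space v f \<and> b \<in> normal_space v f} \<union>
     {sym_part (outer a b) | a b. a \<in> tangent_space v f \<and> b \<in> normal_space v f})"

definition affine_fun :: "(real^'n \<Rightarrow> real) \<Rightarrow> bool"
  where "affine_fun g \<longleftrightarrow> (\<exists>a b. \<forall>x. g x = a \<bullet> x + b)"

definition bary :: "(nat \<Rightarrow> real^'n) \<Rightarrow> nat \<Rightarrow> real^'n \<Rightarrow> real"
  where "bary v i = (THE g. affine_fun g \<and> (\<forall>j\<le>CARD('n). g (v j) = (if j = i then 1 else 0)))"

text \<open>\<open>baryR v i\<close> is \<open>\<lambda>\<^sub>i\<^sup>R\<close> for \<open>i \<le> d\<close>, extended by zero outside \<open>T\<close>; the function belonging to the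
  barycenter is not needed.\<close>

definition baryR :: "(nat \<Rightarrow> real^'n) \<Rightarrow> nat \<Rightarrow> real^'n \<Rightarrow> real"
  where "baryR v i = (THE g. continuous_on (simplex_hull v) g \<and>
    (\<forall>l\<le>CARD('n). \<exists>a. affine_fun a \<and> (\<forall>x\<in>subT v l. g x = a x)) \<and>
    (\<forall>j\<le>CARD('n). g (v j) = (if j = i then 1 else 0)) \<and> g (barycenter v) = 0 \<and>
    (\<forall>x. x \<notin> simplex_hull v \<longrightarrow> g x = 0))"

section \<open>Polynomial and bubble spaces\<close>

definition polys :: "nat \<Rightarrow> (real^'n \<Rightarrow> real) set"
  where "polys r = span {\<lambda>x. \<Prod>i\<in>UNIV. (x $ i) ^ (\<alpha> i) | \<alpha>. (\<Sum>i\<in>UNIV. \<alpha> i) \<le> r}"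

definition poly_sym :: "(nat \<Rightarrow> real^'n) \<Rightarrow> nat \<Rightarrow> (real^'n \<Rightarrow> real^'n^'n) set"
  where "poly_sym v r = {on_split v p | p.
    (\<forall>i j. (\<lambda>x. p x $ i $ j) \<in> polys r) \<and> (\<forall>x. transpose (p x) = p x)}"

definition poly_vec_on :: "(real^'n) set \<Rightarrow> nat \<Rightarrow> (real^'n \<Rightarrow> real^'n) set"
  where "poly_vec_on F r = {(\<lambda>x. indicat_real F x *\<^sub>R q x) | q. \<forall>i. (\<lambda>x. q x $ i) \<in> polys r}"

text \<open>\<open>\<P>\<^sub>r(f)\<close> extended as homogeneous polynomials of degree \<open>r\<close> in \<open>lam i\<close>, \<open>i \<in> f\<close>. The degree is
  an integer: for \<open>r < 0\<close> there are no generators and the space is \<open>{0}\<close>.\<close>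

definition hom_polys :: "int \<Rightarrow> nat set \<Rightarrow> (nat \<Rightarrow> real^'n \<Rightarrow> real) \<Rightarrow> (real^'n \<Rightarrow> real) set"
  where "hom_polys r f lam = span {\<lambda>x. \<Prod>i\<in>f. lam i x ^ (\<alpha> i) | \<alpha>. int (\<Sum>i\<in>f. \<alpha> i) = r}"

text \<open>For \<open>f\<close> of dimension \<open>l\<close> we have \<open>k - l - 1 = k - card f\<close>.\<close>

definition bubble_normal :: "(nat \<Rightarrow> real^'n) \<Rightarrow> nat \<Rightarrow> nat set \<Rightarrow> (real^'n \<Rightarrow> real^'n^'n) set"
  where "bubble_normal v k f = span {on_split v (\<lambda>x. ((\<Prod>i\<in>f. bary v i x) * p x) *\<^sub>R N) | p N.
    p \<in> hom_polys (int k - int (card f)) f (bary v) \<and> N \<in> normal_tensors v f}"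

text \<open>The argument \<open>m\<close> is the index \<open>f(0)\<close> of the chosen vertex of \<open>f\<close>.\<close>

definition phi :: "(nat \<Rightarrow> real^'n) \<Rightarrow> nat \<Rightarrow> nat \<Rightarrow> nat \<Rightarrow> real^'n \<Rightarrow> real^'n^'n"
  where "phi v m i j = (\<lambda>x.
    indicat_real (interior (subT v i)) x *\<^sub>R sym_part (outer (barycenter v - v m) (v j - v m)) -
    indicat_real (interior (subT v j)) x *\<^sub>R sym_part (outer (barycenter v - v m) (v i - v m)))"

definition bubble_phi ::
    "(nat \<Rightarrow> real^'n) \<Rightarrow> (nat set \<Rightarrow> nat) \<Rightarrow> nat \<Rightarrow> nat set \<Rightarrow> (real^'n \<Rightarrow> real^'n^'n) set"
  where "bubble_phi v base k f = span {(\<lambda>x. p x *\<^sub>R \<psi> x) | p \<psi>.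
    p \<in> hom_polys (int k - int (card f)) f (baryR v) \<and>
    \<psi> \<in> span {(\<lambda>x. (\<Prod>m\<in>f. baryR v m x) *\<^sub>R phi v (base f) i j x) | i j.
      i \<in> {..CARD('n)} - f \<and> j \<in> {..CARD('n)} - f \<and> i < j}}"

definition bubble_div :: "(nat \<Rightarrow> real^'n) \<Rightarrow> nat \<Rightarrow> (real^'n \<Rightarrow> real^'n^'n) set"
  where "bubble_div v k = Hdiv0 (simplex_hull v) \<inter> poly_sym v k"

section \<open>The finite element space\<close>

definition Sigma_loc ::
    "(nat \<Rightarrow> real^'n) \<Rightarrow> (nat set \<Rightarrow> nat) \<Rightarrow> nat \<Rightarrow> (real^'n \<Rightarrow> real^'n^'n) set"
  where "Sigma_loc v base k = span (poly_sym v k \<union>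
    (\<Union>l\<in>{0..CARD('n) - 2}. \<Union>f\<in>subsimplices CARD('n) l. bubble_phi v base k f))"

datatype summand = Bulk | Normal "nat set" | Phi "nat set"

definition polyhedral_domain :: "(real^'n) set \<Rightarrow> bool"
  where "polyhedral_domain \<Omega> \<longleftrightarrow> open \<Omega> \<and> connected \<Omega> \<and> \<Omega> \<noteq> {} \<and> interior (closure \<Omega>) = \<Omega> \<and>
    (\<exists>\<P>. finite \<P> \<and> (\<forall>P\<in>\<P>. polytope P) \<and> closure \<Omega> = \<Union>\<P>)"

text \<open>The library notion \<^const>\<open>triangulation\<close> contains conformity: two elements meet in a common
  face.\<close>

definition triangulates :: "(real^'n) set set \<Rightarrow> (real^'n) set \<Rightarrow> bool"
  where "triangulates \<T> \<Omega> \<longleftrightarrow>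
    triangulation \<T> \<and> (\<forall>T\<in>\<T>. int CARD('n) simplex T) \<and> \<Union>\<T> = closure \<Omega>"

definition mesh_facets :: "(real^'n) set set \<Rightarrow> (real^'n) set set"
  where "mesh_facets \<T> = {F. \<exists>T\<in>\<T>. F facet_of T}"

definition Sigma_glob ::
    "(real^'n) set \<Rightarrow> (real^'n) set set \<Rightarrow> ((real^'n) set \<Rightarrow> nat \<Rightarrow> real^'n) \<Rightarrow>
     ((real^'n) set \<Rightarrow> nat set \<Rightarrow> nat) \<Rightarrow> nat \<Rightarrow> (real^'n \<Rightarrow> real^'n^'n) set"
  where "Sigma_glob \<Omega> \<T> v base k = {\<tau> \<in> Hdiv \<Omega>.
    \<forall>T\<in>\<T>. \<exists>\<sigma>\<in>Sigma_loc (v T) (base T) k. AE x in lebesgue. x \<in> T \<longrightarrow> \<tau> x = \<sigma> x}"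

section \<open>Degrees of freedom\<close>

definition unit_normal :: "(real^'n) set \<Rightarrow> real^'n \<Rightarrow> bool"
  where "unit_normal F n \<longleftrightarrow> norm n = 1 \<and> (\<forall>x\<in>F. \<forall>y\<in>F. n \<bullet> (x - y) = 0)"

text \<open>Integral over a flat \<open>(d-1)\<close>-dimensional set \<open>F\<close> with unit normal \<open>n\<close>: the surface measure on
  \<open>F\<close> is the image of Lebesgue measure on the right prism of height 1 over \<open>F\<close> under orthogonal
  projection to the hyperplane of \<open>F\<close>.\<close>

definition facet_integral :: "(real^'n) set \<Rightarrow> real^'n \<Rightarrow> (real^'n \<Rightarrow> real) \<Rightarrow> real"
  where "facet_integral F n g = (let p = (SOME p. p \<in> F) in
    LINT x:{y + t *\<^sub>R n | y t. y \<in> F \<and> 0 \<le> t \<and> t \<le> 1}|lebesgue. g (x - ((x - p) \<bullet> n) *\<^sub>R n))"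

text \<open>The trace of \<open>\<tau> n\<close> at \<open>x\<close> as the limit of averages over small balls intersected with \<open>\<Omega>\<close>. It
  does not depend on values of \<open>\<tau>\<close> on null sets, it is the ordinary one-sided trace on boundary
  facets, and on interior facets, where \<open>\<tau> n\<close> has the same trace from both sides for
  \<open>\<tau>\<close> piecewise polynomial in H(div), it is that common value.\<close>

definition normal_trace ::
    "(real^'n) set \<Rightarrow> (real^'n \<Rightarrow> real^'n^'n) \<Rightarrow> real^'n \<Rightarrow> real^'n \<Rightarrow> real^'n"
  where "normal_trace \<Omega> \<tau> n x = Lim (at_right 0) (\<lambda>r.
    (1 / measure lebesgue (ball x r \<inter> \<Omega>)) *\<^sub>R (LINT y:ball x r \<inter> \<Omega>|lebesgue. \<tau> y *v n))"

text \<open>\<open>\<tau>\<close> takes the prescribed values \<open>\<nu>\<close>, \<open>\<mu>\<close> of the degrees of freedom. A linear functional on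
  \<open>\<P>\<^sub>k(F;\<real>\<^sup>d)\<close> or \<open>\<P>\<^bsub>k-2\<^esub>(T;\<S>)\<close> is given by a linear functional on all functions, of which only the
  restriction to that subspace matters.\<close>

definition has_dofs ::
    "(real^'n) set \<Rightarrow> (real^'n) set set \<Rightarrow> ((real^'n) set \<Rightarrow> nat \<Rightarrow> real^'n) \<Rightarrow>
     ((real^'n) set \<Rightarrow> real^'n) \<Rightarrow> nat \<Rightarrow>
     ((real^'n) set \<Rightarrow> (real^'n \<Rightarrow> real^'n) \<Rightarrow> real) \<Rightarrow>
     ((real^'n) set \<Rightarrow> (real^'n \<Rightarrow> real^'n^'n) \<Rightarrow> real) \<Rightarrow> (real^'n \<Rightarrow> real^'n^'n) \<Rightarrow> bool"
  where "has_dofs \<Omega> \<T> v n k \<nu> \<mu> \<tau> \<longleftrightarrow>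
    (\<forall>F\<in>mesh_facets \<T>. \<forall>q\<in>poly_vec_on F k.
       facet_integral F (n F) (\<lambda>x. normal_trace \<Omega> \<tau> (n F) x \<bullet> q x) = \<nu> F q) \<and>
    (\<forall>T\<in>\<T>. \<forall>q\<in>poly_sym (v T) (k - 2). (LINT x:T|lebesgue. \<tau> x \<bullet> q x) = \<mu> T q)"

end

theory Submission
  imports Defs
begin

text \<open>Symmetric tensors have the basis \<open>t\<^sub>p \<otimes> t\<^sub>p\<close>, \<open>p\<close> an edge of \<open>T\<close>, which is dual to the tensors
  \<open>- sym (\<nabla>\<lambda>\<^sub>i \<otimes> \<nabla>\<lambda>\<^sub>j)\<close>. Hence the local space is spanned by the fields \<open>\<lambda>\<^sup>\<alpha> t\<^sub>p \<otimes> t\<^sub>p\<close> with \<open>|\<alpha>| = k\<close> and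
  the bubbles \<open>\<phi>\<close>. On the facet opposite to \<open>v\<^sub>i\<close> the component of \<open>\<tau> \<nabla>\<lambda>\<^sub>i\<close> along \<open>\<nabla>\<lambda>\<^sub>j\<close> involves only
  the edge \<open>p = {i, j}\<close> of the first family. For \<open>\<alpha>\<close> with \<open>\<alpha>\<^sub>i = \<alpha>\<^sub>j = 0\<close> a single field therefore serves both
  \<open>(i, j)\<close> and \<open>(j, i)\<close>, and polynomial fields give these two coefficients only equal values. The bubbles of the
  face \<open>supp \<alpha>\<close> supply the antisymmetric part. Consequently the normal trace is onto
  all facet polynomials of degree \<open>k\<close>, and its kernel consists of the fields
  \<open>\<Sum>\<^sub>p \<lambda>\<^sub>i \<lambda>\<^sub>j q\<^sub>p t\<^sub>p \<otimes> t\<^sub>p\<close> with \<open>q\<^sub>p\<close> of degree \<open>k - 2\<close>, which are determined by their moments because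
  \<open>\<lambda>\<^sub>i \<lambda>\<^sub>j > 0\<close>. Globally, membership in H(div) means that the normal traces of neighbours agree on
  common facets, so the degrees of freedom decouple.\<close>

text \<open>All integration by parts rests on Fubini in one direction: along lines parallel to an
  edge \<open>v i - v 0\<close> the fundamental theorem of calculus leaves terms on two facets, and
  since these edges and the gradients of the coordinates are dual bases, the terms add up to Gauss's
  theorem. Facet integrals are divided by the length of the gradient that serves as normal. On a
  common facet the gradients of two neighbours are negative multiples of each other, so their terms
  are then exactly opposite. A weak divergence is compared with the piecewise one by testing with a
  smooth field times a cutoff; the same cutoff stands on both sides and tends to 1 without any bound
  on its gradient. Traces are localised by testing with the trace itself times a weight that
  vanishes on the other facets. Solvability comes from explicit preimages: facet data are
  represented by polynomials through a definite bilinear form, and for the moments the operator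
  \<open>Aop\<close> maps degree k - 2 onto the trace-free polynomial fields and pairs positively
  with its argument.\<close>

abbreviation slab :: "'a::euclidean_space \<Rightarrow> real \<Rightarrow> 'a set"
  where "slab n b \<equiv> {x. 0 \<le> n \<bullet> x + b \<and> n \<bullet> x + b \<le> 1}"

section \<open>Fubini along one direction\<close>

lemma nn_integral_lborel_translate:
  fixes h :: "'a::euclidean_space \<Rightarrow> ennreal"
  assumes [measurable]: "h \<in> borel_measurable borel"
  shows "(\<integral>\<^sup>+x. h (x + c) \<partial>lborel) = (\<integral>\<^sup>+x. h x \<partial>lborel)"
proof -
  have "(\<integral>\<^sup>+x. h x \<partial>lborel) = (\<integral>\<^sup>+x. h x \<partial>(distr lborel borel ((+) c)))"
    by (simp add: lborel_distr_plus)
  also have "\<dots> = (\<integral>\<^sup>+x. h (c + x) \<partial>lborel)"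
    by (subst nn_integral_distr) auto
  finally show ?thesis by (simp add: add.commute)
qed

lemma integral_lborel_translate:
  fixes h :: "'a::euclidean_space \<Rightarrow> real"
  assumes [measurable]: "h \<in> borel_measurable borel"
  shows "(\<integral>x. h (x + c) \<partial>lborel) = (\<integral>x. h x \<partial>lborel)"
proof -
  have "(\<integral>x. h x \<partial>lborel) = (\<integral>x. h x \<partial>(distr lborel borel ((+) c)))"
    by (simp add: lborel_distr_plus)
  also have "\<dots> = (\<integral>x. h (c + x) \<partial>lborel)"
    by (subst integral_distr) auto
  finally show ?thesis by (simp add: add.commute)
qed

lemma slab_times:
  fixes n e :: "'a::euclidean_space"
  assumes ne: "n \<bullet> e = 1"
  shows "{t. y - t *\<^sub>R e \<in> slab n b} = {n \<bullet> y + b - 1 .. n \<bullet> y + b}"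
  using ne by (auto simp: inner_diff_right)

text \<open>Fubini along lines of direction \<open>e\<close> without choosing coordinates: the sections are averaged
  over the slab, which every such line crosses in an interval of length 1.\<close>

lemma nn_integral_slab:
  fixes n e :: "'a::euclidean_space" and h :: "'a \<Rightarrow> ennreal"
  assumes [measurable]: "h \<in> borel_measurable borel" and ne: "n \<bullet> e = 1"
  shows "(\<integral>\<^sup>+x. indicator (slab n b) x * (\<integral>\<^sup>+t. h (x + t *\<^sub>R e) \<partial>lborel) \<partial>lborel) = (\<integral>\<^sup>+x. h x \<partial>lborel)"
proof -
  have "(\<integral>\<^sup>+x. indicator (slab n b) x * (\<integral>\<^sup>+t. h (x + t *\<^sub>R e) \<partial>lborel) \<partial>lborel)
     = (\<integral>\<^sup>+x. (\<integral>\<^sup>+t. indicator (slab n b) x * h (x + t *\<^sub>R e) \<partial>lborel) \<partial>lborel)"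
    by (simp add: nn_integral_cmult)
  also have "\<dots> = (\<integral>\<^sup>+t. (\<integral>\<^sup>+x. indicator (slab n b) x * h (x + t *\<^sub>R e) \<partial>lborel) \<partial>(lborel::real measure))"
    by (rule lborel_pair.Fubini'[symmetric]) measurable
  \<comment> \<open>For fixed t, substituting y = x + t e moves the shift from \<open>h\<close> into
    the indicator.\<close>
  also have "\<dots> = (\<integral>\<^sup>+t. (\<integral>\<^sup>+y. indicator (slab n b) (y - t *\<^sub>R e) * h y \<partial>lborel) \<partial>lborel)"
  proof (rule nn_integral_cong)
    fix t :: real
    have "(\<integral>\<^sup>+x. indicator (slab n b) x * h (x + t *\<^sub>R e) \<partial>lborel)
      = (\<integral>\<^sup>+x. (\<lambda>y. indicator (slab n b) (y - t *\<^sub>R e) * h y) (x + t *\<^sub>R e) \<partial>lborel)" by simp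
    also have "\<dots> = (\<integral>\<^sup>+y. indicator (slab n b) (y - t *\<^sub>R e) * h y \<partial>lborel)"
      by (rule nn_integral_lborel_translate) measurable
    finally show "(\<integral>\<^sup>+x. indicator (slab n b) x * h (x + t *\<^sub>R e) \<partial>lborel)
      = (\<integral>\<^sup>+y. indicator (slab n b) (y - t *\<^sub>R e) * h y \<partial>lborel)" .
  qed
  also have "\<dots> = (\<integral>\<^sup>+y. (\<integral>\<^sup>+t. indicator (slab n b) (y - t *\<^sub>R e) * h y \<partial>(lborel::real measure)) \<partial>lborel)"
    by (rule lborel_pair.Fubini') measurable
  also have "\<dots> = (\<integral>\<^sup>+y. h y \<partial>lborel)"
  proof (rule nn_integral_cong)
    fix y
    have "(\<integral>\<^sup>+t. indicator (slab n b) (y - t *\<^sub>R e) * h y \<partial>(lborel::real measure))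
      = (\<integral>\<^sup>+t. indicator {t. y - t *\<^sub>R e \<in> slab n b} t * h y \<partial>(lborel::real measure))"
      by (intro nn_integral_cong) (auto simp: indicator_def)
    also have "\<dots> = h y"
      unfolding slab_times[OF ne] by (subst nn_integral_multc) (auto simp: emeasure_lborel_Icc)
    finally show "(\<integral>\<^sup>+t. indicator (slab n b) (y - t *\<^sub>R e) * h y \<partial>(lborel::real measure)) = h y" .
  qed
  finally show ?thesis .
qed

text \<open>Exchanging the integrals needs integrability on the product space, once for each of the
  two forms \<open>?f\<close> and \<open>?g\<close> of the integrand related by y = x + t e. The
  first follows from \<open>nn_integral_slab\<close> for |h|, the second from the unit length of the
  sections.\<close>

lemma integral_slab:
  fixes n e :: "'a::euclidean_space" and h :: "'a \<Rightarrow> real"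
  assumes h: "integrable lborel h" and ne: "n \<bullet> e = 1"
  shows "(\<integral>x. indicator (slab n b) x * (\<integral>t. h (x + t *\<^sub>R e) \<partial>lborel) \<partial>lborel) = (\<integral>x. h x \<partial>lborel)"
proof -
  have hm [measurable]: "h \<in> borel_measurable borel" using h by auto
  have fin: "(\<integral>\<^sup>+x. ennreal (norm (h x)) \<partial>lborel) < \<infinity>"
    using h by (simp add: integrable_iff_bounded)
  let ?f = "\<lambda>(x, t). indicator (slab n b) x * h (x + t *\<^sub>R e)"
  let ?g = "\<lambda>(y, t). indicator (slab n b) (y - t *\<^sub>R e) * h y"
  have If: "integrable (lborel \<Otimes>\<^sub>M (lborel :: real measure)) ?f"
  proof (rule integrableI_bounded)
    show "?f \<in> borel_measurable (lborel \<Otimes>\<^sub>M lborel)" by measurable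
    have "(\<integral>\<^sup>+p. ennreal (norm (?f p)) \<partial>(lborel \<Otimes>\<^sub>M lborel))
       = (\<integral>\<^sup>+x. (\<integral>\<^sup>+t. ennreal (norm (?f (x, t))) \<partial>lborel) \<partial>lborel)"
      by (rule lborel.nn_integral_fst[symmetric]) measurable
    also have "\<dots> = (\<integral>\<^sup>+x. indicator (slab n b) x * (\<integral>\<^sup>+t. ennreal (norm (h (x + t *\<^sub>R e))) \<partial>lborel) \<partial>lborel)"
      by (intro nn_integral_cong) (auto simp: indicator_def)
    also have "\<dots> = (\<integral>\<^sup>+x. ennreal (norm (h x)) \<partial>lborel)"
      by (rule nn_integral_slab[OF _ ne]) measurable
    finally show "(\<integral>\<^sup>+p. ennreal (norm (?f p)) \<partial>(lborel \<Otimes>\<^sub>M lborel)) < \<infinity>" using fin by simp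
  qed
  have gsec: "(\<integral>\<^sup>+t. ennreal (norm (?g (y, t))) \<partial>lborel) = ennreal (norm (h y))" for y
  proof -
    have "(\<integral>\<^sup>+t. ennreal (norm (?g (y, t))) \<partial>lborel)
      = (\<integral>\<^sup>+t. indicator {t. y - t *\<^sub>R e \<in> slab n b} t * ennreal (norm (h y)) \<partial>(lborel::real measure))"
      by (intro nn_integral_cong) (auto simp: indicator_def)
    also have "\<dots> = ennreal (norm (h y))"
      unfolding slab_times[OF ne] by (subst nn_integral_multc) (auto simp: emeasure_lborel_Icc)
    finally show ?thesis .
  qed
  have Ig: "integrable (lborel \<Otimes>\<^sub>M (lborel :: real measure)) ?g"
  proof (rule integrableI_bounded)
    show "?g \<in> borel_measurable (lborel \<Otimes>\<^sub>M lborel)" by measurable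
    have "(\<integral>\<^sup>+p. ennreal (norm (?g p)) \<partial>(lborel \<Otimes>\<^sub>M lborel))
       = (\<integral>\<^sup>+x. (\<integral>\<^sup>+t. ennreal (norm (?g (x, t))) \<partial>lborel) \<partial>lborel)"
      by (rule lborel.nn_integral_fst[symmetric]) measurable
    also have "\<dots> = (\<integral>\<^sup>+x. ennreal (norm (h x)) \<partial>lborel)" by (simp only: gsec)
    finally show "(\<integral>\<^sup>+p. ennreal (norm (?g p)) \<partial>(lborel \<Otimes>\<^sub>M lborel)) < \<infinity>" using fin by simp
  qed
  have "(\<integral>x. indicator (slab n b) x * (\<integral>t. h (x + t *\<^sub>R e) \<partial>lborel) \<partial>lborel)
     = (\<integral>x. (\<integral>t. indicator (slab n b) x * h (x + t *\<^sub>R e) \<partial>lborel) \<partial>lborel)"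
    by simp
  also have "\<dots> = (\<integral>t. (\<integral>x. indicator (slab n b) x * h (x + t *\<^sub>R e) \<partial>lborel) \<partial>(lborel::real measure))"
    by (rule lborel_pair.Fubini_integral[symmetric]) (use If in simp)
  also have "\<dots> = (\<integral>t. (\<integral>y. indicator (slab n b) (y - t *\<^sub>R e) * h y \<partial>lborel) \<partial>lborel)"
  proof (rule Bochner_Integration.integral_cong[OF refl])
    fix t :: real
    have "(\<integral>x. indicator (slab n b) x * h (x + t *\<^sub>R e) \<partial>lborel)
      = (\<integral>x. (\<lambda>y. indicator (slab n b) (y - t *\<^sub>R e) * h y) (x + t *\<^sub>R e) \<partial>lborel)" by simp
    also have "\<dots> = (\<integral>y. indicator (slab n b) (y - t *\<^sub>R e) * h y \<partial>lborel)"
      by (rule integral_lborel_translate) measurable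
    finally show "(\<integral>x. indicator (slab n b) x * h (x + t *\<^sub>R e) \<partial>lborel)
      = (\<integral>y. indicator (slab n b) (y - t *\<^sub>R e) * h y \<partial>lborel)" .
  qed
  also have "\<dots> = (\<integral>y. (\<integral>t. indicator (slab n b) (y - t *\<^sub>R e) * h y \<partial>(lborel::real measure)) \<partial>lborel)"
    by (rule lborel_pair.Fubini_integral) (use Ig in simp)
  also have "\<dots> = (\<integral>y. h y \<partial>lborel)"
  proof (rule Bochner_Integration.integral_cong[OF refl])
    fix y
    have "(\<integral>t. indicator (slab n b) (y - t *\<^sub>R e) * h y \<partial>(lborel::real measure))
      = (\<integral>t. indicator {t. y - t *\<^sub>R e \<in> slab n b} t * h y \<partial>(lborel::real measure))"
      by (intro Bochner_Integration.integral_cong) (auto simp: indicator_def)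
    also have "\<dots> = h y"
      unfolding slab_times[OF ne] by simp
    finally show "(\<integral>t. indicator (slab n b) (y - t *\<^sub>R e) * h y \<partial>(lborel::real measure)) = h y" .
  qed
  finally show ?thesis .
qed

text \<open>On every line of direction \<open>w\<close> the shift \<open>n \<bullet> z + b\<close>
  is constant because \<open>n \<bullet> w = 0\<close>, so the map translates each such line within
  itself. Fubini in direction \<open>w\<close> reduces the claim to translation invariance on the
  real line.\<close>

lemma distr_lborel_shear:
  fixes n w :: "'a::euclidean_space"
  assumes nw: "n \<bullet> w = 0"
  shows "distr lborel borel (\<lambda>z. z + (n \<bullet> z + b) *\<^sub>R w) = lborel"
proof (cases "w = 0")
  case True
  have "distr lborel borel (\<lambda>z::'a. z) = distr lborel lborel (\<lambda>z. z)"
    by (intro distr_cong) auto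
  then show ?thesis using True by (simp add: distr_id2)
next
  case False
  \<comment> \<open>Dual to \<open>w\<close>, so that lines of direction \<open>w\<close> cross the
    slab of \<open>m\<close> in unit length.\<close>
  define m where "m = (1 / (w \<bullet> w)) *\<^sub>R w"
  have mw: "m \<bullet> w = 1" using False by (simp add: m_def)
  show ?thesis
  proof (rule measure_eqI)
    fix A :: "'a set" assume "A \<in> sets (distr lborel borel (\<lambda>z. z + (n \<bullet> z + b) *\<^sub>R w))"
    then have A [measurable]: "A \<in> sets borel" by simp
    have "emeasure (distr lborel borel (\<lambda>z. z + (n \<bullet> z + b) *\<^sub>R w)) A
       = (\<integral>\<^sup>+x. indicator A x \<partial>distr lborel borel (\<lambda>z. z + (n \<bullet> z + b) *\<^sub>R w))"
      by (subst nn_integral_indicator) auto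
    also have "\<dots> = (\<integral>\<^sup>+z. indicator A (z + (n \<bullet> z + b) *\<^sub>R w) \<partial>lborel)"
      by (subst nn_integral_distr) auto
    also have "\<dots> = (\<integral>\<^sup>+z. indicator (slab m 0) z *
        (\<integral>\<^sup>+t. indicator A (z + t *\<^sub>R w + (n \<bullet> (z + t *\<^sub>R w) + b) *\<^sub>R w) \<partial>lborel) \<partial>lborel)"
      by (rule nn_integral_slab[OF _ mw, symmetric]) measurable
    also have "\<dots> = (\<integral>\<^sup>+z. indicator (slab m 0) z * (\<integral>\<^sup>+t. indicator A (z + t *\<^sub>R w) \<partial>lborel) \<partial>lborel)"
    proof (rule nn_integral_cong)
      fix z
      have "(\<integral>\<^sup>+t. indicator A (z + t *\<^sub>R w + (n \<bullet> (z + t *\<^sub>R w) + b) *\<^sub>R w) \<partial>lborel)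
         = (\<integral>\<^sup>+t. (\<lambda>t. indicator A (z + t *\<^sub>R w)) (t + (n \<bullet> z + b)) \<partial>lborel)"
        using nw by (simp add: inner_add_right algebra_simps)
      also have "\<dots> = (\<integral>\<^sup>+t. indicator A (z + t *\<^sub>R w) \<partial>lborel)"
        by (rule nn_integral_lborel_translate) measurable
      finally show "indicator (slab m 0) z *
         (\<integral>\<^sup>+t. indicator A (z + t *\<^sub>R w + (n \<bullet> (z + t *\<^sub>R w) + b) *\<^sub>R w) \<partial>lborel)
        = indicator (slab m 0) z * (\<integral>\<^sup>+t. indicator A (z + t *\<^sub>R w) \<partial>lborel)" by simp
    qed
    also have "\<dots> = (\<integral>\<^sup>+z. indicator A z \<partial>lborel)"
      by (rule nn_integral_slab[OF _ mw]) measurable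
    finally show "emeasure (distr lborel borel (\<lambda>z. z + (n \<bullet> z + b) *\<^sub>R w)) A = emeasure lborel A"
      by simp
  qed simp
qed

text \<open>A line of direction \<open>e\<close> meets the slab of n' in an interval of length 1 /
  |c|, and \<open>u\<close> is constant on it. For such integrands one slab can be traded for
  another at the price of this factor.\<close>

lemma integral_slab_change:
  fixes n n' e :: "'a::euclidean_space" and u :: "'a \<Rightarrow> real"
  assumes ne: "n \<bullet> e = 1" and c: "n' \<bullet> e = c" "c \<noteq> 0"
    and inv: "\<And>x t. u (x + t *\<^sub>R e) = u x"
    and int: "integrable lborel (\<lambda>x. indicator (slab n' b') x * u x)"
  shows "(\<integral>x. indicator (slab n' b') x * u x \<partial>lborel) = (\<integral>x. indicator (slab n b) x * u x \<partial>lborel) / \<bar>c\<bar>"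
proof -
  have inner: "(\<integral>t. indicator (slab n' b') (x + t *\<^sub>R e) * u (x + t *\<^sub>R e) \<partial>lborel) = u x / \<bar>c\<bar>" for x
  proof -
    have "{t. x + t *\<^sub>R e \<in> slab n' b'} =
       (if c > 0 then {- (n' \<bullet> x + b') / c .. (1 - (n' \<bullet> x + b')) / c}
        else {(1 - (n' \<bullet> x + b')) / c .. - (n' \<bullet> x + b') / c})"
      using c by (auto simp: inner_add_right field_simps)
    then have "measure lborel {t. x + t *\<^sub>R e \<in> slab n' b'} = 1 / \<bar>c\<bar>"
      using c by (auto simp: field_simps divide_simps)
    moreover have "(\<integral>t. indicator (slab n' b') (x + t *\<^sub>R e) * u (x + t *\<^sub>R e) \<partial>lborel)
       = (\<integral>t. indicator {t. x + t *\<^sub>R e \<in> slab n' b'} t * u x \<partial>lborel)"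
      by (intro Bochner_Integration.integral_cong) (auto simp: indicator_def inv)
    ultimately show ?thesis by simp
  qed
  have "(\<integral>x. indicator (slab n' b') x * u x \<partial>lborel)
     = (\<integral>x. indicator (slab n b) x * (\<integral>t. indicator (slab n' b') (x + t *\<^sub>R e) * u (x + t *\<^sub>R e) \<partial>lborel) \<partial>lborel)"
    by (rule integral_slab[OF int ne, symmetric])
  also have "\<dots> = (\<integral>x. indicator (slab n b) x * u x / \<bar>c\<bar> \<partial>lborel)"
    by (simp only: inner) simp
  finally show ?thesis by simp
qed

section \<open>Integrals over hyperplanes\<close>

text \<open>Bounded Borel functions with bounded support: integrable, and stable under sums,
  multiples and the passage to a slab, so that integrability needs little bookkeeping below.\<close>

definition bbs :: "('a::euclidean_space \<Rightarrow> real) \<Rightarrow> bool"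
  where "bbs G \<longleftrightarrow> G \<in> borel_measurable borel \<and> (\<exists>B. \<forall>x. \<bar>G x\<bar> \<le> B) \<and> bounded {x. G x \<noteq> 0}"

lemma bbs_integrable:
  assumes "bbs G" shows "integrable lborel G"
proof -
  obtain B where [measurable]: "G \<in> borel_measurable borel" and B: "\<And>x. \<bar>G x\<bar> \<le> B"
    and bd: "bounded {x. G x \<noteq> 0}" using assms unfolding bbs_def by blast
  obtain R where R: "{x. G x \<noteq> 0} \<subseteq> cball 0 R" using bd by (force simp: bounded_iff)
  have "integrable lborel (indicat_real (cball (0::'a) R))"
    by (rule integrable_real_indicator) (use emeasure_bounded_finite[of "cball (0::'a) R"] in simp_all)
  then have I: "integrable lborel (\<lambda>x::'a. indicator (cball 0 R) x *\<^sub>R B)" by simp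
  show ?thesis
  proof (rule Bochner_Integration.integrable_bound[OF I])
    have "norm (G x) \<le> norm (indicator (cball 0 R) x *\<^sub>R B)" for x
      using B[of x] R by (cases "G x = 0") (auto simp: indicator_def)
    then show "AE x in lborel. norm (G x) \<le> norm (indicator (cball 0 R) x *\<^sub>R B)" by simp
  qed simp
qed

text \<open>Inside the slab the projection moves a point by at most |e|, so bounded support is
  preserved.\<close>

lemma bbs_slab:
  assumes G: "bbs G" and ne: "n \<bullet> e = 1"
  shows "bbs (\<lambda>x. indicator (slab n b) x * G (x - (n \<bullet> x + b) *\<^sub>R e))"
proof -
  obtain B where Gm [measurable]: "G \<in> borel_measurable borel" and B: "\<And>x. \<bar>G x\<bar> \<le> B"
    and bd: "bounded {x. G x \<noteq> 0}" using G unfolding bbs_def by blast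
  obtain R where R: "\<And>x. G x \<noteq> 0 \<Longrightarrow> norm x \<le> R" using bd unfolding bounded_iff by auto
  have "0 \<le> B" using B[of 0] by linarith
  have "norm x \<le> R + norm e" if "x \<in> slab n b" "G (x - (n \<bullet> x + b) *\<^sub>R e) \<noteq> 0" for x
  proof -
    have "norm x \<le> norm (x - (n \<bullet> x + b) *\<^sub>R e) + norm ((n \<bullet> x + b) *\<^sub>R e)"
      by (metis diff_add_cancel norm_triangle_ineq)
    also have "\<dots> \<le> R + 1 * norm e"
      using that R by (intro add_mono) (auto intro!: mult_left_le_one_le)
    finally show ?thesis by simp
  qed
  then have "bounded {x. indicator (slab n b) x * G (x - (n \<bullet> x + b) *\<^sub>R e) \<noteq> 0}"
    by (auto simp: bounded_iff indicator_def intro!: exI[of _ "R + norm e"])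
  moreover have "(\<lambda>x. indicator (slab n b) x * G (x - (n \<bullet> x + b) *\<^sub>R e)) \<in> borel_measurable borel"
    by measurable
  moreover have "\<bar>indicator (slab n b) x * G (x - (n \<bullet> x + b) *\<^sub>R e)\<bar> \<le> B" for x
    using B \<open>0 \<le> B\<close> by (auto simp: indicator_def)
  ultimately show ?thesis unfolding bbs_def by blast
qed

text \<open>The integral of \<open>G\<close> over the hyperplane \<open>n \<bullet> x + b = 0\<close>, divided by the length of \<open>n\<close>.\<close>

definition Fint :: "'a::euclidean_space \<Rightarrow> real \<Rightarrow> ('a \<Rightarrow> real) \<Rightarrow> real"
  where "Fint n b G = (\<integral>x. indicator (slab n b) x * G (x - (n \<bullet> x + b) *\<^sub>R ((1 / (n \<bullet> n)) *\<^sub>R n)) \<partial>lborel)"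

text \<open>The shear \<open>S\<close> leaves \<open>n \<bullet> x\<close> fixed, carries the
  projection along \<open>e\<close> to the orthogonal one and preserves Lebesgue measure by
  \<open>distr_lborel_shear\<close>. Edges of a simplex may thus serve as projection
  directions.\<close>

lemma Fint_direction:
  assumes G: "bbs G" and ne: "n \<bullet> e = 1"
  shows "(\<integral>x. indicator (slab n b) x * G (x - (n \<bullet> x + b) *\<^sub>R e) \<partial>lborel) = Fint n b G"
proof -
  define e' where "e' = (1 / (n \<bullet> n)) *\<^sub>R n"
  have "n \<noteq> 0" using ne by auto
  then have ne': "n \<bullet> e' = 1" by (simp add: e'_def)
  define S where "S = (\<lambda>z. z + (n \<bullet> z + b) *\<^sub>R (e - e'))"
  have nS: "n \<bullet> S z = n \<bullet> z" for z by (simp add: S_def inner_add_right inner_diff_right ne ne')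
  have Gm [measurable]: "G \<in> borel_measurable borel" using G unfolding bbs_def by blast
  have "(\<integral>x. indicator (slab n b) x * G (x - (n \<bullet> x + b) *\<^sub>R e) \<partial>lborel)
    = (\<integral>x. indicator (slab n b) x * G (x - (n \<bullet> x + b) *\<^sub>R e) \<partial>distr lborel borel S)"
    unfolding S_def by (subst distr_lborel_shear) (simp_all add: inner_diff_right ne ne')
  also have "\<dots> = (\<integral>z. indicator (slab n b) (S z) * G (S z - (n \<bullet> S z + b) *\<^sub>R e) \<partial>lborel)"
    by (subst integral_distr) (auto simp: S_def)
  also have "\<dots> = (\<integral>z. indicator (slab n b) z * G (z - (n \<bullet> z + b) *\<^sub>R e') \<partial>lborel)"
  proof (rule Bochner_Integration.integral_cong[OF refl])
    fix z
    have "S z - (n \<bullet> z + b) *\<^sub>R e = z - (n \<bullet> z + b) *\<^sub>R e'"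
      by (simp add: S_def algebra_simps)
    then show "indicator (slab n b) (S z) * G (S z - (n \<bullet> S z + b) *\<^sub>R e)
        = indicator (slab n b) z * G (z - (n \<bullet> z + b) *\<^sub>R e')"
      by (simp add: nS indicator_def)
  qed
  finally show ?thesis by (simp add: Fint_def e'_def)
qed

text \<open>The slab of \<open>c *\<^sub>R n\<close> has 1 / |c| times the thickness, while the
  projected integrand is the same function \<open>u\<close>. This compares \<open>Fint\<close> for
  two normals of one hyperplane, such as the gradients of neighbouring cells.\<close>

lemma Fint_scale:
  assumes G: "bbs G" and n: "n \<noteq> 0" and c: "c \<noteq> 0"
  shows "Fint (c *\<^sub>R n) (c * b) G = Fint n b G / \<bar>c\<bar>"
proof -
  define e where "e = (1 / (n \<bullet> n)) *\<^sub>R n"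
  have ne: "n \<bullet> e = 1" using n by (simp add: e_def)
  define u where "u = (\<lambda>x. G (x - (n \<bullet> x + b) *\<^sub>R e))"
  have u: "G (x - ((c *\<^sub>R n) \<bullet> x + c * b) *\<^sub>R ((1/c) *\<^sub>R e)) = u x" for x
  proof -
    have "((c *\<^sub>R n) \<bullet> x + c * b) * (1/c) = n \<bullet> x + b"
      using c by (simp add: field_simps)
    then have "((c *\<^sub>R n) \<bullet> x + c * b) *\<^sub>R ((1/c) *\<^sub>R e) = (n \<bullet> x + b) *\<^sub>R e"
      by (simp only: scaleR_scaleR)
    then show ?thesis by (simp only: u_def)
  qed
  have I: "bbs (\<lambda>x. indicator (slab (c *\<^sub>R n) (c * b)) x * G (x - ((c *\<^sub>R n) \<bullet> x + c * b) *\<^sub>R ((1/c) *\<^sub>R e)))"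
    by (rule bbs_slab[OF G]) (use ne c in simp)
  have "Fint (c *\<^sub>R n) (c * b) G = (\<integral>x. indicator (slab (c *\<^sub>R n) (c * b)) x * u x \<partial>lborel)"
    by (subst Fint_direction[OF G, of _ "(1/c) *\<^sub>R e", symmetric]) (use ne c u in simp_all)
  also have "\<dots> = (\<integral>x. indicator (slab n b) x * u x \<partial>lborel) / \<bar>c\<bar>"
  proof (rule integral_slab_change[OF ne])
    show "u (x + t *\<^sub>R e) = u x" for x t
      using ne by (simp add: u_def inner_add_right algebra_simps)
    show "integrable lborel (\<lambda>x. indicator (slab (c *\<^sub>R n) (c * b)) x * u x)"
      using bbs_integrable[OF I] by (simp only: u)
  qed (use ne c in auto)
  also have "(\<integral>x. indicator (slab n b) x * u x \<partial>lborel) = Fint n b G"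
    by (simp add: u_def Fint_def e_def)
  finally show ?thesis .
qed

lemma Fint_neg:
  assumes G: "bbs G" and n: "n \<noteq> 0"
  shows "Fint (- n) (- b) G = Fint n b G"
  using Fint_scale[OF G n, of "-1" b] by simp

lemma bbs_Fint_integrable:
  assumes "bbs G" "n \<noteq> 0"
  shows "integrable lborel (\<lambda>x. indicator (slab n b) x * G (x - (n \<bullet> x + b) *\<^sub>R ((1 / (n \<bullet> n)) *\<^sub>R n)))"
  by (rule bbs_integrable, rule bbs_slab) (use assms in auto)

lemma Fint_add:
  assumes "bbs G" "bbs H" "n \<noteq> 0"
  shows "Fint n b (\<lambda>x. G x + H x) = Fint n b G + Fint n b H"
  using bbs_Fint_integrable[OF assms(1,3)] bbs_Fint_integrable[OF assms(2,3)]
  by (simp add: Fint_def distrib_left Bochner_Integration.integral_add)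

lemma Fint_cmult: "Fint n b (\<lambda>x. c * G x) = c * Fint n b G"
  by (simp add: Fint_def mult.left_commute)

lemma bbs_add: assumes "bbs G" "bbs H" shows "bbs (\<lambda>x. G x + H x)"
proof -
  obtain B where B: "\<And>x. \<bar>G x\<bar> \<le> B" using assms(1) unfolding bbs_def by blast
  obtain C where C: "\<And>x. \<bar>H x\<bar> \<le> C" using assms(2) unfolding bbs_def by blast
  have "bounded ({x. G x \<noteq> 0} \<union> {x. H x \<noteq> 0})" using assms unfolding bbs_def by auto
  then have "bounded {x. G x + H x \<noteq> 0}" by (rule bounded_subset) auto
  moreover have "\<bar>G x + H x\<bar> \<le> B + C" for x using B[of x] C[of x] by linarith
  ultimately show ?thesis using assms unfolding bbs_def by auto
qed

lemma bbs_cmult: assumes "bbs G" shows "bbs (\<lambda>x. c * G x)"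
proof -
  obtain B where B: "\<And>x. \<bar>G x\<bar> \<le> B" using assms(1) unfolding bbs_def by blast
  have "bounded {x. c * G x \<noteq> 0}" using assms unfolding bbs_def by (auto elim: bounded_subset)
  moreover have "\<bar>c * G x\<bar> \<le> \<bar>c\<bar> * B" for x using B[of x] by (simp add: abs_mult mult_left_mono)
  ultimately show ?thesis using assms unfolding bbs_def by (auto simp: borel_measurable_times)
qed

lemma bbs_zero: "bbs (\<lambda>x. 0)"
  by (auto simp: bbs_def)

lemma bbs_sum: "(\<And>i. i \<in> I \<Longrightarrow> bbs (f i)) \<Longrightarrow> bbs (\<lambda>x. \<Sum>i\<in>I. f i x)"
  by (induction I rule: infinite_finite_induct) (auto simp: bbs_zero bbs_add)

lemma Fint_sum:
  assumes "\<And>i. i \<in> I \<Longrightarrow> bbs (f i)" "n \<noteq> 0"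
  shows "Fint n b (\<lambda>x. \<Sum>i\<in>I. f i x) = (\<Sum>i\<in>I. Fint n b (f i))"
  using assms
  by (induction I rule: infinite_finite_induct) (auto simp: Fint_add bbs_sum Fint_def[of _ _ "\<lambda>x. 0"])

lemma bbs_indicator_continuous:
  fixes g :: "'a::euclidean_space \<Rightarrow> real"
  assumes S: "S \<in> sets borel" "bounded S" and g: "continuous_on UNIV g"
  shows "bbs (\<lambda>x. indicator S x * g x)"
proof -
  have [measurable]: "g \<in> borel_measurable borel" by (rule borel_measurable_continuous_onI[OF g])
  have "compact (closure S)" using S by (simp add: compact_closure)
  then have "compact (g ` closure S)"
    using g by (meson compact_continuous_image continuous_on_subset subset_UNIV)
  then obtain B where B: "\<And>x. x \<in> closure S \<Longrightarrow> norm (g x) \<le> B"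
    using compact_imp_bounded bounded_iff by (metis imageI)
  have "\<bar>indicator S x * g x\<bar> \<le> max B 0" for x
    using B[of x] closure_subset[of S] by (auto simp: indicator_def)
  moreover have "bounded {x. indicator S x * g x \<noteq> 0}"
    using S(2) by (rule bounded_subset) (auto simp: indicator_def)
  ultimately show ?thesis using S(1) unfolding bbs_def by auto
qed

section \<open>Continuously differentiable functions with explicit gradient\<close>

definition C1 :: "(real^'n \<Rightarrow> real) \<Rightarrow> (real^'n \<Rightarrow> real^'n) \<Rightarrow> bool"
  where "C1 g Dg \<longleftrightarrow> (\<forall>x. (g has_derivative (\<lambda>h. Dg x \<bullet> h)) (at x)) \<and> continuous_on UNIV Dg"

lemma C1D: "C1 g Dg \<Longrightarrow> (g has_derivative (\<lambda>h. Dg x \<bullet> h)) (at x)"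
  by (simp add: C1_def)

lemma C1_cont: "C1 g Dg \<Longrightarrow> continuous_on S g"
  unfolding C1_def by (meson continuous_at_imp_continuous_on has_derivative_continuous)

lemma C1_cont_deriv: "C1 g Dg \<Longrightarrow> continuous_on S Dg"
  unfolding C1_def using continuous_on_subset by blast

lemma C1_unique:
  assumes "C1 g D" "C1 g D'" shows "D = D'"
proof
  fix x
  have "(\<lambda>h. D x \<bullet> h) = (\<lambda>h. D' x \<bullet> h)"
    using assms by (auto simp: C1_def intro: has_derivative_unique)
  then show "D x = D' x" by (metis vector_eq_rdot)
qed

lemma C1_const: "C1 (\<lambda>x. c) (\<lambda>x. 0)"
  by (auto simp: C1_def)

lemma C1_add: "C1 f Df \<Longrightarrow> C1 g Dg \<Longrightarrow> C1 (\<lambda>x. f x + g x) (\<lambda>x. Df x + Dg x)"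
  by (auto simp: C1_def inner_add_left intro!: derivative_eq_intros continuous_intros)

lemma C1_mult: "C1 f Df \<Longrightarrow> C1 g Dg \<Longrightarrow> C1 (\<lambda>x. f x * g x) (\<lambda>x. f x *\<^sub>R Dg x + g x *\<^sub>R Df x)"
  using C1_cont[of f Df UNIV] C1_cont[of g Dg UNIV]
  by (auto simp: C1_def inner_add_left intro!: derivative_eq_intros continuous_intros)

lemma C1_sum: "(\<And>i. i \<in> I \<Longrightarrow> C1 (f i) (Df i)) \<Longrightarrow> C1 (\<lambda>x. \<Sum>i\<in>I. f i x) (\<lambda>x. \<Sum>i\<in>I. Df i x)"
  by (induction I rule: infinite_finite_induct) (auto simp: C1_const intro!: C1_add)

section \<open>Smooth functions\<close>

text \<open>With the parameter \<open>m\<close> the derivatives of \<open>flat m\<close> are combinations of functions \<open>flat m'\<close>.\<close>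

definition flat :: "nat \<Rightarrow> real \<Rightarrow> real"
  where "flat m t = (if t > 0 then exp (- (1 / t)) / t ^ m else 0)"

text \<open>Substituting x = 1 / t turns the right-hand limit into that of
  \<open>x ^ m / exp x\<close> at infinity.\<close>

lemma flat_tendsto_0: "(flat m \<longlongrightarrow> 0) (at 0)"
proof (rule filterlim_split_at)
  have "((\<lambda>x. x ^ m / exp x) \<longlongrightarrow> (0::real)) at_top" by (rule tendsto_power_div_exp_0)
  moreover have "\<forall>\<^sub>F x in at_top. x ^ m / exp x = flat m (inverse x)"
    using eventually_gt_at_top[of 0]
    by eventually_elim (auto simp: flat_def field_simps exp_minus power_divide)
  ultimately have "((\<lambda>x. flat m (inverse x)) \<longlongrightarrow> 0) at_top"
    using tendsto_cong by force
  then show "(flat m \<longlongrightarrow> 0) (at_right 0)" by (simp add: filterlim_at_right_to_top)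
  have "\<forall>\<^sub>F x in at_left (0::real). 0 = flat m x"
    by (auto simp: flat_def eventually_at_filter)
  then show "(flat m \<longlongrightarrow> 0) (at_left 0)"
    using tendsto_cong tendsto_const by force
qed

lemma flat_has_derivative:
  "(flat m has_real_derivative (flat (m + 2) t - real m * flat (m + 1) t)) (at t)"
proof -
  consider "t > 0" | "t < 0" | "t = 0" by linarith
  then show ?thesis
  proof cases
    case 1
    define s where "s = 1 / t"
    have "((\<lambda>t. exp (- (1 / t)) * (1 / t) ^ m) has_real_derivative
       (exp (- s) * s\<^sup>2) * s ^ m + exp (- s) * (real m * s ^ (m - 1) * (- s\<^sup>2))) (at t)"
      using 1 by (auto simp: s_def power2_eq_square intro!: derivative_eq_intros)
    moreover have "(exp (- s) * s\<^sup>2) * s ^ m + exp (- s) * (real m * s ^ (m - 1) * (- s\<^sup>2))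
       = flat (m + 2) t - real m * flat (m + 1) t"
      using 1 by (cases m) (auto simp: flat_def s_def power_one_over algebra_simps power2_eq_square)
    ultimately have "((\<lambda>t. exp (- (1 / t)) / t ^ m) has_real_derivative
       (flat (m + 2) t - real m * flat (m + 1) t)) (at t)"
      by (simp add: power_one_over)
    then show ?thesis
      by (rule has_field_derivative_transform_within_open[of _ _ _ "{0<..}"]) (use 1 in \<open>auto simp: flat_def\<close>)
  next
    case 2
    have "((\<lambda>t. 0) has_real_derivative 0) (at t)" by simp
    then have "(flat m has_real_derivative 0) (at t)"
      by (rule has_field_derivative_transform_within_open[of _ _ _ "{..<0}"]) (use 2 in \<open>auto simp: flat_def\<close>)
    then show ?thesis using 2 by (simp add: flat_def)
  next
    case 3
    \<comment> \<open>At 0 the difference quotient of \<open>flat m\<close> is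
      \<open>flat (m + 1)\<close>, whose limit is known.\<close>
    have "(\<lambda>h. (flat m (0 + h) - flat m 0) / h) = flat (m + 1)"
      by (auto simp: fun_eq_iff flat_def)
    then have "((\<lambda>h. (flat m (0 + h) - flat m 0) / h) \<longlongrightarrow> 0) (at 0)"
      by (simp only: flat_tendsto_0)
    then have "(flat m has_real_derivative 0) (at 0)" by (simp add: DERIV_def)
    then show ?thesis using 3 by (simp add: flat_def)
  qed
qed

lemma flat_nonneg: "0 \<le> flat m t" by (simp add: flat_def)

lemma flat0_le_1: "flat 0 t \<le> 1" by (simp add: flat_def)

lemma flat_nonpos: "t \<le> 0 \<Longrightarrow> flat m t = 0" by (simp add: flat_def)

lemma flat_pos: "t > 0 \<Longrightarrow> 0 < flat m t" by (simp add: flat_def)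

text \<open>A syntactic class in place of smoothness: it contains the polynomials and the cutoffs
  and bumps of the proof, and it is closed under partial derivatives because those of
  \<open>flat m\<close> are combinations of such functions again. Smoothness of a test field then
  follows from how it is built.\<close>

inductive nice :: "(real^'n \<Rightarrow> real) \<Rightarrow> bool" where
  nice_const: "nice (\<lambda>x. c)"
| nice_coord: "nice (\<lambda>x. x $ i)"
| nice_add: "nice f \<Longrightarrow> nice g \<Longrightarrow> nice (\<lambda>x. f x + g x)"
| nice_mult: "nice f \<Longrightarrow> nice g \<Longrightarrow> nice (\<lambda>x. f x * g x)"
| nice_flat: "nice f \<Longrightarrow> nice (\<lambda>x. flat m (f x))"

lemma nice_sum: "(\<And>i. i \<in> I \<Longrightarrow> nice (f i)) \<Longrightarrow> nice (\<lambda>x. \<Sum>i\<in>I. f i x)"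
  by (induction I rule: infinite_finite_induct) (auto simp: nice_const intro!: nice_add)

lemma nice_prod: "(\<And>i. i \<in> I \<Longrightarrow> nice (f i)) \<Longrightarrow> nice (\<lambda>x. \<Prod>i\<in>I. f i x)"
  by (induction I rule: infinite_finite_induct) (auto simp: nice_const intro!: nice_mult)

lemma nice_cmult: "nice f \<Longrightarrow> nice (\<lambda>x. c * f x)"
  by (intro nice_mult nice_const)

lemma nice_diff: "nice f \<Longrightarrow> nice g \<Longrightarrow> nice (\<lambda>x. f x - g x)"
  using nice_add[OF _ nice_cmult[of g "-1"], of f] by simp

lemma nice_power: "nice f \<Longrightarrow> nice (\<lambda>x. f x ^ m)"
  by (induction m) (auto intro: nice_const nice_mult)

lemma nice_inner: "nice (\<lambda>x. a \<bullet> x)"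
  unfolding inner_vec_def by (intro nice_sum) (auto intro!: nice_cmult nice_coord)

lemma nice_affine: "nice (\<lambda>x. a \<bullet> x + b)"
  by (intro nice_add nice_inner nice_const)

lemma nice_polys: "p \<in> polys r \<Longrightarrow> nice p"
  unfolding polys_def
proof (induction rule: span_induct_alt)
  case base then show ?case using nice_const[of 0] by (simp add: zero_fun_def)
next
  case (step c x y)
  from step(1) obtain \<alpha> where "x = (\<lambda>x. \<Prod>i\<in>UNIV. (x $ i) ^ \<alpha> i)" by blast
  then have "nice x" by (auto intro!: nice_prod nice_power nice_coord)
  then show ?case using step(2) by (auto simp: plus_fun_def scaleR_fun_def intro!: nice_add nice_cmult)
qed

lemma nice_derivative:
  assumes "nice g"
  shows "\<exists>D. (\<forall>i. nice (\<lambda>x. D x $ i)) \<and> (\<forall>x. (g has_derivative (\<lambda>h. D x \<bullet> h)) (at x))"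
  using assms
proof induction
  case (nice_const c)
  show ?case by (rule exI[of _ "\<lambda>x. 0"]) (auto simp: nice.nice_const)
next
  case (nice_coord i)
  show ?case
  proof (rule exI[of _ "\<lambda>x. axis i 1"], intro conjI allI)
    have "(\<bullet>) (axis i 1) = (\<lambda>h. h $ i)" by (auto simp: inner_axis')
    then show "((\<lambda>x. x $ i) has_derivative (\<bullet>) (axis i 1)) (at x)" for x
      by (simp add: bounded_linear_imp_has_derivative bounded_linear_vec_nth)
  qed (auto simp: nice.nice_const)
next
  case (nice_add f g)
  then obtain Df Dg where D: "\<forall>i. nice (\<lambda>x. Df x $ i)" "\<forall>x. (f has_derivative (\<lambda>h. Df x \<bullet> h)) (at x)"
    "\<forall>i. nice (\<lambda>x. Dg x $ i)" "\<forall>x. (g has_derivative (\<lambda>h. Dg x \<bullet> h)) (at x)" by blast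
  show ?case
    by (rule exI[of _ "\<lambda>x. Df x + Dg x"])
      (use D in \<open>auto simp: inner_add_left intro!: nice.nice_add derivative_eq_intros\<close>)
next
  case (nice_mult f g)
  then obtain Df Dg where D: "\<forall>i. nice (\<lambda>x. Df x $ i)" "\<forall>x. (f has_derivative (\<lambda>h. Df x \<bullet> h)) (at x)"
    "\<forall>i. nice (\<lambda>x. Dg x $ i)" "\<forall>x. (g has_derivative (\<lambda>h. Dg x \<bullet> h)) (at x)" by blast
  show ?case
    by (rule exI[of _ "\<lambda>x. f x *\<^sub>R Dg x + g x *\<^sub>R Df x"])
      (use D nice_mult in \<open>auto simp: inner_add_left intro!: nice.nice_add nice.nice_mult derivative_eq_intros\<close>)
next
  case (nice_flat f m)
  then obtain Df where D: "\<forall>i. nice (\<lambda>x. Df x $ i)" "\<And>x. (f has_derivative (\<lambda>h. Df x \<bullet> h)) (at x)" by blast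
  have "((\<lambda>x. flat m (f x)) has_derivative
      (\<lambda>h. ((flat (m + 2) (f x) - real m * flat (m + 1) (f x)) *\<^sub>R Df x) \<bullet> h)) (at x)" for x
    using has_derivative_compose[OF D(2), of "flat m" "\<lambda>h. (flat (m + 2) (f x) - real m * flat (m + 1) (f x)) * h" x]
      flat_has_derivative[of m "f x"] by (simp add: has_field_derivative_def)
  moreover have "nice (\<lambda>x. ((flat (m + 2) (f x) - real m * flat (m + 1) (f x)) *\<^sub>R Df x) $ i)" for i
    using D(1) nice_flat(1) by (auto intro!: nice_mult nice_diff nice_cmult nice.nice_flat)
  ultimately show ?case
    by (intro exI[of _ "\<lambda>x. (flat (m + 2) (f x) - real m * flat (m + 1) (f x)) *\<^sub>R Df x"]) blast
qed

lemma nice_continuous: "nice g \<Longrightarrow> continuous_on S g"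
  using nice_derivative continuous_at_imp_continuous_on has_derivative_continuous by metis

lemma continuous_on_vec_nth_iff:
  fixes f :: "'a::topological_space \<Rightarrow> ('b::topological_space)^'n"
  assumes "\<And>i. continuous_on S (\<lambda>x. f x $ i)" shows "continuous_on S f"
proof -
  have "continuous_on S (\<lambda>x. \<chi> i. f x $ i)" by (rule continuous_on_vec_lambda) (rule assms)
  then show ?thesis by simp
qed

lemma nice_C1:
  assumes "nice g" obtains D where "C1 g D" "\<And>i. nice (\<lambda>x. D x $ i)"
proof -
  obtain D where D: "\<forall>i. nice (\<lambda>x. D x $ i)" "\<forall>x. (g has_derivative (\<lambda>h. D x \<bullet> h)) (at x)"
    using nice_derivative[OF assms] by blast
  have "continuous_on UNIV D"
    by (rule continuous_on_vec_nth_iff) (use D(1) nice_continuous in blast)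
  then show ?thesis using D that unfolding C1_def by blast
qed

lemma Ck_mono: "Ck (Suc m) \<phi> \<Longrightarrow> Ck m \<phi>"
proof (induction m arbitrary: \<phi>)
  case 0
  then show ?case by (auto simp: differentiable_imp_continuous_within continuous_at_imp_continuous_on)
next
  case (Suc m)
  then show ?case by (metis Ck.simps(2))
qed

lemma Ck_add: "Ck m \<phi> \<Longrightarrow> Ck m \<psi> \<Longrightarrow> Ck m (\<lambda>x. \<phi> x + \<psi> x)"
proof (induction m arbitrary: \<phi> \<psi>)
  case 0
  then show ?case by (auto intro: continuous_intros)
next
  case (Suc m)
  have "frechet_derivative (\<lambda>x. \<phi> x + \<psi> x) (at x) = (\<lambda>h. frechet_derivative \<phi> (at x) h + frechet_derivative \<psi> (at x) h)" for x
    using Suc.prems by (intro frechet_derivative_at[symmetric] derivative_intros)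
      (auto simp: frechet_derivative_works[symmetric])
  then show ?case using Suc by auto
qed

lemma Ck_zero: "Ck m (\<lambda>x. 0)"
  by (induction m) auto

lemma Ck_const: "Ck m (\<lambda>x. c)"
  by (cases m) (auto simp: Ck_zero)

text \<open>Generalised over \<open>s\<close> and \<open>\<phi>\<close>, since a partial derivative
  is a sum of two products of the same shape. The vector factor only has to be \<open>Ck\<close>,
  which lets cutoffs multiply arbitrary smooth fields.\<close>

lemma Ck_nice_scale:
  fixes s :: "real^'n \<Rightarrow> real" and \<phi> :: "real^'n \<Rightarrow> real^'n"
  shows "nice s \<Longrightarrow> Ck m \<phi> \<Longrightarrow> Ck m (\<lambda>x. s x *\<^sub>R \<phi> x)"
proof (induction m arbitrary: s \<phi>)
  case 0
  then show ?case by (auto intro: continuous_intros nice_continuous)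
next
  case (Suc m)
  obtain D where D: "\<And>i. nice (\<lambda>x. D x $ i)" "\<And>x. (s has_derivative (\<lambda>h. D x \<bullet> h)) (at x)"
    using nice_derivative[OF Suc.prems(1)] by blast
  have der: "((\<lambda>x. s x *\<^sub>R \<phi> x) has_derivative
      (\<lambda>h. s x *\<^sub>R frechet_derivative \<phi> (at x) h + (D x \<bullet> h) *\<^sub>R \<phi> x)) (at x)" for x
    using Suc.prems by (intro has_derivative_scaleR D(2)) (auto simp: frechet_derivative_works[symmetric])
  have fd: "frechet_derivative (\<lambda>x. s x *\<^sub>R \<phi> x) (at x) (axis i 1)
     = s x *\<^sub>R frechet_derivative \<phi> (at x) (axis i 1) + D x $ i *\<^sub>R \<phi> x" for x i
    by (subst frechet_derivative_at[OF der, symmetric]) (simp add: inner_axis)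
  have "Ck m (\<lambda>x. s x *\<^sub>R frechet_derivative \<phi> (at x) (axis i 1) + D x $ i *\<^sub>R \<phi> x)" for i
    using Suc.prems by (intro Ck_add Suc.IH D(1) Ck_mono[of m \<phi>]) auto
  then show ?case using der by (auto simp: fd differentiable_def)
qed

lemma smooth_nice_scale: "nice s \<Longrightarrow> smooth \<phi> \<Longrightarrow> smooth (\<lambda>x. s x *\<^sub>R \<phi> x)"
  by (simp add: smooth_def Ck_nice_scale)

lemma smooth_nice:
  fixes \<phi> :: "real^'n \<Rightarrow> real^'n"
  assumes "\<And>i. nice (\<lambda>x. \<phi> x $ i)" shows "smooth \<phi>"
proof -
  have A: "Ck m (\<lambda>x. \<Sum>i\<in>I. \<phi> x $ i *\<^sub>R axis i 1)" if "finite I" for I m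
    using that by (induction I) (auto simp: Ck_zero intro!: Ck_add Ck_nice_scale assms Ck_const)
  have B: "(\<lambda>x. \<Sum>i\<in>UNIV. \<phi> x $ i *\<^sub>R axis i 1) = \<phi>"
    using basis_expansion by (auto simp: fun_eq_iff scalar_mult_eq_scaleR[symmetric])
  show ?thesis unfolding smooth_def using A[OF finite[of UNIV], unfolded B] by blast
qed

lemma smooth_C1:
  fixes \<phi> :: "real^'n \<Rightarrow> real^'n"
  assumes "smooth \<phi>" shows "C1 (\<lambda>x. \<phi> x $ i) (\<lambda>x. jacobian \<phi> (at x) $ i)"
proof -
  have c: "Ck (Suc 0) \<phi>" using assms by (simp add: smooth_def)
  then have df: "(\<phi> has_derivative frechet_derivative \<phi> (at x)) (at x)" for x
    by (auto simp: frechet_derivative_works[symmetric])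
  have "((\<lambda>x. \<phi> x $ i) has_derivative (\<lambda>h. frechet_derivative \<phi> (at x) h $ i)) (at x)" for x
    using df by (rule bounded_linear.has_derivative[OF bounded_linear_vec_nth])
  moreover have "frechet_derivative \<phi> (at x) h $ i = jacobian \<phi> (at x) $ i \<bullet> h" for x h
  proof -
    have "linear (frechet_derivative \<phi> (at x))"
      using df has_derivative_linear by blast
    then have "frechet_derivative \<phi> (at x) h = matrix (frechet_derivative \<phi> (at x)) *v h"
      by (simp add: matrix_works)
    then show ?thesis by (simp add: jacobian_def matrix_vector_mult_def inner_vec_def)
  qed
  moreover have "continuous_on UNIV (\<lambda>x. jacobian \<phi> (at x) $ i)"
  proof (rule continuous_on_vec_nth_iff)
    fix j
    have "continuous_on UNIV (\<lambda>x. frechet_derivative \<phi> (at x) (axis j 1))" using c by auto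
    then have "continuous_on UNIV (\<lambda>x. frechet_derivative \<phi> (at x) (axis j 1) $ i)"
      by (intro continuous_intros)
    then show "continuous_on UNIV (\<lambda>x. jacobian \<phi> (at x) $ i $ j)"
      by (simp add: jacobian_def matrix_def)
  qed
  ultimately show ?thesis by (simp add: C1_def)
qed

lemma test_fun_cutoff:
  assumes s: "nice s" and \<phi>: "smooth \<phi>" and K: "compact K" "{x. s x \<noteq> 0} \<subseteq> K" "K \<subseteq> interior D"
  shows "test_fun D (\<lambda>x. s x *\<^sub>R \<phi> x)"
proof -
  have sub: "closure {x. s x *\<^sub>R \<phi> x \<noteq> 0} \<subseteq> K"
    using K(2) by (intro closure_minimal compact_imp_closed[OF K(1)]) auto
  then have "compact (closure {x. s x *\<^sub>R \<phi> x \<noteq> 0})"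
    using compact_Int_closed[OF K(1) closed_closure, of "{x. s x *\<^sub>R \<phi> x \<noteq> 0}"] by (simp add: Int_absorb1)
  then show ?thesis
    using sub K(3) smooth_nice_scale[OF s \<phi>] by (auto simp: test_fun_def)
qed

section \<open>Barycentric coordinates and the split of a simplex\<close>

lemma affine_funI: "(\<And>x. g x = a \<bullet> x + b) \<Longrightarrow> affine_fun g"
  unfolding affine_fun_def by blast

lemma affine_fun_const: "affine_fun (\<lambda>x. c)"
  by (rule affine_funI[of _ 0 c]) simp

lemma affine_fun_add: "affine_fun f \<Longrightarrow> affine_fun g \<Longrightarrow> affine_fun (\<lambda>x. f x + g x)"
  unfolding affine_fun_def
proof (elim exE)
  fix a b a' b' assume "\<forall>x. f x = a \<bullet> x + b" "\<forall>x. g x = a' \<bullet> x + b'"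
  then show "\<exists>a b. \<forall>x. f x + g x = a \<bullet> x + b"
    by (intro exI[of _ "a + a'"] exI[of _ "b + b'"]) (auto simp: inner_add_left)
qed

lemma affine_fun_cmult: "affine_fun f \<Longrightarrow> affine_fun (\<lambda>x. c * f x)"
  unfolding affine_fun_def
proof (elim exE)
  fix a b assume "\<forall>x. f x = a \<bullet> x + b"
  then show "\<exists>a b. \<forall>x. c * f x = a \<bullet> x + b"
    by (intro exI[of _ "c *\<^sub>R a"] exI[of _ "c * b"]) (auto simp: algebra_simps)
qed

lemma affine_fun_diff: "affine_fun f \<Longrightarrow> affine_fun g \<Longrightarrow> affine_fun (\<lambda>x. f x - g x)"
  using affine_fun_add[OF _ affine_fun_cmult[of g "-1"], of f] by simp

lemma affine_fun_sum: "(\<And>i. i \<in> I \<Longrightarrow> affine_fun (f i)) \<Longrightarrow> affine_fun (\<lambda>x. \<Sum>i\<in>I. f i x)"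
  by (induction I rule: infinite_finite_induct) (auto simp: affine_fun_const intro!: affine_fun_add)

lemma affine_fun_coord: "affine_fun (\<lambda>x. x $ m)"
  by (rule affine_funI[of _ "axis m 1" 0]) (simp add: inner_axis')

lemma affine_fun_continuous: "affine_fun g \<Longrightarrow> continuous_on S g"
  unfolding affine_fun_def by (auto intro!: continuous_intros simp: fun_eq_iff[symmetric])

text \<open>Nondegeneracy is stated as existence of barycentric coordinates instead of affine
  independence: for the subsimplices of the split the coordinates can be written down
  (\<open>sub_coord\<close>), so that all results of the locale apply to them as well.\<close>

locale nsimplex =
  fixes v :: "nat \<Rightarrow> real^('n::finite)"
  assumes ex_coord: "i \<le> CARD('n) \<Longrightarrow>
    \<exists>g. affine_fun g \<and> (\<forall>j\<le>CARD('n). g (v j) = (if j = i then 1 else 0))"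
begin


text \<open>The linear parts of the coordinates 1, ..., d form a system dual to the edges at
  \<open>v 0\<close>; this gives injectivity and independence, and d independent vectors
  span.\<close>

lemma edges:
  shows "independent ((\<lambda>j. v j - v 0) ` {1..CARD('n)})" "inj_on (\<lambda>j. v j - v 0) {1..CARD('n)}"
    "span ((\<lambda>j. v j - v 0) ` {1..CARD('n)}) = UNIV"
proof -
  let ?w = "\<lambda>j. v j - v 0"
  have "\<exists>a. \<forall>j\<in>{1..CARD('n)}. a \<bullet> ?w j = (if j = i then 1 else 0)" if "i \<in> {1..CARD('n)}" for i
  proof -
    have "i \<le> CARD('n)" using that by simp
    then obtain g where g: "affine_fun g" "\<forall>j\<le>CARD('n). g (v j) = (if j = i then 1 else 0)"
      using ex_coord by blast
    obtain a b where "\<forall>x. g x = a \<bullet> x + b" using g(1) unfolding affine_fun_def by blast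
    then have "a \<bullet> ?w j = g (v j) - g (v 0)" for j by (simp add: inner_diff_right)
    then show ?thesis using g(2) that by (intro exI[of _ a]) auto
  qed
  then obtain a where a: "\<And>i j. i \<in> {1..CARD('n)} \<Longrightarrow> j \<in> {1..CARD('n)} \<Longrightarrow> a i \<bullet> ?w j = (if j = i then 1 else 0)"
    by metis
  show inj: "inj_on ?w {1..CARD('n)}"
  proof (rule inj_onI)
    fix x y assume "x \<in> {1..CARD('n)}" "y \<in> {1..CARD('n)}" "?w x = ?w y"
    then show "x = y" using a[of x x] a[of x y] by (metis zero_neq_one)
  qed
  show ind: "independent (?w ` {1..CARD('n)})"
  proof (rule independent_if_scalars_zero)
    fix f x assume s: "(\<Sum>x\<in>?w ` {1..CARD('n)}. f x *\<^sub>R x) = 0" and "x \<in> ?w ` {1..CARD('n)}"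
    then obtain i where i: "i \<in> {1..CARD('n)}" "x = ?w i" by blast
    have "(\<Sum>j\<in>{1..CARD('n)}. f (?w j) *\<^sub>R ?w j) = 0"
      using s unfolding sum.reindex[OF inj] o_def .
    then have "a i \<bullet> (\<Sum>j\<in>{1..CARD('n)}. f (?w j) *\<^sub>R ?w j) = 0" by simp
    moreover have "a i \<bullet> (\<Sum>j\<in>{1..CARD('n)}. f (?w j) *\<^sub>R ?w j) = (\<Sum>j\<in>{1..CARD('n)}. if j = i then f (?w j) else 0)"
      unfolding inner_sum_right by (rule sum.cong) (use a i in auto)
    ultimately show "f x = 0" using i by simp
  qed simp
  have "UNIV \<subseteq> span (?w ` {1..CARD('n)})"
    by (rule card_ge_dim_independent[OF _ ind]) (use card_image[OF inj] in auto)
  then show "span (?w ` {1..CARD('n)}) = UNIV" by auto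
qed

lemma affine_eqI:
  assumes "affine_fun g" "affine_fun h" and eq: "\<And>j. j \<le> CARD('n) \<Longrightarrow> g (v j) = h (v j)"
  shows "g = h"
proof -
  have "affine_fun (\<lambda>x. g x - h x)" using assms by (intro affine_fun_diff)
  then obtain a b where ab: "\<And>x. g x - h x = a \<bullet> x + b" unfolding affine_fun_def by blast
  have z: "a \<bullet> (v j - v 0) = 0" if "j \<le> CARD('n)" for j
    using eq[OF that] eq[of 0] ab[of "v j"] ab[of "v 0"] by (simp add: inner_diff_right)
  have z2: "a \<bullet> y = 0" if "y \<in> span ((\<lambda>j. v j - v 0) ` {1..CARD('n)})" for y
    using that by (induction rule: span_induct_alt) (auto simp: inner_add_right z)
  have "a \<bullet> a = 0" by (rule z2) (simp only: edges(3) UNIV_I)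
  then have "a = 0" by simp
  moreover have "b = 0" using ab[of "v 0"] eq[of 0] \<open>a = 0\<close> by simp
  ultimately show ?thesis using ab by (auto simp: fun_eq_iff)
qed

lemma bary_unique:
  assumes "i \<le> CARD('n)" "affine_fun g" "\<And>j. j \<le> CARD('n) \<Longrightarrow> g (v j) = (if j = i then 1 else 0)"
  shows "bary v i = g"
  unfolding bary_def
proof (rule the_equality)
  show "h = g" if "affine_fun h \<and> (\<forall>j\<le>CARD('n). h (v j) = (if j = i then 1 else 0))" for h
    using that assms by (intro affine_eqI) auto
qed (use assms in auto)

lemma bary_affine: "i \<le> CARD('n) \<Longrightarrow> affine_fun (bary v i)"
  and bary_vertex: "i \<le> CARD('n) \<Longrightarrow> j \<le> CARD('n) \<Longrightarrow> bary v i (v j) = (if j = i then 1 else 0)"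
  using ex_coord[of i] bary_unique[of i] by (metis (full_types))+

definition grad :: "nat \<Rightarrow> real^'n"
  where "grad i = (\<chi> m. bary v i (axis m 1) - bary v i 0)"

lemma bary_eq: "i \<le> CARD('n) \<Longrightarrow> bary v i x = grad i \<bullet> x + bary v i 0"
proof -
  assume "i \<le> CARD('n)"
  then obtain a b where ab: "\<And>x. bary v i x = a \<bullet> x + b"
    using bary_affine unfolding affine_fun_def by blast
  then have "grad i = a" by (auto simp: grad_def vec_eq_iff inner_axis)
  then show ?thesis using ab by simp
qed

lemma bary_add: "i \<le> CARD('n) \<Longrightarrow> bary v i (x + y) = bary v i x + grad i \<bullet> y"
  using bary_eq[of i x] bary_eq[of i "x + y"] by (simp add: inner_add_right)

lemma bary_diff: "i \<le> CARD('n) \<Longrightarrow> bary v i (x - y) = bary v i x - grad i \<bullet> y"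
  using bary_eq[of i x] bary_eq[of i "x - y"] by (simp add: inner_diff_right)

lemma bary_continuous: "i \<le> CARD('n) \<Longrightarrow> continuous_on S (bary v i)"
  by (rule affine_fun_continuous[OF bary_affine])

lemma bary_nice: "i \<le> CARD('n) \<Longrightarrow> nice (bary v i)"
  using nice_affine[of "grad i" "bary v i 0"] by (simp add: bary_eq[symmetric])

lemma sum_bary: "(\<Sum>i\<le>CARD('n). bary v i x) = 1"
proof -
  have "(\<lambda>x. \<Sum>i\<le>CARD('n). bary v i x) = (\<lambda>x. 1)"
    by (rule affine_eqI) (auto intro!: affine_fun_sum bary_affine affine_fun_const simp: bary_vertex)
  then show ?thesis by meson
qed

lemma bary_expand: "(\<Sum>i\<le>CARD('n). bary v i x *\<^sub>R v i) = x"
proof -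
  have "(\<Sum>i\<le>CARD('n). bary v i x *\<^sub>R v i) $ m = x $ m" for m
  proof -
    have "(\<lambda>x. \<Sum>i\<le>CARD('n). v i $ m * bary v i x) = (\<lambda>x. x $ m)"
      by (rule affine_eqI)
        (auto intro!: affine_fun_sum bary_affine affine_fun_cmult affine_fun_coord simp: bary_vertex if_distrib cong: if_cong)
    then have "(\<Sum>i\<le>CARD('n). v i $ m * bary v i x) = x $ m" by meson
    then show ?thesis by (simp add: mult.commute)
  qed
  then show ?thesis by (simp add: vec_eq_iff)
qed

lemma sum_grad: "(\<Sum>i\<le>CARD('n). grad i) = 0"
proof -
  have "(\<Sum>i\<le>CARD('n). grad i) = (\<chi> m. (\<Sum>i\<le>CARD('n). bary v i (axis m 1)) - (\<Sum>i\<le>CARD('n). bary v i 0))"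
    by (simp add: vec_eq_iff grad_def sum_subtractf)
  then show ?thesis by (simp add: sum_bary vec_eq_iff)
qed

lemma grad_expand: "(\<Sum>i\<le>CARD('n). (grad i \<bullet> w) *\<^sub>R v i) = w"
proof -
  have "(\<Sum>i\<le>CARD('n). bary v i (0 + w) *\<^sub>R v i) - (\<Sum>i\<le>CARD('n). bary v i 0 *\<^sub>R v i) = (\<Sum>i\<le>CARD('n). (grad i \<bullet> w) *\<^sub>R v i)"
    unfolding sum_subtractf[symmetric]
    by (rule sum.cong) (auto simp: bary_add scaleR_add_left simp del: add_0)
  then show ?thesis by (simp only: bary_expand) simp
qed

lemma grad_vertex:
  "i \<le> CARD('n) \<Longrightarrow> j \<le> CARD('n) \<Longrightarrow> m \<le> CARD('n) \<Longrightarrow> grad i \<bullet> (v j - v m) = (if j = i then 1 else 0) - (if m = i then 1 else 0)"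
  using bary_eq[of i "v j"] bary_eq[of i "v m"] by (simp add: inner_diff_right bary_vertex)

text \<open>The gradients sum to 0, so d of them determine the product with the last one, and
  \<open>grad_expand\<close> recovers the vector from all products. With \<open>m\<close> as the
  index of a facet, only the directions different from its normal have to be compared.\<close>

lemma grad_eqI:
  assumes "m \<le> CARD('n)" "\<And>i. i \<le> CARD('n) \<Longrightarrow> i \<noteq> m \<Longrightarrow> grad i \<bullet> w = grad i \<bullet> z"
  shows "w = z"
proof -
  have s: "(\<Sum>i\<le>CARD('n). grad i \<bullet> (w - z)) = 0"
    using sum_grad by (simp add: inner_sum_left[symmetric])
  have "grad i \<bullet> (w - z) = 0" if "i \<le> CARD('n)" for i
  proof (cases "i = m")
    case True
    have "(\<Sum>i\<in>{..CARD('n)} - {m}. grad i \<bullet> (w - z)) = 0"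
      using assms by (intro sum.neutral) (auto simp: inner_diff_right)
    then show ?thesis using s sum.remove[of "{..CARD('n)}" m "\<lambda>i. grad i \<bullet> (w - z)"] assms(1) True by simp
  qed (use assms that in \<open>simp add: inner_diff_right\<close>)
  then have "(\<Sum>i\<le>CARD('n). (grad i \<bullet> (w - z)) *\<^sub>R v i) = 0" by simp
  then show ?thesis by (simp add: grad_expand)
qed

lemma D_pos: "0 < CARD('n)" by simp

lemma grad_nonzero: assumes "i \<le> CARD('n)" shows "grad i \<noteq> 0"
proof -
  have "\<exists>j\<le>CARD('n). j \<noteq> i" using D_pos by (cases "i = 0") (auto intro: exI[of _ "Suc 0"] exI[of _ 0] simp: Suc_le_eq)
  then obtain j where "j \<le> CARD('n)" "j \<noteq> i" by blast
  then have "grad i \<bullet> (v i - v j) = 1" using assms by (simp add: grad_vertex)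
  then show ?thesis by auto
qed

lemma bary_affine_combination:
  assumes "a + b = 1" "i \<le> CARD('n)"
  shows "bary v i (a *\<^sub>R x + b *\<^sub>R y) = a * bary v i x + b * bary v i y"
proof -
  have "bary v i (a *\<^sub>R x + b *\<^sub>R y) = a * (grad i \<bullet> x) + b * (grad i \<bullet> y) + (a + b) * bary v i 0"
    using assms by (subst bary_eq) (auto simp: inner_add_right)
  also have "\<dots> = a * bary v i x + b * bary v i y"
    using bary_eq[OF assms(2), of x] bary_eq[OF assms(2), of y] by (simp add: algebra_simps)
  finally show ?thesis .
qed

lemma hull_eq: "simplex_hull v = {x. \<forall>i\<le>CARD('n). 0 \<le> bary v i x}"
proof
  have "convex {x. \<forall>i\<le>CARD('n). 0 \<le> bary v i x}"
    by (rule convexI) (auto simp: bary_affine_combination)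
  then show "simplex_hull v \<subseteq> {x. \<forall>i\<le>CARD('n). 0 \<le> bary v i x}"
    unfolding simplex_hull_def by (intro hull_minimal) (auto simp: bary_vertex)
  show "{x. \<forall>i\<le>CARD('n). 0 \<le> bary v i x} \<subseteq> simplex_hull v"
  proof
    fix x assume "x \<in> {x. \<forall>i\<le>CARD('n). 0 \<le> bary v i x}"
    then have "(\<Sum>i\<le>CARD('n). bary v i x *\<^sub>R v i) \<in> simplex_hull v"
      unfolding simplex_hull_def
      by (intro convex_sum) (auto simp: sum_bary convex_convex_hull intro: hull_inc)
    then show "x \<in> simplex_hull v" by (simp add: bary_expand)
  qed
qed

lemma open_pos: "open {x. \<forall>i\<le>CARD('n). 0 < bary v i x}"
proof -
  have "{x. \<forall>i\<le>CARD('n). 0 < bary v i x} = (\<Inter>i\<in>{..CARD('n)}. {x. 0 < bary v i x})" by auto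
  then show ?thesis
    by (auto intro!: open_INT open_Collect_less continuous_on_const bary_continuous)
qed

lemma interior_eq: "interior (simplex_hull v) = {x. \<forall>i\<le>CARD('n). 0 < bary v i x}"
proof
  show "{x. \<forall>i\<le>CARD('n). 0 < bary v i x} \<subseteq> interior (simplex_hull v)"
    by (rule interior_maximal) (use open_pos in \<open>auto simp: hull_eq less_imp_le\<close>)
  show "interior (simplex_hull v) \<subseteq> {x. \<forall>i\<le>CARD('n). 0 < bary v i x}"
  proof safe
    fix x i assume x: "x \<in> interior (simplex_hull v)" and i: "i \<le> CARD('n)"
    then obtain e where e: "e > 0" "ball x e \<subseteq> simplex_hull v" unfolding mem_interior by blast
    \<comment> \<open>A step of length e / 2 against the gradient: it stays in the simplex and
      lowers the coordinate.\<close>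
    define y where "y = x - (e / (2 * norm (grad i))) *\<^sub>R grad i"
    have "dist x y = e / 2" using grad_nonzero[OF i] e(1) by (simp add: y_def dist_norm)
    then have "y \<in> simplex_hull v" using e by auto
    then have "0 \<le> bary v i y" using i by (simp add: hull_eq)
    moreover have "bary v i y < bary v i x"
      using e(1) i grad_nonzero[OF i] by (simp add: y_def bary_diff)
    ultimately show "0 < bary v i x" by linarith
  qed
qed

lemma hull_compact: "compact (simplex_hull v)"
  unfolding simplex_hull_def by (intro compact_convex_hull finite_imp_compact) simp

lemma hull_closed: "closed (simplex_hull v)"
  using hull_compact compact_imp_closed by blast

lemma hull_bounded: "bounded (simplex_hull v)"
  using hull_compact compact_imp_bounded by blast

lemma hull_borel [measurable]: "simplex_hull v \<in> sets borel"
  using hull_closed by simp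

lemma vertex_in_hull: "j \<le> CARD('n) \<Longrightarrow> v j \<in> simplex_hull v"
  unfolding simplex_hull_def by (auto intro: hull_inc)

lemma bary_barycenter:
  assumes i: "i \<le> CARD('n)" shows "bary v i (barycenter v) = 1 / (real CARD('n) + 1)"
proof -
  have "bary v i (barycenter v) = (1 / (real CARD('n) + 1)) * (\<Sum>j\<le>CARD('n). grad i \<bullet> v j) + bary v i 0"
    using i by (subst bary_eq) (auto simp: barycenter_def inner_sum_right)
  also have "\<dots> = (1 / (real CARD('n) + 1)) * (\<Sum>j\<le>CARD('n). grad i \<bullet> v j + bary v i 0)"
    by (simp add: sum.distrib divide_simps)
  also have "(\<Sum>j\<le>CARD('n). grad i \<bullet> v j + bary v i 0) = (\<Sum>j\<le>CARD('n). bary v i (v j))"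
    using i by (simp add: bary_eq[symmetric])
  also have "\<dots> = 1" using i by (simp add: bary_vertex)
  finally show ?thesis by simp
qed

lemma interior_nonempty: "interior (simplex_hull v) \<noteq> {}"
proof -
  have "barycenter v \<in> interior (simplex_hull v)"
    by (auto simp: interior_eq bary_barycenter add_pos_pos)
  then show ?thesis by blast
qed

lemma grad_barycenter:
  "i \<le> CARD('n) \<Longrightarrow> m \<le> CARD('n) \<Longrightarrow> grad i \<bullet> (barycenter v - v m) = 1 / (real CARD('n) + 1) - (if m = i then 1 else 0)"
  using bary_eq[of i "barycenter v"] bary_eq[of i "v m"]
  by (simp add: inner_diff_right bary_vertex bary_barycenter)

text \<open>The coordinate of the new vertex is a multiple of the old coordinate \<open>l\<close>,
  with factor d + 1 because the latter equals 1 / (d + 1) at the barycenter. Subtracting the old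
  coordinate \<open>l\<close> from the others makes them vanish there and keeps their values at the
  remaining old vertices.\<close>

lemma sub_coord:
  assumes "l \<le> CARD('n)"
  shows "nsimplex (v(l := barycenter v))"
    and "\<And>j. j \<le> CARD('n) \<Longrightarrow> bary (v(l := barycenter v)) j =
      (\<lambda>x. if j = l then (real CARD('n) + 1) * bary v l x else bary v j x - bary v l x)"
proof -
  define g where "g = (\<lambda>j x. if j = l then (real CARD('n) + 1) * bary v l x else bary v j x - bary v l x)"
  have aff: "affine_fun (g j)" if "j \<le> CARD('n)" for j
    using that assms by (cases "j = l") (auto simp: g_def intro!: affine_fun_cmult affine_fun_diff bary_affine)
  have val: "g j ((v(l := barycenter v)) i) = (if i = j then 1 else 0)" if "j \<le> CARD('n)" "i \<le> CARD('n)" for i j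
    using that assms by (auto simp: g_def bary_vertex bary_barycenter)
  show ns: "nsimplex (v(l := barycenter v))"
    by unfold_locales (use aff val in blast)
  show "bary (v(l := barycenter v)) j =
      (\<lambda>x. if j = l then (real CARD('n) + 1) * bary v l x else bary v j x - bary v l x)" if "j \<le> CARD('n)" for j
    using nsimplex.bary_unique[OF ns that aff[OF that]] val[OF that] by (simp add: g_def)
qed

text \<open>Signs of the coordinates in \<open>sub_coord\<close>. The split is thus the partition of
  T by the index of the smallest coordinate, which makes membership, disjointness and the common
  facets on \<open>\<lambda>\<^sub>l = \<lambda>\<^sub>j\<close> elementary.\<close>

lemma sub_hull:
  assumes "l \<le> CARD('n)"
  shows "subT v l = {x. 0 \<le> bary v l x \<and> (\<forall>j\<le>CARD('n). bary v l x \<le> bary v j x)}"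
  unfolding subT_def nsimplex.hull_eq[OF sub_coord(1)[OF assms]]
  using assms by (auto simp: sub_coord(2) zero_le_mult_iff split: if_splits)

lemma sub_interior:
  assumes "l \<le> CARD('n)"
  shows "interior (subT v l) = {x. 0 < bary v l x \<and> (\<forall>j\<le>CARD('n). j \<noteq> l \<longrightarrow> bary v l x < bary v j x)}"
  unfolding subT_def nsimplex.interior_eq[OF sub_coord(1)[OF assms]]
  using assms by (auto simp: sub_coord(2) zero_less_mult_iff split: if_splits)

lemma sub_closed: "l \<le> CARD('n) \<Longrightarrow> closed (subT v l)"
  unfolding subT_def by (rule nsimplex.hull_closed[OF sub_coord(1)])

lemma hull_sub: "simplex_hull v = (\<Union>l\<in>{..CARD('n)}. subT v l)"
proof
  show "simplex_hull v \<subseteq> (\<Union>l\<in>{..CARD('n)}. subT v l)"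
  proof
    fix x assume x: "x \<in> simplex_hull v"
    have "Min ((\<lambda>i. bary v i x) ` {..CARD('n)}) \<in> (\<lambda>i. bary v i x) ` {..CARD('n)}" by (rule Min_in) auto
    then obtain l where "l \<in> {..CARD('n)}" "Min ((\<lambda>i. bary v i x) ` {..CARD('n)}) = bary v l x" by blast
    then have l: "l \<le> CARD('n)" "bary v l x = Min ((\<lambda>i. bary v i x) ` {..CARD('n)})" by simp_all
    have "bary v l x \<le> bary v j x" if "j \<le> CARD('n)" for j
      unfolding l(2) using that by (intro Min_le) auto
    then have "x \<in> subT v l" using x l(1) by (simp add: sub_hull hull_eq)
    then show "x \<in> (\<Union>l\<in>{..CARD('n)}. subT v l)" using l by blast
  qed
  show "(\<Union>l\<in>{..CARD('n)}. subT v l) \<subseteq> simplex_hull v"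
    by (auto simp: sub_hull hull_eq intro: order_trans)
qed

lemma sub_disjoint: "l \<le> CARD('n) \<Longrightarrow> j \<le> CARD('n) \<Longrightarrow> l \<noteq> j \<Longrightarrow> interior (subT v l) \<inter> interior (subT v j) = {}"
  by (fastforce simp: sub_interior)

lemma split_interior_sub: "split_interior v \<subseteq> interior (simplex_hull v)"
  by (auto simp: split_interior_def sub_interior interior_eq)

lemma negligible_split: "negligible (simplex_hull v - split_interior v)"
proof -
  have "simplex_hull v - split_interior v \<subseteq> (\<Union>l\<in>{..CARD('n)}. frontier (subT v l))"
    by (auto simp: hull_sub split_interior_def frontier_def sub_closed closure_closed)
  moreover have "negligible (\<Union>l\<in>{..CARD('n)}. frontier (subT v l))"
    by (intro negligible_Union)
      (auto simp: subT_def simplex_hull_def intro!: negligible_convex_frontier convex_convex_hull)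
  ultimately show ?thesis using negligible_subset by blast
qed

text \<open>On the subsimplex \<open>l\<close> the function has to be the difference of the
  coordinates \<open>i\<close> and \<open>l\<close>, and there the coordinate \<open>l\<close> is
  the minimum; one formula therefore covers all pieces and gives existence and continuity.
  Uniqueness is affine interpolation at the vertices of each piece.\<close>

lemma baryR_unique:
  assumes i: "i \<le> CARD('n)"
  shows "baryR v i = (\<lambda>x. if x \<in> simplex_hull v then bary v i x - Min ((\<lambda>m. bary v m x) ` {..CARD('n)}) else 0)"
    (is "_ = ?h")
proof -
  have on_sub: "?h x = bary v i x - bary v l x" if "x \<in> subT v l" "l \<le> CARD('n)" for x l
  proof -
    have "Min ((\<lambda>m. bary v m x) ` {..CARD('n)}) = bary v l x"
      using that by (intro Min_eqI) (auto simp: sub_hull)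
    then show ?thesis using that hull_sub by auto
  qed
  have aff: "affine_fun (\<lambda>x. bary v i x - bary v l x)" if "l \<le> CARD('n)" for l
    using i that by (intro affine_fun_diff bary_affine)
  have vsub: "v j \<in> subT v l" if "j \<le> CARD('n)" "l \<le> CARD('n)" "j \<noteq> l" for j l
    using that by (auto simp: sub_hull bary_vertex)
  have csub: "barycenter v \<in> subT v l" if "l \<le> CARD('n)" for l
    using that by (auto simp: sub_hull bary_barycenter)
  have hv: "?h (v j) = (if j = i then 1 else 0)" if "j \<le> CARD('n)" for j
  proof -
    obtain l where "l \<le> CARD('n)" "l \<noteq> j" using D_pos by (cases j) (auto intro: that[of 0] that[of "Suc 0"])
    then show ?thesis
    proof (cases "l = i")
      case True
      then show ?thesis using on_sub[OF vsub[OF that, of l]] \<open>l \<le> CARD('n)\<close> \<open>l \<noteq> j\<close> that i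
        by (simp add: bary_vertex)
    next
      case False
      then show ?thesis using on_sub[OF vsub[OF that, of l]] \<open>l \<le> CARD('n)\<close> \<open>l \<noteq> j\<close> that i
        by (simp add: bary_vertex)
    qed
  qed
  have hc: "?h (barycenter v) = 0"
    using on_sub[OF csub[of 0]] i by (simp add: bary_barycenter)
  have cont: "continuous_on (simplex_hull v) ?h"
    unfolding hull_sub
  proof (rule continuous_on_closed_Union)
    fix l assume l: "l \<in> {..CARD('n)}"
    have "continuous_on (subT v l) (\<lambda>x. bary v i x - bary v l x)"
      using aff l affine_fun_continuous by auto
    then show "continuous_on (subT v l)
      (\<lambda>x. if x \<in> (\<Union>l\<in>{..CARD('n)}. subT v l) then bary v i x - Min ((\<lambda>m. bary v m x) ` {..CARD('n)}) else 0)"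
      using on_sub l by (subst continuous_on_cong[OF refl]) (auto simp: hull_sub)
  qed (auto simp: sub_closed)
  show ?thesis
    unfolding baryR_def
  proof (rule the_equality)
    show "continuous_on (simplex_hull v) ?h \<and>
      (\<forall>l\<le>CARD('n). \<exists>a. affine_fun a \<and> (\<forall>x\<in>subT v l. ?h x = a x)) \<and>
      (\<forall>j\<le>CARD('n). ?h (v j) = (if j = i then 1 else 0)) \<and> ?h (barycenter v) = 0 \<and>
      (\<forall>x. x \<notin> simplex_hull v \<longrightarrow> ?h x = 0)"
      using cont aff on_sub hv hc by (intro conjI) (blast, blast, blast, blast, simp)
  next
    fix g assume g: "continuous_on (simplex_hull v) g \<and>
      (\<forall>l\<le>CARD('n). \<exists>a. affine_fun a \<and> (\<forall>x\<in>subT v l. g x = a x)) \<and>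
      (\<forall>j\<le>CARD('n). g (v j) = (if j = i then 1 else 0)) \<and> g (barycenter v) = 0 \<and>
      (\<forall>x. x \<notin> simplex_hull v \<longrightarrow> g x = 0)"
    show "g = ?h"
    proof
      fix x
      show "g x = ?h x"
      proof (cases "x \<in> simplex_hull v")
        case True
        then obtain l where l: "l \<le> CARD('n)" "x \<in> subT v l" by (auto simp: hull_sub)
        obtain a where a: "affine_fun a" "\<forall>x\<in>subT v l. g x = a x" using g l by blast
        have "a = (\<lambda>x. bary v i x - bary v l x)"
        proof (rule nsimplex.affine_eqI[OF sub_coord(1)[OF l(1)] a(1) aff[OF l(1)]])
          fix j assume j: "j \<le> CARD('n)"
          show "a ((v(l := barycenter v)) j) = bary v i ((v(l := barycenter v)) j) - bary v l ((v(l := barycenter v)) j)"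
          proof (cases "j = l")
            case True
            then show ?thesis using a(2) csub[OF l(1)] g i l by (auto simp: bary_barycenter)
          next
            case False
            then have "a (v j) = g (v j)" using a(2) vsub[OF j l(1)] by simp
            then show ?thesis using False g i j l(1) by (auto simp: bary_vertex)
          qed
        qed
        then show ?thesis using a(2) l on_sub[OF l(2,1)] by simp
      qed (use g in auto)
    qed
  qed
qed

lemma baryR_on_sub:
  assumes "i \<le> CARD('n)" "l \<le> CARD('n)" "x \<in> subT v l"
  shows "baryR v i x = bary v i x - bary v l x"
proof -
  have "Min ((\<lambda>m. bary v m x) ` {..CARD('n)}) = bary v l x"
    using assms by (intro Min_eqI) (auto simp: sub_hull)
  then show ?thesis using assms by (auto simp: baryR_unique hull_sub)
qed

end

section \<open>Gauss's theorem on a simplex and on its split\<close>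

lemma has_vector_derivative_line:
  assumes "C1 g Dg"
  shows "((\<lambda>t. g (x + t *\<^sub>R e)) has_vector_derivative (Dg (x + t *\<^sub>R e) \<bullet> e)) (at t within S)"
proof -
  have "((\<lambda>t. x + t *\<^sub>R e) has_derivative (\<lambda>h. h *\<^sub>R e)) (at t within S)"
    by (auto intro!: derivative_eq_intros)
  then have "((\<lambda>t. g (x + t *\<^sub>R e)) has_derivative (\<lambda>h. Dg (x + t *\<^sub>R e) \<bullet> (h *\<^sub>R e))) (at t within S)"
    using has_derivative_compose[OF _ C1D[OF assms]] by blast
  then show ?thesis by (simp add: has_vector_derivative_def)
qed

text \<open>A total gradient operator: the gradient field in \<open>C1\<close> is unique, so on nice
  functions the choice is the gradient.\<close>

definition cderiv :: "(real^'n \<Rightarrow> real) \<Rightarrow> real^'n \<Rightarrow> real^'n"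
  where "cderiv g = (SOME D. C1 g D)"

lemma cderiv_eq: "C1 g D \<Longrightarrow> cderiv g = D"
  unfolding cderiv_def by (rule some_equality) (auto intro: C1_unique)

lemma nice_cderiv: assumes "nice g" shows "C1 g (cderiv g)" "nice (\<lambda>x. cderiv g x $ i)"
  using nice_C1[OF assms] cderiv_eq by metis+

definition nice_field :: "(real^'n \<Rightarrow> real^'n^'n) \<Rightarrow> bool"
  where "nice_field P \<longleftrightarrow> (\<forall>i j. nice (\<lambda>x. P x $ i $ j))"

definition rdiv :: "(real^'n \<Rightarrow> real^'n^'n) \<Rightarrow> real^'n \<Rightarrow> real^'n"
  where "rdiv P x = (\<chi> i. \<Sum>j\<in>UNIV. cderiv (\<lambda>x. P x $ i $ j) x $ j)"

lemma nice_field_continuous: "nice_field P \<Longrightarrow> continuous_on S P"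
  unfolding nice_field_def by (intro continuous_on_vec_nth_iff nice_continuous) auto

lemma rdiv_continuous: "nice_field P \<Longrightarrow> continuous_on S (rdiv P)"
  unfolding nice_field_def rdiv_def
  by (intro continuous_on_vec_nth_iff nice_continuous) (auto intro!: nice_sum nice_cderiv(2))

lemma nice_field_mult_continuous: "nice_field P \<Longrightarrow> continuous_on S (\<lambda>x. P x *v a)"
  unfolding nice_field_def matrix_vector_mult_def
  by (intro continuous_on_vec_nth_iff nice_continuous) (auto intro!: nice_sum nice_mult nice_const)

context nsimplex
begin

definition facet :: "nat \<Rightarrow> (real^'n) set"
  where "facet i = {x. bary v i x = 0 \<and> (\<forall>j\<le>CARD('n). 0 \<le> bary v j x)}"

text \<open>The relative interior of \<open>facet i\<close>. It is dense in the facet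
  (\<open>facet_zero\<close>) and avoids the other facets, so identities on facets are established
  here first.\<close>

definition ri :: "nat \<Rightarrow> (real^'n) set"
  where "ri i = {x. bary v i x = 0 \<and> (\<forall>j\<le>CARD('n). j \<noteq> i \<longrightarrow> 0 < bary v j x)}"

text \<open>For integrands cut off by the indicator of \<open>facet i\<close> this is the surface
  integral divided by the length of \<open>grad i\<close>. As \<open>grad i\<close> is an inner
  normal, inserting \<open>w x \<bullet> grad i\<close> gives minus the outward flux of w, without
  normalising factors.\<close>

definition FI :: "nat \<Rightarrow> (real^'n \<Rightarrow> real) \<Rightarrow> real"
  where "FI i G = Fint (grad i) (bary v i 0) G"

lemma facet_subset: "facet i \<subseteq> simplex_hull v"
  by (auto simp: facet_def hull_eq)

lemma ri_subset: "i \<le> CARD('n) \<Longrightarrow> ri i \<subseteq> facet i"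
  by (auto simp: facet_def ri_def)

lemma facet_closed: "i \<le> CARD('n) \<Longrightarrow> closed (facet i)"
proof -
  assume i: "i \<le> CARD('n)"
  have "facet i = {x. bary v i x = 0} \<inter> simplex_hull v" by (auto simp: facet_def hull_eq)
  moreover have "closed {x. bary v i x = 0}"
    using bary_continuous[OF i] by (intro closed_Collect_eq) auto
  ultimately show ?thesis using hull_closed by auto
qed

lemma facet_bounded: "bounded (facet i)"
  using hull_bounded facet_subset bounded_subset by blast

lemma bbs_facet:
  "i \<le> CARD('n) \<Longrightarrow> continuous_on UNIV g \<Longrightarrow> bbs (\<lambda>x. indicator (facet i) x * g x)"
  by (intro bbs_indicator_continuous facet_bounded) (use facet_closed in auto)

lemma bbs_hull: "continuous_on UNIV g \<Longrightarrow> bbs (\<lambda>x. indicator (simplex_hull v) x * g x)"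
  by (intro bbs_indicator_continuous hull_bounded) auto

text \<open>Fubini in the direction of the edge and the fundamental theorem of calculus on each
  line: the lines enter the simplex through facet i, where coordinate i is 0, and leave it through
  facet 0, while the other coordinates stay constant.\<close>

lemma edge_formula:
  assumes i: "i \<in> {1..CARD('n)}" and g: "C1 g Dg"
  shows "(\<integral>x. indicator (simplex_hull v) x * (Dg x \<bullet> (v i - v 0)) \<partial>lborel)
    = FI 0 (\<lambda>x. indicator (facet 0) x * g x) - FI i (\<lambda>x. indicator (facet i) x * g x)"
proof -
  define e where "e = v i - v 0"
  have iD: "i \<le> CARD('n)" "i \<noteq> 0" using i by auto
  have ge: "grad i \<bullet> e = 1" "grad 0 \<bullet> e = -1" "\<And>j. j \<le> CARD('n) \<Longrightarrow> j \<noteq> i \<Longrightarrow> j \<noteq> 0 \<Longrightarrow> grad j \<bullet> e = 0"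
    using iD by (auto simp: e_def grad_vertex)
  have bi: "bary v i (x + t *\<^sub>R e) = bary v i x + t" for x t
    using iD ge by (simp add: bary_add)
  have b0: "bary v 0 (x + t *\<^sub>R e) = bary v 0 x - t" for x t
    using ge by (simp add: bary_add)
  have bj: "bary v j (x + t *\<^sub>R e) = bary v j x" if "j \<le> CARD('n)" "j \<noteq> i" "j \<noteq> 0" for x t j
    using ge that by (simp add: bary_add)
  have bii: "grad i \<bullet> x + bary v i 0 = bary v i x" for x by (rule bary_eq[OF iD(1), symmetric])
  have b00: "grad 0 \<bullet> x + bary v 0 0 = bary v 0 x" for x by (rule bary_eq[symmetric]) simp
  \<comment> \<open>The line through x in direction e meets the simplex: coordinates i and 0 change
    by t and -t, so only their sum is constrained.\<close>
  define A where "A x \<longleftrightarrow> 0 \<le> bary v i x + bary v 0 x \<and> (\<forall>j\<le>CARD('n). j \<noteq> i \<and> j \<noteq> 0 \<longrightarrow> 0 \<le> bary v j x)" for x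
  have mem: "x + t *\<^sub>R e \<in> simplex_hull v \<longleftrightarrow> A x \<and> t \<in> {- bary v i x .. bary v 0 x}" for x t
  proof -
    have "x + t *\<^sub>R e \<in> simplex_hull v \<longleftrightarrow> 0 \<le> bary v i x + t \<and> 0 \<le> bary v 0 x - t \<and>
       (\<forall>j\<le>CARD('n). j \<noteq> i \<and> j \<noteq> 0 \<longrightarrow> 0 \<le> bary v j x)" (is "?L = ?R")
    proof
      assume ?L
      then have H: "0 \<le> bary v j (x + t *\<^sub>R e)" if "j \<le> CARD('n)" for j using that by (simp add: hull_eq)
      have "0 \<le> bary v j x" if "j \<le> CARD('n)" "j \<noteq> i" "j \<noteq> 0" for j
        using H[of j] bj[of j x t] that by simp
      then show ?R using H[of i] H[of 0] iD by (simp add: bi b0)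
    next
      assume R: ?R
      have "0 \<le> bary v j (x + t *\<^sub>R e)" if "j \<le> CARD('n)" for j
        using R bj[OF that, of x t] that by (cases "j = i"; cases "j = 0") (auto simp: bi b0)
      then show ?L by (simp add: hull_eq)
    qed
    then show ?thesis unfolding A_def by auto
  qed
  have facet_i: "x - bary v i x *\<^sub>R e \<in> facet i \<longleftrightarrow> A x" for x
    unfolding facet_def using mem[of x "- bary v i x"] bi[of x "- bary v i x"]
    by (auto simp: hull_eq A_def)
  have facet_0: "x + bary v 0 x *\<^sub>R e \<in> facet 0 \<longleftrightarrow> A x" for x
    unfolding facet_def using mem[of x "bary v 0 x"] b0[of x "bary v 0 x"]
    by (auto simp: hull_eq A_def)
  let ?h = "\<lambda>x. indicator (simplex_hull v) x * (Dg x \<bullet> e)"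
  have hb: "bbs ?h"
    by (intro bbs_hull continuous_intros C1_cont_deriv[OF g])
  have inner: "(\<integral>t. ?h (x + t *\<^sub>R e) \<partial>lborel) =
    indicator {x. A x} x * (g (x + bary v 0 x *\<^sub>R e) - g (x - bary v i x *\<^sub>R e))" for x
  proof (cases "A x")
    case True
    have "(\<integral>t. ?h (x + t *\<^sub>R e) \<partial>lborel)
      = (\<integral>t. indicator {- bary v i x .. bary v 0 x} t *\<^sub>R (Dg (x + t *\<^sub>R e) \<bullet> e) \<partial>lborel)"
      using True by (intro Bochner_Integration.integral_cong) (auto simp: mem indicator_def)
    also have "\<dots> = g (x + bary v 0 x *\<^sub>R e) - g (x + (- bary v i x) *\<^sub>R e)"
    proof (rule integral_FTC_atLeastAtMost)
      show "- bary v i x \<le> bary v 0 x" using True by (simp add: A_def)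
      show "continuous_on {- bary v i x..bary v 0 x} (\<lambda>t. Dg (x + t *\<^sub>R e) \<bullet> e)"
        by (intro continuous_intros continuous_on_compose2[OF C1_cont_deriv[OF g, of UNIV]]) auto
    qed (rule has_vector_derivative_line[OF g])
    finally show ?thesis using True by simp
  next
    case False
    then show ?thesis by (simp add: mem indicator_def)
  qed
  define G where "G z = indicator (facet i) z * g (z + bary v 0 z *\<^sub>R e)" for z
  have Gb: "bbs G" unfolding G_def
    by (intro bbs_facet[OF iD(1)] continuous_on_compose2[OF C1_cont[OF g, of UNIV]]
        continuous_intros bary_continuous) auto
  \<comment> \<open>The value of g at the exit point. It is constant along e, so it may be
    integrated over the slab of facet i as well as over that of facet 0.\<close>
  define u where "u x = G (x - bary v i x *\<^sub>R e)" for x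
  have u: "u x = indicator {x. A x} x * g (x + bary v 0 x *\<^sub>R e)" for x
    using b0[of x "- bary v i x"]
    by (auto simp: u_def G_def facet_i indicator_def scaleR_add_left algebra_simps)
  have u0: "u x = indicator (facet 0) (x - bary v 0 x *\<^sub>R (- e)) * g (x - bary v 0 x *\<^sub>R (- e))" for x
    by (auto simp: u facet_0 indicator_def)
  have Fi: "(\<lambda>x. indicator {x. A x} x * g (x - bary v i x *\<^sub>R e)) =
     (\<lambda>x. indicator (facet i) (x - bary v i x *\<^sub>R e) * g (x - bary v i x *\<^sub>R e))"
    by (auto simp: facet_i indicator_def)
  have bg: "bbs (\<lambda>x. indicator (facet i) x * g x)" "bbs (\<lambda>x. indicator (facet 0) x * g x)"
    using iD by (auto intro!: bbs_facet C1_cont[OF g])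
  let ?Si = "slab (grad i) (bary v i 0)" and ?S0 = "slab (grad 0) (bary v 0 0)"
  have I1: "integrable lborel (\<lambda>x. indicator ?Si x * u x)"
    using bbs_integrable[OF bbs_slab[OF Gb ge(1), of "bary v i 0"]] by (simp add: bii u_def)
  have I2: "integrable lborel (\<lambda>x. indicator ?Si x * (indicator {x. A x} x * g (x - bary v i x *\<^sub>R e)))"
    using bbs_integrable[OF bbs_slab[OF bg(1) ge(1), of "bary v i 0"]] by (simp add: bii fun_cong[OF Fi])
  have ge0: "grad 0 \<bullet> (- e) = 1" using ge by simp
  have I0: "integrable lborel (\<lambda>x. indicator ?S0 x * u x)"
    using bbs_integrable[OF bbs_slab[OF bg(2) ge0, of "bary v 0 0"]] by (simp only: b00 u0)
  have "(\<integral>x. ?h x \<partial>lborel) = (\<integral>x. indicator ?Si x * (\<integral>t. ?h (x + t *\<^sub>R e) \<partial>lborel) \<partial>lborel)"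
    by (rule integral_slab[OF bbs_integrable[OF hb] ge(1), symmetric])
  also have "\<dots> = (\<integral>x. indicator ?Si x * u x - indicator ?Si x * (indicator {x. A x} x * g (x - bary v i x *\<^sub>R e)) \<partial>lborel)"
    unfolding inner u by (simp add: algebra_simps)
  also have "\<dots> = (\<integral>x. indicator ?Si x * u x \<partial>lborel)
      - (\<integral>x. indicator ?Si x * (indicator {x. A x} x * g (x - bary v i x *\<^sub>R e)) \<partial>lborel)"
    by (rule Bochner_Integration.integral_diff[OF I1 I2])
  \<comment> \<open>Both slabs are crossed in unit length since
    \<open>grad 0 \<bullet> e = -1\<close>, so changing the slab costs the factor 1.\<close>
  also have "(\<integral>x. indicator ?Si x * u x \<partial>lborel) = (\<integral>x. indicator ?S0 x * u x \<partial>lborel)"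
  proof -
    have "u (x + t *\<^sub>R e) = u x" for x t
      unfolding u_def bi by (simp add: algebra_simps)
    then show ?thesis
      using integral_slab_change[OF ge(1) ge(2) _ _ I0, of "bary v i 0"] by simp
  qed
  also have "\<dots> = FI 0 (\<lambda>x. indicator (facet 0) x * g x)"
    using Fint_direction[OF bg(2) ge0, of "bary v 0 0"] by (simp only: u0 b00 FI_def)
  also have "(\<integral>x. indicator ?Si x * (indicator {x. A x} x * g (x - bary v i x *\<^sub>R e)) \<partial>lborel)
      = FI i (\<lambda>x. indicator (facet i) x * g x)"
    using Fint_direction[OF bg(1) ge(1), of "bary v i 0"] by (simp add: fun_cong[OF Fi] bii FI_def)
  finally show ?thesis by (simp add: e_def)
qed

lemma FI_add: "i \<le> CARD('n) \<Longrightarrow> bbs G \<Longrightarrow> bbs H \<Longrightarrow> FI i (\<lambda>x. G x + H x) = FI i G + FI i H"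
  by (simp add: FI_def Fint_add grad_nonzero)

lemma FI_cmult: "FI i (\<lambda>x. c * G x) = c * FI i G"
  by (simp add: FI_def Fint_cmult)

lemma FI_sum: "i \<le> CARD('n) \<Longrightarrow> (\<And>k. k \<in> I \<Longrightarrow> bbs (f k)) \<Longrightarrow> FI i (\<lambda>x. \<Sum>k\<in>I. f k x) = (\<Sum>k\<in>I. FI i (f k))"
  by (simp add: FI_def Fint_sum grad_nonzero)

text \<open>The gradients 1, ..., d are dual to the edges at \<open>v 0\<close>, so the divergence
  of w is the sum of the derivatives of \<open>w x \<bullet> grad i\<close> along
  \<open>v i - v 0\<close>. \<open>edge_formula\<close> treats each summand, and the terms on facet
  0 combine because all gradients sum to 0.\<close>

lemma gauss:
  assumes w: "\<And>m. C1 (\<lambda>x. w x $ m) (Dw m)"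
  shows "(\<integral>x. indicator (simplex_hull v) x * (\<Sum>m\<in>UNIV. Dw m x $ m) \<partial>lborel)
     = - (\<Sum>i\<le>CARD('n). FI i (\<lambda>x. indicator (facet i) x * (w x \<bullet> grad i)))"
proof -
  define D where "D i x = (\<Sum>m\<in>UNIV. grad i $ m *\<^sub>R Dw m x)" for i x
  have C: "C1 (\<lambda>x. w x \<bullet> grad i) (D i)" for i
  proof -
    have "C1 (\<lambda>x. \<Sum>m\<in>UNIV. grad i $ m * w x $ m) (\<lambda>x. \<Sum>m\<in>UNIV. (grad i $ m *\<^sub>R Dw m x + w x $ m *\<^sub>R 0))"
      by (intro C1_sum C1_mult C1_const w)
    moreover have "(\<lambda>x. \<Sum>m\<in>UNIV. grad i $ m * w x $ m) = (\<lambda>x. w x \<bullet> grad i)"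
      by (simp add: inner_vec_def mult.commute)
    ultimately show ?thesis by (simp add: D_def[abs_def])
  qed
  have wc: "continuous_on UNIV (\<lambda>x. w x \<bullet> grad i)" for i by (rule C1_cont[OF C])
  have div: "(\<Sum>m\<in>UNIV. Dw m x $ m) = (\<Sum>i\<in>{1..CARD('n)}. D i x \<bullet> (v i - v 0))" for x
  proof -
    have ax: "(\<Sum>i\<in>{1..CARD('n)}. grad i $ m *\<^sub>R (v i - v 0)) = axis m 1" for m
    proof -
      have "(\<Sum>i\<le>CARD('n). grad i $ m) = 0"
        using arg_cong[OF sum_grad, of "\<lambda>x. x $ m"] by simp
      then have "(\<Sum>i\<le>CARD('n). grad i $ m *\<^sub>R (v i - v 0)) = (\<Sum>i\<le>CARD('n). grad i $ m *\<^sub>R v i)"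
        by (simp add: scaleR_diff_right sum_subtractf scaleR_sum_left[symmetric])
      also have "\<dots> = axis m 1" using grad_expand[of "axis m 1"] by (simp add: inner_axis)
      finally have "(\<Sum>i\<le>CARD('n). grad i $ m *\<^sub>R (v i - v 0)) = axis m 1" .
      moreover have "{..CARD('n)} = insert 0 {1..CARD('n)}" by auto
      ultimately show ?thesis by simp
    qed
    have "(\<Sum>i\<in>{1..CARD('n)}. D i x \<bullet> (v i - v 0)) = (\<Sum>m\<in>UNIV. Dw m x \<bullet> (\<Sum>i\<in>{1..CARD('n)}. grad i $ m *\<^sub>R (v i - v 0)))"
      unfolding D_def inner_sum_left inner_sum_right by (subst sum.swap) simp
    then show ?thesis by (simp only: ax inner_axis) simp
  qed
  have bh: "bbs (\<lambda>x. indicator (simplex_hull v) x * (D i x \<bullet> (v i - v 0)))" for i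
    by (intro bbs_hull continuous_intros C1_cont_deriv[OF C])
  have "(\<integral>x. indicator (simplex_hull v) x * (\<Sum>m\<in>UNIV. Dw m x $ m) \<partial>lborel)
     = (\<integral>x. (\<Sum>i\<in>{1..CARD('n)}. indicator (simplex_hull v) x * (D i x \<bullet> (v i - v 0))) \<partial>lborel)"
    unfolding div by (simp add: sum_distrib_left)
  also have "\<dots> = (\<Sum>i\<in>{1..CARD('n)}. (\<integral>x. indicator (simplex_hull v) x * (D i x \<bullet> (v i - v 0)) \<partial>lborel))"
    by (rule Bochner_Integration.integral_sum) (rule bbs_integrable[OF bh])
  also have "\<dots> = (\<Sum>i\<in>{1..CARD('n)}. FI 0 (\<lambda>x. indicator (facet 0) x * (w x \<bullet> grad i))
       - FI i (\<lambda>x. indicator (facet i) x * (w x \<bullet> grad i)))"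
    by (rule sum.cong[OF refl]) (rule edge_formula[OF _ C])
  also have "\<dots> = (\<Sum>i\<in>{1..CARD('n)}. FI 0 (\<lambda>x. indicator (facet 0) x * (w x \<bullet> grad i)))
       - (\<Sum>i\<in>{1..CARD('n)}. FI i (\<lambda>x. indicator (facet i) x * (w x \<bullet> grad i)))"
    by (rule sum_subtractf)
  also have "(\<Sum>i\<in>{1..CARD('n)}. FI 0 (\<lambda>x. indicator (facet 0) x * (w x \<bullet> grad i)))
      = FI 0 (\<lambda>x. \<Sum>i\<in>{1..CARD('n)}. indicator (facet 0) x * (w x \<bullet> grad i))"
    by (rule FI_sum[symmetric]) (auto intro: bbs_facet wc)
  also have "(\<lambda>x. \<Sum>i\<in>{1..CARD('n)}. indicator (facet 0) x * (w x \<bullet> grad i))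
      = (\<lambda>x. (-1) * (indicator (facet 0) x * (w x \<bullet> grad 0)))"
  proof
    fix x
    have e: "{..CARD('n)} = insert 0 {1..CARD('n)}" by auto
    have "(\<Sum>i\<in>{1..CARD('n)}. w x \<bullet> grad i) = - (w x \<bullet> grad 0)"
      using sum_grad unfolding e by (simp add: inner_sum_right[symmetric] add_eq_0_iff)
    then show "(\<Sum>i\<in>{1..CARD('n)}. indicator (facet 0) x * (w x \<bullet> grad i)) = (-1) * (indicator (facet 0) x * (w x \<bullet> grad 0))"
      by (simp add: sum_distrib_left[symmetric])
  qed
  also have "FI 0 \<dots> = (-1) * FI 0 (\<lambda>x. indicator (facet 0) x * (w x \<bullet> grad 0))" by (rule FI_cmult)
  finally show ?thesis
  proof -
    have e: "{..CARD('n)} = insert 0 {1..CARD('n)}" by auto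
    assume a: "(\<integral>x. indicator (simplex_hull v) x * (\<Sum>m\<in>UNIV. Dw m x $ m) \<partial>lborel) =
      - 1 * FI 0 (\<lambda>x. indicator (facet 0) x * (w x \<bullet> grad 0)) -
      (\<Sum>i\<in>{1..CARD('n)}. FI i (\<lambda>x. indicator (facet i) x * (w x \<bullet> grad i)))"
    show ?thesis unfolding e using a by simp
  qed
qed

text \<open>\<open>gauss\<close> for the vector field \<open>w\<close>, the transpose of P applied
  to \<open>\<phi>\<close>; the product rule turns its divergence into the integrand.\<close>

lemma gauss_tensor:
  assumes P: "nice_field P" and \<phi>: "\<And>i. C1 (\<lambda>x. \<phi> x $ i) (\<lambda>x. D\<phi> x $ i)"
  shows "(\<integral>x. indicator (simplex_hull v) x * (P x \<bullet> D\<phi> x + rdiv P x \<bullet> \<phi> x) \<partial>lborel)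
     = - (\<Sum>i\<le>CARD('n). FI i (\<lambda>x. indicator (facet i) x * (\<phi> x \<bullet> (P x *v grad i))))"
proof -
  define w where "w x = (\<chi> m. \<Sum>i\<in>UNIV. P x $ i $ m * \<phi> x $ i)" for x
  define Dw where "Dw m x = (\<Sum>i\<in>UNIV. P x $ i $ m *\<^sub>R D\<phi> x $ i + \<phi> x $ i *\<^sub>R cderiv (\<lambda>x. P x $ i $ m) x)" for m x
  have C: "C1 (\<lambda>x. w x $ m) (Dw m)" for m
    using P unfolding w_def Dw_def nice_field_def
    by (auto intro!: C1_sum C1_mult \<phi> nice_cderiv)
  have "(\<Sum>m\<in>UNIV. Dw m x $ m) = P x \<bullet> D\<phi> x + rdiv P x \<bullet> \<phi> x" for x
  proof -
    have "(\<Sum>m\<in>UNIV. Dw m x $ m) = (\<Sum>m\<in>UNIV. \<Sum>i\<in>UNIV. P x $ i $ m * D\<phi> x $ i $ m)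
        + (\<Sum>m\<in>UNIV. \<Sum>i\<in>UNIV. \<phi> x $ i * cderiv (\<lambda>x. P x $ i $ m) x $ m)"
      by (simp add: Dw_def sum.distrib)
    also have "(\<Sum>m\<in>UNIV. \<Sum>i\<in>UNIV. P x $ i $ m * D\<phi> x $ i $ m) = P x \<bullet> D\<phi> x"
      by (subst sum.swap) (simp add: inner_vec_def)
    also have "(\<Sum>m\<in>UNIV. \<Sum>i\<in>UNIV. \<phi> x $ i * cderiv (\<lambda>x. P x $ i $ m) x $ m) = rdiv P x \<bullet> \<phi> x"
      by (subst sum.swap) (simp add: inner_vec_def rdiv_def sum_distrib_left mult.commute)
    finally show ?thesis .
  qed
  moreover have "w x \<bullet> grad i = \<phi> x \<bullet> (P x *v grad i)" for x i
    unfolding w_def inner_vec_def matrix_vector_mult_def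
    by (simp add: sum_distrib_left sum_distrib_right, subst sum.swap) (simp add: ac_simps)
  ultimately show ?thesis using gauss[OF C] by simp
qed

text \<open>The normal components of the pieces match on the common facet of two subsimplices, which lies on
  the hyperplane \<open>\<lambda>\<^sub>l = \<lambda>\<^sub>j\<close>.\<close>

definition conf :: "(nat \<Rightarrow> real^'n \<Rightarrow> real^'n^'n) \<Rightarrow> bool"
  where "conf P \<longleftrightarrow> (\<forall>l\<le>CARD('n). \<forall>j\<le>CARD('n). \<forall>x. bary v l x = bary v j x \<longrightarrow>
     P l x *v (grad j - grad l) = P j x *v (grad j - grad l))"

lemma sub_grad: "l \<le> CARD('n) \<Longrightarrow> j \<le> CARD('n) \<Longrightarrow> nsimplex.grad (v(l := barycenter v)) j =
    (if j = l then (real CARD('n) + 1) *\<^sub>R grad l else grad j - grad l)"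
  by (simp add: nsimplex.grad_def[OF sub_coord(1)] sub_coord(2)) 
    (auto simp: vec_eq_iff grad_def algebra_simps)

lemma grad_distinct: "l \<le> CARD('n) \<Longrightarrow> j \<le> CARD('n) \<Longrightarrow> j \<noteq> l \<Longrightarrow> grad j \<noteq> grad l"
  using nsimplex.grad_nonzero[OF sub_coord(1), of l j] by (auto simp: sub_grad)

lemma sub_facet_outer: "l \<le> CARD('n) \<Longrightarrow> nsimplex.facet (v(l := barycenter v)) l = facet l"
  by (auto simp: nsimplex.facet_def[OF sub_coord(1)] facet_def sub_coord(2)
      zero_le_mult_iff split: if_splits) 

lemma sub_facet_inner: "l \<le> CARD('n) \<Longrightarrow> j \<le> CARD('n) \<Longrightarrow> j \<noteq> l \<Longrightarrow> nsimplex.facet (v(l := barycenter v)) j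
    = {x. bary v l x = bary v j x \<and> 0 \<le> bary v l x \<and> (\<forall>m\<le>CARD('n). bary v l x \<le> bary v m x)}"
  by (auto simp: nsimplex.facet_def[OF sub_coord(1)] sub_coord(2) zero_le_mult_iff split: if_splits)

text \<open>Gauss on every subsimplex visits each inner facet twice. The term \<open>t l j\<close>
  carries the normal \<open>grad j - grad l\<close>, which changes sign when l and j are exchanged,
  while \<open>conf\<close> makes the traces equal; the double sum is antisymmetric and
  vanishes.\<close>

lemma gauss_split:
  assumes P: "\<And>l. l \<le> CARD('n) \<Longrightarrow> nice_field (P l)" and c: "conf P"
    and \<phi>: "\<And>i. C1 (\<lambda>x. \<phi> x $ i) (\<lambda>x. D\<phi> x $ i)"
  shows "(\<Sum>l\<le>CARD('n). (\<integral>x. indicator (subT v l) x * (P l x \<bullet> D\<phi> x + rdiv (P l) x \<bullet> \<phi> x) \<partial>lborel))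
     = - (\<Sum>l\<le>CARD('n). FI l (\<lambda>x. indicator (facet l) x * (\<phi> x \<bullet> (P l x *v grad l))))"
proof -
  define R where "R l j = {x. bary v l x = bary v j x \<and> 0 \<le> bary v l x \<and> (\<forall>m\<le>CARD('n). bary v l x \<le> bary v m x)}" for l j
  have Rsym: "R l j = R j l" for l j by (auto simp: R_def)
  \<comment> \<open>The value 0 for j = l lets the inner terms run over all pairs of
    indices.\<close>
  define t where "t l j = (if j = l then 0 else Fint (grad j - grad l) (bary v j 0 - bary v l 0)
     (\<lambda>x. indicator (R l j) x * (\<phi> x \<bullet> (P l x *v (grad j - grad l)))))" for l j
  have \<phi>c: "continuous_on UNIV \<phi>" by (rule continuous_on_vec_nth_iff) (rule C1_cont[OF \<phi>])
  have cont: "continuous_on UNIV (\<lambda>x. \<phi> x \<bullet> (P l x *v a))" if "l \<le> CARD('n)" for l a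
    by (intro continuous_on_inner \<phi>c nice_field_mult_continuous P that)
  have one: "(\<integral>x. indicator (subT v l) x * (P l x \<bullet> D\<phi> x + rdiv (P l) x \<bullet> \<phi> x) \<partial>lborel)
     = - FI l (\<lambda>x. indicator (facet l) x * (\<phi> x \<bullet> (P l x *v grad l))) - (\<Sum>j\<le>CARD('n). t l j)" if l: "l \<le> CARD('n)" for l
  proof -
    interpret S: nsimplex "v(l := barycenter v)" by (rule sub_coord(1)[OF l])
    define T where "T j = S.FI j (\<lambda>x. indicator (S.facet j) x * (\<phi> x \<bullet> (P l x *v S.grad j)))" for j
    have Tl: "T l = FI l (\<lambda>x. indicator (facet l) x * (\<phi> x \<bullet> (P l x *v grad l)))"
    proof -
      have "T l = Fint ((real CARD('n) + 1) *\<^sub>R grad l) ((real CARD('n) + 1) * bary v l 0)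
         (\<lambda>x. (real CARD('n) + 1) * (indicator (facet l) x * (\<phi> x \<bullet> (P l x *v grad l))))"
        using l by (simp add: T_def S.FI_def sub_grad sub_coord(2) sub_facet_outer
            matrix_vector_mult_scaleR algebra_simps)
      also have "\<dots> = (real CARD('n) + 1) * Fint ((real CARD('n) + 1) *\<^sub>R grad l) ((real CARD('n) + 1) * bary v l 0)
         (\<lambda>x. indicator (facet l) x * (\<phi> x \<bullet> (P l x *v grad l)))" by (rule Fint_cmult)
      \<comment> \<open>On the outer facet the gradient of the subsimplex is d + 1 times that of T;
        this factor cancels against the one from \<open>Fint_scale\<close>.\<close>
      also have "\<dots> = Fint (grad l) (bary v l 0) (\<lambda>x. indicator (facet l) x * (\<phi> x \<bullet> (P l x *v grad l)))"
        by (subst Fint_scale[OF bbs_facet[OF l cont[OF l]] grad_nonzero[OF l]]) auto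
      finally show ?thesis by (simp add: FI_def)
    qed
    have Tj: "T j = t l j" if "j \<le> CARD('n)" "j \<noteq> l" for j
      using that l by (simp add: T_def t_def S.FI_def sub_grad sub_coord(2) sub_facet_inner R_def)
    have "(\<Sum>j\<le>CARD('n). T j) = T l + (\<Sum>j\<in>{..CARD('n)} - {l}. T j)" using l by (intro sum.remove) auto
    also have "(\<Sum>j\<in>{..CARD('n)} - {l}. T j) = (\<Sum>j\<in>{..CARD('n)} - {l}. t l j)" by (intro sum.cong) (auto simp: Tj)
    also have "\<dots> = (\<Sum>j\<le>CARD('n). t l j)" using l by (intro sum.mono_neutral_left) (auto simp: t_def)
    finally have "(\<Sum>j\<le>CARD('n). T j) = T l + (\<Sum>j\<le>CARD('n). t l j)" .
    moreover have "(\<integral>x. indicator (subT v l) x * (P l x \<bullet> D\<phi> x + rdiv (P l) x \<bullet> \<phi> x) \<partial>lborel) = - (\<Sum>j\<le>CARD('n). T j)"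
      unfolding T_def subT_def by (rule S.gauss_tensor[OF P[OF l] \<phi>])
    ultimately show ?thesis using Tl by simp
  qed
  have anti: "t j l = - t l j" if "l \<le> CARD('n)" "j \<le> CARD('n)" for l j
  proof (cases "j = l")
    case False
    have b: "bbs (\<lambda>x. indicator (R l j) x * (\<phi> x \<bullet> (P l x *v (grad j - grad l))))"
    proof -
      interpret S: nsimplex "v(l := barycenter v)" by (rule sub_coord(1)[OF that(1)])
      show ?thesis using S.bbs_facet[OF that(2) cont[OF that(1)]] False that
        by (simp add: sub_facet_inner R_def)
    qed
    have "t j l = Fint (- (grad j - grad l)) (- (bary v j 0 - bary v l 0))
       (\<lambda>x. (-1) * (indicator (R l j) x * (\<phi> x \<bullet> (P j x *v (grad j - grad l)))))"
      using False by (simp add: t_def Rsym[of j l] matrix_vector_mult_diff_distrib inner_diff_right algebra_simps)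
    also have "\<dots> = (-1) * Fint (- (grad j - grad l)) (- (bary v j 0 - bary v l 0))
       (\<lambda>x. indicator (R l j) x * (\<phi> x \<bullet> (P j x *v (grad j - grad l))))" by (rule Fint_cmult)
    also have "(\<lambda>x. indicator (R l j) x * (\<phi> x \<bullet> (P j x *v (grad j - grad l))))
       = (\<lambda>x. indicator (R l j) x * (\<phi> x \<bullet> (P l x *v (grad j - grad l))))"
      using c that unfolding conf_def by (auto simp: R_def indicator_def)
    also have "Fint (- (grad j - grad l)) (- (bary v j 0 - bary v l 0)) \<dots> = t l j"
      using Fint_neg[OF b, of "grad j - grad l" "bary v j 0 - bary v l 0"] grad_distinct[of l j] False that
      by (simp add: t_def del: minus_diff_eq)
    finally show ?thesis by simp
  qed (simp add: t_def)
  have "(\<Sum>l\<le>CARD('n). \<Sum>j\<le>CARD('n). t l j) = (\<Sum>j\<le>CARD('n). \<Sum>l\<le>CARD('n). t l j)" by (rule sum.swap)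
  also have "\<dots> = (\<Sum>j\<le>CARD('n). \<Sum>l\<le>CARD('n). - t j l)" by (intro sum.cong refl, rule anti) auto
  also have "\<dots> = - (\<Sum>l\<le>CARD('n). \<Sum>j\<le>CARD('n). t l j)" by (simp add: sum_negf)
  finally have "(\<Sum>l\<le>CARD('n). \<Sum>j\<le>CARD('n). t l j) = 0" by simp
  moreover have "(\<Sum>l\<le>CARD('n). (\<integral>x. indicator (subT v l) x * (P l x \<bullet> D\<phi> x + rdiv (P l) x \<bullet> \<phi> x) \<partial>lborel))
     = (\<Sum>l\<le>CARD('n). - FI l (\<lambda>x. indicator (facet l) x * (\<phi> x \<bullet> (P l x *v grad l))) - (\<Sum>j\<le>CARD('n). t l j))"
    by (rule sum.cong) (auto simp: one)
  ultimately show ?thesis by (simp add: sum_subtractf sum_negf)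
qed

section \<open>Vanishing integrals of nonnegative functions\<close>

lemma integral_zero_on_open:
  fixes f :: "real^'n \<Rightarrow> real"
  assumes "integrable lborel f" "\<And>x. 0 \<le> f x" "(\<integral>x. f x \<partial>lborel) = 0" "open U" "\<And>x. x \<in> U \<Longrightarrow> 0 < f x"
  shows "U = {}"
proof (rule ccontr)
  assume "U \<noteq> {}"
  have "AE x in lborel. f x = 0"
    using assms integral_nonneg_eq_0_iff_AE[of lborel f] by auto
  then have "AE x in lborel. x \<notin> U" by (rule eventually_mono) (metis less_irrefl assms(5))
  then have "AE x in lebesgue. x \<notin> U" by (rule AE_completion)
  moreover have "U \<in> sets lebesgue" using assms(4) by (intro sets_completionI_sets) simp
  ultimately have "negligible U" unfolding negligible_iff_null_sets by (subst AE_iff_null_sets)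
  then show False using open_not_negligible[OF assms(4) \<open>U \<noteq> {}\<close>] by simp
qed

lemma vol_zero:
  fixes g :: "real^'n \<Rightarrow> real"
  assumes g: "continuous_on UNIV g" "\<And>x. x \<in> simplex_hull v \<Longrightarrow> 0 \<le> g x"
    and z: "(\<integral>x. indicator (simplex_hull v) x * g x \<partial>lborel) = 0" and y: "y \<in> interior (simplex_hull v)"
  shows "g y = 0"
proof (rule ccontr)
  assume "g y \<noteq> 0"
  moreover have "0 \<le> g y" using g(2) y interior_subset by blast
  ultimately have "0 < g y" by linarith
  then have "y \<in> interior (simplex_hull v) \<inter> {x. 0 < g x}" using y by blast
  moreover have "interior (simplex_hull v) \<inter> {x. 0 < g x} = {}"
  proof (rule integral_zero_on_open[OF bbs_integrable[OF bbs_hull[OF g(1)]] _ z])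
    show "0 \<le> indicator (simplex_hull v) x * g x" for x using g(2) by (simp add: indicator_def)
    show "open (interior (simplex_hull v) \<inter> {x. 0 < g x})"
      using g(1) by (intro open_Int open_Collect_less) auto
    show "0 < indicator (simplex_hull v) x * g x" if "x \<in> interior (simplex_hull v) \<inter> {x. 0 < g x}" for x
      using that interior_subset by (auto simp: indicator_def)
  qed
  ultimately show False by blast
qed

text \<open>A facet is a null set, so the argument takes place in the slab above it: if g were
  positive at y, the lifted integrand would be positive on a nonempty open set although its integral
  is 0.\<close>

lemma FI_zero:
  assumes i: "i \<le> CARD('n)" and g: "continuous_on UNIV g" "\<And>x. x \<in> facet i \<Longrightarrow> 0 \<le> g x"
    and z: "FI i (\<lambda>x. indicator (facet i) x * g x) = 0" and y: "y \<in> ri i"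
  shows "g y = 0"
proof (rule ccontr)
  assume gy: "g y \<noteq> 0"
  define e where "e = (1 / (grad i \<bullet> grad i)) *\<^sub>R grad i"
  define p where "p x = x - bary v i x *\<^sub>R e" for x
  have ge: "grad i \<bullet> e = 1" using grad_nonzero[OF i] by (simp add: e_def)
  have bii: "grad i \<bullet> x + bary v i 0 = bary v i x" for x by (rule bary_eq[OF i, symmetric])
  have bp: "bary v i (p x) = 0" for x using i ge by (simp add: p_def bary_diff)
  have pc: "continuous_on UNIV p" unfolding p_def by (intro continuous_intros bary_continuous i)
  define U where "U = {x. 0 < bary v i x} \<inter> {x. bary v i x < 1} \<inter> {x. 0 < g (p x)} \<inter> (\<Inter>j\<in>{..CARD('n)} - {i}. {x. 0 < bary v j (p x)})"
  have "U = {}"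
  proof (rule integral_zero_on_open)
    show "integrable lborel (\<lambda>x. indicator (slab (grad i) (bary v i 0)) x * (indicator (facet i) (p x) * g (p x)))"
      using bbs_integrable[OF bbs_slab[OF bbs_facet[OF i g(1)] ge, of "bary v i 0"]] by (simp add: p_def bii)
    show "0 \<le> indicator (slab (grad i) (bary v i 0)) x * (indicator (facet i) (p x) * g (p x))" for x
      using g(2) by (simp add: indicator_def)
    show "(\<integral>x. indicator (slab (grad i) (bary v i 0)) x * (indicator (facet i) (p x) * g (p x)) \<partial>lborel) = 0"
      using z unfolding FI_def Fint_def by (simp add: bii p_def e_def)
    show "open U" unfolding U_def
      by (intro open_Int open_INT ballI open_Collect_less continuous_on_const bary_continuous i
          continuous_on_compose2[OF g(1) pc] continuous_on_compose2[OF bary_continuous[of _ UNIV] pc]) auto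
    show "0 < indicator (slab (grad i) (bary v i 0)) x * (indicator (facet i) (p x) * g (p x))" if "x \<in> U" for x
    proof -
      have "x \<in> slab (grad i) (bary v i 0)" using that by (simp add: U_def bii)
      moreover have "p x \<in> facet i"
      proof -
        have "0 \<le> bary v j (p x)" if "j \<le> CARD('n)" for j
          using that \<open>x \<in> U\<close> bp[of x] by (cases "j = i") (auto simp: U_def less_imp_le)
        then show ?thesis using bp[of x] by (simp add: facet_def)
      qed
      ultimately show ?thesis using that by (simp add: U_def)
    qed
  qed
  moreover have "y + (1/2) *\<^sub>R e \<in> U"
  proof -
    have b: "bary v i (y + (1/2) *\<^sub>R e) = 1/2" using y i ge by (simp add: bary_add ri_def)
    then have "p (y + (1/2) *\<^sub>R e) = y" by (simp add: p_def)
    moreover have "0 < g y" using gy g(2)[of y] ri_subset[OF i] y by force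
    ultimately show ?thesis using b y by (auto simp: U_def ri_def)
  qed
  ultimately show False by blast
qed

text \<open>Points that project to the relative boundary of the facet lie in finitely many
  hyperplanes.\<close>

lemma ae_facet_ri:
  assumes D2: "2 \<le> CARD('n)" and i: "i \<le> CARD('n)" and ge: "grad i \<bullet> e = 1"
  shows "AE x in lebesgue. x - bary v i x *\<^sub>R e \<in> facet i \<longrightarrow> x - bary v i x *\<^sub>R e \<in> ri i"
proof -
  let ?p = "\<lambda>x. x - bary v i x *\<^sub>R e"
  define N where "N j = {x. bary v j (?p x) = 0}" for j
  have negl: "negligible (N j)" if j: "j \<le> CARD('n)" "j \<noteq> i" for j
  proof -
    \<comment> \<open>The gradient of coordinate j composed with the projection. It is nonzero
      because it gives 1 on the edge from a third vertex to \<open>v j\<close>; here d \<ge> 2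
      enters.\<close>
    define a where "a = grad j - (grad j \<bullet> e) *\<^sub>R grad i"
    have "\<exists>m\<le>CARD('n). m \<noteq> i \<and> m \<noteq> j"
    proof -
      have "card ({..CARD('n)} - {i, j}) \<ge> 1" using D2 i j by (subst card_Diff_subset) auto
      then have "{..CARD('n)} - {i, j} \<noteq> {}" by (metis card.empty not_one_le_zero)
      then show ?thesis by auto
    qed
    then obtain m where "m \<le> CARD('n)" "m \<noteq> i" "m \<noteq> j" by blast
    then have "a \<bullet> (v j - v m) = 1" using i j by (simp add: a_def inner_diff_left grad_vertex)
    then have "a \<noteq> 0" by auto
    have bb: "bary v j (?p x) = a \<bullet> x + (bary v j 0 - (grad j \<bullet> e) * bary v i 0)" for x
      using bary_eq[OF j(1), of "?p x"] bary_eq[OF i, of x]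
      by (simp add: a_def inner_diff_left inner_diff_right algebra_simps)
    have "N j = {x. a \<bullet> x = - (bary v j 0 - (grad j \<bullet> e) * bary v i 0)}"
      unfolding N_def bb by (simp add: add_eq_0_iff2)
    then show ?thesis using negligible_hyperplane[of a] \<open>a \<noteq> 0\<close> by simp
  qed
  have "negligible (\<Union>j\<in>{..CARD('n)} - {i}. N j)"
    using negl by (intro negligible_Union) auto
  then have "AE x in lebesgue. x \<notin> (\<Union>j\<in>{..CARD('n)} - {i}. N j)"
    unfolding negligible_iff_null_sets by (rule AE_not_in)
  then show ?thesis
    by (rule eventually_mono) (force simp: N_def facet_def ri_def less_le)
qed

end

section \<open>Multi-indices and monomials\<close>

text \<open>Exponents are forced to be 0 outside \<open>A\<close>, so that for A \<subseteq> B the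
  indices on A are literally among those on B.\<close>

definition MI :: "nat set \<Rightarrow> nat \<Rightarrow> (nat \<Rightarrow> nat) set"
  where "MI A k = {\<alpha>. (\<forall>m. m \<notin> A \<longrightarrow> \<alpha> m = 0) \<and> (\<Sum>m\<in>A. \<alpha> m) = k}"

lemma bij_betw_MI:
  assumes "distinct xs" "set xs = A"
  shows "bij_betw (\<lambda>\<alpha>. map \<alpha> xs) (MI A k) {l. length l = length xs \<and> sum_list l = k}"
proof (rule bij_betwI')
  fix \<alpha> \<beta> assume "\<alpha> \<in> MI A k" "\<beta> \<in> MI A k"
  then have "\<alpha> m = \<beta> m" if "m \<notin> A" for m using that by (simp add: MI_def)
  then show "map \<alpha> xs = map \<beta> xs \<longleftrightarrow> \<alpha> = \<beta>"
    unfolding map_eq_conv assms(2) by (metis ext)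
next
  fix \<alpha> assume "\<alpha> \<in> MI A k"
  then show "map \<alpha> xs \<in> {l. length l = length xs \<and> sum_list l = k}"
    using assms by (auto simp: MI_def sum_list_distinct_conv_sum_set)
next
  fix l assume l: "l \<in> {l. length l = length xs \<and> sum_list l = k}"
  define \<alpha> where "\<alpha> m = (case map_of (zip xs l) m of None \<Rightarrow> 0 | Some n \<Rightarrow> n)" for m
  have m: "map \<alpha> xs = l"
    using l assms(1) by (intro nth_equalityI) (auto simp: \<alpha>_def map_of_zip_nth)
  have "\<alpha> \<in> MI A k"
  proof -
    have "\<alpha> m = 0" if "m \<notin> A" for m
    proof -
      have "map_of (zip xs l) m = None" using that assms(2) l by (simp add: map_of_zip_is_None)
      then show ?thesis by (simp add: \<alpha>_def)
    qed
    moreover have "(\<Sum>m\<in>A. \<alpha> m) = k"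
      using sum_list_distinct_conv_sum_set[OF assms(1), of \<alpha>] assms(2) l m by simp
    ultimately show ?thesis by (simp add: MI_def)
  qed
  then show "\<exists>\<alpha>\<in>MI A k. l = map \<alpha> xs" using m by blast
qed

text \<open>Stars and bars, transported from lists of length \<open>card A\<close> with given
  sum.\<close>

lemma card_MI: assumes "finite A" shows "card (MI A k) = (k + card A - 1) choose k"
proof -
  obtain xs where xs: "distinct xs" "set xs = A" using finite_distinct_list[OF assms] by blast
  have "card (MI A k) = card {l. length l = length xs \<and> sum_list l = k}"
    by (rule bij_betw_same_card[OF bij_betw_MI[OF xs]])
  then show ?thesis using xs distinct_card[OF xs(1)] by (simp add: card_length_sum_list)
qed

lemma finite_MI: assumes "finite A" shows "finite (MI A k)"
proof -
  obtain xs where xs: "distinct xs" "set xs = A" using finite_distinct_list[OF assms] by blast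
  have "{l::nat list. length l = length xs \<and> sum_list l = k} \<subseteq> {l. set l \<subseteq> {..k} \<and> length l = length xs}"
    by (auto intro: member_le_sum_list)
  then have "finite {l::nat list. length l = length xs \<and> sum_list l = k}"
    by (rule finite_subset) (simp add: finite_lists_length_eq)
  then show ?thesis using bij_betw_finite[OF bij_betw_MI[OF xs]] by blast
qed

lemma MI_mono: "finite B \<Longrightarrow> A \<subseteq> B \<Longrightarrow> MI A k \<subseteq> MI B k"
  by (auto simp: MI_def intro: sum.mono_neutral_right)

lemma MI_restrict: "finite B \<Longrightarrow> A \<subseteq> B \<Longrightarrow> \<alpha> \<in> MI B k \<Longrightarrow> (\<And>m. m \<in> B - A \<Longrightarrow> \<alpha> m = 0) \<Longrightarrow> \<alpha> \<in> MI A k"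
  unfolding MI_def by (auto simp: sum.mono_neutral_left[of B A \<alpha>])

text \<open>Dedekind's independence of characters, applied to the monomials as characters of the group
  of positive vectors.\<close>

lemma monomial_independent:
  fixes c :: "(nat \<Rightarrow> nat) \<Rightarrow> 'b::real_vector"
  assumes "finite A" "finite I" "\<And>\<alpha> m. \<alpha> \<in> A \<Longrightarrow> m \<notin> I \<Longrightarrow> \<alpha> m = 0"
    and "\<And>y. (\<And>m. m \<in> I \<Longrightarrow> 0 < y m) \<Longrightarrow> (\<Sum>\<alpha>\<in>A. (\<Prod>m\<in>I. y m ^ \<alpha> m) *\<^sub>R c \<alpha>) = 0" and "\<alpha> \<in> A"
  shows "c \<alpha> = 0"
  using assms(1,3,4,5)
proof (induction A arbitrary: c \<alpha> rule: finite_induct)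
  case (insert \<beta> B)
  define X :: "(nat \<Rightarrow> nat) \<Rightarrow> (nat \<Rightarrow> real) \<Rightarrow> real" where "X \<alpha> y = (\<Prod>m\<in>I. y m ^ \<alpha> m)" for \<alpha> y
  have X_mult: "X \<alpha> (\<lambda>m. y m * z m) = X \<alpha> y * X \<alpha> z" for \<alpha> y z
    by (simp add: X_def power_mult_distrib prod.distrib)
  have B0: "c \<gamma> = 0" if \<gamma>: "\<gamma> \<in> B" for \<gamma>
  proof -
    obtain m where m: "\<gamma> m \<noteq> \<beta> m" using \<gamma> insert.hyps(2) by (metis ext)
    then have mI: "m \<in> I" using insert.prems(1) \<gamma> by (metis insertCI)
    \<comment> \<open>A vector that separates the monomials of \<gamma> and \<beta>: 2 in a
      coordinate where the exponents differ, 1 elsewhere.\<close>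
    define y :: "nat \<Rightarrow> real" where "y = (\<lambda>_. 1)(m := 2)"
    have Xy: "X \<delta> y = 2 ^ \<delta> m" for \<delta>
    proof -
      have "X \<delta> y = (\<Prod>i\<in>I. if i = m then 2 ^ \<delta> m else 1)"
        unfolding X_def by (rule prod.cong) (auto simp: y_def)
      then show ?thesis using mI assms(2) by simp
    qed
    have "(X \<gamma> y - X \<beta> y) *\<^sub>R c \<gamma> = 0"
    proof (rule insert.IH[of "\<lambda>\<delta>. (X \<delta> y - X \<beta> y) *\<^sub>R c \<delta>"])
      show "\<And>\<delta> m. \<delta> \<in> B \<Longrightarrow> m \<notin> I \<Longrightarrow> \<delta> m = 0" using insert.prems(1) by blast
      show "\<gamma> \<in> B" by (rule \<gamma>)
      fix z :: "nat \<Rightarrow> real" assume z: "\<And>m. m \<in> I \<Longrightarrow> 0 < z m"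
      have 1: "(\<Sum>\<delta>\<in>insert \<beta> B. X \<delta> z *\<^sub>R c \<delta>) = 0"
        using insert.prems(2)[of z] z by (simp add: X_def)
      have 2: "(\<Sum>\<delta>\<in>insert \<beta> B. X \<delta> (\<lambda>m. y m * z m) *\<^sub>R c \<delta>) = 0"
        using insert.prems(2)[of "\<lambda>m. y m * z m"] z by (simp add: X_def y_def)
      have "(\<Sum>\<delta>\<in>B. X \<delta> z *\<^sub>R (X \<delta> y - X \<beta> y) *\<^sub>R c \<delta>) = (\<Sum>\<delta>\<in>insert \<beta> B. X \<delta> z *\<^sub>R (X \<delta> y - X \<beta> y) *\<^sub>R c \<delta>)"
        using insert.hyps by simp
      \<comment> \<open>The relation at the product of y and z, minus the value of \<beta> at y
        times the relation at z: the term of \<beta> cancels and a relation over the smaller set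
        remains.\<close>
      also have "\<dots> = (\<Sum>\<delta>\<in>insert \<beta> B. X \<delta> (\<lambda>m. y m * z m) *\<^sub>R c \<delta>) - X \<beta> y *\<^sub>R (\<Sum>\<delta>\<in>insert \<beta> B. X \<delta> z *\<^sub>R c \<delta>)"
        unfolding scaleR_sum_right sum_subtractf[symmetric]
        by (rule sum.cong) (auto simp: X_mult algebra_simps)
      also have "\<dots> = 0" using 1 2 by simp
      finally show "(\<Sum>\<delta>\<in>B. (\<Prod>m\<in>I. z m ^ \<delta> m) *\<^sub>R (X \<delta> y - X \<beta> y) *\<^sub>R c \<delta>) = 0" by (simp add: X_def)
    qed
    moreover have "(2::real) ^ \<gamma> m \<noteq> 2 ^ \<beta> m" using m by simp
    ultimately show ?thesis by (simp add: Xy)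
  qed
  have "(\<Sum>\<delta>\<in>insert \<beta> B. (\<Prod>m\<in>I. (1::real) ^ \<delta> m) *\<^sub>R c \<delta>) = 0" by (rule insert.prems(2)) simp
  then have "c \<beta> = 0" using insert.hyps B0 by simp
  then show ?case using insert.prems(3) B0 by blast
qed simp

section \<open>Spans\<close>

text \<open>Coefficients are attached to indices rather than to vectors, which suits families whose
  injectivity only follows later from their independence.\<close>

lemma span_image_finite:
  fixes g :: "'z \<Rightarrow> 'a::real_vector"
  assumes "finite J"
  shows "span (g ` J) = (range (\<lambda>c. \<Sum>z\<in>J. c z *\<^sub>R g z))"
proof
  have "subspace (range (\<lambda>c. \<Sum>z\<in>J. c z *\<^sub>R g z))"
  proof (rule subspaceI)
    show "0 \<in> (range (\<lambda>c. \<Sum>z\<in>J. c z *\<^sub>R g z))" by (rule range_eqI[of _ _ "\<lambda>_. 0"]) simp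
  next
    fix x y assume "x \<in> (range (\<lambda>c. \<Sum>z\<in>J. c z *\<^sub>R g z))" "y \<in> (range (\<lambda>c. \<Sum>z\<in>J. c z *\<^sub>R g z))"
    then obtain c d where "x = (\<Sum>z\<in>J. c z *\<^sub>R g z)" "y = (\<Sum>z\<in>J. d z *\<^sub>R g z)" by blast
    then have "x + y = (\<Sum>z\<in>J. (c z + d z) *\<^sub>R g z)" by (simp add: scaleR_add_left sum.distrib)
    then show "x + y \<in> (range (\<lambda>c. \<Sum>z\<in>J. c z *\<^sub>R g z))" by (rule range_eqI[of _ _ "\<lambda>z. c z + d z"])
  next
    fix a x assume "x \<in> (range (\<lambda>c. \<Sum>z\<in>J. c z *\<^sub>R g z))"
    then obtain c where "x = (\<Sum>z\<in>J. c z *\<^sub>R g z)" by blast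
    then have "a *\<^sub>R x = (\<Sum>z\<in>J. (a * c z) *\<^sub>R g z)" by (simp add: scaleR_sum_right)
    then show "a *\<^sub>R x \<in> (range (\<lambda>c. \<Sum>z\<in>J. c z *\<^sub>R g z))" by (rule range_eqI[of _ _ "\<lambda>z. a * c z"])
  qed
  moreover have "g ` J \<subseteq> (range (\<lambda>c. \<Sum>z\<in>J. c z *\<^sub>R g z))"
  proof safe
    fix w assume "w \<in> J"
    then have "g w = (\<Sum>z\<in>J. (if z = w then 1 else 0) *\<^sub>R g z)"
      using assms by (simp add: if_distrib[of "\<lambda>a. a *\<^sub>R _"] cong: if_cong)
    then show "g w \<in> (range (\<lambda>c. \<Sum>z\<in>J. c z *\<^sub>R g z))" by (rule range_eqI[of _ _ "\<lambda>z. if z = w then 1 else 0"])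
  qed
  ultimately show "span (g ` J) \<subseteq> (range (\<lambda>c. \<Sum>z\<in>J. c z *\<^sub>R g z))" by (intro span_minimal)
  show "(range (\<lambda>c. \<Sum>z\<in>J. c z *\<^sub>R g z)) \<subseteq> span (g ` J)"
    by (intro image_subsetI span_sum span_scale) (auto intro: span_base)
qed

lemma span_bilinear:
  fixes f :: "'a::real_vector \<Rightarrow> 'b::real_vector \<Rightarrow> 'c::real_vector"
  assumes f: "bilinear f" and "x \<in> span A" "y \<in> span B"
  shows "f x y \<in> span {f a b | a b. a \<in> A \<and> b \<in> B}"
  using assms(2)
proof (induction rule: span_induct_alt)
  case base
  then show ?case by (simp add: bilinear_lzero[OF f] span_zero)
next
  case (step c a x)
  have "f a y \<in> span {f a b | a b. a \<in> A \<and> b \<in> B}"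
    using assms(3)
  proof (induction rule: span_induct_alt)
    case base
    then show ?case by (simp add: bilinear_rzero[OF f] span_zero)
  next
    case (step c b y)
    then have "f a b \<in> span {f a b | a b. a \<in> A \<and> b \<in> B}" using \<open>a \<in> A\<close> by (intro span_base) blast
    then show ?case using step
      by (simp add: bilinear_radd[OF f] bilinear_rmul[OF f] span_add span_scale)
  qed
  then show ?case using step
    by (auto simp: bilinear_ladd[OF f] bilinear_lmul[OF f] intro!: span_add span_scale)
qed

text \<open>The bubble spaces are spans of products of two spans; this reduces them to products of
  generators.\<close>

lemma span_bilinear_eq:
  assumes f: "bilinear f"
  shows "span {f x y | x y. x \<in> span A \<and> y \<in> span B} = span {f a b | a b. a \<in> A \<and> b \<in> B}"
proof
  show "span {f x y | x y. x \<in> span A \<and> y \<in> span B} \<subseteq> span {f a b | a b. a \<in> A \<and> b \<in> B}"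
    by (rule span_minimal) (use span_bilinear[OF f] in auto)
  show "span {f a b | a b. a \<in> A \<and> b \<in> B} \<subseteq> span {f x y | x y. x \<in> span A \<and> y \<in> span B}"
  proof (rule span_mono, clarify)
    fix a b assume "a \<in> A" "b \<in> B"
    then show "\<exists>x y. f a b = f x y \<and> x \<in> span A \<and> y \<in> span B"
      by (intro exI[of _ a] exI[of _ b]) (simp add: span_base)
  qed
qed

lemma sum_fun_apply: "(\<Sum>i\<in>I. f i) x = (\<Sum>i\<in>I. f i x)"
  by (induction I rule: infinite_finite_induct) auto

lemma scaleR_fun_apply [simp]: "(c *\<^sub>R f) x = c *\<^sub>R f x"
  by (simp add: scaleR_fun_def)

lemma internal_direct_sum_cong:
  "(\<And>s. s \<in> S \<Longrightarrow> V s = V' s) \<Longrightarrow> W = W' \<Longrightarrow> internal_direct_sum W S V \<longleftrightarrow> internal_direct_sum W' S V'"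
  unfolding internal_direct_sum_def by (intro conj_cong) auto

lemma internal_direct_sum_span:
  fixes g :: "'z \<Rightarrow> 'a::real_vector" and J :: "'s \<Rightarrow> 'z set"
  assumes S: "finite S" and J: "\<And>s. s \<in> S \<Longrightarrow> finite (J s)"
    and disj: "\<And>s t. s \<in> S \<Longrightarrow> t \<in> S \<Longrightarrow> s \<noteq> t \<Longrightarrow> J s \<inter> J t = {}"
    and ind: "\<And>c z. (\<Sum>z\<in>(\<Union>s\<in>S. J s). c z *\<^sub>R g z) = 0 \<Longrightarrow> z \<in> (\<Union>s\<in>S. J s) \<Longrightarrow> c z = 0"
  shows "internal_direct_sum (span (g ` (\<Union>s\<in>S. J s))) S (\<lambda>s. span (g ` J s))"
  unfolding internal_direct_sum_def
proof (intro conjI ballI)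
  let ?U = "\<Union>s\<in>S. J s"
  have U: "finite ?U" using S J by blast
  show "subspace (span (g ` J s))" for s by simp
  show "span (g ` ?U) = {\<Sum>s\<in>S. x s | x. \<forall>s\<in>S. x s \<in> span (g ` J s)}"
  proof (intro equalityI subsetI)
    fix w assume "w \<in> span (g ` ?U)"
    then obtain c where "w = (\<Sum>z\<in>?U. c z *\<^sub>R g z)" using span_image_finite[OF U, of g] by blast
    then have "w = (\<Sum>s\<in>S. \<Sum>z\<in>J s. c z *\<^sub>R g z)"
      using S J disj by (simp add: sum.UNION_disjoint)
    moreover have "(\<Sum>z\<in>J s. c z *\<^sub>R g z) \<in> span (g ` J s)" for s
      by (intro span_sum span_scale span_base) auto
    ultimately show "w \<in> {\<Sum>s\<in>S. x s | x. \<forall>s\<in>S. x s \<in> span (g ` J s)}"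
      by (intro CollectI exI[of _ "\<lambda>s. \<Sum>z\<in>J s. c z *\<^sub>R g z"]) auto
  next
    fix w assume "w \<in> {\<Sum>s\<in>S. x s | x. \<forall>s\<in>S. x s \<in> span (g ` J s)}"
    then obtain x where x: "w = (\<Sum>s\<in>S. x s)" "\<And>s. s \<in> S \<Longrightarrow> x s \<in> span (g ` J s)" by blast
    have "x s \<in> span (g ` ?U)" if "s \<in> S" for s
      using x(2)[OF that] span_mono[of "g ` J s" "g ` ?U"] that by blast
    then show "w \<in> span (g ` ?U)" unfolding x(1) by (intro span_sum)
  qed
  show "\<forall>x. (\<forall>s\<in>S. x s \<in> span (g ` J s)) \<and> (\<Sum>s\<in>S. x s) = 0 \<longrightarrow> (\<forall>s\<in>S. x s = 0)"
  proof (intro allI impI ballI, elim conjE)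
    fix x s assume x: "\<forall>s\<in>S. x s \<in> span (g ` J s)" "(\<Sum>s\<in>S. x s) = 0" and s: "s \<in> S"
    have "\<forall>s\<in>S. \<exists>c. x s = (\<Sum>z\<in>J s. c z *\<^sub>R g z)"
      using x(1) span_image_finite[OF J, of _ g] by blast
    then obtain c where c: "\<And>s. s \<in> S \<Longrightarrow> x s = (\<Sum>z\<in>J s. c s z *\<^sub>R g z)" by metis
    \<comment> \<open>The block that contains z, unique by disjointness; it merges the coefficients
      of all blocks into one family.\<close>
    define h where "h z = (SOME s. s \<in> S \<and> z \<in> J s)" for z
    have h: "h z = t" if "t \<in> S" "z \<in> J t" for z t
      unfolding h_def by (rule some_equality) (use that disj in auto)
    have xs: "x t = (\<Sum>z\<in>J t. c (h z) z *\<^sub>R g z)" if "t \<in> S" for t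
      unfolding c[OF that] by (rule sum.cong) (use h that in auto)
    have "(\<Sum>z\<in>?U. c (h z) z *\<^sub>R g z) = (\<Sum>t\<in>S. \<Sum>z\<in>J t. c (h z) z *\<^sub>R g z)"
      using S J disj by (simp add: sum.UNION_disjoint)
    also have "\<dots> = (\<Sum>t\<in>S. x t)" by (rule sum.cong) (auto simp: xs)
    finally have "(\<Sum>z\<in>?U. c (h z) z *\<^sub>R g z) = 0" using x(2) by simp
    then have "c (h z) z = 0" if "z \<in> ?U" for z using ind[of "\<lambda>z. c (h z) z"] that by blast
    then show "x s = 0" unfolding xs[OF s] using s by (intro sum.neutral) auto
  qed
qed

lemma dim_span_family:
  fixes g :: "'z \<Rightarrow> 'a::real_vector"
  assumes J: "finite J" and ind: "\<And>c z. (\<Sum>z\<in>J. c z *\<^sub>R g z) = 0 \<Longrightarrow> z \<in> J \<Longrightarrow> c z = 0"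
  shows "dim (span (g ` J)) = card J"
proof -
  have inj: "inj_on g J"
  proof (rule inj_onI, rule ccontr)
    fix x y assume xy: "x \<in> J" "y \<in> J" "g x = g y" "x \<noteq> y"
    define c where "c z = (if z = x then 1 else 0) - (if z = y then 1 else (0::real))" for z
    have "(\<Sum>z\<in>J. c z *\<^sub>R g z) = (\<Sum>z\<in>J. (if z = x then g z else 0)) - (\<Sum>z\<in>J. (if z = y then g z else 0))"
      unfolding sum_subtractf[symmetric] by (rule sum.cong) (auto simp: c_def)
    then have "(\<Sum>z\<in>J. c z *\<^sub>R g z) = 0" using xy J by simp
    then show False using ind[of c x] xy by (simp add: c_def)
  qed
  have "independent (g ` J)"
  proof (rule independent_if_scalars_zero)
    fix f x assume "(\<Sum>x\<in>g ` J. f x *\<^sub>R x) = 0" and "x \<in> g ` J"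
    then obtain z where "z \<in> J" "x = g z" by blast
    have "(\<Sum>z\<in>J. f (g z) *\<^sub>R g z) = 0"
      using \<open>(\<Sum>x\<in>g ` J. f x *\<^sub>R x) = 0\<close> unfolding sum.reindex[OF inj] o_def .
    then show "f x = 0" using ind[of "\<lambda>z. f (g z)"] \<open>z \<in> J\<close> \<open>x = g z\<close> by blast
  qed (use J in simp)
  then have "dim (span (g ` J)) = card (g ` J)" by (rule dim_span_eq_card_independent)
  then show ?thesis by (simp add: card_image[OF inj])
qed

definition lin_on :: "'a::real_vector set \<Rightarrow> ('a \<Rightarrow> real) \<Rightarrow> bool"
  where "lin_on S f \<longleftrightarrow> (\<forall>x\<in>S. \<forall>y\<in>S. f (x + y) = f x + f y) \<and> (\<forall>x\<in>S. \<forall>c. f (c *\<^sub>R x) = c * f x)"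

lemma lin_on_subset: "lin_on S f \<Longrightarrow> T \<subseteq> S \<Longrightarrow> lin_on T f"
  unfolding lin_on_def by blast

text \<open>Gram-Schmidt by induction on the spanning set. That \<open>a x x = 0\<close> forces
  \<open>x = 0\<close> passes to subspaces, and it makes the new direction, once orthogonal to the
  old span, usable as a pivot.\<close>

lemma riesz_span:
  fixes a :: "'a::real_vector \<Rightarrow> 'a \<Rightarrow> real"
  assumes "finite B"
    and "\<And>x. x \<in> span B \<Longrightarrow> lin_on (span B) (a x)" "\<And>y. y \<in> span B \<Longrightarrow> lin_on (span B) (\<lambda>x. a x y)"
    and "\<And>x. x \<in> span B \<Longrightarrow> a x x = 0 \<Longrightarrow> x = 0" and "lin_on (span B) \<nu>"
  shows "\<exists>w\<in>span B. \<forall>q\<in>span B. a w q = \<nu> q"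
  using assms
proof (induction B arbitrary: \<nu> rule: finite_induct)
  case empty
  have "\<nu> (0 *\<^sub>R 0) = 0 * \<nu> 0" "a 0 (0 *\<^sub>R 0) = 0 * a 0 0"
    using empty(1)[of 0] empty(4) unfolding lin_on_def by (metis span_zero)+
  then show ?case by simp
next
  case (insert b B)
  let ?S = "span (insert b B)"
  have sub: "span B \<subseteq> ?S" by (rule span_mono) auto
  have bS: "b \<in> ?S" by (rule span_base) simp
  have rep: "\<exists>w\<in>span B. \<forall>q\<in>span B. a w q = \<mu> q" if "lin_on (span B) \<mu>" for \<mu>
  proof (rule insert.IH)
    show "lin_on (span B) (a x)" if "x \<in> span B" for x
      by (rule lin_on_subset[OF insert.prems(1) sub]) (use that sub in blast)
    show "lin_on (span B) (\<lambda>x. a x y)" if "y \<in> span B" for y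
      by (rule lin_on_subset[OF insert.prems(2) sub]) (use that sub in blast)
    show "x = 0" if "x \<in> span B" "a x x = 0" for x
      by (rule insert.prems(3)) (use that sub in blast)+
  qed (rule that)
  have al: "a (x + y) q = a x q + a y q" "a (c *\<^sub>R x) q = c * a x q" "a q (x + y) = a q x + a q y"
    "a q (c *\<^sub>R x) = c * a q x" if "x \<in> ?S" "y \<in> ?S" "q \<in> ?S" for x y q c
    using insert.prems(1,2)[OF that(3)] that unfolding lin_on_def by auto
  have \<nu>l: "\<nu> (x + y) = \<nu> x + \<nu> y" "\<nu> (c *\<^sub>R x) = c * \<nu> x" if "x \<in> ?S" "y \<in> ?S" for x y c
    using insert.prems(4) that unfolding lin_on_def by auto
  obtain w where w: "w \<in> span B" "\<And>q. q \<in> span B \<Longrightarrow> a w q = \<nu> q"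
    using rep[OF lin_on_subset[OF insert.prems(4) sub]] by blast
  obtain p where p: "p \<in> span B" "\<And>q. q \<in> span B \<Longrightarrow> a p q = a b q"
    using rep[OF lin_on_subset[OF insert.prems(1)[OF bS] sub]] by blast
  \<comment> \<open>\<open>p\<close> represents \<open>a b\<close> on the old span, so
    \<open>r = b - p\<close> satisfies \<open>a r q = 0\<close> for all q in it.\<close>
  define r where "r = b + (-1) *\<^sub>R p"
  have rS: "r \<in> ?S" unfolding r_def using bS p(1) sub by (intro span_add span_scale) auto
  have rq: "a r q = 0" if "q \<in> span B" for q
  proof -
    have S: "p \<in> ?S" "q \<in> ?S" using p(1) that sub by auto
    have "a r q = a b q + a ((-1) *\<^sub>R p) q" unfolding r_def by (rule al(1)[OF bS span_scale[OF S(1)] S(2)])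
    also have "a ((-1) *\<^sub>R p) q = (-1) * a p q" by (rule al(2)[OF S(1) S(1) S(2)])
    finally show ?thesis using p(2)[OF that] by simp
  qed
  \<comment> \<open>Fitted so that \<open>u\<close> is also correct on \<open>r\<close>. If r = 0,
    both sides of that condition are 0 whatever the quotient is.\<close>
  define c where "c = (\<nu> r - a w r) / a r r"
  define u where "u = w + c *\<^sub>R r"
  have uS: "u \<in> ?S" unfolding u_def using w(1) sub rS by (intro span_add span_scale) auto
  have "a u q = \<nu> q" if q: "q \<in> ?S" for q
  proof -
    obtain s q0 where q0: "q0 \<in> span B" "q = q0 + s *\<^sub>R r"
    proof -
      obtain s where "q - s *\<^sub>R b \<in> span B" using q unfolding span_insert by blast
      then have "q - s *\<^sub>R b + s *\<^sub>R p \<in> span B" using p(1) by (intro span_add span_scale)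
      then show ?thesis by (rule that[of _ s]) (simp add: r_def algebra_simps)
    qed
    have wS: "w \<in> ?S" "q0 \<in> ?S" "s *\<^sub>R r \<in> ?S" "c *\<^sub>R r \<in> ?S" using w(1) q0(1) sub rS by (auto intro: span_scale)
    have ur: "a u r = \<nu> r"
    proof (cases "r = 0")
      case True
      have "\<nu> (0 *\<^sub>R r) = 0 * \<nu> r" "a u (0 *\<^sub>R r) = 0 * a u r" by (rule \<nu>l[OF rS rS], rule al(4)[OF rS rS uS])
      then show ?thesis using True by simp
    next
      case False
      then have "a r r \<noteq> 0" using insert.prems(3)[OF rS] by blast
      have "a u r = a w r + c * a r r" unfolding u_def
        using al(1)[OF wS(1,4) rS] al(2)[OF rS rS rS] by simp
      then show ?thesis using \<open>a r r \<noteq> 0\<close> by (simp add: c_def)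
    qed
    have uq0: "a u q0 = \<nu> q0" unfolding u_def
      using al(1)[OF wS(1,4,2)] al(2)[OF rS rS wS(2)] rq[OF q0(1)] w(2)[OF q0(1)] by simp
    show ?thesis unfolding q0(2)
      using al(3)[OF wS(2,3) uS] al(4)[OF rS rS uS] \<nu>l(1)[OF wS(2,3)] \<nu>l(2)[OF rS rS] ur uq0 by simp
  qed
  then show ?case using uS by blast
qed

section \<open>Polynomials\<close>

lemma bilinear_fun_mult: "bilinear (\<lambda>p q :: 'a \<Rightarrow> real. \<lambda>x. p x * q x)"
  unfolding bilinear_def
  by (auto intro!: linearI simp: fun_eq_iff algebra_simps)

lemma bilinear_fun_scale: "bilinear (\<lambda>(p::'a \<Rightarrow> real) (q::'a \<Rightarrow> 'b::real_vector). \<lambda>x. p x *\<^sub>R q x)"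
  unfolding bilinear_def
  by (auto intro!: linearI simp: fun_eq_iff algebra_simps)

lemma polys_subspace: "subspace (polys r)"
  by (simp add: polys_def)

lemma polys_add: "p \<in> polys r \<Longrightarrow> q \<in> polys r \<Longrightarrow> (\<lambda>x. p x + q x) \<in> polys r"
  using subspace_add[OF polys_subspace] by (simp add: plus_fun_def)

lemma polys_cmult: "p \<in> polys r \<Longrightarrow> (\<lambda>x. c * p x) \<in> polys r"
  using subspace_scale[OF polys_subspace] by (simp add: scaleR_fun_def)

lemma polys_zero: "(\<lambda>x. 0) \<in> polys r"
  using subspace_0[OF polys_subspace] by (simp add: zero_fun_def)

lemma polys_sum: "(\<And>i. i \<in> I \<Longrightarrow> p i \<in> polys r) \<Longrightarrow> (\<lambda>x. \<Sum>i\<in>I. p i x) \<in> polys r"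
  by (induction I rule: infinite_finite_induct) (auto simp: polys_zero intro: polys_add)

lemma polys_mult:
  assumes "p \<in> polys r" "q \<in> polys s" shows "(\<lambda>x. p x * q x) \<in> polys (r + s)"
proof -
  have "(\<lambda>x. p x * q x) \<in> span {\<lambda>x. a x * b x | a b.
     a \<in> {\<lambda>x. \<Prod>i\<in>UNIV. (x $ i) ^ (\<alpha> i) | \<alpha>. (\<Sum>i\<in>UNIV. \<alpha> i) \<le> r} \<and>
     b \<in> {\<lambda>x. \<Prod>i\<in>UNIV. (x $ i) ^ (\<alpha> i) | \<alpha>. (\<Sum>i\<in>UNIV. \<alpha> i) \<le> s}}"
    using span_bilinear[OF bilinear_fun_mult] assms unfolding polys_def by blast
  also have "\<dots> \<subseteq> polys (r + s)"
    unfolding polys_def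
  proof (rule span_mono, clarify)
    fix \<alpha> \<beta> :: "'a \<Rightarrow> nat" assume "(\<Sum>i\<in>UNIV. \<alpha> i) \<le> r" "(\<Sum>i\<in>UNIV. \<beta> i) \<le> s"
    then show "\<exists>\<gamma>. (\<lambda>x. (\<Prod>i\<in>UNIV. x $ i ^ \<alpha> i) * (\<Prod>i\<in>UNIV. x $ i ^ \<beta> i)) = (\<lambda>x. \<Prod>i\<in>UNIV. x $ i ^ \<gamma> i) \<and>
        (\<Sum>i\<in>UNIV. \<gamma> i) \<le> r + s"
      by (intro exI[of _ "\<lambda>i. \<alpha> i + \<beta> i"]) (auto simp: power_add prod.distrib sum.distrib)
  qed
  finally show ?thesis .
qed

lemma polys_coord: "(\<lambda>x. x $ i) \<in> polys 1"
  unfolding polys_def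
proof (rule span_base, rule CollectI, intro exI conjI)
  have "(\<Prod>j\<in>UNIV. x $ j ^ (if j = i then 1 else 0)) = x $ i" for x :: "real^'a"
  proof -
    have "(\<Prod>j\<in>UNIV. x $ j ^ (if j = i then 1 else 0)) = (\<Prod>j\<in>UNIV. if j = i then x $ j else 1)"
      by (rule prod.cong) auto
    then show ?thesis by simp
  qed
  then show "(\<lambda>x. x $ i) = (\<lambda>x::real^'a. \<Prod>j\<in>UNIV. x $ j ^ (if j = i then 1 else 0))" by simp
qed simp

lemma polys_1: "(\<lambda>x. 1) \<in> polys r"
  unfolding polys_def by (rule span_base) (auto intro!: exI[of _ "\<lambda>_. 0"])

lemma polys_const: "(\<lambda>x. c) \<in> polys r"
  using polys_cmult[OF polys_1, of c] by simp

lemma polys_affine: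
  assumes "affine_fun g" shows "g \<in> polys 1"
proof -
  obtain a b where ab: "\<And>x. g x = a \<bullet> x + b" using assms unfolding affine_fun_def by blast
  have "(\<lambda>x. (\<Sum>i\<in>UNIV. a $ i * x $ i) + b) \<in> polys 1"
    by (intro polys_add polys_sum polys_cmult polys_coord polys_const)
  moreover have "g = (\<lambda>x. (\<Sum>i\<in>UNIV. a $ i * x $ i) + b)" using ab by (auto simp: inner_vec_def)
  ultimately show ?thesis by simp
qed

lemma polys_power: "p \<in> polys r \<Longrightarrow> (\<lambda>x. p x ^ m) \<in> polys (m * r)"
  by (induction m) (auto simp: polys_1 intro: polys_mult)

lemma polys_prod: "(\<And>i. i \<in> I \<Longrightarrow> p i \<in> polys (r i)) \<Longrightarrow> (\<lambda>x. \<Prod>i\<in>I. p i x) \<in> polys (\<Sum>i\<in>I. r i)"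
  by (induction I rule: infinite_finite_induct) (auto simp: polys_1 intro: polys_mult)

section \<open>Symmetric tensors\<close>

lemma outer_mult_vec: "outer a b *v w = (b \<bullet> w) *\<^sub>R a"
  by (simp add: vec_eq_iff outer_def matrix_vector_mult_def inner_vec_def sum_distrib_right)
    (simp add: ac_simps)

lemma outer_inner: "outer a b \<bullet> outer c d = (a \<bullet> c) * (b \<bullet> d)"
  by (simp add: outer_def inner_vec_def sum_product ac_simps)

lemma transpose_outer: "transpose (outer a b) = outer b a"
  by (simp add: vec_eq_iff outer_def transpose_def mult.commute)

lemma transpose_add: "transpose (A + B) = transpose A + transpose (B :: real^'n^'m)"
  by (simp add: vec_eq_iff transpose_def)

lemma transpose_scaleR: "transpose (c *\<^sub>R A) = c *\<^sub>R transpose (A :: real^'n^'m)"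
  by (simp add: vec_eq_iff transpose_def)

lemma transpose_zero: "transpose (0 :: real^'n^'m) = 0"
  by (simp add: vec_eq_iff transpose_def)

lemma transpose_uminus: "transpose (- A) = - transpose (A :: real^'n^'m)"
  by (simp add: vec_eq_iff transpose_def)

lemma transpose_sum: "transpose (\<Sum>i\<in>I. A i) = (\<Sum>i\<in>I. transpose (A i :: real^'n^'m))"
  by (induction I rule: infinite_finite_induct) (auto simp: transpose_add transpose_zero)

lemma transpose_sym_part: "transpose (sym_part A) = sym_part A"
  by (simp add: sym_part_def transpose_scaleR transpose_add add.commute)

lemma sym_part_outer: "sym_part (outer a b) = (1/2) *\<^sub>R (outer a b + outer b a)"
  by (simp add: sym_part_def transpose_outer)

lemma matrix_vector_mult_scaleR_left: "(c *\<^sub>R A) *v w = c *\<^sub>R (A *v (w :: real^'n))"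
  by (simp add: vec_eq_iff matrix_vector_mult_def sum_distrib_left mult.assoc)

lemma matrix_vector_mult_minus_left: "(- A) *v w = - (A *v (w :: real^'n))"
  by (simp add: vec_eq_iff matrix_vector_mult_def sum_negf)

lemma matrix_vector_mult_sum_left: "(\<Sum>i\<in>I. A i) *v w = (\<Sum>i\<in>I. A i *v (w :: real^'n))"
  by (induction I rule: infinite_finite_induct) (auto simp: matrix_vector_mult_add_rdistrib)

lemma sym_part_outer_mult: "sym_part (outer a b) *v w = (1/2) *\<^sub>R ((b \<bullet> w) *\<^sub>R a + (a \<bullet> w) *\<^sub>R b)"
  by (simp add: sym_part_outer matrix_vector_mult_scaleR_left matrix_vector_mult_add_rdistrib outer_mult_vec)

lemma symmetric_inner: "transpose A = A \<Longrightarrow> a \<bullet> (A *v b) = b \<bullet> (A *v (a :: real^'n))"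
  by (metis dot_lmul_matrix inner_commute vector_transpose_matrix)

lemma outer_inner_sym_part: "outer a a \<bullet> sym_part (outer c d) = (a \<bullet> c) * (a \<bullet> d)"
  by (simp add: sym_part_outer inner_add_right outer_inner algebra_simps)

definition supp :: "(nat \<Rightarrow> nat) \<Rightarrow> nat set"
  where "supp \<alpha> = {m. \<alpha> m \<noteq> 0}"

lemma prod_supp:
  "finite A \<Longrightarrow> (\<And>m. m \<notin> A \<Longrightarrow> \<alpha> m = 0) \<Longrightarrow> A \<subseteq> B \<Longrightarrow> finite B \<Longrightarrow> (\<Prod>m\<in>B. f m ^ \<alpha> m) = (\<Prod>m\<in>A. (f m :: real) ^ \<alpha> m)"
  by (rule prod.mono_neutral_right) auto

context nsimplex
begin

definition pairs :: "(nat \<times> nat) set"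
  where "pairs = {(i, j). i < j \<and> j \<le> CARD('n)}"

lemma finite_pairs: "finite pairs"
  by (rule finite_subset[of _ "{..CARD('n)} \<times> {..CARD('n)}"]) (auto simp: pairs_def)

lemma card_pairs: "2 * card pairs = CARD('n) * (CARD('n) + 1)"
proof -
  have "card pairs = card (SIGMA j:{..CARD('n)}. {..<j})"
    by (rule bij_betw_same_card[of "\<lambda>(i, j). (j, i)"])
      (auto simp: bij_betw_def inj_on_def pairs_def image_iff)
  also have "\<dots> = \<Sum>{..CARD('n)}" by simp
  finally show ?thesis using gauss_sum_nat[of "CARD('n)"] by (simp add: atMost_atLeast0)
qed

definition tt :: "nat \<times> nat \<Rightarrow> real^'n^'n"
  where "tt p = outer (v (snd p) - v (fst p)) (v (snd p) - v (fst p))"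

lemma transpose_tt: "transpose (tt p) = tt p"
  by (simp add: tt_def transpose_outer)

text \<open>The form factors into the products of the edge vector with the two gradients, and a
  gradient is nonzero only on edges at its vertex. For a \<noteq> b both factors survive only on the
  edge {a, b}, with opposite signs.\<close>

lemma tt_grad:
  assumes "p \<in> pairs" "a \<le> CARD('n)" "b \<le> CARD('n)" "a \<noteq> b"
  shows "grad b \<bullet> (tt p *v grad a) = (if {fst p, snd p} = {a, b} then -1 else 0)"
  using assms by (auto simp: tt_def outer_mult_vec pairs_def grad_vertex inner_commute[of _ "grad a"] doubleton_eq_iff)

text \<open>Diagonal entries follow from the off-diagonal ones because the gradients sum to 0
  (\<open>grad_eqI\<close>), and the gradients span.\<close>

lemma tensor_eqI:
  assumes "\<And>a b. a \<le> CARD('n) \<Longrightarrow> b \<le> CARD('n) \<Longrightarrow> a \<noteq> b \<Longrightarrow> grad b \<bullet> (M *v grad a) = grad b \<bullet> (M' *v grad a)"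
  shows "M = M'"
proof -
  have g: "M *v grad a = M' *v grad a" if "a \<le> CARD('n)" for a
    by (rule grad_eqI[OF that]) (use assms that in auto)
  have "M *v w = M' *v w" for w
  proof -
    have "(\<Sum>i\<le>CARD('n). (v i \<bullet> w) *\<^sub>R grad i) = w"
    proof (rule vector_eq_rdot[THEN iffD1], rule allI)
      fix z
      show "(\<Sum>i\<le>CARD('n). (v i \<bullet> w) *\<^sub>R grad i) \<bullet> z = w \<bullet> z"
        using arg_cong[OF grad_expand[of z], of "\<lambda>y. w \<bullet> y"]
        by (simp add: inner_sum_left inner_sum_right inner_commute mult.commute)
    qed
    then have w: "w = (\<Sum>i\<le>CARD('n). (v i \<bullet> w) *\<^sub>R grad i)" by simp
    have "A *v w = (\<Sum>i\<le>CARD('n). (v i \<bullet> w) *\<^sub>R (A *v grad i))" for A :: "real^'n^'n"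
      by (subst w) (simp add: linear_sum[OF matrix_vector_mul_linear] matrix_vector_mult_scaleR)
    then show ?thesis using g by simp
  qed
  then show ?thesis by (simp add: matrix_eq)
qed

text \<open>Pairing with two different gradients isolates one edge by \<open>tt_grad\<close>, and
  these pairings determine a tensor by \<open>tensor_eqI\<close>.\<close>

lemma tensor_expand:
  assumes "transpose S = S"
  shows "S = (\<Sum>p\<in>pairs. (- (grad (snd p) \<bullet> (S *v grad (fst p)))) *\<^sub>R tt p)"
proof (rule tensor_eqI)
  fix a b assume ab: "a \<le> CARD('n)" "b \<le> CARD('n)" "a \<noteq> b"
  define q where "q = (min a b, max a b)"
  have q: "q \<in> pairs" "{fst q, snd q} = {a, b}" using ab by (auto simp: q_def pairs_def)
  have u: "{fst p, snd p} = {a, b} \<longleftrightarrow> p = q" if "p \<in> pairs" for p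
    using that ab by (auto simp: q_def pairs_def doubleton_eq_iff)
  have "grad b \<bullet> ((\<Sum>p\<in>pairs. (- (grad (snd p) \<bullet> (S *v grad (fst p)))) *\<^sub>R tt p) *v grad a)
     = (\<Sum>p\<in>pairs. (- (grad (snd p) \<bullet> (S *v grad (fst p)))) * (grad b \<bullet> (tt p *v grad a)))"
    by (simp only: matrix_vector_mult_sum_left inner_sum_right matrix_vector_mult_scaleR_left inner_scaleR_right)
  also have "\<dots> = (\<Sum>p\<in>pairs. if p = q then grad (snd q) \<bullet> (S *v grad (fst q)) else 0)"
    by (rule sum.cong) (auto simp: tt_grad ab u)
  also have "\<dots> = grad (snd q) \<bullet> (S *v grad (fst q))" using q finite_pairs by simp
  also have "\<dots> = grad b \<bullet> (S *v grad a)"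
    using symmetric_inner[OF assms, of "grad a" "grad b"] by (auto simp: q_def min_def max_def)
  finally show "grad b \<bullet> (S *v grad a) =
    grad b \<bullet> ((\<Sum>p\<in>pairs. (- (grad (snd p) \<bullet> (S *v grad (fst p)))) *\<^sub>R tt p) *v grad a)" by simp
qed

lemma tt_independent:
  assumes "(\<Sum>p\<in>pairs. c p *\<^sub>R tt p) = 0" "q \<in> pairs" shows "c q = 0"
proof -
  have q: "fst q \<le> CARD('n)" "snd q \<le> CARD('n)" "fst q \<noteq> snd q" using assms(2) by (auto simp: pairs_def)
  have "(\<Sum>p\<in>pairs. c p * (grad (snd q) \<bullet> (tt p *v grad (fst q)))) = 0"
    using arg_cong[OF assms(1), of "\<lambda>M. grad (snd q) \<bullet> (M *v grad (fst q))"]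
    by (simp add: matrix_vector_mult_sum_left inner_sum_right matrix_vector_mult_scaleR_left)
  moreover have "(\<Sum>p\<in>pairs. c p * (grad (snd q) \<bullet> (tt p *v grad (fst q)))) = (\<Sum>p\<in>pairs. if p = q then - c q else 0)"
    by (rule sum.cong) (use assms(2) q in \<open>auto simp: tt_grad pairs_def doubleton_eq_iff\<close>)
  ultimately show ?thesis using assms(2) finite_pairs by simp
qed

definition bmono :: "(nat \<Rightarrow> nat) \<Rightarrow> real^'n \<Rightarrow> real"
  where "bmono \<alpha> x = (\<Prod>m\<le>CARD('n). bary v m x ^ \<alpha> m)"

lemma bmono_mult: "bmono \<alpha> x * bmono \<beta> x = bmono (\<lambda>m. \<alpha> m + \<beta> m) x"
  by (simp add: bmono_def power_add prod.distrib)

lemma bmono_polys: "\<alpha> \<in> MI {..CARD('n)} r \<Longrightarrow> bmono \<alpha> \<in> polys r"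
proof -
  assume "\<alpha> \<in> MI {..CARD('n)} r"
  then have "(\<Sum>m\<le>CARD('n). \<alpha> m * 1) = r" by (simp add: MI_def)
  moreover have "(\<lambda>x. \<Prod>m\<le>CARD('n). bary v m x ^ \<alpha> m) \<in> polys (\<Sum>m\<le>CARD('n). \<alpha> m * 1)"
    by (intro polys_prod polys_power polys_affine bary_affine) simp
  ultimately show ?thesis unfolding bmono_def[abs_def] by simp
qed

lemma finite_MI_all: "finite (MI {..CARD('n)} r)"
  by (rule finite_MI) simp

lemma span_bmono_mult:
  assumes "p \<in> span (bmono ` MI {..CARD('n)} r)" "q \<in> span (bmono ` MI {..CARD('n)} s)"
  shows "(\<lambda>x. p x * q x) \<in> span (bmono ` MI {..CARD('n)} (r + s))"
proof -
  have "(\<lambda>x. p x * q x) \<in> span {\<lambda>x. a x * b x | a b. a \<in> bmono ` MI {..CARD('n)} r \<and> b \<in> bmono ` MI {..CARD('n)} s}"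
    using span_bilinear[OF bilinear_fun_mult assms] .
  also have "\<dots> \<subseteq> span (bmono ` MI {..CARD('n)} (r + s))"
  proof (rule span_mono, clarify)
    fix \<alpha> \<beta> assume "\<alpha> \<in> MI {..CARD('n)} r" "\<beta> \<in> MI {..CARD('n)} s"
    then have "(\<lambda>m. \<alpha> m + \<beta> m) \<in> MI {..CARD('n)} (r + s)" by (auto simp: MI_def sum.distrib)
    then show "(\<lambda>x. bmono \<alpha> x * bmono \<beta> x) \<in> bmono ` MI {..CARD('n)} (r + s)"
      by (intro image_eqI[of _ _ "\<lambda>m. \<alpha> m + \<beta> m"]) (auto simp: bmono_mult)
  qed
  finally show ?thesis .
qed

lemma affine_expand:
  assumes "affine_fun h" shows "h x = (\<Sum>i\<le>CARD('n). bary v i x * h (v i))"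
proof -
  have "h = (\<lambda>x. \<Sum>i\<le>CARD('n). h (v i) * bary v i x)"
    by (rule affine_eqI[OF assms])
      (auto intro!: affine_fun_sum affine_fun_cmult bary_affine simp: bary_vertex if_distrib cong: if_cong)
  then show ?thesis by (subst mult.commute) meson
qed

lemma bmono_single: "i \<le> CARD('n) \<Longrightarrow> bmono (\<lambda>m. if m = i then 1 else 0) x = bary v i x"
proof -
  assume i: "i \<le> CARD('n)"
  have "bmono (\<lambda>m. if m = i then 1 else 0) x = (\<Prod>m\<le>CARD('n). if m = i then bary v m x else 1)"
    unfolding bmono_def by (rule prod.cong) auto
  then show ?thesis using i by simp
qed

lemma affine_span_bmono:
  assumes "affine_fun g" shows "g \<in> span (bmono ` MI {..CARD('n)} 1)"
proof -
  have b: "bary v i \<in> span (bmono ` MI {..CARD('n)} 1)" if "i \<le> CARD('n)" for i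
  proof (rule span_base, rule image_eqI)
    show "(\<lambda>m. if m = i then 1 else 0) \<in> MI {..CARD('n)} 1" using that by (auto simp: MI_def)
    show "bary v i = bmono (\<lambda>m. if m = i then 1 else 0)" using bmono_single[OF that] by auto
  qed
  have "g = (\<Sum>i\<le>CARD('n). g (v i) *\<^sub>R bary v i)"
    by (rule ext, subst affine_expand[OF assms]) (simp add: sum_fun_apply mult.commute)
  also have "\<dots> \<in> span (bmono ` MI {..CARD('n)} 1)" by (intro span_sum span_scale b) simp
  finally show ?thesis .
qed

lemma one_span_bmono: "(\<lambda>x. 1) \<in> span (bmono ` MI {..CARD('n)} r)"
proof (induction r)
  case 0
  have "(\<lambda>_. 0) \<in> MI {..CARD('n)} 0" by (simp add: MI_def)
  moreover have "bmono (\<lambda>_. 0) = (\<lambda>x. 1)" by (simp add: bmono_def[abs_def])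
  ultimately show ?case by (metis imageI span_base)
next
  case (Suc r)
  then show ?case using span_bmono_mult[OF Suc affine_span_bmono[OF affine_fun_const[of 1]]] by simp
qed

lemma power_span_mono: "affine_fun g \<Longrightarrow> (\<lambda>x. g x ^ m) \<in> span (bmono ` MI {..CARD('n)} m)"
proof (induction m)
  case 0
  then show ?case using one_span_bmono[of 0] by simp
next
  case (Suc m)
  then show ?case using span_bmono_mult[OF Suc.IH affine_span_bmono] by (simp add: mult.commute)
qed

text \<open>Homogenisation: the coordinates sum to 1, so a polynomial of degree at most r can be
  filled up to a form of degree exactly r by powers of that sum.\<close>

lemma polys_eq: "polys r = span (bmono ` MI {..CARD('n)} r)"
proof
  show "span (bmono ` MI {..CARD('n)} r) \<subseteq> polys r"
    by (rule span_minimal) (auto simp: bmono_polys polys_subspace)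
  show "polys r \<subseteq> span (bmono ` MI {..CARD('n)} r)"
    unfolding polys_def
  proof (rule span_minimal)
    show "{\<lambda>x. \<Prod>i\<in>UNIV. x $ i ^ \<alpha> i |\<alpha>. sum \<alpha> UNIV \<le> r} \<subseteq> span (bmono ` MI {..CARD('n)} r)"
    proof safe
      fix \<alpha> :: "'n \<Rightarrow> nat" assume "sum \<alpha> UNIV \<le> r"
      have "(\<lambda>x. \<Prod>i\<in>I. x $ i ^ \<alpha> i) \<in> span (bmono ` MI {..CARD('n)} (sum \<alpha> I))" if "finite I" for I
        using that
      proof induction
        case empty then show ?case using one_span_bmono[of 0] by simp
      next
        case (insert i I)
        then show ?case using span_bmono_mult[OF power_span_mono[OF affine_fun_coord] insert.IH] by simp
      qed
      from span_bmono_mult[OF this one_span_bmono, of UNIV "r - sum \<alpha> UNIV"]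
      show "(\<lambda>x. \<Prod>i\<in>UNIV. x $ i ^ \<alpha> i) \<in> span (bmono ` MI {..CARD('n)} r)" using \<open>sum \<alpha> UNIV \<le> r\<close> by simp
    qed
  qed simp
qed

lemma polys_expand:
  assumes "p \<in> polys r" obtains c where "\<And>x. p x = (\<Sum>\<alpha>\<in>MI {..CARD('n)} r. c \<alpha> * bmono \<alpha> x)"
proof -
  obtain c where "p = (\<Sum>\<alpha>\<in>MI {..CARD('n)} r. c \<alpha> *\<^sub>R bmono \<alpha>)"
    using assms unfolding polys_eq span_image_finite[OF finite_MI_all] by blast
  then show ?thesis by (intro that[of c]) (simp add: sum_fun_apply)
qed

lemma bary_combination:
  assumes "m \<le> CARD('n)" "J \<subseteq> {..CARD('n)}" "(\<Sum>j\<in>J. w j) = 1"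
  shows "bary v m (\<Sum>j\<in>J. w j *\<^sub>R v j) = (if m \<in> J then w m else 0)"
proof -
  have "bary v m (\<Sum>j\<in>J. w j *\<^sub>R v j) = (\<Sum>j\<in>J. w j * (grad m \<bullet> v j)) + (\<Sum>j\<in>J. w j) * bary v m 0"
    using assms by (subst bary_eq) (auto simp: inner_sum_right)
  also have "\<dots> = (\<Sum>j\<in>J. w j * (grad m \<bullet> v j + bary v m 0))"
    by (simp add: sum.distrib distrib_left sum_distrib_right)
  also have "\<dots> = (\<Sum>j\<in>J. if j = m then w m else 0)"
    by (rule sum.cong) (use assms in \<open>auto simp: bary_eq[symmetric] bary_vertex\<close>)
  finally show ?thesis using assms finite_subset[OF assms(2)] by simp
qed

text \<open>Independence on the open face J. A positive vector y is divided by its sum s to give the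
  coordinates of a point of that face, and a form of degree r only changes by the factor
  \<open>s ^ r\<close>; then \<open>monomial_independent\<close> applies.\<close>

lemma bmono_independent:
  fixes c :: "(nat \<Rightarrow> nat) \<Rightarrow> 'b::real_vector"
  assumes J: "J \<subseteq> {..CARD('n)}" "J \<noteq> {}"
    and z: "\<And>x. (\<And>m. m \<in> J \<Longrightarrow> 0 < bary v m x) \<Longrightarrow> (\<And>m. m \<le> CARD('n) \<Longrightarrow> m \<notin> J \<Longrightarrow> bary v m x = 0) \<Longrightarrow>
      (\<Sum>\<alpha>\<in>MI J r. bmono \<alpha> x *\<^sub>R c \<alpha>) = 0"
    and \<alpha>: "\<alpha> \<in> MI J r"
  shows "c \<alpha> = 0"
proof (rule monomial_independent[where A = "MI J r" and I = J and c = c])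
  have fin: "finite J" using J finite_subset by blast
  then show "finite J" "finite (MI J r)" by (auto intro: finite_MI)
  show "\<And>\<alpha> m. \<alpha> \<in> MI J r \<Longrightarrow> m \<notin> J \<Longrightarrow> \<alpha> m = 0" by (simp add: MI_def)
  fix y :: "nat \<Rightarrow> real" assume y: "\<And>m. m \<in> J \<Longrightarrow> 0 < y m"
  define s where "s = (\<Sum>j\<in>J. y j)"
  have s: "0 < s" unfolding s_def using J fin y by (intro sum_pos) auto
  define x where "x = (\<Sum>j\<in>J. (y j / s) *\<^sub>R v j)"
  have "(\<Sum>j\<in>J. y j / s) = 1" using s by (simp add: sum_divide_distrib[symmetric] s_def[symmetric])
  then have b: "bary v m x = (if m \<in> J then y m / s else 0)" if "m \<le> CARD('n)" for m
    unfolding x_def using bary_combination[OF that J(1)] by simp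
  have m: "bmono \<beta> x = (\<Prod>m\<in>J. y m ^ \<beta> m) / s ^ r" if "\<beta> \<in> MI J r" for \<beta>
  proof -
    have "bmono \<beta> x = (\<Prod>m\<in>J. bary v m x ^ \<beta> m)"
      unfolding bmono_def using that J fin by (intro prod_supp) (auto simp: MI_def)
    also have "\<dots> = (\<Prod>m\<in>J. y m ^ \<beta> m / s ^ \<beta> m)"
      using J by (intro prod.cong) (auto simp: b power_divide)
    also have "\<dots> = (\<Prod>m\<in>J. y m ^ \<beta> m) / s ^ r"
      using that power_sum[of s \<beta> J] by (simp add: prod_dividef MI_def)
    finally show ?thesis .
  qed
  have "(\<Sum>\<beta>\<in>MI J r. bmono \<beta> x *\<^sub>R c \<beta>) = 0"
    using J y s by (intro z) (auto simp: b subset_eq)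
  then have "s ^ r *\<^sub>R (\<Sum>\<beta>\<in>MI J r. bmono \<beta> x *\<^sub>R c \<beta>) = 0" by simp
  moreover have "s ^ r *\<^sub>R (\<Sum>\<beta>\<in>MI J r. bmono \<beta> x *\<^sub>R c \<beta>) = (\<Sum>\<beta>\<in>MI J r. (\<Prod>m\<in>J. y m ^ \<beta> m) *\<^sub>R c \<beta>)"
    unfolding scaleR_sum_right by (rule sum.cong) (use s in \<open>auto simp: m\<close>)
  ultimately show "(\<Sum>\<beta>\<in>MI J r. (\<Prod>m\<in>J. y m ^ \<beta> m) *\<^sub>R c \<beta>) = 0" by simp
qed (rule \<alpha>)

section \<open>Piecewise fields on the split\<close>

text \<open>The representative with pieces \<open>P l\<close>: it is 0 off the open subsimplices, in
  accordance with the convention under which equality almost everywhere is equality.\<close>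

definition asm :: "(nat \<Rightarrow> real^'n \<Rightarrow> real^'n^'n) \<Rightarrow> real^'n \<Rightarrow> real^'n^'n"
  where "asm P = (\<lambda>x. \<Sum>l\<le>CARD('n). indicat_real (interior (subT v l)) x *\<^sub>R P l x)"

lemma linear_asm: "linear asm"
proof (rule linearI)
  show "asm (P + Q) = asm P + asm Q" for P Q
    by (simp add: asm_def fun_eq_iff scaleR_add_right sum.distrib)
  show "asm (c *\<^sub>R P) = c *\<^sub>R asm P" for c P
    unfolding asm_def fun_eq_iff scaleR_fun_apply scaleR_sum_right
    by (intro allI sum.cong refl) (simp add: mult.commute)
qed

lemma asm_on:
  assumes "l \<le> CARD('n)" "x \<in> interior (subT v l)" shows "asm P x = P l x"
proof -
  have "x \<notin> interior (subT v j)" if "j \<le> CARD('n)" "j \<noteq> l" for j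
    using sub_disjoint[OF assms(1) that(1)] that(2) assms(2) by blast
  then have "asm P x = (\<Sum>j\<le>CARD('n). if j = l then P l x else 0)"
    unfolding asm_def using assms by (intro sum.cong) (auto simp: indicator_def)
  then show ?thesis using assms by simp
qed

lemma asm_off: "x \<notin> split_interior v \<Longrightarrow> asm P x = 0"
  unfolding asm_def split_interior_def by (intro sum.neutral) (auto simp: indicator_def)

lemma on_split_eq: "on_split v p = asm (\<lambda>l. p)"
proof
  fix x
  show "on_split v p x = asm (\<lambda>l. p) x"
  proof (cases "x \<in> split_interior v")
    case True
    then show ?thesis by (auto simp: on_split_def split_interior_def asm_on)
  next
    case False
    then show ?thesis by (simp add: on_split_def asm_off)
  qed
qed

lemma sub_closure: "l \<le> CARD('n) \<Longrightarrow> closure (interior (subT v l)) = subT v l"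
proof -
  assume l: "l \<le> CARD('n)"
  have "convex (subT v l)" by (simp add: subT_def simplex_hull_def convex_convex_hull)
  moreover have "interior (subT v l) \<noteq> {}"
    unfolding subT_def by (rule nsimplex.interior_nonempty[OF sub_coord(1)[OF l]])
  ultimately have "closure (interior (subT v l)) = closure (subT v l)" by (rule convex_closure_interior)
  then show ?thesis using sub_closed[OF l] by simp
qed

lemma piece_eq_closed:
  fixes p q :: "real^'n \<Rightarrow> 'b::t2_space"
  assumes "l \<le> CARD('n)" "\<And>x. x \<in> interior (subT v l) \<Longrightarrow> p x = q x" "continuous_on UNIV p" "continuous_on UNIV q"
    "x \<in> subT v l"
  shows "p x = q x"
proof -
  have "closed {x. p x = q x}" using assms(3,4) by (intro closed_Collect_eq) auto
  then have "closure (interior (subT v l)) \<subseteq> {x. p x = q x}"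
    using assms(2) by (intro closure_minimal) auto
  then show ?thesis using assms(1,5) by (auto simp: sub_closure)
qed

lemma facet_subset_subT: "i \<le> CARD('n) \<Longrightarrow> facet i \<subseteq> subT v i"
  by (auto simp: facet_def sub_hull)

definition genB :: "nat \<times> nat \<Rightarrow> (nat \<Rightarrow> nat) \<Rightarrow> nat \<Rightarrow> real^'n \<Rightarrow> real^'n^'n"
  where "genB p \<alpha> = (\<lambda>l x. bmono \<alpha> x *\<^sub>R tt p)"

lemma poly_field_polys:
  assumes "\<And>i j. (\<lambda>x. p x $ i $ j) \<in> polys r"
  shows "(\<lambda>x. a \<bullet> (p x *v b)) \<in> polys r"
proof -
  have "(\<lambda>x. \<Sum>i\<in>UNIV. a $ i * (\<Sum>j\<in>UNIV. b $ j * p x $ i $ j)) \<in> polys r"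
    by (intro polys_sum polys_cmult assms)
  then show ?thesis by (simp add: inner_vec_def matrix_vector_mult_def mult.commute)
qed

text \<open>Expand the tensor in the edges, then each coefficient function in barycentric
  monomials.\<close>

lemma poly_sym_eq: "poly_sym v r = span ((\<lambda>(p, \<alpha>). asm (genB p \<alpha>)) ` (pairs \<times> MI {..CARD('n)} r))"
proof
  show "poly_sym v r \<subseteq> span ((\<lambda>(p, \<alpha>). asm (genB p \<alpha>)) ` (pairs \<times> MI {..CARD('n)} r))"
  proof
    fix \<tau> assume "\<tau> \<in> poly_sym v r"
    then obtain p where p: "\<tau> = on_split v p" "\<And>i j. (\<lambda>x. p x $ i $ j) \<in> polys r"
      "\<And>x. transpose (p x) = p x" unfolding poly_sym_def by blast
    define q where "q s x = - (grad (snd s) \<bullet> (p x *v grad (fst s)))" for s x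
    have q: "q s \<in> polys r" for s
      using polys_cmult[OF poly_field_polys[OF p(2)], of "-1"] by (simp add: q_def[abs_def])
    have "p x = (\<Sum>s\<in>pairs. q s x *\<^sub>R tt s)" for x
      using tensor_expand[OF p(3)] by (simp add: q_def)
    then have "(\<lambda>l::nat. p) = (\<Sum>s\<in>pairs. (\<lambda>l x. q s x *\<^sub>R tt s))" by (simp add: fun_eq_iff sum_fun_apply)
    then have "\<tau> = (\<Sum>s\<in>pairs. asm (\<lambda>l x. q s x *\<^sub>R tt s))"
      by (simp add: p(1) on_split_eq linear_sum[OF linear_asm])
    also have "\<dots> \<in> span ((\<lambda>(p, \<alpha>). asm (genB p \<alpha>)) ` (pairs \<times> MI {..CARD('n)} r))"
    proof (rule span_sum)
      fix s assume s: "s \<in> pairs"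
      obtain c where c: "\<And>x. q s x = (\<Sum>\<alpha>\<in>MI {..CARD('n)} r. c \<alpha> * bmono \<alpha> x)" by (rule polys_expand[OF q[of s]]) (rule that)
      have "(\<lambda>(l::nat) x. q s x *\<^sub>R tt s) = (\<Sum>\<alpha>\<in>MI {..CARD('n)} r. c \<alpha> *\<^sub>R genB s \<alpha>)"
        by (simp add: fun_eq_iff sum_fun_apply c genB_def scaleR_sum_left)
      then have "asm (\<lambda>l x. q s x *\<^sub>R tt s) = (\<Sum>\<alpha>\<in>MI {..CARD('n)} r. c \<alpha> *\<^sub>R asm (genB s \<alpha>))"
        by (simp add: linear_sum[OF linear_asm] linear_cmul[OF linear_asm])
      also have "\<dots> \<in> span ((\<lambda>(p, \<alpha>). asm (genB p \<alpha>)) ` (pairs \<times> MI {..CARD('n)} r))"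
        using s by (intro span_sum span_scale span_base) auto
      finally show "asm (\<lambda>l x. q s x *\<^sub>R tt s) \<in> span ((\<lambda>(p, \<alpha>). asm (genB p \<alpha>)) ` (pairs \<times> MI {..CARD('n)} r))" .
    qed
    finally show "\<tau> \<in> span ((\<lambda>(p, \<alpha>). asm (genB p \<alpha>)) ` (pairs \<times> MI {..CARD('n)} r))" .
  qed
  show "span ((\<lambda>(p, \<alpha>). asm (genB p \<alpha>)) ` (pairs \<times> MI {..CARD('n)} r)) \<subseteq> poly_sym v r"
  proof (rule span_minimal)
    show "(\<lambda>(p, \<alpha>). asm (genB p \<alpha>)) ` (pairs \<times> MI {..CARD('n)} r) \<subseteq> poly_sym v r"
    proof clarify
      fix a b \<alpha> assume "\<alpha> \<in> MI {..CARD('n)} r"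
      have "on_split v (\<lambda>x. bmono \<alpha> x *\<^sub>R tt (a, b)) \<in> poly_sym v r"
        unfolding poly_sym_def
      proof (rule CollectI, rule exI, intro conjI allI)
        show "(\<lambda>x. (bmono \<alpha> x *\<^sub>R tt (a, b)) $ i $ j) \<in> polys r" for i j
          using polys_cmult[OF bmono_polys[OF \<open>\<alpha> \<in> MI {..CARD('n)} r\<close>], of "tt (a, b) $ i $ j"]
          by (simp add: mult.commute)
      qed (auto simp: transpose_scaleR transpose_tt)
      then show "asm (genB (a, b) \<alpha>) \<in> poly_sym v r" by (simp add: on_split_eq genB_def)
    qed
    show "subspace (poly_sym v r)"
    proof (rule subspaceI)
      show "0 \<in> poly_sym v r"
        unfolding poly_sym_def by (rule CollectI, rule exI[of _ "\<lambda>x. 0"])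
          (auto simp: on_split_def fun_eq_iff polys_zero transpose_zero)
    next
      fix x y assume "x \<in> poly_sym v r" "y \<in> poly_sym v r"
      then obtain p q where "x = on_split v p" "\<forall>i j. (\<lambda>x. p x $ i $ j) \<in> polys r"
        "\<forall>x. transpose (p x) = p x" "y = on_split v q" "\<forall>i j. (\<lambda>x. q x $ i $ j) \<in> polys r"
        "\<forall>x. transpose (q x) = q x" unfolding poly_sym_def by blast
      then show "x + y \<in> poly_sym v r"
        unfolding poly_sym_def by (intro CollectI exI[of _ "\<lambda>x. p x + q x"])
          (auto simp: on_split_def fun_eq_iff scaleR_add_right transpose_add intro: polys_add)
    next
      fix c x assume "x \<in> poly_sym v r"
      then obtain p where "x = on_split v p" "\<forall>i j. (\<lambda>x. p x $ i $ j) \<in> polys r"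
        "\<forall>x. transpose (p x) = p x" unfolding poly_sym_def by blast
      then show "c *\<^sub>R x \<in> poly_sym v r"
        unfolding poly_sym_def by (intro CollectI exI[of _ "\<lambda>x. c *\<^sub>R p x"])
          (auto simp: on_split_def fun_eq_iff transpose_scaleR intro: polys_cmult)
    qed
  qed
qed

end

lemma MI_supp: "\<alpha> \<in> MI A k \<Longrightarrow> supp \<alpha> \<subseteq> A"
  by (auto simp: MI_def supp_def)

section \<open>The local space: generators and their normal traces\<close>

locale element = nsimplex v for v :: "nat \<Rightarrow> real^('n::finite)" +
  fixes base :: "nat set \<Rightarrow> nat" and k :: nat
  assumes base_in: "f \<subseteq> {..CARD('n)} \<Longrightarrow> f \<noteq> {} \<Longrightarrow> base f \<in> f"
    and D2: "2 \<le> CARD('n)" and k2: "2 \<le> k"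
begin

definition SS :: "nat \<Rightarrow> nat \<Rightarrow> real^'n^'n"
  where "SS m j = sym_part (outer (barycenter v - v m) (v j - v m))"

text \<open>On \<open>subT v l\<close> the function \<open>\<lambda>\<^sub>m\<^sup>R\<close> is \<open>\<lambda>\<^sub>m - \<lambda>\<^sub>l\<close>.\<close>

definition monoR :: "nat \<Rightarrow> (nat \<Rightarrow> nat) \<Rightarrow> real^'n \<Rightarrow> real"
  where "monoR l \<alpha> x = (\<Prod>m\<le>CARD('n). (bary v m x - bary v l x) ^ \<alpha> m)"

definition genP :: "nat \<Rightarrow> nat \<times> nat \<Rightarrow> (nat \<Rightarrow> nat) \<Rightarrow> nat \<Rightarrow> real^'n \<Rightarrow> real^'n^'n"
  where "genP m p \<alpha> = (\<lambda>l x. monoR l \<alpha> x *\<^sub>R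
    (if l = fst p then SS m (snd p) else if l = snd p then - SS m (fst p) else 0))"

text \<open>A generator is indexed by a pair \<open>p\<close> of vertices and a multi-index \<open>\<alpha>\<close>: the left summand stands
  for \<open>\<lambda>\<^sup>\<alpha> t\<^sub>p \<otimes> t\<^sub>p\<close>, the right one for the bubble \<open>\<lambda>\<^sup>\<alpha> \<phi>\<^sub>p\<close> of the face \<open>supp \<alpha>\<close>.\<close>

type_synonym gen_index = "(nat \<times> nat) \<times> (nat \<Rightarrow> nat) + (nat \<times> nat) \<times> (nat \<Rightarrow> nat)"

definition gen :: "gen_index \<Rightarrow> nat \<Rightarrow> real^'n \<Rightarrow> real^'n^'n"
  where "gen z = (case z of Inl (p, \<alpha>) \<Rightarrow> genB p \<alpha> | Inr (p, \<alpha>) \<Rightarrow> genP (base (supp \<alpha>)) p \<alpha>)"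

text \<open>The exponents vanish at both ends of p, so their support is a face disjoint from p.
  Reading off the face from the support turns the bubbles of all faces into a single family
  (\<open>IP_eq\<close>).\<close>

definition MP :: "nat \<times> nat \<Rightarrow> (nat \<Rightarrow> nat) set"
  where "MP p = MI ({..CARD('n)} - {fst p, snd p}) k"

definition IB :: "gen_index set"
  where "IB = Inl ` (pairs \<times> MI {..CARD('n)} k)"

definition IP :: "gen_index set"
  where "IP = Inr ` (SIGMA p:pairs. MP p)"

definition field where "field u = (\<lambda>l x. \<Sum>z\<in>IB \<union> IP. u z *\<^sub>R gen z l x)"

lemma finite_MP: "finite (MP p)"
  unfolding MP_def by (rule finite_MI) simp

lemma finite_IB: "finite IB" and finite_IP: "finite IP"
  by (auto simp: IB_def IP_def finite_pairs finite_MI_all finite_MP)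

lemma IB_IP: "IB \<inter> IP = {}"
  by (auto simp: IB_def IP_def)

lemma sum_IB: "(\<Sum>z\<in>IB. f z) = (\<Sum>p\<in>pairs. \<Sum>\<alpha>\<in>MI {..CARD('n)} k. f (Inl (p, \<alpha>)))"
proof -
  have "(\<Sum>z\<in>IB. f z) = (\<Sum>z\<in>pairs \<times> MI {..CARD('n)} k. f (Inl z))"
    unfolding IB_def by (subst sum.reindex) (auto simp: inj_on_def)
  then show ?thesis by (simp add: sum.cartesian_product)
qed

lemma sum_IP: "(\<Sum>z\<in>IP. f z) = (\<Sum>p\<in>pairs. \<Sum>\<alpha>\<in>MP p. f (Inr (p, \<alpha>)))"
proof -
  have "(\<Sum>z\<in>IP. f z) = (\<Sum>z\<in>(SIGMA p:pairs. MP p). f (Inr z))"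
    unfolding IP_def by (subst sum.reindex) (auto simp: inj_on_def)
  then show ?thesis by (simp add: sum.Sigma finite_pairs finite_MP)
qed

lemma sum_Z: "(\<Sum>z\<in>IB \<union> IP. f z) = (\<Sum>z\<in>IB. f z) + (\<Sum>z\<in>IP. f z)"
  by (rule sum.union_disjoint[OF finite_IB finite_IP IB_IP])

lemma MP_sub: "MP p \<subseteq> MI {..CARD('n)} k"
  unfolding MP_def by (rule MI_mono) auto

lemma MP_supp:
  assumes "\<alpha> \<in> MP p"
  shows "supp \<alpha> \<subseteq> {..CARD('n)} - {fst p, snd p}" "supp \<alpha> \<noteq> {}" "base (supp \<alpha>) \<in> supp \<alpha>"
    "base (supp \<alpha>) \<le> CARD('n)" "base (supp \<alpha>) \<noteq> fst p" "base (supp \<alpha>) \<noteq> snd p" "0 < \<alpha> (base (supp \<alpha>))"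
proof -
  show s: "supp \<alpha> \<subseteq> {..CARD('n)} - {fst p, snd p}"
    using MI_supp[of \<alpha>] assms unfolding MP_def by metis
  show n: "supp \<alpha> \<noteq> {}"
  proof
    assume "supp \<alpha> = {}"
    then have "\<alpha> = (\<lambda>_. 0)" by (auto simp: supp_def)
    then show False using assms k2 by (auto simp: MP_def MI_def)
  qed
  show b: "base (supp \<alpha>) \<in> supp \<alpha>" using base_in[of "supp \<alpha>"] s n by blast
  then show "base (supp \<alpha>) \<le> CARD('n)" "base (supp \<alpha>) \<noteq> fst p" "base (supp \<alpha>) \<noteq> snd p" using s by auto
  show "0 < \<alpha> (base (supp \<alpha>))" using b by (auto simp: supp_def)
qed

lemma field_add: "field (\<lambda>z. u z + w z) l x = field u l x + field w l x"
  by (simp add: field_def scaleR_add_left sum.distrib)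

lemma field_scale: "field (\<lambda>z. c * u z) l x = c *\<^sub>R field u l x"
  by (simp add: field_def scaleR_sum_right)

lemma field_diff: "field (\<lambda>z. u z - w z) l x = field u l x - field w l x"
  by (simp add: field_def scaleR_diff_left sum_subtractf)

lemma field_single:
  assumes "w \<in> IB \<union> IP" shows "field (\<lambda>z. if z = w then 1 else 0) l x = gen w l x"
proof -
  have "field (\<lambda>z. if z = w then 1 else 0) l x = (\<Sum>z\<in>IB \<union> IP. if z = w then gen w l x else 0)"
    unfolding field_def by (rule sum.cong) auto
  then show ?thesis using assms finite_IB finite_IP by simp
qed

lemma monoR_polys: "l \<le> CARD('n) \<Longrightarrow> \<alpha> \<in> MI {..CARD('n)} r \<Longrightarrow> monoR l \<alpha> \<in> polys r"
proof -
  assume l: "l \<le> CARD('n)" and "\<alpha> \<in> MI {..CARD('n)} r"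
  then have "(\<Sum>m\<le>CARD('n). \<alpha> m * 1) = r" by (simp add: MI_def)
  moreover have "(\<lambda>x. \<Prod>m\<le>CARD('n). (bary v m x - bary v l x) ^ \<alpha> m) \<in> polys (\<Sum>m\<le>CARD('n). \<alpha> m * 1)"
    using l by (intro polys_prod polys_power polys_affine affine_fun_diff bary_affine) auto
  ultimately show ?thesis unfolding monoR_def[abs_def] by simp
qed

lemma scaled_polys:
  assumes "p \<in> polys r" shows "(\<lambda>x. (p x *\<^sub>R (M::real^'n^'n)) $ i $ j) \<in> polys r"
  using polys_cmult[OF assms, of "M $ i $ j"] by (simp add: mult.commute)

lemma gen_polys:
  assumes "z \<in> IB \<union> IP" "l \<le> CARD('n)" shows "(\<lambda>x. gen z l x $ i $ j) \<in> polys k"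
  using assms(1)
proof
  assume "z \<in> IB"
  then obtain p \<alpha> where "z = Inl (p, \<alpha>)" "\<alpha> \<in> MI {..CARD('n)} k" by (auto simp: IB_def)
  then show ?thesis using scaled_polys[OF bmono_polys] by (simp add: gen_def genB_def)
next
  assume "z \<in> IP"
  then obtain p \<alpha> where z: "z = Inr (p, \<alpha>)" "\<alpha> \<in> MP p" by (auto simp: IP_def)
  then have "\<alpha> \<in> MI {..CARD('n)} k" using MP_sub by blast
  with z show ?thesis using scaled_polys[OF monoR_polys[OF assms(2)]] by (simp add: gen_def genP_def)
qed

lemma field_polys: "l \<le> CARD('n) \<Longrightarrow> (\<lambda>x. field u l x $ i $ j) \<in> polys k"
  unfolding field_def by (simp, intro polys_sum polys_cmult gen_polys)

lemma field_nice: "l \<le> CARD('n) \<Longrightarrow> nice_field (field u l)"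
  unfolding nice_field_def using field_polys nice_polys by blast

lemma transpose_gen: "transpose (gen z l x) = gen z l x"
  by (auto simp: gen_def genB_def genP_def SS_def transpose_scaleR transpose_tt transpose_sym_part
      transpose_uminus transpose_zero split: sum.split)

lemma transpose_field: "transpose (field u l x) = field u l x"
  by (simp add: field_def transpose_sum transpose_scaleR transpose_gen)

lemma SS_grad:
  "a \<le> CARD('n) \<Longrightarrow> m \<le> CARD('n) \<Longrightarrow> j \<le> CARD('n) \<Longrightarrow> SS m j *v grad a =
    (1/2) *\<^sub>R (((if j = a then 1 else 0) - (if m = a then 1 else 0)) *\<^sub>R (barycenter v - v m) +
      (1 / (real CARD('n) + 1) - (if m = a then 1 else 0)) *\<^sub>R (v j - v m))"
  unfolding SS_def sym_part_outer_mult
  by (simp add: grad_vertex grad_barycenter inner_commute[of _ "grad a"])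

text \<open>The sign makes it the coefficient of the edge {i, b} in \<open>tensor_expand\<close> for
  symmetric pieces; all b \<noteq> i together determine the normal component on facet i by
  \<open>grad_eqI\<close>.\<close>

definition tr :: "nat \<Rightarrow> nat \<Rightarrow> (nat \<Rightarrow> real^'n \<Rightarrow> real^'n^'n) \<Rightarrow> real^'n \<Rightarrow> real"
  where "tr i b P x = - (grad b \<bullet> (P i x *v grad i))"

lemma tr_genB:
  "p \<in> pairs \<Longrightarrow> i \<le> CARD('n) \<Longrightarrow> b \<le> CARD('n) \<Longrightarrow> i \<noteq> b \<Longrightarrow>
    tr i b (genB p \<alpha>) x = (if {fst p, snd p} = {i, b} then bmono \<alpha> x else 0)"
  by (simp add: tr_def genB_def matrix_vector_mult_scaleR_left tt_grad)

text \<open>The factor 1/2 comes from the symmetrisation, 1 / (d + 1) from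
  \<open>grad i \<bullet> (barycenter v - v m)\<close> for i \<noteq> m.\<close>

definition kap :: real where "kap = 1 / (2 * (real CARD('n) + 1))"

lemma kap_nonzero: "kap \<noteq> 0" by (simp add: kap_def)

text \<open>Trace coefficients of \<open>\<phi>\<close> for the pair p and base vertex m: the normal
  component is \<open>kap\<close> times \<open>v (snd p) - v m\<close> on facet
  \<open>fst p\<close>, minus \<open>kap\<close> times \<open>v (fst p) - v m\<close> on facet
  \<open>snd p\<close>, and 0 on the others. The entry at b = m is a side effect that
  \<open>basic_trace\<close> has to remove.\<close>

definition TP :: "nat \<times> nat \<Rightarrow> nat \<Rightarrow> nat \<Rightarrow> nat \<Rightarrow> real"
  where "TP p m i b = (if i = fst p then - kap * ((if b = snd p then 1 else 0) - (if b = m then 1 else 0))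
    else if i = snd p then kap * ((if b = fst p then 1 else 0) - (if b = m then 1 else 0)) else 0)"

lemma monoR_facet: "bary v i x = 0 \<Longrightarrow> monoR i \<alpha> x = bmono \<alpha> x"
  by (simp add: monoR_def bmono_def)

text \<open>On facet a, with a different from j and m, only the part of \<open>SS m j\<close>
  survives in which \<open>grad a\<close> meets \<open>barycenter v - v m\<close>; the split
  monomial is the ordinary one there.\<close>

lemma tr_genP:
  assumes p: "p \<in> pairs" and ib: "i \<le> CARD('n)" "b \<le> CARD('n)" "i \<noteq> b" and m: "m \<le> CARD('n)" "m \<noteq> fst p" "m \<noteq> snd p"
    and x: "bary v i x = 0"
  shows "tr i b (genP m p \<alpha>) x = bmono \<alpha> x * TP p m i b"
proof -
  have pd: "fst p \<le> CARD('n)" "snd p \<le> CARD('n)" "fst p \<noteq> snd p" using p by (auto simp: pairs_def)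
  have "grad b \<bullet> (SS m j *v grad a) = kap * ((if j = b then 1 else 0) - (if m = b then 1 else 0))"
    if "a \<le> CARD('n)" "j \<le> CARD('n)" "a \<noteq> j" "a \<noteq> m" for a j
    using that m ib by (simp add: SS_grad grad_vertex kap_def)
  then show ?thesis using pd m ib
    by (auto simp: tr_def genP_def TP_def monoR_facet[OF x] matrix_vector_mult_scaleR_left
        matrix_vector_mult_minus_left)
qed

lemma tr_gen_Inl:
  "p \<in> pairs \<Longrightarrow> i \<le> CARD('n) \<Longrightarrow> b \<le> CARD('n) \<Longrightarrow> i \<noteq> b \<Longrightarrow>
    tr i b (gen (Inl (p, \<alpha>))) x = (if {fst p, snd p} = {i, b} then bmono \<alpha> x else 0)"
  by (simp add: gen_def tr_genB)

lemma tr_gen_Inr: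
  "p \<in> pairs \<Longrightarrow> \<alpha> \<in> MP p \<Longrightarrow> i \<le> CARD('n) \<Longrightarrow> b \<le> CARD('n) \<Longrightarrow> i \<noteq> b \<Longrightarrow> bary v i x = 0 \<Longrightarrow>
    tr i b (gen (Inr (p, \<alpha>))) x = bmono \<alpha> x * TP p (base (supp \<alpha>)) i b"
  using MP_supp[of \<alpha> p] by (simp add: gen_def tr_genP)

lemma tr_field: "tr i b (field u) x = (\<Sum>z\<in>IB \<union> IP. u z * tr i b (gen z) x)"
  by (simp add: tr_def field_def matrix_vector_mult_sum_left inner_sum_right
      matrix_vector_mult_scaleR_left sum_negf)

text \<open>If \<alpha> involves l or j, the split monomial vanishes on both sides where the two
  coordinates agree. Otherwise l and j differ from the base vertex m, the normal
  \<open>grad j - grad l\<close> is orthogonal to \<open>barycenter v - v m\<close>, and the signs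
  in \<open>\<phi>\<close> make the remaining vectors coincide.\<close>

lemma conf_gen:
  assumes "z \<in> IB \<union> IP" shows "conf (gen z)"
  using assms
proof
  assume "z \<in> IB"
  then show ?thesis by (auto simp: IB_def gen_def genB_def conf_def)
next
  assume "z \<in> IP"
  then obtain p \<alpha> where z: "z = Inr (p, \<alpha>)" and p: "p \<in> pairs" and \<alpha>: "\<alpha> \<in> MP p" by (auto simp: IP_def)
  define m where "m = base (supp \<alpha>)"
  have m: "m \<le> CARD('n)" "m \<noteq> fst p" "m \<noteq> snd p" using MP_supp[OF \<alpha>] by (auto simp: m_def)
  have pd: "fst p \<le> CARD('n)" "snd p \<le> CARD('n)" "fst p \<noteq> snd p" using p by (auto simp: pairs_def)
  define T where "T l = (if l = fst p then SS m (snd p) else if l = snd p then - SS m (fst p) else 0)" for l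
  have R: "monoR l \<alpha> x = 0" if "\<alpha> j \<noteq> 0" "j \<le> CARD('n)" "bary v l x = bary v j x" for l j x
    unfolding monoR_def using that by (intro prod_zero) (auto intro!: bexI[of _ j])
  have Req: "monoR l \<alpha> x = monoR j \<alpha> x" if "bary v l x = bary v j x" for l j x
    using that by (simp add: monoR_def)
  have T0: "T l *v (grad j - grad l) = T j *v (grad j - grad l)"
    if lj: "l \<le> CARD('n)" "j \<le> CARD('n)" "l \<noteq> j" "\<alpha> j = 0" "\<alpha> l = 0" for l j
  proof -
    have mm: "m \<noteq> l" "m \<noteq> j" using lj MP_supp(7)[OF \<alpha>] by (auto simp: m_def)
    have S: "SS m a *v (grad j - grad l) =
      (1/2) *\<^sub>R (((if a = j then 1 else 0) - (if a = l then 1 else 0)) *\<^sub>R (barycenter v - v m))" if "a \<le> CARD('n)" for a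
    proof -
      define X Y where "X = barycenter v - v m" and "Y = (1 / (real CARD('n) + 1)) *\<^sub>R (v a - v m)"
      have e: "SS m a *v grad c = (1/2) *\<^sub>R ((if a = c then 1 else 0) *\<^sub>R X + Y)" if "c \<le> CARD('n)" "c \<noteq> m" for c
        using SS_grad[OF that(1) m(1) \<open>a \<le> CARD('n)\<close>] that(2) by (simp add: X_def Y_def)
      show ?thesis unfolding matrix_vector_mult_diff_distrib e[OF lj(2) mm(2)[symmetric]] e[OF lj(1) mm(1)[symmetric]] X_def[symmetric]
        by (simp add: scaleR_add_right scaleR_diff_left scaleR_diff_right)
    qed
    show ?thesis using lj pd S[OF pd(1)] S[OF pd(2)]
      by (auto simp: T_def matrix_vector_mult_minus_left)
  qed
  have g: "gen z l x = monoR l \<alpha> x *\<^sub>R T l" for l x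
    by (simp add: z gen_def genP_def T_def m_def)
  show ?thesis
    unfolding conf_def g
  proof (intro allI impI)
    fix l j x assume lj: "l \<le> CARD('n)" "j \<le> CARD('n)" and x: "bary v l x = bary v j x"
    show "(monoR l \<alpha> x *\<^sub>R T l) *v (grad j - grad l) = (monoR j \<alpha> x *\<^sub>R T j) *v (grad j - grad l)"
    proof (cases "l = j \<or> \<alpha> j \<noteq> 0 \<or> \<alpha> l \<noteq> 0")
      case True
      then show ?thesis using R[of j l x] R[of l j x] x lj Req[OF x] by auto
    next
      case False
      then show ?thesis using T0[of l j] lj Req[OF x] by (simp add: matrix_vector_mult_scaleR_left)
    qed
  qed
qed

lemma conf_field: "conf (field u)"
  unfolding conf_def field_def
proof (intro allI impI)
  fix l j x assume lj: "l \<le> CARD('n)" "j \<le> CARD('n)" and x: "bary v l x = bary v j x"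
  have "gen z l x *v (grad j - grad l) = gen z j x *v (grad j - grad l)" if "z \<in> IB \<union> IP" for z
    using conf_gen[OF that] lj x unfolding conf_def by blast
  then show "(\<Sum>z\<in>IB \<union> IP. u z *\<^sub>R gen z l x) *v (grad j - grad l) = (\<Sum>z\<in>IB \<union> IP. u z *\<^sub>R gen z j x) *v (grad j - grad l)"
    by (simp add: matrix_vector_mult_sum_left matrix_vector_mult_scaleR_left)
qed

section \<open>Kernel and surjectivity of the normal trace\<close>

lemma facet_mono_zero: "bary v i x = 0 \<Longrightarrow> i \<le> CARD('n) \<Longrightarrow> \<alpha> i \<noteq> 0 \<Longrightarrow> bmono \<alpha> x = 0"
  unfolding bmono_def by (rule prod_zero) (auto intro!: bexI[of _ i])

lemma pair_unique:
  assumes "i \<le> CARD('n)" "b \<le> CARD('n)" "i \<noteq> b" "p \<in> pairs"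
  shows "{fst p, snd p} = {i, b} \<longleftrightarrow> p = (min i b, max i b)"
  using assms by (auto simp: pairs_def doubleton_eq_iff)

text \<open>The trace on the facet \<open>i\<close> is a polynomial in the barycentric coordinates other than the
  \<open>i\<close>-th; the coefficient of the monomial \<open>\<alpha>\<close> collects one bulk coefficient and the split bubbles.\<close>

lemma tr_coef:
  assumes ib: "i \<le> CARD('n)" "b \<le> CARD('n)" "i \<noteq> b" and x: "bary v i x = 0"
  shows "tr i b (field u) x = (\<Sum>\<alpha>\<in>MI ({..CARD('n)} - {i}) k. bmono \<alpha> x *\<^sub>R
    (u (Inl ((min i b, max i b), \<alpha>)) + (\<Sum>p\<in>pairs. if \<alpha> \<in> MP p then u (Inr (p, \<alpha>)) * TP p (base (supp \<alpha>)) i b else 0)))"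
proof -
  let ?M = "MI ({..CARD('n)} - {i}) k" and ?q = "(min i b, max i b)"
  have q: "?q \<in> pairs" using ib by (auto simp: pairs_def)
  have fM: "finite ?M" by (rule finite_MI) simp
  have sM: "?M \<subseteq> MI {..CARD('n)} k" by (rule MI_mono) auto
  have "(\<Sum>z\<in>IB. u z * tr i b (gen z) x) = (\<Sum>p\<in>pairs. \<Sum>\<alpha>\<in>MI {..CARD('n)} k. u (Inl (p, \<alpha>)) * tr i b (gen (Inl (p, \<alpha>))) x)"
    by (rule sum_IB)
  also have "\<dots> = (\<Sum>p\<in>pairs. if p = ?q then (\<Sum>\<alpha>\<in>MI {..CARD('n)} k. u (Inl (?q, \<alpha>)) * bmono \<alpha> x) else 0)"
    by (rule sum.cong) (auto simp: tr_gen_Inl ib pair_unique)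
  also have "\<dots> = (\<Sum>\<alpha>\<in>MI {..CARD('n)} k. u (Inl (?q, \<alpha>)) * bmono \<alpha> x)" using q finite_pairs by simp
  also have "\<dots> = (\<Sum>\<alpha>\<in>?M. u (Inl (?q, \<alpha>)) * bmono \<alpha> x)"
  proof (rule sum.mono_neutral_right[OF finite_MI_all sM], rule ballI)
    fix \<alpha> assume a: "\<alpha> \<in> MI {..CARD('n)} k - ?M"
    have "\<alpha> i \<noteq> 0"
    proof
      assume "\<alpha> i = 0"
      moreover have "\<alpha> \<in> MI {..CARD('n)} k" using a by (rule DiffD1)
      ultimately have "\<alpha> \<in> ?M" by - (rule MI_restrict[of "{..CARD('n)}"], auto)
      then show False using DiffD2[OF a] by simp
    qed
    then show "u (Inl (?q, \<alpha>)) * bmono \<alpha> x = 0" using facet_mono_zero[OF x ib(1)] by simp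
  qed
  finally have 1: "(\<Sum>z\<in>IB. u z * tr i b (gen z) x) = (\<Sum>\<alpha>\<in>?M. u (Inl (?q, \<alpha>)) * bmono \<alpha> x)" .
  have "(\<Sum>z\<in>IP. u z * tr i b (gen z) x) = (\<Sum>p\<in>pairs. \<Sum>\<alpha>\<in>MP p. u (Inr (p, \<alpha>)) * tr i b (gen (Inr (p, \<alpha>))) x)"
    by (rule sum_IP)
  also have "\<dots> = (\<Sum>p\<in>pairs. \<Sum>\<alpha>\<in>MP p. u (Inr (p, \<alpha>)) * (bmono \<alpha> x * TP p (base (supp \<alpha>)) i b))"
    by (intro sum.cong refl) (simp add: tr_gen_Inr ib x)
  also have "\<dots> = (\<Sum>p\<in>pairs. \<Sum>\<alpha>\<in>?M. if \<alpha> \<in> MP p then u (Inr (p, \<alpha>)) * (bmono \<alpha> x * TP p (base (supp \<alpha>)) i b) else 0)"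
  proof (rule sum.cong[OF refl])
    fix p assume "p \<in> pairs"
    show "(\<Sum>\<alpha>\<in>MP p. u (Inr (p, \<alpha>)) * (bmono \<alpha> x * TP p (base (supp \<alpha>)) i b)) =
      (\<Sum>\<alpha>\<in>?M. if \<alpha> \<in> MP p then u (Inr (p, \<alpha>)) * (bmono \<alpha> x * TP p (base (supp \<alpha>)) i b) else 0)"
    proof (cases "i = fst p \<or> i = snd p")
      case True
      then have "MP p \<subseteq> ?M" unfolding MP_def by (intro MI_mono) auto
      then have "?M \<inter> MP p = MP p" by blast
      then show ?thesis using sum.inter_restrict[OF fM, of _ "MP p"] by simp
    next
      case False
      then have "TP p m i b = 0" for m by (auto simp: TP_def)
      then show ?thesis by (simp cong: if_cong)
    qed
  qed
  also have "\<dots> = (\<Sum>\<alpha>\<in>?M. \<Sum>p\<in>pairs. if \<alpha> \<in> MP p then u (Inr (p, \<alpha>)) * (bmono \<alpha> x * TP p (base (supp \<alpha>)) i b) else 0)"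
    by (rule sum.swap)
  finally have 2: "(\<Sum>z\<in>IP. u z * tr i b (gen z) x) = 
    (\<Sum>\<alpha>\<in>?M. \<Sum>p\<in>pairs. if \<alpha> \<in> MP p then u (Inr (p, \<alpha>)) * (bmono \<alpha> x * TP p (base (supp \<alpha>)) i b) else 0)" .
  show ?thesis
    unfolding tr_field sum_Z 1 2 sum.distrib[symmetric]
    by (rule sum.cong[OF refl])
      (auto simp: distrib_left sum_distrib_left mult.commute mult.left_commute intro!: sum.cong)
qed

text \<open>For a pair {i, j} and \<alpha> avoiding both ends, the coefficients at (i, j) and (j, i)
  contain the same bulk unknown and the bubble unknown with factors \<open>- kap\<close> and
  \<open>kap\<close>; their difference isolates the bubble. Afterwards each coefficient is a single
  bulk unknown.\<close>

lemma kernel: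
  assumes z: "\<And>i b x. i \<le> CARD('n) \<Longrightarrow> b \<le> CARD('n) \<Longrightarrow> i \<noteq> b \<Longrightarrow> x \<in> ri i \<Longrightarrow> tr i b (field u) x = 0"
  shows "z \<in> IP \<Longrightarrow> u z = 0"
    and "p \<in> pairs \<Longrightarrow> \<alpha> \<in> MI {..CARD('n)} k \<Longrightarrow> \<alpha> (fst p) = 0 \<or> \<alpha> (snd p) = 0 \<Longrightarrow> u (Inl (p, \<alpha>)) = 0"
proof -
  have coef: "u (Inl ((min i b, max i b), \<alpha>)) +
      (\<Sum>p\<in>pairs. if \<alpha> \<in> MP p then u (Inr (p, \<alpha>)) * TP p (base (supp \<alpha>)) i b else 0) = 0"
    if ib: "i \<le> CARD('n)" "b \<le> CARD('n)" "i \<noteq> b" and \<alpha>: "\<alpha> \<in> MI ({..CARD('n)} - {i}) k" for i b \<alpha>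
  proof (rule bmono_independent[OF _ _ _ \<alpha>, where c = "\<lambda>\<alpha>. u (Inl ((min i b, max i b), \<alpha>)) +
      (\<Sum>p\<in>pairs. if \<alpha> \<in> MP p then u (Inr (p, \<alpha>)) * TP p (base (supp \<alpha>)) i b else 0)"])
    show "{..CARD('n)} - {i} \<noteq> {}" using ib by auto
    fix x assume "\<And>m. m \<in> {..CARD('n)} - {i} \<Longrightarrow> 0 < bary v m x" "\<And>m. m \<le> CARD('n) \<Longrightarrow> m \<notin> {..CARD('n)} - {i} \<Longrightarrow> bary v m x = 0"
    then have x: "x \<in> ri i" using ib by (auto simp: ri_def)
    then show "(\<Sum>\<alpha>\<in>MI ({..CARD('n)} - {i}) k. bmono \<alpha> x *\<^sub>R
      (u (Inl ((min i b, max i b), \<alpha>)) + (\<Sum>p\<in>pairs. if \<alpha> \<in> MP p then u (Inr (p, \<alpha>)) * TP p (base (supp \<alpha>)) i b else 0))) = 0"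
      using z[OF ib x] tr_coef[OF ib, of x u] by (simp add: ri_def)
  qed auto
  have Inr0: "u (Inr (p, \<alpha>)) = 0" if p: "p \<in> pairs" and \<alpha>: "\<alpha> \<in> MP p" for p \<alpha>
  proof -
    obtain i j where ij: "p = (i, j)" by (cases p)
    then have d: "i \<le> CARD('n)" "j \<le> CARD('n)" "i < j" using p by (auto simp: pairs_def)
    note m = MP_supp[OF \<alpha>]
    have \<alpha>i: "\<alpha> \<in> MI ({..CARD('n)} - {i}) k" "\<alpha> \<in> MI ({..CARD('n)} - {j}) k"
      using \<alpha> unfolding MP_def ij by (auto intro: MI_mono[THEN subsetD, rotated 2])
    have s1: "(\<Sum>q\<in>pairs. if \<alpha> \<in> MP q then u (Inr (q, \<alpha>)) * TP q (base (supp \<alpha>)) i j else 0) = - kap * u (Inr (p, \<alpha>))"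
    proof -
      \<comment> \<open>Only q = p contributes: q has to contain i, and an entry of another q at its
        base vertex would require \<alpha> j \<noteq> 0.\<close>
      have "(\<Sum>q\<in>pairs. if \<alpha> \<in> MP q then u (Inr (q, \<alpha>)) * TP q (base (supp \<alpha>)) i j else 0)
        = (\<Sum>q\<in>pairs. if q = p then - kap * u (Inr (p, \<alpha>)) else 0)"
        using m d \<alpha> by (intro sum.cong refl) (auto simp: TP_def ij pairs_def)
      then show ?thesis using p finite_pairs by simp
    qed
    have s2: "(\<Sum>q\<in>pairs. if \<alpha> \<in> MP q then u (Inr (q, \<alpha>)) * TP q (base (supp \<alpha>)) j i else 0) = kap * u (Inr (p, \<alpha>))"
    proof -
      have "(\<Sum>q\<in>pairs. if \<alpha> \<in> MP q then u (Inr (q, \<alpha>)) * TP q (base (supp \<alpha>)) j i else 0)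
        = (\<Sum>q\<in>pairs. if q = p then kap * u (Inr (p, \<alpha>)) else 0)"
        using m d \<alpha> by (intro sum.cong refl) (auto simp: TP_def ij pairs_def)
      then show ?thesis using p finite_pairs by simp
    qed
    have "kap * u (Inr (p, \<alpha>)) = 0"
      using coef[of i j \<alpha>] coef[of j i \<alpha>] d \<alpha>i s1 s2 by (simp add: min_def max_def)
    then show ?thesis using kap_nonzero by simp
  qed
  then show "z \<in> IP \<Longrightarrow> u z = 0" by (auto simp: IP_def)
  show "u (Inl (p, \<alpha>)) = 0" if p: "p \<in> pairs" and \<alpha>: "\<alpha> \<in> MI {..CARD('n)} k" and "\<alpha> (fst p) = 0 \<or> \<alpha> (snd p) = 0"
  proof -
    obtain i j where ij: "p = (i, j)" by (cases p)
    then have d: "i \<le> CARD('n)" "j \<le> CARD('n)" "i < j" using p by (auto simp: pairs_def)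
    have s0: "(\<Sum>q\<in>pairs. if \<beta> \<in> MP q then u (Inr (q, \<beta>)) * TP q (base (supp \<beta>)) a b else 0) = 0" for \<beta> a b
      by (rule sum.neutral) (simp add: Inr0)
    from that(3) show ?thesis
    proof
      assume "\<alpha> (fst p) = 0"
      then have "\<alpha> \<in> MI ({..CARD('n)} - {i}) k" using \<alpha> ij by - (rule MI_restrict[of "{..CARD('n)}"], auto)
      then show ?thesis using coef[of i j \<alpha>] d ij by (simp add: s0 min_def max_def)
    next
      assume "\<alpha> (snd p) = 0"
      then have "\<alpha> \<in> MI ({..CARD('n)} - {j}) k" using \<alpha> ij by - (rule MI_restrict[of "{..CARD('n)}"], auto)
      then show ?thesis using coef[of j i \<alpha>] d ij by (simp add: s0 min_def max_def)
    qed
  qed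
qed

text \<open>Zero traces remove the bubbles by \<open>kernel\<close>. What remains is one polynomial
  field, the same on all pieces and zero on T, and both the monomials and the edge tensors are
  independent.\<close>

lemma independent_gen:
  assumes z: "asm (field u) = 0" and w: "w \<in> IB \<union> IP"
  shows "u w = 0"
proof -
  have zero: "field u l x = 0" if "l \<le> CARD('n)" "x \<in> subT v l" for l x
  proof (rule piece_eq_closed[OF that(1) _ _ _ that(2)])
    show "field u l y = 0" if "y \<in> interior (subT v l)" for y
      using asm_on[OF \<open>l \<le> CARD('n)\<close> that, of "field u"] z by simp
    show "continuous_on UNIV (field u l)" by (rule nice_field_continuous[OF field_nice[OF that(1)]])
  qed simp
  have "tr i b (field u) x = 0" if "i \<le> CARD('n)" "x \<in> ri i" for i b x
    using zero[of i x] ri_subset[OF that(1)] facet_subset_subT[OF that(1)] that by (auto simp: tr_def)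
  then have IP0: "u z = 0" if "z \<in> IP" for z using kernel(1) that by blast
  have f: "field u l x = (\<Sum>\<alpha>\<in>MI {..CARD('n)} k. bmono \<alpha> x *\<^sub>R (\<Sum>p\<in>pairs. u (Inl (p, \<alpha>)) *\<^sub>R tt p))" for l x
  proof -
    have "field u l x = (\<Sum>p\<in>pairs. \<Sum>\<alpha>\<in>MI {..CARD('n)} k. u (Inl (p, \<alpha>)) *\<^sub>R gen (Inl (p, \<alpha>)) l x)"
      unfolding field_def sum_Z sum_IB using IP0 by simp
    also have "\<dots> = (\<Sum>\<alpha>\<in>MI {..CARD('n)} k. \<Sum>p\<in>pairs. u (Inl (p, \<alpha>)) *\<^sub>R gen (Inl (p, \<alpha>)) l x)" by (rule sum.swap)
    finally show ?thesis by (simp add: gen_def genB_def scaleR_sum_right mult.commute)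
  qed
  have IB0: "u (Inl (p, \<alpha>)) = 0" if "p \<in> pairs" "\<alpha> \<in> MI {..CARD('n)} k" for p \<alpha>
  proof -
    have "(\<Sum>p\<in>pairs. u (Inl (p, \<alpha>)) *\<^sub>R tt p) = 0"
    proof (rule bmono_independent[OF subset_refl _ _ that(2), where c = "\<lambda>\<alpha>. \<Sum>p\<in>pairs. u (Inl (p, \<alpha>)) *\<^sub>R tt p"])
      fix x assume "\<And>m. m \<in> {..CARD('n)} \<Longrightarrow> 0 < bary v m x"
      then have "x \<in> simplex_hull v" by (auto simp: hull_eq less_imp_le)
      then obtain l where "l \<le> CARD('n)" "x \<in> subT v l" by (auto simp: hull_sub)
      then show "(\<Sum>\<alpha>\<in>MI {..CARD('n)} k. bmono \<alpha> x *\<^sub>R (\<Sum>p\<in>pairs. u (Inl (p, \<alpha>)) *\<^sub>R tt p)) = 0"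
        using zero[of l x] f[of l x] by simp
    qed auto
    then show ?thesis using tt_independent[of "\<lambda>p. u (Inl (p, \<alpha>))"] that by blast
  qed
  show ?thesis using w IP0 IB0 by (auto simp: IB_def)
qed

definition has_tr where
  "has_tr u T \<longleftrightarrow> (\<forall>i\<le>CARD('n). \<forall>b\<le>CARD('n). i \<noteq> b \<longrightarrow> (\<forall>x\<in>facet i. tr i b (field u) x = T i b x))"

lemma has_tr_comb:
  assumes "has_tr u T" "has_tr w S"
  shows "has_tr (\<lambda>z. a * u z + c * w z) (\<lambda>i b x. a * T i b x + c * S i b x)"
proof -
  have "tr i b (field (\<lambda>z. a * u z + c * w z)) x = a * tr i b (field u) x + c * tr i b (field w) x" for i b x
    by (simp add: tr_def field_add field_scale matrix_vector_mult_add_rdistrib matrix_vector_mult_scaleR_left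
        inner_add_right algebra_simps)
  then show ?thesis using assms by (simp add: has_tr_def)
qed

lemma has_tr_sum:
  assumes "\<And>i. i \<in> I \<Longrightarrow> has_tr (u i) (T i)" "finite I"
  shows "has_tr (\<lambda>z. \<Sum>i\<in>I. c i * u i z) (\<lambda>j b x. \<Sum>i\<in>I. c i * T i j b x)"
  using assms(2,1)
proof induction
  case empty
  then show ?case by (simp add: has_tr_def tr_field)
next
  case (insert i I)
  then show ?case using has_tr_comb[of "u i" "T i" "\<lambda>z. \<Sum>i\<in>I. c i * u i z" _ "c i" 1] by simp
qed

text \<open>As \<alpha> contains b, the monomial vanishes on facet b, and the bulk field of the edge
  {i, b} keeps only its trace on facet i.\<close>

lemma basic_trace_pos:
  assumes ib: "i \<le> CARD('n)" "b \<le> CARD('n)" "i \<noteq> b" and \<alpha>: "\<alpha> \<in> MI {..CARD('n)} k" "\<alpha> b \<noteq> 0"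
  shows "\<exists>u. has_tr u (\<lambda>i' b' x. if i' = i \<and> b' = b then bmono \<alpha> x else 0)"
proof -
  define q where "q = (min i b, max i b)"
  have q: "q \<in> pairs" using ib by (auto simp: q_def pairs_def)
  have "Inl (q, \<alpha>) \<in> IB \<union> IP" using q \<alpha> by (auto simp: IB_def)
  note f = field_single[OF this]
  have "has_tr (\<lambda>z. if z = Inl (q, \<alpha>) then 1 else 0) (\<lambda>i' b' x. if i' = i \<and> b' = b then bmono \<alpha> x else 0)"
    unfolding has_tr_def
  proof (intro allI impI ballI)
    fix i' b' x assume i': "i' \<le> CARD('n)" "b' \<le> CARD('n)" "i' \<noteq> b'" and x: "x \<in> facet i'"
    have "tr i' b' (field (\<lambda>z. if z = Inl (q, \<alpha>) then 1 else 0)) x = tr i' b' (gen (Inl (q, \<alpha>))) x"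
      by (simp only: tr_def f)
    also have "\<dots> = (if {fst q, snd q} = {i', b'} then bmono \<alpha> x else 0)" using q i' by (simp add: tr_gen_Inl)
    also have "{fst q, snd q} = {i', b'} \<longleftrightarrow> i' = i \<and> b' = b \<or> i' = b \<and> b' = i"
      using ib i' by (auto simp: q_def doubleton_eq_iff min_def max_def)
    finally show "tr i' b' (field (\<lambda>z. if z = Inl (q, \<alpha>) then 1 else 0)) x = (if i' = i \<and> b' = b then bmono \<alpha> x else 0)"
      using facet_mono_zero[of b x \<alpha>] \<alpha> x ib by (auto simp: facet_def)
  qed
  then show ?thesis by blast
qed

text \<open>The remaining case is \<alpha> b = 0: half of the symmetric trace of the bulk field plus
  or minus half of an antisymmetric trace, made from a bubble after correction, isolates one of the
  two entries.\<close>

lemma basic_trace: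
  assumes ib: "i \<le> CARD('n)" "b \<le> CARD('n)" "i \<noteq> b" and \<alpha>: "\<alpha> \<in> MI {..CARD('n)} k" "\<alpha> i = 0"
  shows "\<exists>u. has_tr u (\<lambda>i' b' x. if i' = i \<and> b' = b then bmono \<alpha> x else 0)"
proof (cases "\<alpha> b = 0")
  case True
  define q where "q = (min i b, max i b)"
  define f s where "f = min i b" and "s = max i b"
  have q: "q \<in> pairs" "q = (f, s)" using ib by (auto simp: q_def f_def s_def pairs_def)
  have fs: "f \<le> CARD('n)" "s \<le> CARD('n)" "f < s" using ib by (auto simp: f_def s_def)
  have ib_fs: "(i = f \<and> b = s) \<or> (i = s \<and> b = f)" using ib by (auto simp: f_def s_def)
  have \<alpha>q: "\<alpha> \<in> MP q" unfolding MP_def q(2) using \<alpha> True ib_fs by - (rule MI_restrict[of "{..CARD('n)}"], auto)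
  define m where "m = base (supp \<alpha>)"
  have m: "m \<le> CARD('n)" "m \<noteq> f" "m \<noteq> s" "\<alpha> m \<noteq> 0" using MP_supp[OF \<alpha>q] by (auto simp: m_def q(2))
  \<comment> \<open>\<alpha> contains the base vertex m, so the unwanted entries of the bubble at m
    can be produced separately by \<open>basic_trace_pos\<close> and then cancelled.\<close>
  obtain uf where uf: "has_tr uf (\<lambda>i' b' x. if i' = f \<and> b' = m then bmono \<alpha> x else 0)"
    using basic_trace_pos[of f m \<alpha>] fs m \<alpha> by auto
  obtain us where us: "has_tr us (\<lambda>i' b' x. if i' = s \<and> b' = m then bmono \<alpha> x else 0)"
    using basic_trace_pos[of s m \<alpha>] fs m \<alpha> by auto
  have z1: "has_tr (\<lambda>z. if z = Inl (q, \<alpha>) then 1 else 0)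
     (\<lambda>i' b' x. if (i' = f \<and> b' = s) \<or> (i' = s \<and> b' = f) then bmono \<alpha> x else 0)"
    unfolding has_tr_def
  proof (intro allI impI ballI)
    fix i' b' x assume i': "i' \<le> CARD('n)" "b' \<le> CARD('n)" "i' \<noteq> b'" and x: "x \<in> facet i'"
    have "Inl (q, \<alpha>) \<in> IB \<union> IP" using q \<alpha> by (auto simp: IB_def)
    then have "tr i' b' (field (\<lambda>z. if z = Inl (q, \<alpha>) then 1 else 0)) x = tr i' b' (gen (Inl (q, \<alpha>))) x"
      by (simp only: tr_def field_single)
    also have "\<dots> = (if {fst q, snd q} = {i', b'} then bmono \<alpha> x else 0)" using q i' by (simp add: tr_gen_Inl)
    also have "{fst q, snd q} = {i', b'} \<longleftrightarrow> i' = f \<and> b' = s \<or> i' = s \<and> b' = f"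
      by (auto simp: q(2) doubleton_eq_iff)
    finally show "tr i' b' (field (\<lambda>z. if z = Inl (q, \<alpha>) then 1 else 0)) x =
      (if (i' = f \<and> b' = s) \<or> (i' = s \<and> b' = f) then bmono \<alpha> x else 0)" .
  qed
  have z2: "has_tr (\<lambda>z. if z = Inr (q, \<alpha>) then 1 else 0) (\<lambda>i' b' x. bmono \<alpha> x * TP q m i' b')"
    unfolding has_tr_def
  proof (intro allI impI ballI)
    fix i' b' x assume i': "i' \<le> CARD('n)" "b' \<le> CARD('n)" "i' \<noteq> b'" and x: "x \<in> facet i'"
    have "Inr (q, \<alpha>) \<in> IB \<union> IP" using q \<alpha>q by (auto simp: IP_def)
    then have "tr i' b' (field (\<lambda>z. if z = Inr (q, \<alpha>) then 1 else 0)) x = tr i' b' (gen (Inr (q, \<alpha>))) x"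
      by (simp only: tr_def field_single)
    also have "\<dots> = bmono \<alpha> x * TP q m i' b'" using q \<alpha>q i' x by (simp add: tr_gen_Inr m_def facet_def)
    finally show "tr i' b' (field (\<lambda>z. if z = Inr (q, \<alpha>) then 1 else 0)) x = bmono \<alpha> x * TP q m i' b'" .
  qed
  \<comment> \<open>The sign of the antisymmetric part; it selects the entry (f, s) or (s,
    f).\<close>
  define e :: real where "e = (if i = f then 1 else -1)"
  let ?T = "\<lambda>i' b' x. 1/2 * (if (i' = f \<and> b' = s) \<or> (i' = s \<and> b' = f) then bmono \<alpha> x else 0)
     + (- e / (2 * kap)) * (1 * (bmono \<alpha> x * TP q m i' b') + 1 * ((- kap) * (if i' = f \<and> b' = m then bmono \<alpha> x else 0)
      + kap * (if i' = s \<and> b' = m then bmono \<alpha> x else 0)))"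
  have "\<exists>u. has_tr u ?T"
    using has_tr_comb[OF z1 has_tr_comb[OF z2 has_tr_comb[OF uf us, of "- kap" kap], of 1 1], of "1/2" "- e / (2 * kap)"] by blast
  moreover have "?T i' b' x = (if i' = i \<and> b' = b then bmono \<alpha> x else 0)" for i' b' x
  proof -
    \<comment> \<open>With the entries at m removed, the bubble has trace \<open>kap\<close> at (s,
      f) and \<open>- kap\<close> at (f, s), times the monomial.\<close>
    have A: "1 * (B * TP q m i' b') + 1 * ((- kap) * (if i' = f \<and> b' = m then B else 0)
        + kap * (if i' = s \<and> b' = m then B else 0))
      = kap * ((if i' = s \<and> b' = f then B else 0) - (if i' = f \<and> b' = s then B else 0))" for B
      using fs m by (auto simp: TP_def q(2))
    have C: "(- e / (2 * kap)) * (kap * y) = - (e / 2) * y" for y using kap_nonzero by simp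
    from ib_fs show ?thesis unfolding A C using fs
      by (elim disjE conjE) (auto simp: e_def)
  qed
  ultimately show ?thesis by simp
next
  case False
  then show ?thesis using basic_trace_pos[OF ib \<alpha>(1)] by simp
qed

text \<open>Monomials with \<alpha> i \<noteq> 0 vanish on facet i and may be dropped from the data
  there; \<open>basic_trace\<close> realises the others one at a time.\<close>

lemma trace_solve:
  assumes g: "\<And>i b. g i b \<in> polys k"
  shows "\<exists>u. \<forall>i\<le>CARD('n). \<forall>b\<le>CARD('n). i \<noteq> b \<longrightarrow> (\<forall>x\<in>facet i. tr i b (field u) x = g i b x)"
proof -
  have "\<exists>c. \<forall>x. g i b x = (\<Sum>\<alpha>\<in>MI {..CARD('n)} k. c \<alpha> * bmono \<alpha> x)" for i b
    using polys_expand[OF g[of i b]] by metis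
  then obtain c where c: "\<And>i b x. g i b x = (\<Sum>\<alpha>\<in>MI {..CARD('n)} k. c i b \<alpha> * bmono \<alpha> x)" by metis
  define I where "I = {(i, b, \<alpha>). i \<le> CARD('n) \<and> b \<le> CARD('n) \<and> i \<noteq> b \<and> \<alpha> \<in> MI {..CARD('n)} k \<and> \<alpha> i = 0}"
  have fI: "finite I"
    by (rule finite_subset[of _ "{..CARD('n)} \<times> {..CARD('n)} \<times> MI {..CARD('n)} k"]) (auto simp: I_def finite_MI_all)
  define T :: "nat \<times> nat \<times> (nat \<Rightarrow> nat) \<Rightarrow> nat \<Rightarrow> nat \<Rightarrow> real^'n \<Rightarrow> real"
    where "T t i' b' x = (case t of (i, b, \<alpha>) \<Rightarrow> if i' = i \<and> b' = b then bmono \<alpha> x else 0)" for t i' b' x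
  have "\<forall>t\<in>I. \<exists>u. has_tr u (T t)"
    unfolding T_def I_def using basic_trace by auto
  then obtain U where U: "\<And>t. t \<in> I \<Longrightarrow> has_tr (U t) (T t)" by metis
  define C where "C t = (case t of (i, b, \<alpha>) \<Rightarrow> c i b \<alpha>)" for t
  have h: "has_tr (\<lambda>z. \<Sum>t\<in>I. C t * U t z) (\<lambda>j b x. \<Sum>t\<in>I. C t * T t j b x)"
    by (rule has_tr_sum[OF U fI])
  have "(\<Sum>t\<in>I. C t * T t j b x) = g j b x" if j: "j \<le> CARD('n)" "b \<le> CARD('n)" "j \<noteq> b" "x \<in> facet j" for j b x
  proof -
    let ?A = "{\<alpha> \<in> MI {..CARD('n)} k. \<alpha> j = 0}"
    have "(\<Sum>t\<in>I. C t * T t j b x) = (\<Sum>t\<in>(\<lambda>\<alpha>. (j, b, \<alpha>)) ` ?A. C t * T t j b x)"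
      using fI j by (intro sum.mono_neutral_right) (auto simp: I_def T_def image_iff split: if_splits)
    also have "\<dots> = (\<Sum>\<alpha>\<in>?A. c j b \<alpha> * bmono \<alpha> x)"
      by (subst sum.reindex) (auto simp: inj_on_def C_def T_def)
    also have "\<dots> = (\<Sum>\<alpha>\<in>MI {..CARD('n)} k. c j b \<alpha> * bmono \<alpha> x)"
      using j facet_mono_zero[of j x] by (intro sum.mono_neutral_left finite_MI_all) (auto simp: facet_def)
    finally show ?thesis by (simp add: c)
  qed
  then show ?thesis using h unfolding has_tr_def by (metis (no_types, lifting))
qed

lemma facet_solve:
  assumes w: "\<And>i j. (\<lambda>x. w i x $ j) \<in> polys k"
  shows "\<exists>u. \<forall>i\<le>CARD('n). \<forall>x\<in>facet i. field u i x *v grad i = w i x"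
proof -
  have "(\<lambda>x. - (grad b \<bullet> w i x)) \<in> polys k" for i b
  proof -
    have "(\<lambda>x. (-1) * (\<Sum>j\<in>UNIV. grad b $ j * w i x $ j)) \<in> polys k"
      by (intro polys_cmult polys_sum w)
    then show ?thesis by (simp add: inner_vec_def)
  qed
  then obtain u where u: "\<And>i b x. i \<le> CARD('n) \<Longrightarrow> b \<le> CARD('n) \<Longrightarrow> i \<noteq> b \<Longrightarrow> x \<in> facet i \<Longrightarrow> tr i b (field u) x = - (grad b \<bullet> w i x)"
    using trace_solve[of "\<lambda>i b x. - (grad b \<bullet> w i x)"] by blast
  have "field u i x *v grad i = w i x" if "i \<le> CARD('n)" "x \<in> facet i" for i x
    by (rule grad_eqI[OF that(1)]) (use u[OF that(1) _ _ that(2)] in \<open>auto simp: tr_def\<close>)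
  then show ?thesis by blast
qed

end

section \<open>Generators of the defining spaces, first direct sum, dimension\<close>

context element
begin

abbreviation g where "g z \<equiv> asm (gen z)"

lemma finite_Z: "finite (IB \<union> IP)"
  using finite_IB finite_IP by blast

lemma asm_field: "asm (field u) = (\<Sum>z\<in>IB \<union> IP. u z *\<^sub>R g z)"
proof -
  have "field u = (\<Sum>z\<in>IB \<union> IP. u z *\<^sub>R gen z)"
    by (simp add: fun_eq_iff field_def sum_fun_apply)
  then show ?thesis by (simp add: linear_sum[OF linear_asm] linear_cmul[OF linear_asm])
qed

lemma g_independent: "(\<Sum>z\<in>IB \<union> IP. c z *\<^sub>R g z) = 0 \<Longrightarrow> z \<in> IB \<union> IP \<Longrightarrow> c z = 0"
  using independent_gen[of c z] by (simp add: asm_field)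

text \<open>Exponents with support exactly f: the bubble factor contributes one power of each
  coordinate of f, and the polynomial factor involves no others.\<close>

definition JP :: "nat set \<Rightarrow> gen_index set"
  where "JP f = Inr ` {(p, \<alpha>). p \<in> pairs \<and> fst p \<notin> f \<and> snd p \<notin> f \<and> \<alpha> \<in> MI f k \<and> supp \<alpha> = f}"

lemma bump_power:
  assumes "f \<subseteq> {..CARD('n)}"
  shows "(\<Prod>m\<in>f. (a m :: real) ^ \<beta> m) * (\<Prod>m\<in>f. a m) = (\<Prod>m\<le>CARD('n). a m ^ (if m \<in> f then \<beta> m + 1 else 0))"
proof -
  have fin: "finite f" using assms finite_subset by blast
  have "(\<Prod>m\<le>CARD('n). a m ^ (if m \<in> f then \<beta> m + 1 else 0)) = (\<Prod>m\<in>f. a m ^ (if m \<in> f then \<beta> m + 1 else 0))"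
    using assms fin by (intro prod_supp) auto
  also have "\<dots> = (\<Prod>m\<in>f. a m ^ \<beta> m * a m)" by (rule prod.cong) auto
  finally show ?thesis by (simp add: prod.distrib)
qed

text \<open>The bubble factor raises every exponent on f by one. This matches degree k - card f with
  the exponents of degree k and support f; for k < card f there are none on either side, which is
  why the degree is compared as an integer.\<close>

lemma shift_index:
  assumes "f \<subseteq> {..CARD('n)}"
  shows "int (\<Sum>m\<in>f. \<beta> m) = int k - int (card f) \<Longrightarrow> (\<lambda>m. if m \<in> f then \<beta> m + 1 else 0) \<in> MI f k"
    "supp (\<lambda>m. if m \<in> f then \<beta> m + 1 else (0::nat)) = f"
    "\<alpha> \<in> MI f k \<Longrightarrow> supp \<alpha> = f \<Longrightarrow> (\<lambda>m. if m \<in> f then (\<alpha> m - 1) + 1 else 0) = \<alpha>"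
    "\<alpha> \<in> MI f k \<Longrightarrow> supp \<alpha> = f \<Longrightarrow> int (\<Sum>m\<in>f. \<alpha> m - 1) = int k - int (card f)"
proof -
  have fin: "finite f" using assms finite_subset by blast
  show "(\<lambda>m. if m \<in> f then \<beta> m + 1 else 0) \<in> MI f k" if "int (\<Sum>m\<in>f. \<beta> m) = int k - int (card f)"
  proof -
    have "(\<Sum>m\<in>f. \<beta> m + 1) = (\<Sum>m\<in>f. \<beta> m) + card f" by (simp only: sum.distrib) simp
    moreover have "(\<Sum>m\<in>f. \<beta> m) + card f = k" using that by linarith
    ultimately show ?thesis by (simp add: MI_def)
  qed
  show "supp (\<lambda>m. if m \<in> f then \<beta> m + 1 else (0::nat)) = f" by (auto simp: supp_def)
  assume \<alpha>: "\<alpha> \<in> MI f k" "supp \<alpha> = f"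
  then have pos: "0 < \<alpha> m \<longleftrightarrow> m \<in> f" for m by (auto simp: supp_def)
  then show "(\<lambda>m. if m \<in> f then (\<alpha> m - 1) + 1 else 0) = \<alpha>" by (auto simp: fun_eq_iff)
  have "(\<Sum>m\<in>f. \<alpha> m - 1) + card f = (\<Sum>m\<in>f. (\<alpha> m - 1) + 1)" by (simp only: sum.distrib) simp
  also have "\<dots> = (\<Sum>m\<in>f. \<alpha> m)" by (rule sum.cong) (use pos in auto)
  also have "\<dots> = k" using \<alpha> by (simp add: MI_def)
  finally show "int (\<Sum>m\<in>f. \<alpha> m - 1) = int k - int (card f)" by linarith
qed

lemma bubble_phi_gen:
  assumes f: "f \<subseteq> {..CARD('n)}" and p: "(i, j) \<in> pairs" "i \<notin> f" "j \<notin> f"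
  shows "(\<lambda>x. (\<Prod>m\<in>f. baryR v m x ^ \<beta> m) *\<^sub>R ((\<Prod>m\<in>f. baryR v m x) *\<^sub>R phi v b i j x))
     = asm (genP b (i, j) (\<lambda>m. if m \<in> f then \<beta> m + 1 else 0))"
proof
  fix x
  have d: "i \<le> CARD('n)" "j \<le> CARD('n)" "i \<noteq> j" using p by (auto simp: pairs_def)
  show "(\<Prod>m\<in>f. baryR v m x ^ \<beta> m) *\<^sub>R ((\<Prod>m\<in>f. baryR v m x) *\<^sub>R phi v b i j x)
     = asm (genP b (i, j) (\<lambda>m. if m \<in> f then \<beta> m + 1 else 0)) x"
  proof (cases "x \<in> split_interior v")
    case True
    then obtain l where l: "l \<le> CARD('n)" "x \<in> interior (subT v l)" by (auto simp: split_interior_def)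
    then have xl: "x \<in> subT v l" using interior_subset by blast
    have ind: "x \<in> interior (subT v a) \<longleftrightarrow> a = l" if "a \<le> CARD('n)" for a
      using sub_disjoint[OF that l(1)] l(2) by blast
    have "(\<Prod>m\<in>f. baryR v m x ^ \<beta> m) * (\<Prod>m\<in>f. baryR v m x)
      = (\<Prod>m\<in>f. (bary v m x - bary v l x) ^ \<beta> m) * (\<Prod>m\<in>f. (bary v m x - bary v l x))"
      by (intro arg_cong2[of _ _ _ _ "(*)"] prod.cong refl)
        (use f in \<open>auto simp: baryR_on_sub[OF _ l(1) xl]\<close>)
    also have "\<dots> = monoR l (\<lambda>m. if m \<in> f then \<beta> m + 1 else 0) x"
      unfolding monoR_def by (rule bump_power[OF f])
    finally have "(\<Prod>m\<in>f. baryR v m x ^ \<beta> m) * (\<Prod>m\<in>f. baryR v m x) = monoR l (\<lambda>m. if m \<in> f then \<beta> m + 1 else 0) x" .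
    moreover have "phi v b i j x = (if l = i then SS b j else if l = j then - SS b i else 0)"
      using d by (auto simp: phi_def ind SS_def)
    ultimately show ?thesis
      by (simp only: scaleR_scaleR asm_on[OF l] genP_def) simp
  next
    case False
    then have "x \<notin> interior (subT v i)" "x \<notin> interior (subT v j)" using d by (auto simp: split_interior_def)
    then show ?thesis using False by (simp add: phi_def asm_off)
  qed
qed

lemma bubble_phi_eq:
  assumes f: "f \<subseteq> {..CARD('n)}"
  shows "bubble_phi v base k f = span (g ` JP f)"
proof -
  define A where "A = {\<lambda>x. \<Prod>i\<in>f. baryR v i x ^ (\<alpha> i) | \<alpha>. int (\<Sum>i\<in>f. \<alpha> i) = int k - int (card f)}"
  define B where "B = {(\<lambda>x. (\<Prod>m\<in>f. baryR v m x) *\<^sub>R phi v (base f) i j x) | i j.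
      i \<in> {..CARD('n)} - f \<and> j \<in> {..CARD('n)} - f \<and> i < j}"
  have "bubble_phi v base k f = span {(\<lambda>x. p x *\<^sub>R \<psi> x) | p \<psi>. p \<in> span A \<and> \<psi> \<in> span B}"
    unfolding bubble_phi_def hom_polys_def A_def B_def ..
  also have "\<dots> = span {(\<lambda>x. p x *\<^sub>R \<psi> x) | p \<psi>. p \<in> A \<and> \<psi> \<in> B}"
    by (rule span_bilinear_eq[OF bilinear_fun_scale])
  also have "{(\<lambda>x. p x *\<^sub>R \<psi> x) | p \<psi>. p \<in> A \<and> \<psi> \<in> B} = g ` JP f"
  proof (intro equalityI subsetI)
    fix \<tau> assume "\<tau> \<in> {(\<lambda>x. p x *\<^sub>R \<psi> x) | p \<psi>. p \<in> A \<and> \<psi> \<in> B}"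
    then obtain \<beta> i j where \<beta>: "int (\<Sum>i\<in>f. \<beta> i) = int k - int (card f)"
      and ij: "i \<in> {..CARD('n)} - f" "j \<in> {..CARD('n)} - f" "i < j"
      and \<tau>: "\<tau> = (\<lambda>x. (\<Prod>m\<in>f. baryR v m x ^ \<beta> m) *\<^sub>R ((\<Prod>m\<in>f. baryR v m x) *\<^sub>R phi v (base f) i j x))"
      unfolding A_def B_def by blast
    have p: "(i, j) \<in> pairs" using ij by (auto simp: pairs_def)
    define \<alpha> where "\<alpha> = (\<lambda>m. if m \<in> f then \<beta> m + 1 else 0)"
    have \<alpha>: "\<alpha> \<in> MI f k" "supp \<alpha> = f" using shift_index(1,2)[OF f] \<beta> unfolding \<alpha>_def by blast+
    have "\<tau> = g (Inr ((i, j), \<alpha>))"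
      using bubble_phi_gen[OF f p] ij \<alpha>(2) by (simp add: \<tau> gen_def \<alpha>_def)
    moreover have "Inr ((i, j), \<alpha>) \<in> JP f" using p ij \<alpha> by (auto simp: JP_def)
    ultimately show "\<tau> \<in> g ` JP f" by blast
  next
    fix \<tau> assume "\<tau> \<in> g ` JP f"
    then obtain i j \<alpha> where p: "(i, j) \<in> pairs" "i \<notin> f" "j \<notin> f" and \<alpha>: "\<alpha> \<in> MI f k" "supp \<alpha> = f"
      and \<tau>: "\<tau> = g (Inr ((i, j), \<alpha>))" by (auto simp: JP_def)
    have "\<tau> = (\<lambda>x. (\<Prod>m\<in>f. baryR v m x ^ (\<alpha> m - 1)) *\<^sub>R ((\<Prod>m\<in>f. baryR v m x) *\<^sub>R phi v (base f) i j x))"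
      unfolding bubble_phi_gen[OF f p, of "\<lambda>m. \<alpha> m - 1"] shift_index(3)[OF f \<alpha>] \<tau>
      using \<alpha>(2) by (simp add: gen_def)
    moreover have "(\<lambda>x. \<Prod>m\<in>f. baryR v m x ^ (\<alpha> m - 1)) \<in> A"
      unfolding A_def using shift_index(4)[OF f \<alpha>] by (intro CollectI exI[of _ "\<lambda>m. \<alpha> m - 1"]) simp
    moreover have "(\<lambda>x. (\<Prod>m\<in>f. baryR v m x) *\<^sub>R phi v (base f) i j x) \<in> B"
      unfolding B_def using p by (intro CollectI exI[of _ i] exI[of _ j]) (auto simp: pairs_def)
    ultimately show "\<tau> \<in> {(\<lambda>x. p x *\<^sub>R \<psi> x) | p \<psi>. p \<in> A \<and> \<psi> \<in> B}"
      by - (rule CollectI, intro exI conjI, assumption+)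
  qed
  finally show ?thesis .
qed

definition FS :: "nat set set"
  where "FS = (\<Union>l\<in>{0..CARD('n) - 2}. subsimplices CARD('n) l)"

text \<open>Sorting by support. A support misses two vertices, so it has at most d - 1 elements and
  dimension at most d - 2; conversely each index of a block avoids its pair.\<close>

lemma IP_eq: "IP = (\<Union>f\<in>FS. JP f)"
proof (intro equalityI subsetI)
  fix z assume "z \<in> IP"
  then obtain p \<alpha> where z: "z = Inr (p, \<alpha>)" "p \<in> pairs" "\<alpha> \<in> MP p" by (auto simp: IP_def)
  define f where "f = supp \<alpha>"
  have sf: "f \<subseteq> {..CARD('n)} - {fst p, snd p}" "f \<noteq> {}" using MP_supp[OF z(3)] by (auto simp: f_def)
  have fin: "finite f" using sf finite_subset by blast
  have "card ({..CARD('n)} - {fst p, snd p}) = CARD('n) - 1" using z(2) by (auto simp: pairs_def card_Diff_subset)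
  then have "card f \<le> CARD('n) - 1" using card_mono[OF _ sf(1)] by simp
  moreover have "0 < card f" using sf fin by (simp add: card_gt_0_iff)
  ultimately have "f \<in> subsimplices CARD('n) (card f - 1)" "card f - 1 \<in> {0..CARD('n) - 2}"
    using sf by (auto simp: subsimplices_def)
  then have "f \<in> FS" unfolding FS_def by blast
  moreover have "\<alpha> \<in> MI f k"
  proof (rule MI_restrict)
    show "\<alpha> \<in> MI {..CARD('n)} k" using z(3) MP_sub by blast
  qed (use sf in \<open>auto simp: f_def supp_def\<close>)
  moreover have "fst p \<notin> f" "snd p \<notin> f" using sf by auto
  ultimately have "z \<in> JP f" "f \<in> FS" using z by (auto simp: JP_def f_def)
  then show "z \<in> (\<Union>f\<in>FS. JP f)" by blast
next
  fix z assume "z \<in> (\<Union>f\<in>FS. JP f)"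
  then obtain f p \<alpha> where f: "f \<in> FS" and z: "z = Inr (p, \<alpha>)" "p \<in> pairs" "fst p \<notin> f" "snd p \<notin> f" "\<alpha> \<in> MI f k"
    by (auto simp: JP_def)
  have "f \<subseteq> {..CARD('n)} - {fst p, snd p}" using f z by (auto simp: FS_def subsimplices_def)
  then have "MI f k \<subseteq> MP p" unfolding MP_def by (intro MI_mono) auto
  then show "z \<in> IP" using z by (auto simp: IP_def)
qed

lemma FS_sub: "f \<in> FS \<Longrightarrow> f \<subseteq> {..CARD('n)}"
  by (auto simp: FS_def subsimplices_def)

lemma poly_sym_IB: "poly_sym v k = span (g ` IB)"
proof -
  have "g ` IB = (\<lambda>(p, \<alpha>). asm (genB p \<alpha>)) ` (pairs \<times> MI {..CARD('n)} k)"
    unfolding IB_def image_image by (rule image_cong) (auto simp: gen_def)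
  then show ?thesis by (simp add: poly_sym_eq)
qed

lemma Sigma_loc_eq: "Sigma_loc v base k = span (g ` (IB \<union> IP))"
proof
  have sub: "bubble_phi v base k f \<subseteq> span (g ` (IB \<union> IP))" if "f \<in> FS" for f
  proof -
    have "JP f \<subseteq> IB \<union> IP" using IP_eq that by blast
    then show ?thesis unfolding bubble_phi_eq[OF FS_sub[OF that]] by (intro span_mono image_mono)
  qed
  have "poly_sym v k \<subseteq> span (g ` (IB \<union> IP))" unfolding poly_sym_IB by (intro span_mono image_mono) auto
  then show "Sigma_loc v base k \<subseteq> span (g ` (IB \<union> IP))"
    unfolding Sigma_loc_def using sub by (intro span_minimal) (auto simp: FS_def)
  show "span (g ` (IB \<union> IP)) \<subseteq> Sigma_loc v base k"
    unfolding Sigma_loc_def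
  proof (rule span_mono, rule image_subsetI)
    fix z assume "z \<in> IB \<union> IP"
    then show "g z \<in> poly_sym v k \<union> (\<Union>l\<in>{0..CARD('n) - 2}. \<Union>f\<in>subsimplices CARD('n) l. bubble_phi v base k f)"
    proof
      assume "z \<in> IB"
      then have "g z \<in> poly_sym v k" unfolding poly_sym_IB by (intro span_base) blast
      then show ?thesis by blast
    next
      assume "z \<in> IP"
      then obtain f where f: "f \<in> FS" "z \<in> JP f" by (auto simp: IP_eq)
      then have "g z \<in> bubble_phi v base k f" unfolding bubble_phi_eq[OF FS_sub[OF f(1)]] by (intro span_base) blast
      then show ?thesis using f(1) by (auto simp: FS_def)
    qed
  qed
qed

lemma Sigma_loc_field: "\<sigma> \<in> Sigma_loc v base k \<longleftrightarrow> (\<exists>u. \<sigma> = asm (field u))"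
  unfolding Sigma_loc_eq span_image_finite[OF finite_Z] asm_field by blast

lemma finite_FS: "finite FS"
  by (rule finite_subset[of _ "Pow {..CARD('n)}"]) (auto simp: FS_def subsimplices_def)

lemma finite_JP: "f \<subseteq> {..CARD('n)} \<Longrightarrow> finite (JP f)"
proof -
  assume "f \<subseteq> {..CARD('n)}"
  then have "finite f" by (rule finite_subset) simp
  then have "finite (pairs \<times> MI f k)" by (simp add: finite_pairs finite_MI)
  then show ?thesis unfolding JP_def by (intro finite_imageI) (rule finite_subset[rotated], auto)
qed

lemma JP_disjoint: "z \<in> JP f \<Longrightarrow> z \<in> JP f' \<Longrightarrow> f = f'" "z \<in> JP f \<Longrightarrow> z \<notin> IB"
  "Inl p \<notin> JP f"
  by (auto simp: JP_def IB_def)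

lemma direct_sum_split:
  "internal_direct_sum (Sigma_loc v base k)
     (insert Bulk (Phi ` (\<Union>l\<in>{0..CARD('n) - 2}. subsimplices CARD('n) l)))
     (\<lambda>s. case s of Bulk \<Rightarrow> poly_sym v k
       | Normal f \<Rightarrow> bubble_normal v k f
       | Phi f \<Rightarrow> bubble_phi v base k f)"
proof -
  let ?S = "insert Bulk (Phi ` FS)"
  define J where "J s = (case s of Bulk \<Rightarrow> IB | Normal f \<Rightarrow> {} | Phi f \<Rightarrow> JP f)" for s
  have U: "(\<Union>s\<in>?S. J s) = IB \<union> IP" by (auto simp: J_def IP_eq)
  have "internal_direct_sum (span (g ` (\<Union>s\<in>?S. J s))) ?S (\<lambda>s. span (g ` J s))"
  proof (rule internal_direct_sum_span)
    show "finite ?S" using finite_FS by simp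
    show "finite (J s)" if "s \<in> ?S" for s using that finite_IB finite_JP FS_sub by (auto simp: J_def)
    show "J s \<inter> J t = {}" if "s \<in> ?S" "t \<in> ?S" "s \<noteq> t" for s t
      using that by (auto simp: J_def dest: JP_disjoint(1,2))
    show "c z = 0" if "(\<Sum>z\<in>(\<Union>s\<in>?S. J s). c z *\<^sub>R g z) = 0" "z \<in> (\<Union>s\<in>?S. J s)" for c z
      using that unfolding U by (rule g_independent)
  qed
  then show ?thesis
    unfolding U FS_def[symmetric]
    by (subst internal_direct_sum_cong[where V' = "\<lambda>s. span (g ` J s)" and W' = "span (g ` (IB \<union> IP))"])
      (auto simp: J_def Sigma_loc_eq poly_sym_IB bubble_phi_eq FS_sub)
qed

text \<open>There are d (d + 1) / 2 edges. Each carries all exponents of degree k in d + 1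
  variables, and the bubble exponents of degree k in the d - 1 variables off the edge.\<close>

lemma dim_Sigma_loc:
  "real (dim (Sigma_loc v base k)) =
    1/2 * real CARD('n) * (real CARD('n) + 1) * real ((k + CARD('n)) choose CARD('n)) +
    1/2 * real CARD('n) * (real CARD('n) + 1) * real ((k + CARD('n) - 2) choose (CARD('n) - 2))"
proof -
  have "dim (Sigma_loc v base k) = card (IB \<union> IP)"
    unfolding Sigma_loc_eq by (rule dim_span_family[OF finite_Z]) (rule g_independent)
  also have "\<dots> = card IB + card IP" by (rule card_Un_disjoint[OF finite_IB finite_IP IB_IP])
  also have "card IB = card pairs * card (MI {..CARD('n)} k)"
    unfolding IB_def by (subst card_image) (auto simp: card_cartesian_product)
  also have "card (MI {..CARD('n)} k) = (k + CARD('n)) choose CARD('n)"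
    by (simp add: card_MI) (metis add_diff_cancel_left' binomial_symmetric le_add1)
  also have "card IP = (\<Sum>p\<in>pairs. card (MP p))"
    unfolding IP_def by (subst card_image) (auto simp: finite_pairs finite_MP)
  also have "\<dots> = (\<Sum>p\<in>pairs. (k + CARD('n) - 2) choose (CARD('n) - 2))"
  proof (rule sum.cong[OF refl])
    fix p assume p: "p \<in> pairs"
    have c: "card ({..CARD('n)} - {fst p, snd p}) = CARD('n) - 1" using p by (auto simp: pairs_def card_Diff_subset)
    have "card (MP p) = (k + (CARD('n) - 1) - 1) choose k" unfolding MP_def by (subst card_MI) (auto simp: c)
    also have "k + (CARD('n) - 1) - 1 = k + CARD('n) - 2" using D2 by simp
    also have "(k + CARD('n) - 2) choose k = (k + CARD('n) - 2) choose (CARD('n) - 2)"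
      using D2 binomial_symmetric[of k "k + CARD('n) - 2"] by simp
    finally show "card (MP p) = (k + CARD('n) - 2) choose (CARD('n) - 2)" .
  qed
  finally have d: "dim (Sigma_loc v base k) = card pairs * ((k + CARD('n)) choose CARD('n)) + card pairs * ((k + CARD('n) - 2) choose (CARD('n) - 2))"
    by simp
  have "2 * real (card pairs) = real CARD('n) * (real CARD('n) + 1)"
    using arg_cong[OF card_pairs, of real] by (simp add: algebra_simps)
  then have c: "real (card pairs) = 1/2 * real CARD('n) * (real CARD('n) + 1)" by linarith
  show ?thesis unfolding d of_nat_add of_nat_mult c by simp
qed

section \<open>Normal bubbles\<close>

lemma tangent_grad: "f \<subseteq> {..CARD('n)} \<Longrightarrow> a \<in> tangent_space v f \<Longrightarrow> i \<le> CARD('n) \<Longrightarrow> i \<notin> f \<Longrightarrow> a \<bullet> grad i = 0"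
proof -
  assume f: "f \<subseteq> {..CARD('n)}" and a: "a \<in> tangent_space v f" and i: "i \<le> CARD('n)" "i \<notin> f"
  have "(v j - v m) \<bullet> grad i = 0" if "m \<in> f" "j \<in> f" for m j
  proof -
    have "j \<le> CARD('n)" "m \<le> CARD('n)" "j \<noteq> i" "m \<noteq> i" using f i that by auto
    then show ?thesis using i by (simp add: grad_vertex inner_commute[of _ "grad i"])
  qed
  then have "tangent_space v f \<subseteq> {a. a \<bullet> grad i = 0}"
    unfolding tangent_space_def by (intro span_minimal) (auto intro!: subspaceI simp: inner_add_left)
  then show ?thesis using a by blast
qed

lemma normal_tensors_sym: "N \<in> normal_tensors v f \<Longrightarrow> transpose N = N"
proof -
  assume "N \<in> normal_tensors v f"
  moreover have "normal_tensors v f \<subseteq> {N. transpose N = N}"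
    unfolding normal_tensors_def
    by (rule span_minimal)
      (auto simp: transpose_sym_part intro!: subspaceI simp: transpose_zero transpose_add transpose_scaleR)
  ultimately show ?thesis by blast
qed

text \<open>An edge of f is tangential, so it is orthogonal to the normal factor of every
  generator.\<close>

lemma normal_tensors_orth:
  assumes "p \<in> pairs" "fst p \<in> f" "snd p \<in> f" "N \<in> normal_tensors v f"
  shows "tt p \<bullet> N = 0"
proof -
  define t where "t = v (snd p) - v (fst p)"
  have t: "t \<in> tangent_space v f" unfolding t_def tangent_space_def using assms by (intro span_base) blast
  have tn: "t \<bullet> b = 0" if "b \<in> normal_space v f" for b
    using that t by (auto simp: normal_space_def orthogonal_comp_def orthogonal_def)
  have "normal_tensors v f \<subseteq> {N. tt p \<bullet> N = 0}"
    unfolding normal_tensors_def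
    by (rule span_minimal)
      (auto simp: tt_def t_def[symmetric] outer_inner_sym_part tn inner_add_right intro!: subspaceI)
  then show ?thesis using assms(4) by blast
qed

text \<open>By symmetry the coefficient of an edge can be read with the gradient of either end
  first, so it vanishes as soon as one end lies off f.\<close>

lemma tangential_expand:
  assumes f: "f \<subseteq> {..CARD('n)}" and S: "transpose S = S" "\<And>i. i \<le> CARD('n) \<Longrightarrow> i \<notin> f \<Longrightarrow> S *v grad i = 0"
  shows "S = (\<Sum>p\<in>{p\<in>pairs. fst p \<in> f \<and> snd p \<in> f}. (- (grad (snd p) \<bullet> (S *v grad (fst p)))) *\<^sub>R tt p)"
proof -
  have "(- (grad (snd p) \<bullet> (S *v grad (fst p)))) = 0" if "p \<in> pairs" "\<not> (fst p \<in> f \<and> snd p \<in> f)" for p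
    using that S(2)[of "fst p"] S(2)[of "snd p"] symmetric_inner[OF S(1), of "grad (snd p)" "grad (fst p)"]
    by (auto simp: pairs_def)
  then show ?thesis
    using finite_pairs by (subst tensor_expand[OF S(1)]) (intro sum.mono_neutral_right, auto)
qed

text \<open>Split the edge vector into a + b, tangential and normal to f. The square of a is
  annihilated by the gradients off f, and the rest consists of the square of b and twice the
  symmetric product of a and b.\<close>

lemma tensor_decomp:
  assumes f: "f \<subseteq> {..CARD('n)}"
  shows "\<exists>S N. tt p = S + N \<and> N \<in> normal_tensors v f \<and> transpose S = S \<and> (\<forall>i\<le>CARD('n). i \<notin> f \<longrightarrow> S *v grad i = 0)"
proof -
  define t where "t = v (snd p) - v (fst p)"
  let ?E = "{v j - v i |i j. i \<in> f \<and> j \<in> f}"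
  obtain a b where "a \<in> span ?E" "\<And>w. w \<in> span ?E \<Longrightarrow> orthogonal b w" "t = a + b"
    by (rule orthogonal_subspace_decomp_exists[of ?E t]) (rule that)
  note ab = this[folded tangent_space_def]
  have b: "b \<in> normal_space v f"
    using ab(2) by (auto simp: normal_space_def orthogonal_comp_def orthogonal_commute)
  define N where "N = sym_part (outer b b) + 2 *\<^sub>R sym_part (outer a b)"
  have "tt p = outer a a + N"
  proof -
    have "sym_part (outer b b) = outer b b" "2 *\<^sub>R sym_part (outer a b) = outer a b + outer b a"
      by (simp_all add: sym_part_outer scaleR_2[symmetric])
    then show ?thesis
      by (simp add: tt_def t_def[symmetric] ab(3) N_def) (simp add: outer_def vec_eq_iff algebra_simps)
  qed
  moreover have "N \<in> normal_tensors v f"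
    unfolding N_def normal_tensors_def using ab(1) b
    by (intro span_add span_scale) (auto intro!: span_base)
  moreover have "outer a a *v grad i = 0" if "i \<le> CARD('n)" "i \<notin> f" for i
    using tangent_grad[OF f ab(1) that] by (simp add: outer_mult_vec)
  ultimately show ?thesis by (intro exI[of _ "outer a a"] exI[of _ N]) (auto simp: transpose_outer)
qed

definition NB :: "nat set \<Rightarrow> (real^'n^'n) set"
  where "NB f = (SOME B. independent B \<and> span B = normal_tensors v f)"

lemma NB: "independent (NB f)" "span (NB f) = normal_tensors v f" "finite (NB f)"
proof -
  obtain B where B: "B \<subseteq> normal_tensors v f" "independent B" "normal_tensors v f \<subseteq> span B"
    by (rule basis_exists[of "normal_tensors v f"]) (rule that)
  moreover have "span B \<subseteq> normal_tensors v f"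
    by (rule span_minimal[OF B(1)]) (simp add: normal_tensors_def)
  ultimately have "\<exists>B. independent B \<and> span B = normal_tensors v f" by blast
  from someI_ex[OF this] show i: "independent (NB f)" and "span (NB f) = normal_tensors v f"
    unfolding NB_def by auto
  show "finite (NB f)" using i by (rule independent_imp_finite)
qed

definition gN :: "(nat \<Rightarrow> nat) \<times> (real^'n^'n) \<Rightarrow> real^'n \<Rightarrow> real^'n^'n"
  where "gN z = asm (\<lambda>l x. bmono (fst z) x *\<^sub>R snd z)"

lemma linear_gN: "linear (\<lambda>N. gN (\<alpha>, N))"
proof -
  have "linear (\<lambda>N (l::nat) x. bmono \<alpha> x *\<^sub>R N)"
    by (rule linearI) (auto simp: fun_eq_iff scaleR_add_right)
  from linear_compose[OF this linear_asm] show ?thesis by (simp add: gN_def o_def)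
qed

definition JN :: "nat set \<Rightarrow> ((nat \<Rightarrow> nat) \<times> (real^'n^'n)) set"
  where "JN f = {(\<alpha>, N). \<alpha> \<in> MI f k \<and> supp \<alpha> = f \<and> N \<in> NB f}"

lemma bubble_normal_eq:
  assumes f: "f \<subseteq> {..CARD('n)}"
  shows "bubble_normal v k f = span (gN ` JN f)"
proof -
  define A where "A = {\<lambda>x. \<Prod>i\<in>f. bary v i x ^ (\<alpha> i) | \<alpha>. int (\<Sum>i\<in>f. \<alpha> i) = int k - int (card f)}"
  define F where "F p N = on_split v (\<lambda>x. ((\<Prod>i\<in>f. bary v i x) * p x) *\<^sub>R (N :: real^'n^'n))" for p N
  have bil: "bilinear F"
    unfolding bilinear_def
    by (auto intro!: linearI simp: F_def on_split_def fun_eq_iff algebra_simps)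
  have "bubble_normal v k f = span {F p N | p N. p \<in> span A \<and> N \<in> span (NB f)}"
    unfolding bubble_normal_def hom_polys_def A_def F_def NB(2) ..
  also have "\<dots> = span {F p N | p N. p \<in> A \<and> N \<in> NB f}" by (rule span_bilinear_eq[OF bil])
  also have "{F p N | p N. p \<in> A \<and> N \<in> NB f} = gN ` JN f"
  proof -
    have FgN: "F (\<lambda>x. \<Prod>i\<in>f. bary v i x ^ (\<beta> i)) N = gN ((\<lambda>m. if m \<in> f then \<beta> m + 1 else 0), N)" for \<beta> N
      using bump_power[OF f] by (simp add: F_def gN_def on_split_eq bmono_def mult.commute)
    show ?thesis
    proof (intro equalityI subsetI)
      fix \<tau> assume "\<tau> \<in> {F p N | p N. p \<in> A \<and> N \<in> NB f}"
      then obtain \<beta> N where \<beta>: "int (\<Sum>i\<in>f. \<beta> i) = int k - int (card f)" "N \<in> NB f"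
        "\<tau> = F (\<lambda>x. \<Prod>i\<in>f. bary v i x ^ (\<beta> i)) N" unfolding A_def by blast
      then show "\<tau> \<in> gN ` JN f" using shift_index(1,2)[OF f] by (auto simp: FgN JN_def)
    next
      fix \<tau> assume "\<tau> \<in> gN ` JN f"
      then obtain \<alpha> N where \<alpha>: "\<alpha> \<in> MI f k" "supp \<alpha> = f" "N \<in> NB f" "\<tau> = gN (\<alpha>, N)" by (auto simp: JN_def)
      have "\<tau> = F (\<lambda>x. \<Prod>i\<in>f. bary v i x ^ (\<alpha> i - 1)) N"
        unfolding FgN shift_index(3)[OF f \<alpha>(1,2)] by (rule \<alpha>(4))
      moreover have "(\<lambda>x. \<Prod>i\<in>f. bary v i x ^ (\<alpha> i - 1)) \<in> A"
        unfolding A_def using shift_index(4)[OF f \<alpha>(1,2)] by (intro CollectI exI[of _ "\<lambda>m. \<alpha> m - 1"]) simp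
      ultimately show "\<tau> \<in> {F p N | p N. p \<in> A \<and> N \<in> NB f}" using \<alpha>(3) by blast
    qed
  qed
  finally show ?thesis .
qed

text \<open>The monomial contains the coordinates of both ends of the edge, which makes the normal
  trace vanish on every facet; these fields turn out to span the bubble space
  (\<open>bubble_div_eq\<close>).\<close>

definition IBB :: "gen_index set"
  where "IBB = Inl ` {(p, \<alpha>). p \<in> pairs \<and> \<alpha> \<in> MI {..CARD('n)} k \<and> \<alpha> (fst p) \<noteq> 0 \<and> \<alpha> (snd p) \<noteq> 0}"

lemma IBB_sub: "IBB \<subseteq> IB"
  by (auto simp: IBB_def IB_def)

definition FN :: "nat set set"
  where "FN = (\<Union>l\<in>{0..CARD('n) - 1}. subsimplices CARD('n) l)"

lemma FN_iff: "f \<in> FN \<longleftrightarrow> f \<subseteq> {..CARD('n)} \<and> f \<noteq> {} \<and> f \<noteq> {..CARD('n)}"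
proof
  assume "f \<in> FN"
  then show "f \<subseteq> {..CARD('n)} \<and> f \<noteq> {} \<and> f \<noteq> {..CARD('n)}"
    using D2 by (auto simp: FN_def subsimplices_def)
next
  assume f: "f \<subseteq> {..CARD('n)} \<and> f \<noteq> {} \<and> f \<noteq> {..CARD('n)}"
  then have fin: "finite f" using finite_subset by blast
  have "card f < card {..CARD('n)}" using f by (intro psubset_card_mono) auto
  moreover have "0 < card f" using f fin by (simp add: card_gt_0_iff)
  ultimately have "f \<in> subsimplices CARD('n) (card f - 1)" "card f - 1 \<in> {0..CARD('n) - 1}"
    using f by (auto simp: subsimplices_def)
  then show "f \<in> FN" unfolding FN_def by blast
qed

lemma FS_FN: "FS \<subseteq> FN" unfolding FS_def FN_def by (rule UN_mono) auto

lemma finite_FN: "finite FN"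
  by (rule finite_subset[of _ "Pow {..CARD('n)}"]) (auto simp: FN_iff)

text \<open>Facets add nothing: a pair off f needs two vertices outside f.\<close>

lemma JP_FN: "(\<Union>f\<in>FN. JP f) = IP"
proof
  show "IP \<subseteq> (\<Union>f\<in>FN. JP f)" using IP_eq FS_FN by blast
  show "(\<Union>f\<in>FN. JP f) \<subseteq> IP"
  proof safe
    fix f z assume "f \<in> FN" "z \<in> JP f"
    then obtain p \<alpha> where z: "z = Inr (p, \<alpha>)" "p \<in> pairs" "fst p \<notin> f" "snd p \<notin> f" "\<alpha> \<in> MI f k"
      by (auto simp: JP_def)
    have "f \<subseteq> {..CARD('n)} - {fst p, snd p}" using \<open>f \<in> FN\<close> z by (auto simp: FN_iff)
    then have "MI f k \<subseteq> MP p" unfolding MP_def by (intro MI_mono) auto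
    then show "z \<in> IP" using z by (auto simp: IP_def)
  qed
qed

lemma finite_JN: "f \<subseteq> {..CARD('n)} \<Longrightarrow> finite (JN f)"
proof -
  assume "f \<subseteq> {..CARD('n)}"
  then have "finite f" by (rule finite_subset) simp
  then have "finite (MI f k \<times> NB f)" by (simp add: NB finite_MI)
  then show ?thesis unfolding JN_def by (rule finite_subset[rotated]) auto
qed

lemma gN_Sigma:
  assumes "f \<subseteq> {..CARD('n)}" "z \<in> JN f" shows "gN z \<in> poly_sym v k"
proof -
  obtain \<alpha> N where z: "z = (\<alpha>, N)" "\<alpha> \<in> MI f k" "N \<in> NB f" using assms(2) by (auto simp: JN_def)
  have "\<alpha> \<in> MI {..CARD('n)} k" using z(2) MI_mono[of "{..CARD('n)}" f k] assms(1) by auto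
  moreover have "transpose N = N" using normal_tensors_sym[of N f] span_base[OF z(3)] NB(2)[of f] by simp
  ultimately show ?thesis
    unfolding poly_sym_def gN_def on_split_eq[symmetric]
    using scaled_polys[OF bmono_polys] by (intro CollectI exI[of _ "\<lambda>x. bmono \<alpha> x *\<^sub>R N"]) (auto simp: z transpose_scaleR)
qed

lemma supp_in:
  assumes "\<alpha> \<in> MI {..CARD('n)} k" shows "\<alpha> \<in> MI (supp \<alpha>) k" "supp \<alpha> \<subseteq> {..CARD('n)}" "supp \<alpha> \<noteq> {}"
proof -
  show s: "supp \<alpha> \<subseteq> {..CARD('n)}" using MI_supp[OF assms] .
  show "\<alpha> \<in> MI (supp \<alpha>) k"
    by (rule MI_restrict[OF _ s assms]) (auto simp: supp_def)
  show "supp \<alpha> \<noteq> {}"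
  proof
    assume "supp \<alpha> = {}"
    then have "\<alpha> = (\<lambda>_. 0)" by (auto simp: supp_def)
    then show False using assms k2 by (auto simp: MI_def)
  qed
qed

text \<open>Decompose the edge tensor relative to the face supp \<alpha>: the tangential part is a
  combination of edges of this face and gives fields in \<open>IBB\<close>, the normal part gives
  normal bubbles of the face. For full support the field itself is in \<open>IBB\<close>.\<close>

lemma g_in_normal_span:
  assumes p: "p \<in> pairs" and \<alpha>: "\<alpha> \<in> MI {..CARD('n)} k"
  shows "g (Inl (p, \<alpha>)) \<in> span (g ` IBB \<union> (\<Union>f\<in>FN. gN ` JN f))"
proof -
  define f where "f = supp \<alpha>"
  note f = supp_in[OF \<alpha>, folded f_def]
  let ?W = "span (g ` IBB \<union> (\<Union>f\<in>FN. gN ` JN f))"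
  obtain S N where SN: "tt p = S + N" "N \<in> normal_tensors v f" "transpose S = S"
    "\<And>i. i \<le> CARD('n) \<Longrightarrow> i \<notin> f \<Longrightarrow> S *v grad i = 0" using tensor_decomp[OF f(2), of p] by blast
  have IBBq: "Inl (q, \<alpha>) \<in> IBB" if "q \<in> pairs" "fst q \<in> f" "snd q \<in> f" for q
    using that \<alpha> by (auto simp: IBB_def f_def supp_def)
  note lin = linear_gN[of \<alpha>]
  show ?thesis
  proof (cases "f = {..CARD('n)}")
    case True
    then have "Inl (p, \<alpha>) \<in> IBB" using IBBq[OF p] p by (auto simp: pairs_def)
    then show ?thesis by (intro span_base) blast
  next
    case False
    then have fN: "f \<in> FN" using f by (simp add: FN_iff)
    have N: "gN (\<alpha>, N) \<in> ?W"
    proof -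
      have "N \<in> span (NB f)" using SN(2) by (simp add: NB)
      then have "gN (\<alpha>, N) \<in> (\<lambda>N. gN (\<alpha>, N)) ` span (NB f)" by blast
      also have "\<dots> = span ((\<lambda>N. gN (\<alpha>, N)) ` NB f)" by (rule linear_span_image[OF lin, symmetric])
      also have "\<dots> \<subseteq> ?W" using fN f(1) by (intro span_mono) (auto simp: JN_def f_def)
      finally show ?thesis .
    qed
    have S: "gN (\<alpha>, S) \<in> ?W"
    proof -
      have "gN (\<alpha>, S) = gN (\<alpha>, \<Sum>q\<in>{q\<in>pairs. fst q \<in> f \<and> snd q \<in> f}. (- (grad (snd q) \<bullet> (S *v grad (fst q)))) *\<^sub>R tt q)"
        using tangential_expand[OF f(2) SN(3,4)] by simp
      also have "\<dots> = (\<Sum>q\<in>{q\<in>pairs. fst q \<in> f \<and> snd q \<in> f}. (- (grad (snd q) \<bullet> (S *v grad (fst q)))) *\<^sub>R gN (\<alpha>, tt q))"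
        by (simp only: linear_sum[OF lin] linear_cmul[OF lin])
      also have "\<dots> \<in> ?W"
      proof (rule span_sum, rule span_scale, rule span_base)
        fix q assume q: "q \<in> {q \<in> pairs. fst q \<in> f \<and> snd q \<in> f}"
        have "gN (\<alpha>, tt q) = g (Inl (q, \<alpha>))" by (simp add: gN_def gen_def genB_def)
        then show "gN (\<alpha>, tt q) \<in> g ` IBB \<union> (\<Union>f\<in>FN. gN ` JN f)" using IBBq[of q] q by auto
      qed
      finally show ?thesis .
    qed
    have "g (Inl (p, \<alpha>)) = gN (\<alpha>, S) + gN (\<alpha>, N)"
      using linear_add[OF lin, of S N] by (simp add: SN(1)[symmetric] gN_def gen_def genB_def)
    then show ?thesis using span_add[OF S N] by simp
  qed
qed

text \<open>For each \<alpha> the normal bubbles contribute one normal tensor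
  \<open>X \<alpha>\<close> of the face supp \<alpha>. Expanded in edges and compared with the
  independent generators, it can only involve edges of this face; as it is also orthogonal to them,
  it is 0.\<close>

lemma normal_independent:
  assumes z: "(\<Sum>z\<in>IBB \<union> IP. c z *\<^sub>R g z) + (\<Sum>z\<in>(\<Union>f\<in>FN. JN f). d z *\<^sub>R gN z) = 0"
  shows "z \<in> IBB \<union> IP \<Longrightarrow> c z = 0" "w \<in> (\<Union>f\<in>FN. JN f) \<Longrightarrow> d w = 0"
proof -
  define n where "n p N = - (grad (snd p) \<bullet> (N *v grad (fst p)))" for p and N :: "real^'n^'n"
  define X where "X \<alpha> = (if supp \<alpha> \<in> FN then \<Sum>N\<in>NB (supp \<alpha>). d (\<alpha>, N) *\<^sub>R N else 0)" for \<alpha>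
  have Xn: "X \<alpha> \<in> normal_tensors v (supp \<alpha>)" for \<alpha>
    unfolding X_def NB(2)[symmetric] by (auto intro!: span_sum span_scale span_zero intro: span_base)
  have Xs: "transpose (X \<alpha>) = X \<alpha>" for \<alpha> by (rule normal_tensors_sym[OF Xn])
  have JNall: "(\<Union>f\<in>FN. JN f) = (SIGMA \<alpha>:{\<alpha>\<in>MI {..CARD('n)} k. supp \<alpha> \<in> FN}. NB (supp \<alpha>))"
  proof (intro equalityI subsetI)
    fix z assume "z \<in> (\<Union>f\<in>FN. JN f)"
    then obtain f \<alpha> N where "f \<in> FN" "z = (\<alpha>, N)" "\<alpha> \<in> MI f k" "supp \<alpha> = f" "N \<in> NB f" by (auto simp: JN_def)
    then show "z \<in> (SIGMA \<alpha>:{\<alpha>\<in>MI {..CARD('n)} k. supp \<alpha> \<in> FN}. NB (supp \<alpha>))"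
      using MI_mono[of "{..CARD('n)}" f k] by (auto simp: FN_iff)
  next
    fix z assume "z \<in> (SIGMA \<alpha>:{\<alpha>\<in>MI {..CARD('n)} k. supp \<alpha> \<in> FN}. NB (supp \<alpha>))"
    then show "z \<in> (\<Union>f\<in>FN. JN f)" using supp_in by (fastforce simp: JN_def)
  qed
  \<comment> \<open>Coefficients of the whole relation with respect to the independent family
    \<open>g\<close>.\<close>
  define u where "u z = (if z \<in> IBB \<union> IP then c z else 0) +
      (case z of Inl (p, \<alpha>) \<Rightarrow> n p (X \<alpha>) | Inr _ \<Rightarrow> 0)" for z
  have "(\<Sum>z\<in>(\<Union>f\<in>FN. JN f). d z *\<^sub>R gN z) = (\<Sum>\<alpha>\<in>{\<alpha>\<in>MI {..CARD('n)} k. supp \<alpha> \<in> FN}. \<Sum>N\<in>NB (supp \<alpha>). d (\<alpha>, N) *\<^sub>R gN (\<alpha>, N))"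
    unfolding JNall by (subst sum.Sigma) (auto simp: finite_MI_all NB intro: finite_subset)
  also have "\<dots> = (\<Sum>\<alpha>\<in>{\<alpha>\<in>MI {..CARD('n)} k. supp \<alpha> \<in> FN}. gN (\<alpha>, X \<alpha>))"
  proof (rule sum.cong[OF refl])
    fix \<alpha> assume "\<alpha> \<in> {\<alpha>\<in>MI {..CARD('n)} k. supp \<alpha> \<in> FN}"
    then have Xa: "X \<alpha> = (\<Sum>N\<in>NB (supp \<alpha>). d (\<alpha>, N) *\<^sub>R N)" by (simp add: X_def)
    note lin = linear_gN[of \<alpha>]
    show "(\<Sum>N\<in>NB (supp \<alpha>). d (\<alpha>, N) *\<^sub>R gN (\<alpha>, N)) = gN (\<alpha>, X \<alpha>)"
      unfolding Xa by (simp add: linear_sum[OF lin] linear_cmul[OF lin])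
  qed
  also have "\<dots> = (\<Sum>\<alpha>\<in>MI {..CARD('n)} k. gN (\<alpha>, X \<alpha>))"
  proof (rule sum.mono_neutral_left[OF finite_MI_all], blast, rule ballI)
    fix \<alpha> assume "\<alpha> \<in> MI {..CARD('n)} k - {\<alpha>\<in>MI {..CARD('n)} k. supp \<alpha> \<in> FN}"
    then have "X \<alpha> = 0" by (auto simp: X_def)
    then show "gN (\<alpha>, X \<alpha>) = 0" by (simp add: gN_def asm_def fun_eq_iff)
  qed
  also have "\<dots> = (\<Sum>\<alpha>\<in>MI {..CARD('n)} k. \<Sum>p\<in>pairs. n p (X \<alpha>) *\<^sub>R g (Inl (p, \<alpha>)))"
  proof (rule sum.cong[OF refl])
    fix \<alpha>
    have "(\<lambda>(l::nat) x. bmono \<alpha> x *\<^sub>R X \<alpha>) = (\<Sum>p\<in>pairs. n p (X \<alpha>) *\<^sub>R gen (Inl (p, \<alpha>)))"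
    proof (intro ext)
      fix l :: nat and x
      have "bmono \<alpha> x *\<^sub>R X \<alpha> = bmono \<alpha> x *\<^sub>R (\<Sum>p\<in>pairs. n p (X \<alpha>) *\<^sub>R tt p)"
        using tensor_expand[OF Xs[of \<alpha>]] by (simp add: n_def)
      then show "bmono \<alpha> x *\<^sub>R X \<alpha> = (\<Sum>p\<in>pairs. n p (X \<alpha>) *\<^sub>R gen (Inl (p, \<alpha>))) l x"
        by (simp add: sum_fun_apply gen_def genB_def scaleR_sum_right mult.commute)
    qed
    then show "gN (\<alpha>, X \<alpha>) = (\<Sum>p\<in>pairs. n p (X \<alpha>) *\<^sub>R g (Inl (p, \<alpha>)))"
      by (simp add: gN_def linear_sum[OF linear_asm] linear_cmul[OF linear_asm])
  qed
  also have "\<dots> = (\<Sum>p\<in>pairs. \<Sum>\<alpha>\<in>MI {..CARD('n)} k. n p (X \<alpha>) *\<^sub>R g (Inl (p, \<alpha>)))" by (rule sum.swap)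
  also have "\<dots> = (\<Sum>z\<in>IB. (case z of Inl (p, \<alpha>) \<Rightarrow> n p (X \<alpha>) | Inr _ \<Rightarrow> 0) *\<^sub>R g z)"
    by (simp add: sum_IB)
  also have "\<dots> = (\<Sum>z\<in>IB \<union> IP. (case z of Inl (p, \<alpha>) \<Rightarrow> n p (X \<alpha>) | Inr _ \<Rightarrow> 0) *\<^sub>R g z)"
    by (rule sum.mono_neutral_left[OF finite_Z]) (auto simp: IP_def)
  finally have N: "(\<Sum>z\<in>(\<Union>f\<in>FN. JN f). d z *\<^sub>R gN z) =
    (\<Sum>z\<in>IB \<union> IP. (case z of Inl (p, \<alpha>) \<Rightarrow> n p (X \<alpha>) | Inr _ \<Rightarrow> 0) *\<^sub>R g z)" .
  have C: "(\<Sum>z\<in>IBB \<union> IP. c z *\<^sub>R g z) = (\<Sum>z\<in>IB \<union> IP. (if z \<in> IBB \<union> IP then c z else 0) *\<^sub>R g z)"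
    by (rule sum.mono_neutral_cong_left[OF finite_Z]) (use IBB_sub in auto)
  have "(\<Sum>z\<in>IB \<union> IP. u z *\<^sub>R g z) = 0"
    using z unfolding N C sum.distrib[symmetric] u_def scaleR_add_left by simp
  then have u0: "u z = 0" if "z \<in> IB \<union> IP" for z using g_independent that by blast
  have nX: "n p (X \<alpha>) = (if fst p \<in> supp \<alpha> \<and> snd p \<in> supp \<alpha> then - c (Inl (p, \<alpha>)) else 0)"
    if "p \<in> pairs" "\<alpha> \<in> MI {..CARD('n)} k" for p \<alpha>
  proof -
    have "Inl (p, \<alpha>) \<in> IBB \<longleftrightarrow> fst p \<in> supp \<alpha> \<and> snd p \<in> supp \<alpha>" using that by (auto simp: IBB_def supp_def)
    moreover have "Inl (p, \<alpha>) \<notin> IP" by (auto simp: IP_def)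
    moreover have "Inl (p, \<alpha>) \<in> IB" using that by (simp add: IB_def)
    ultimately show ?thesis using u0[of "Inl (p, \<alpha>)"] by (auto simp: u_def split: if_splits)
  qed
  have X0: "X \<alpha> = 0" if \<alpha>: "\<alpha> \<in> MI {..CARD('n)} k" for \<alpha>
  proof -
    have "X \<alpha> = (\<Sum>p\<in>pairs. n p (X \<alpha>) *\<^sub>R tt p)" using tensor_expand[OF Xs[of \<alpha>]] by (simp add: n_def)
    then have "X \<alpha> \<bullet> X \<alpha> = (\<Sum>p\<in>pairs. n p (X \<alpha>) *\<^sub>R tt p) \<bullet> X \<alpha>" by simp
    also have "\<dots> = (\<Sum>p\<in>pairs. n p (X \<alpha>) * (tt p \<bullet> X \<alpha>))" by (simp add: inner_sum_left)
    also have "\<dots> = 0"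
      using normal_tensors_orth[OF _ _ _ Xn] nX[OF _ \<alpha>] by (intro sum.neutral) auto
    finally show ?thesis by simp
  qed
  show "c z = 0" if "z \<in> IBB \<union> IP" for z
    using that
  proof
    assume "z \<in> IBB"
    then obtain p \<alpha> where "z = Inl (p, \<alpha>)" "p \<in> pairs" "\<alpha> \<in> MI {..CARD('n)} k" "fst p \<in> supp \<alpha>" "snd p \<in> supp \<alpha>"
      by (auto simp: IBB_def supp_def)
    then show ?thesis using nX[of p \<alpha>] X0[of \<alpha>] by (simp add: n_def)
  next
    assume "z \<in> IP"
    then show ?thesis using u0[of z] by (auto simp: u_def IP_def split: if_splits)
  qed
  show "d w = 0" if w: "w \<in> (\<Union>f\<in>FN. JN f)" for w
  proof -
    obtain \<alpha> N where w': "w = (\<alpha>, N)" "\<alpha> \<in> MI {..CARD('n)} k" "supp \<alpha> \<in> FN" "N \<in> NB (supp \<alpha>)"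
      using w unfolding JNall by blast
    then have "(\<Sum>N\<in>NB (supp \<alpha>). d (\<alpha>, N) *\<^sub>R N) = 0" using X0[of \<alpha>] by (simp add: X_def)
    from independentD[OF NB(1) NB(3) subset_refl this w'(4)] show ?thesis by (simp add: w'(1))
  qed
qed

text \<open>The hypothesis is the link to the function space with zero normal trace and is supplied
  by \<open>bubble_div_eq\<close> once weak divergences are available. Indexing by a sum type keeps
  the normal bubbles apart from the other generators.\<close>

lemma direct_sum_normal:
  assumes bd: "bubble_div v k = span (g ` IBB)"
  shows "internal_direct_sum (Sigma_loc v base k)
     (insert Bulk (\<Union>l\<in>{0..CARD('n) - 1}. Normal ` subsimplices CARD('n) l \<union> Phi ` subsimplices CARD('n) l))
     (\<lambda>s. case s of Bulk \<Rightarrow> bubble_div v k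
       | Normal f \<Rightarrow> bubble_normal v k f
       | Phi f \<Rightarrow> bubble_phi v base k f)"
proof -
  define h where "h z = (case z of Inl z \<Rightarrow> g z | Inr w \<Rightarrow> gN w)" for z
  define J where "J s = (case s of Bulk \<Rightarrow> Inl ` IBB | Normal f \<Rightarrow> Inr ` JN f | Phi f \<Rightarrow> Inl ` JP f)" for s
  let ?S = "insert Bulk (Normal ` FN \<union> Phi ` FN)"
  have S: "insert Bulk (\<Union>l\<in>{0..CARD('n) - 1}. Normal ` subsimplices CARD('n) l \<union> Phi ` subsimplices CARD('n) l) = ?S"
    by (auto simp: FN_def)
  have U: "(\<Union>s\<in>?S. J s) = Inl ` (IBB \<union> IP) \<union> Inr ` (\<Union>f\<in>FN. JN f)"
    by (auto simp: J_def JP_FN[symmetric])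
  have fin: "finite (\<Union>f\<in>FN. JN f)" "finite (IBB \<union> IP)"
    using finite_FN finite_JN finite_IP finite_subset[OF IBB_sub finite_IB] by (auto simp: FN_iff)
  have "internal_direct_sum (span (h ` (\<Union>s\<in>?S. J s))) ?S (\<lambda>s. span (h ` J s))"
  proof (rule internal_direct_sum_span)
    show "finite ?S" using finite_FN by simp
    show "finite (J s)" if "s \<in> ?S" for s
      using that fin finite_JN finite_JP by (auto simp: J_def FN_iff)
    show "J s \<inter> J t = {}" if "s \<in> ?S" "t \<in> ?S" "s \<noteq> t" for s t
      using that by (auto simp: J_def JN_def IBB_def JP_disjoint(3) dest: JP_disjoint(1))
    show "c z = 0" if z: "(\<Sum>z\<in>(\<Union>s\<in>?S. J s). c z *\<^sub>R h z) = 0" "z \<in> (\<Union>s\<in>?S. J s)" for c z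
    proof -
      have "(\<Sum>z\<in>(\<Union>s\<in>?S. J s). c z *\<^sub>R h z) = (\<Sum>z\<in>Inl ` (IBB \<union> IP). c z *\<^sub>R h z) + (\<Sum>z\<in>Inr ` (\<Union>f\<in>FN. JN f). c z *\<^sub>R h z)"
        unfolding U using fin by (intro sum.union_disjoint) auto
      also have "\<dots> = (\<Sum>z\<in>IBB \<union> IP. c (Inl z) *\<^sub>R g z) + (\<Sum>z\<in>(\<Union>f\<in>FN. JN f). c (Inr z) *\<^sub>R gN z)"
        by (simp add: sum.reindex h_def)
      finally have e: "(\<Sum>z\<in>IBB \<union> IP. c (Inl z) *\<^sub>R g z) + (\<Sum>z\<in>(\<Union>f\<in>FN. JN f). c (Inr z) *\<^sub>R gN z) = 0" using z(1) by simp
      show ?thesis using z(2) normal_independent[OF e] unfolding U by auto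
    qed
  qed
  moreover have "span (h ` (\<Union>s\<in>?S. J s)) = Sigma_loc v base k"
  proof
    have hU: "h ` (\<Union>s\<in>?S. J s) = g ` (IBB \<union> IP) \<union> (\<Union>f\<in>FN. gN ` JN f)"
      unfolding U by (simp add: image_Un image_image image_UN h_def)
    show "span (h ` (\<Union>s\<in>?S. J s)) \<subseteq> Sigma_loc v base k"
    proof (rule span_minimal)
      have "gN z \<in> Sigma_loc v base k" if "f \<in> FN" "z \<in> JN f" for f z
      proof -
        have "gN z \<in> span (g ` IB)" using gN_Sigma[of f z] that by (auto simp: FN_iff poly_sym_IB)
        also have "\<dots> \<subseteq> Sigma_loc v base k" unfolding Sigma_loc_eq by (intro span_mono image_mono) auto
        finally show ?thesis .
      qed
      moreover have "g ` (IBB \<union> IP) \<subseteq> Sigma_loc v base k"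
        unfolding Sigma_loc_eq using IBB_sub by (auto intro!: span_base)
      ultimately show "h ` (\<Union>s\<in>?S. J s) \<subseteq> Sigma_loc v base k" unfolding hU by blast
      show "subspace (Sigma_loc v base k)" by (simp add: Sigma_loc_def)
    qed
    show "Sigma_loc v base k \<subseteq> span (h ` (\<Union>s\<in>?S. J s))"
      unfolding Sigma_loc_eq
    proof (rule span_minimal)
      show "g ` (IB \<union> IP) \<subseteq> span (h ` (\<Union>s\<in>?S. J s))"
      proof (rule image_subsetI)
        fix z assume "z \<in> IB \<union> IP"
        then show "g z \<in> span (h ` (\<Union>s\<in>?S. J s))"
        proof
          assume "z \<in> IB"
          then have "g z \<in> span (g ` IBB \<union> (\<Union>f\<in>FN. gN ` JN f))" using g_in_normal_span by (auto simp: IB_def)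
          also have "\<dots> \<subseteq> span (h ` (\<Union>s\<in>?S. J s))" unfolding hU by (intro span_mono) auto
          finally show ?thesis .
        next
          assume "z \<in> IP"
          then show ?thesis unfolding hU by (intro span_base) blast
        qed
      qed
    qed simp
  qed
  ultimately show ?thesis
    unfolding S
    by (subst internal_direct_sum_cong[where V' = "\<lambda>s. span (h ` J s)" and W' = "span (h ` (\<Union>s\<in>?S. J s))"])
      (auto simp: J_def bd bubble_phi_eq bubble_normal_eq FN_iff h_def image_image)
qed

end

section \<open>Weak divergence\<close>

text \<open>The vector-valued counterpart of \<open>bbs\<close>.\<close>

definition bv :: "(real^'n \<Rightarrow> 'b::euclidean_space) \<Rightarrow> bool"
  where "bv f \<longleftrightarrow> f \<in> borel_measurable borel \<and> (\<exists>B. \<forall>x. norm (f x) \<le> B) \<and> bounded {x. f x \<noteq> 0}"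

lemma bv_borel: "bv f \<Longrightarrow> f \<in> borel_measurable borel" by (simp add: bv_def)

lemma bv_zero: "bv (\<lambda>x. 0)" by (auto simp: bv_def)

lemma bv_add: assumes "bv f" "bv h" shows "bv (\<lambda>x. f x + h x)"
proof -
  obtain B where B: "\<And>x. norm (f x) \<le> B" using assms(1) unfolding bv_def by blast
  obtain C where C: "\<And>x. norm (h x) \<le> C" using assms(2) unfolding bv_def by blast
  have "bounded ({x. f x \<noteq> 0} \<union> {x. h x \<noteq> 0})" using assms unfolding bv_def by auto
  then have "bounded {x. f x + h x \<noteq> 0}" by (rule bounded_subset) auto
  moreover have "norm (f x + h x) \<le> B + C" for x using norm_triangle_le[OF add_mono[OF B C]] .
  ultimately show ?thesis using assms unfolding bv_def by auto
qed

lemma bv_sum: "(\<And>i. i \<in> I \<Longrightarrow> bv (f i)) \<Longrightarrow> bv (\<lambda>x. \<Sum>i\<in>I. f i x)"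
  by (induction I rule: infinite_finite_induct) (auto simp: bv_zero bv_add)

lemma bv_indicator_continuous:
  fixes h :: "real^'n \<Rightarrow> 'b::euclidean_space"
  assumes S: "S \<in> sets borel" "bounded S" and h: "continuous_on UNIV h"
  shows "bv (\<lambda>x. indicat_real S x *\<^sub>R h x)"
proof -
  have [measurable]: "h \<in> borel_measurable borel" by (rule borel_measurable_continuous_onI[OF h])
  have "compact (closure S)" using S by (simp add: compact_closure)
  then have "compact (h ` closure S)"
    using h by (meson compact_continuous_image continuous_on_subset subset_UNIV)
  then obtain B where B: "\<And>x. x \<in> closure S \<Longrightarrow> norm (h x) \<le> B"
    using compact_imp_bounded bounded_iff by (metis imageI)
  have "norm (indicat_real S x *\<^sub>R h x) \<le> max B 0" for x
    using B[of x] closure_subset[of S] by (auto simp: indicator_def)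
  moreover have "bounded {x. indicat_real S x *\<^sub>R h x \<noteq> 0}"
    using S(2) by (rule bounded_subset) (auto simp: indicator_def)
  ultimately show ?thesis using S(1) unfolding bv_def by auto
qed

lemma bv_inner:
  assumes f: "bv f" and h: "continuous_on UNIV h"
  shows "bbs (\<lambda>x. f x \<bullet> h x)"
proof -
  obtain B where B: "\<And>x. norm (f x) \<le> B" and bd: "bounded {x. f x \<noteq> 0}" and [measurable]: "f \<in> borel_measurable borel"
    using f unfolding bv_def by blast
  have [measurable]: "h \<in> borel_measurable borel" by (rule borel_measurable_continuous_onI[OF h])
  have "compact (closure {x. f x \<noteq> 0})" using bd by (simp add: compact_closure)
  then have "compact (h ` closure {x. f x \<noteq> 0})"
    using h by (meson compact_continuous_image continuous_on_subset subset_UNIV)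
  then obtain C where C: "\<And>x. x \<in> closure {x. f x \<noteq> 0} \<Longrightarrow> norm (h x) \<le> C"
    using compact_imp_bounded bounded_iff by (metis imageI)
  have "\<bar>f x \<bullet> h x\<bar> \<le> B * max C 0" for x
  proof (cases "f x = 0")
    case True
    then show ?thesis using B[of x] by simp
  next
    case False
    then have "norm (h x) \<le> C" using C closure_subset[of "{x. f x \<noteq> 0}"] by blast
    moreover have "0 \<le> B" using B[of x] norm_ge_zero[of "f x"] by linarith
    ultimately have "norm (f x) * norm (h x) \<le> B * max C 0" using B[of x] by (intro mult_mono) auto
    then show ?thesis using Cauchy_Schwarz_ineq2[of "f x" "h x"] by linarith
  qed
  moreover have "bounded {x. f x \<bullet> h x \<noteq> 0}" using bd by (rule bounded_subset) auto
  ultimately show ?thesis unfolding bbs_def by auto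
qed

lemma bbs_set_integrable: "bbs f \<Longrightarrow> S \<in> sets lebesgue \<Longrightarrow> set_integrable lebesgue S f"
proof -
  assume f: "bbs f" and S: "S \<in> sets lebesgue"
  have "integrable lebesgue f"
    using bbs_integrable[OF f] f by (simp add: integrable_completion bbs_def)
  then show ?thesis unfolding set_integrable_def by (rule integrable_mult_indicator[OF S])
qed

lemma bv_L2:
  assumes f: "bv f" and S: "S \<in> sets lebesgue" shows "L2_on S f"
proof -
  have [measurable]: "f \<in> borel_measurable borel" using f by (rule bv_borel)
  have m: "f \<in> borel_measurable lebesgue" by (rule measurable_completion) simp
  obtain B where B: "\<And>x. norm (f x) \<le> B" and bd: "bounded {x. f x \<noteq> 0}" using f unfolding bv_def by blast
  have "bbs (\<lambda>x. (norm (f x))\<^sup>2)"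
  proof -
    have "\<bar>(norm (f x))\<^sup>2\<bar> \<le> B\<^sup>2" for x using B[of x] by (simp add: power_mono)
    moreover have "{x. (norm (f x))\<^sup>2 \<noteq> 0} = {x. f x \<noteq> 0}" by auto
    ultimately show ?thesis unfolding bbs_def using bd by (intro conjI) (measurable, blast, simp)
  qed
  then show ?thesis using bbs_set_integrable[OF _ S] m S by (auto simp: L2_on_def set_borel_measurable_def)
qed

text \<open>h is bounded on the compact closure of S, and |f| \<le> 1 + |f|^2 dominates f by
  integrable functions on a bounded set.\<close>

lemma L2_inner_integrable:
  fixes f :: "real^'n \<Rightarrow> 'b::euclidean_space"
  assumes f: "L2_on D f" and h: "continuous_on UNIV h" and S: "S \<subseteq> D" "S \<in> sets lebesgue" "bounded S"
  shows "set_integrable lebesgue S (\<lambda>x. f x \<bullet> h x)"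
proof -
  have fm: "(\<lambda>x. indicat_real D x *\<^sub>R f x) \<in> borel_measurable lebesgue"
    using f by (simp add: L2_on_def set_borel_measurable_def)
  have hm: "h \<in> borel_measurable lebesgue"
    by (rule measurable_completion) (simp add: borel_measurable_continuous_onI[OF h])
  have I: "integrable lebesgue (\<lambda>x. indicat_real D x *\<^sub>R (norm (f x))\<^sup>2)"
    using f by (simp add: L2_on_def set_integrable_def)
  have "compact (closure S)" using S by (simp add: compact_closure)
  then have "compact (h ` closure S)"
    using h by (meson compact_continuous_image continuous_on_subset subset_UNIV)
  then obtain C where C: "\<And>x. x \<in> closure S \<Longrightarrow> norm (h x) \<le> C"
    using compact_imp_bounded bounded_iff by (metis imageI)
  have SI: "integrable lebesgue (indicat_real S)"
    using S bounded_set_imp_lmeasurable lmeasurable_iff_integrable by blast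
  have "integrable lebesgue (\<lambda>x. max C 0 * (indicat_real S x + indicat_real D x *\<^sub>R (norm (f x))\<^sup>2))"
    using I SI by (intro integrable_mult_right Bochner_Integration.integrable_add)
  then have "integrable lebesgue (\<lambda>x. indicat_real S x *\<^sub>R (f x \<bullet> h x))"
  proof (rule Bochner_Integration.integrable_bound)
    have "(\<lambda>x. indicat_real S x *\<^sub>R ((indicat_real D x *\<^sub>R f x) \<bullet> h x)) \<in> borel_measurable lebesgue"
      using S(2) by (intro borel_measurable_scaleR borel_measurable_inner borel_measurable_indicator fm hm)
    also have "(\<lambda>x. indicat_real S x *\<^sub>R ((indicat_real D x *\<^sub>R f x) \<bullet> h x)) = (\<lambda>x. indicat_real S x *\<^sub>R (f x \<bullet> h x))"
      using S(1) by (auto simp: indicator_def fun_eq_iff)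
    finally show "(\<lambda>x. indicat_real S x *\<^sub>R (f x \<bullet> h x)) \<in> borel_measurable lebesgue" .
    show "AE x in lebesgue. norm (indicat_real S x *\<^sub>R (f x \<bullet> h x)) \<le>
        norm (max C 0 * (indicat_real S x + indicat_real D x *\<^sub>R (norm (f x))\<^sup>2))"
    proof (rule AE_I2)
      fix x
      show "norm (indicat_real S x *\<^sub>R (f x \<bullet> h x)) \<le>
        norm (max C 0 * (indicat_real S x + indicat_real D x *\<^sub>R (norm (f x))\<^sup>2))"
      proof (cases "x \<in> S")
        case True
        then have "norm (h x) \<le> max C 0" using C[of x] closure_subset[of S] by auto
        moreover have "norm (f x) \<le> 1 + (norm (f x))\<^sup>2"
        proof -
          have "0 \<le> (norm (f x) - 1)\<^sup>2" by simp
          then have "2 * norm (f x) \<le> 1 + (norm (f x))\<^sup>2" by (simp add: power2_diff)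
          then show ?thesis using norm_ge_zero[of "f x"] by linarith
        qed
        ultimately have "norm (h x) * norm (f x) \<le> max C 0 * (1 + (norm (f x))\<^sup>2)"
          by (intro mult_mono) auto
        moreover have "\<bar>f x \<bullet> h x\<bar> \<le> norm (h x) * norm (f x)"
          using Cauchy_Schwarz_ineq2[of "f x" "h x"] by (simp add: mult.commute)
        moreover have "0 \<le> max C 0 * (1 + (norm (f x))\<^sup>2)" by simp
        ultimately show ?thesis using True S(1) by (auto simp: indicator_def)
      qed simp
    qed
  qed
  then show ?thesis by (simp add: set_integrable_def)
qed

lemma C1_zero_open:
  assumes "C1 g Dg" "open U" "\<And>x. x \<in> U \<Longrightarrow> g x = 0" "x \<in> U"
  shows "Dg x = 0"
proof -
  have "((\<lambda>x. 0) has_derivative (\<lambda>h. Dg x \<bullet> h)) (at x)"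
    by (rule has_derivative_transform_within_open[OF C1D[OF assms(1)] assms(2,4)]) (use assms(3) in auto)
  then have "(\<lambda>h. Dg x \<bullet> h) = (\<lambda>h. 0)" by (rule has_derivative_unique) simp
  then have "Dg x \<bullet> Dg x = 0" by meson
  then show ?thesis by simp
qed

lemma smooth_continuous: "smooth \<phi> \<Longrightarrow> continuous_on S \<phi>"
  by (rule continuous_on_vec_nth_iff) (rule C1_cont[OF smooth_C1])

lemma jacobian_continuous: "smooth \<phi> \<Longrightarrow> continuous_on S (\<lambda>x. jacobian \<phi> (at x))"
  by (rule continuous_on_vec_nth_iff) (rule C1_cont_deriv[OF smooth_C1])

lemma jacobian_zero_open:
  assumes "smooth \<phi>" "open U" "\<And>x. x \<in> U \<Longrightarrow> \<phi> x = 0" "x \<in> U"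
  shows "jacobian \<phi> (at x) = 0"
  using C1_zero_open[OF smooth_C1[OF assms(1)] assms(2) _ assms(4)] assms(3) by (simp add: vec_eq_iff)

lemma set_integral_restrict:
  fixes F :: "real^'n \<Rightarrow> real"
  assumes "\<And>x. x \<notin> S \<Longrightarrow> F x = 0" "S \<subseteq> D"
  shows "(LINT x:D|lebesgue. F x) = (LINT x:S|lebesgue. F x)"
  unfolding set_lebesgue_integral_def
  by (rule Bochner_Integration.integral_cong) (use assms in \<open>auto simp: indicator_def\<close>)

context nsimplex
begin

text \<open>Smooth, supported in the interior of the simplex, and converging to 1 there as \<open>m \<rightarrow> \<infinity>\<close>.\<close>

definition cutoff :: "nat \<Rightarrow> real^'n \<Rightarrow> real"
  where "cutoff m x = (\<Prod>i\<le>CARD('n). flat 0 (real (Suc m) * bary v i x - 1))"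

lemma cutoff_nice: "nice (cutoff m)"
  unfolding cutoff_def[abs_def]
  by (intro nice_prod nice_flat nice_diff nice_cmult nice_const bary_nice) simp

lemma cutoff_bounds: "0 \<le> cutoff m x" "cutoff m x \<le> 1"
  unfolding cutoff_def by (auto intro!: prod_nonneg prod_le_1 simp: flat_nonneg flat0_le_1)

text \<open>A compact set inside the open simplex that contains the support of
  \<open>cutoff m\<close>, as \<open>test_fun_cutoff\<close> requires.\<close>

definition core :: "nat \<Rightarrow> (real^'n) set"
  where "core m = {x. \<forall>i\<le>CARD('n). 1 / real (Suc m) \<le> bary v i x}"

lemma core_interior: "core m \<subseteq> interior (simplex_hull v)"
  unfolding core_def interior_eq by (auto intro: less_le_trans[of 0 "1 / real (Suc m)"])

lemma cutoff_support: "{x. cutoff m x \<noteq> 0} \<subseteq> core m"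
proof safe
  fix x assume "cutoff m x \<noteq> 0"
  then have "flat 0 (real (Suc m) * bary v i x - 1) \<noteq> 0" if "i \<le> CARD('n)" for i
    using that unfolding cutoff_def by auto
  then have "1 < real (Suc m) * bary v i x" if "i \<le> CARD('n)" for i
    using that flat_nonpos[of "real (Suc m) * bary v i x - 1" 0] by force
  then show "x \<in> core m" unfolding core_def
    by (auto simp: divide_le_eq mult.commute intro: less_imp_le)
qed

lemma core_compact: "compact (core m)"
proof -
  have "core m = (\<Inter>i\<in>{..CARD('n)}. {x. 1 / real (Suc m) \<le> bary v i x})" by (auto simp: core_def)
  then have "closed (core m)"
    by (auto intro!: closed_INT closed_Collect_le continuous_on_const bary_continuous)
  moreover have "bounded (core m)"
    using hull_bounded core_interior interior_subset bounded_subset by metis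
  ultimately show ?thesis by (simp add: compact_eq_bounded_closed)
qed

lemma cutoff_tendsto:
  assumes "x \<in> interior (simplex_hull v)" shows "(\<lambda>m. cutoff m x) \<longlonglongrightarrow> 1"
proof -
  have "(\<lambda>m. flat 0 (real (Suc m) * bary v i x - 1)) \<longlonglongrightarrow> 1" if "i \<le> CARD('n)" for i
  proof -
    define b where "b = bary v i x"
    have b: "0 < b" using assms that by (simp add: b_def interior_eq)
    have "filterlim (\<lambda>m. real m) at_top sequentially" by (rule filterlim_real_sequentially)
    then have "filterlim (\<lambda>m. real (Suc m)) at_top sequentially"
      using filterlim_compose filterlim_Suc by blast
    then have "filterlim (\<lambda>m. - 1 + real (Suc m) * b) at_top sequentially"
      using b by (intro filterlim_tendsto_add_at_top[OF tendsto_const] filterlim_at_top_mult_tendsto_pos[OF tendsto_const]) auto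
    then have lim: "filterlim (\<lambda>m. real (Suc m) * b - 1) at_top sequentially" by simp
    then have "(\<lambda>m. inverse (real (Suc m) * b - 1)) \<longlonglongrightarrow> 0"
      by (rule tendsto_inverse_0_at_top)
    then have "(\<lambda>m. exp (- inverse (real (Suc m) * b - 1))) \<longlonglongrightarrow> exp (- 0)" by (intro tendsto_intros)
    moreover have "\<forall>\<^sub>F m in sequentially. exp (- inverse (real (Suc m) * b - 1)) = flat 0 (real (Suc m) * b - 1)"
      using filterlim_at_top_dense[THEN iffD1, OF lim, rule_format, of 0]
      by eventually_elim (auto simp: flat_def inverse_eq_divide)
    ultimately show ?thesis unfolding b_def by (simp add: tendsto_cong)
  qed
  then have "(\<lambda>m. \<Prod>i\<le>CARD('n). flat 0 (real (Suc m) * bary v i x - 1)) \<longlonglongrightarrow> (\<Prod>i\<le>CARD('n). 1)"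
    by (intro tendsto_prod) auto
  then show ?thesis by (simp add: cutoff_def)
qed

lemma hull_lebesgue: "simplex_hull v \<in> sets lebesgue"
  by simp

lemma AE_interior: "AE x in lebesgue. x \<in> simplex_hull v \<longrightarrow> x \<in> interior (simplex_hull v)"
proof -
  have "negligible (frontier (simplex_hull v))"
    by (rule negligible_convex_frontier) (simp add: simplex_hull_def convex_convex_hull)
  then have "AE x in lebesgue. x \<notin> frontier (simplex_hull v)"
    unfolding negligible_iff_null_sets by (rule AE_not_in)
  then show ?thesis
    by (rule eventually_mono) (use closure_subset in \<open>auto simp: frontier_def\<close>)
qed

lemma AE_split: "AE x in lebesgue. x \<in> simplex_hull v \<longrightarrow> x \<in> split_interior v"
  using negligible_split unfolding negligible_iff_null_sets
  by (rule AE_not_in[THEN eventually_mono]) blast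

text \<open>Dominated convergence; the boundary, on which the cutoffs stay 0, is a null set.\<close>

lemma cutoff_limit:
  assumes "set_integrable lebesgue (simplex_hull v) F"
  shows "(\<lambda>m. LINT x:simplex_hull v|lebesgue. cutoff m x * F x) \<longlonglongrightarrow> (LINT x:simplex_hull v|lebesgue. F x)"
  unfolding set_lebesgue_integral_def
proof (rule integral_dominated_convergence)
  let ?w = "\<lambda>x. norm (indicat_real (simplex_hull v) x *\<^sub>R F x)"
  have I: "integrable lebesgue (\<lambda>x. indicat_real (simplex_hull v) x *\<^sub>R F x)"
    using assms by (simp add: set_integrable_def)
  then show "integrable lebesgue ?w" by (rule integrable_norm)
  show m: "(\<lambda>x. indicat_real (simplex_hull v) x *\<^sub>R F x) \<in> borel_measurable lebesgue" using I by auto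
  have c: "cutoff m \<in> borel_measurable lebesgue" for m
    by (rule measurable_completion) (simp add: borel_measurable_continuous_onI[OF nice_continuous[OF cutoff_nice]])
  show "(\<lambda>x. indicat_real (simplex_hull v) x *\<^sub>R (cutoff m x * F x)) \<in> borel_measurable lebesgue" for m
    using borel_measurable_times[OF c[of m] m] by (simp add: mult.left_commute)
  show "AE x in lebesgue. (\<lambda>m. indicat_real (simplex_hull v) x *\<^sub>R (cutoff m x * F x))
      \<longlonglongrightarrow> indicat_real (simplex_hull v) x *\<^sub>R F x"
    using AE_interior
  proof eventually_elim
    case (elim x)
    show ?case
    proof (cases "x \<in> simplex_hull v")
      case True
      then have "(\<lambda>m. cutoff m x * F x) \<longlonglongrightarrow> 1 * F x"
        using elim by (intro tendsto_mult cutoff_tendsto tendsto_const) auto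
      then show ?thesis using True by simp
    qed simp
  qed
  show "AE x in lebesgue. norm (indicat_real (simplex_hull v) x *\<^sub>R (cutoff m x * F x)) \<le> ?w x" for m
    using cutoff_bounds[of m] by (intro AE_I2) (auto simp: indicator_def abs_mult intro: mult_left_le_one_le)
qed

lemma ri_nonempty: assumes l: "l \<le> CARD('n)" shows "ri l \<noteq> {}"
proof -
  \<comment> \<open>The barycenter of the facet.\<close>
  define y where "y = (\<Sum>j\<in>{..CARD('n)} - {l}. (1 / real CARD('n)) *\<^sub>R v j)"
  have "bary v m y = (if m \<in> {..CARD('n)} - {l} then 1 / real CARD('n) else 0)" if "m \<le> CARD('n)" for m
    unfolding y_def using l by (intro bary_combination[OF that]) auto
  then have "y \<in> ri l" using l by (auto simp: ri_def)
  then show ?thesis by blast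
qed

text \<open>A segment from x to a point of the relative interior runs in the relative interior
  except possibly at x, so the latter is dense in the facet.\<close>

lemma facet_zero:
  fixes f :: "real^'n \<Rightarrow> 'b::real_normed_vector"
  assumes l: "l \<le> CARD('n)" and z: "\<And>x. x \<in> ri l \<Longrightarrow> f x = 0" and f: "continuous_on UNIV f" and x: "x \<in> facet l"
  shows "f x = 0"
proof -
  obtain y where y: "y \<in> ri l" using ri_nonempty[OF l] by blast
  define s where "s n = x + (1 / real (Suc n)) *\<^sub>R (y - x)" for n
  have "s n \<in> ri l" for n
  proof -
    have b: "bary v j (s n) = (1 - 1 / real (Suc n)) * bary v j x + (1 / real (Suc n)) * bary v j y" if "j \<le> CARD('n)" for j
    proof -
      have e: "grad j \<bullet> (y - x) = bary v j y - bary v j x"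
        using bary_diff[OF that, of y "y - x"] by simp
      have "bary v j (s n) = bary v j x + (1 / real (Suc n)) * (grad j \<bullet> (y - x))"
        unfolding s_def bary_add[OF that] by simp
      then show ?thesis unfolding e by (simp add: algebra_simps)
    qed
    have "0 < bary v j (s n)" if "j \<le> CARD('n)" "j \<noteq> l" for j
      unfolding b[OF that(1)] using x y that
      by (intro add_nonneg_pos mult_nonneg_nonneg mult_pos_pos) (auto simp: facet_def ri_def)
    then show ?thesis using x y l by (simp add: ri_def b facet_def)
  qed
  then have "f (s n) = 0" for n using z l by blast
  moreover have "(\<lambda>n. f (s n)) \<longlonglongrightarrow> f x"
  proof -
    have "(\<lambda>n. x + (1 / real (Suc n)) *\<^sub>R (y - x)) \<longlonglongrightarrow> x + 0 *\<^sub>R (y - x)"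
      by (intro tendsto_intros LIMSEQ_Suc[OF lim_1_over_n])
    then have "s \<longlonglongrightarrow> x" by (simp add: s_def[abs_def])
    moreover have "isCont f x"
      using f by (simp add: continuous_on_eq_continuous_at)
    ultimately show ?thesis by (rule isCont_tendsto_compose[rotated])
  qed
  ultimately have "(\<lambda>n::nat. 0) \<longlonglongrightarrow> f x" by simp
  then show ?thesis using LIMSEQ_unique[OF tendsto_const] by metis
qed

lemma sub_bounded: "l \<le> CARD('n) \<Longrightarrow> bounded (interior (subT v l))"
  using hull_bounded hull_sub interior_subset by (metis (no_types, lifting) UN_upper atMost_iff bounded_subset)

end

section \<open>Weak divergence of piecewise fields and the bubble space\<close>

context element
begin

definition dv where "dv u x = (\<Sum>l\<le>CARD('n). indicat_real (interior (subT v l)) x *\<^sub>R rdiv (field u l) x)"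

lemma dv_on:
  assumes "l \<le> CARD('n)" "x \<in> interior (subT v l)" shows "dv u x = rdiv (field u l) x"
proof -
  have "x \<notin> interior (subT v j)" if "j \<le> CARD('n)" "j \<noteq> l" for j
    using sub_disjoint[OF assms(1) that(1)] that(2) assms(2) by blast
  then have "dv u x = (\<Sum>j\<le>CARD('n). if j = l then rdiv (field u l) x else 0)"
    unfolding dv_def using assms by (intro sum.cong) (auto simp: indicator_def)
  then show ?thesis using assms by simp
qed

lemma asm_bv: "bv (asm (field u))"
  unfolding asm_def
  by (intro bv_sum bv_indicator_continuous sub_bounded nice_field_continuous field_nice) auto

lemma dv_bv: "bv (dv u)"
  unfolding dv_def[abs_def]
  by (intro bv_sum bv_indicator_continuous sub_bounded rdiv_continuous field_nice) auto

lemma asm_support: "x \<notin> simplex_hull v \<Longrightarrow> asm P x = 0"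
  using split_interior_sub interior_subset by (intro asm_off) blast

lemma dv_support: "x \<notin> simplex_hull v \<Longrightarrow> dv u x = 0"
  unfolding dv_def using hull_sub interior_subset
  by (intro sum.neutral) (fastforce simp: indicator_def)

text \<open>\<open>gauss_split\<close> for the assembled field: off a null set each point of the
  simplex lies in exactly one piece, and there the assembled field and \<open>dv u\<close> are the
  piece and its divergence.\<close>

lemma gauss_asm:
  assumes \<phi>: "\<And>i. C1 (\<lambda>x. \<phi> x $ i) (\<lambda>x. D\<phi> x $ i)"
  shows "(LINT x:simplex_hull v|lebesgue. asm (field u) x \<bullet> D\<phi> x) + (LINT x:simplex_hull v|lebesgue. dv u x \<bullet> \<phi> x)
     = - (\<Sum>l\<le>CARD('n). FI l (\<lambda>x. indicator (facet l) x * (\<phi> x \<bullet> (field u l x *v grad l))))"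
proof -
  have \<phi>c: "continuous_on UNIV \<phi>" by (rule continuous_on_vec_nth_iff) (rule C1_cont[OF \<phi>])
  have Dc: "continuous_on UNIV D\<phi>" by (rule continuous_on_vec_nth_iff) (rule C1_cont_deriv[OF \<phi>])
  have b: "bbs (\<lambda>x. asm (field u) x \<bullet> D\<phi> x)" "bbs (\<lambda>x. dv u x \<bullet> \<phi> x)"
    by (intro bv_inner asm_bv dv_bv \<phi>c Dc)+
  let ?F = "\<lambda>l x. field u l x \<bullet> D\<phi> x + rdiv (field u l) x \<bullet> \<phi> x"
  have cF: "continuous_on UNIV (?F l)" if "l \<le> CARD('n)" for l
    by (intro continuous_intros \<phi>c Dc nice_field_continuous rdiv_continuous field_nice that)
  have bF: "bbs (\<lambda>x. indicator (subT v l) x * ?F l x)" if "l \<le> CARD('n)" for l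
    unfolding subT_def by (rule nsimplex.bbs_hull[OF sub_coord(1)[OF that] cF[OF that]])
  have "(LINT x:simplex_hull v|lebesgue. asm (field u) x \<bullet> D\<phi> x) + (LINT x:simplex_hull v|lebesgue. dv u x \<bullet> \<phi> x)
     = (LINT x:simplex_hull v|lebesgue. asm (field u) x \<bullet> D\<phi> x + dv u x \<bullet> \<phi> x)"
    by (rule set_integral_add(2)[symmetric]) (intro bbs_set_integrable b hull_lebesgue)+
  also have "\<dots> = (\<integral>x. asm (field u) x \<bullet> D\<phi> x + dv u x \<bullet> \<phi> x \<partial>lebesgue)"
    unfolding set_lebesgue_integral_def
    by (rule Bochner_Integration.integral_cong) (auto simp: indicator_def asm_support dv_support)
  also have "\<dots> = (\<integral>x. (\<Sum>l\<le>CARD('n). indicator (subT v l) x * ?F l x) \<partial>lebesgue)"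
  proof (rule integral_cong_AE)
    show "(\<lambda>x. asm (field u) x \<bullet> D\<phi> x + dv u x \<bullet> \<phi> x) \<in> borel_measurable lebesgue"
      using bbs_add[OF b] by (intro measurable_completion) (simp add: bbs_def)
    show "(\<lambda>x. (\<Sum>l\<le>CARD('n). indicator (subT v l) x * ?F l x)) \<in> borel_measurable lebesgue"
      using bbs_sum[of "{..CARD('n)}" "\<lambda>l x. indicator (subT v l) x * ?F l x", OF bF]
      by (intro measurable_completion) (simp add: bbs_def)
    show "AE x in lebesgue. asm (field u) x \<bullet> D\<phi> x + dv u x \<bullet> \<phi> x = (\<Sum>l\<le>CARD('n). indicator (subT v l) x * ?F l x)"
      using AE_split
    proof eventually_elim
      case (elim x)
      show ?case
      proof (cases "x \<in> simplex_hull v")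
        case True
        then obtain l where l: "l \<le> CARD('n)" "x \<in> interior (subT v l)" using elim by (auto simp: split_interior_def)
        have "x \<in> subT v j \<longleftrightarrow> j = l" if "j \<le> CARD('n)" for j
        proof
          assume "x \<in> subT v j"
          then have "bary v j x \<le> bary v l x" using l by (simp add: sub_hull that)
          then show "j = l" using l that by (force simp: sub_interior)
        qed (use l interior_subset in auto)
        then have "(\<Sum>j\<le>CARD('n). indicator (subT v j) x * ?F j x) = (\<Sum>j\<le>CARD('n). if j = l then ?F l x else 0)"
          by (intro sum.cong) (auto simp: indicator_def)
        then show ?thesis using l by (simp add: asm_on dv_on)
      next
        case False
        then have "x \<notin> subT v l" if "l \<le> CARD('n)" for l using hull_sub that by blast
        then have "(\<Sum>l\<le>CARD('n). indicator (subT v l) x * ?F l x) = 0" by (intro sum.neutral) (auto simp: indicator_def)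
        then show ?thesis using False by (simp add: asm_support dv_support)
      qed
    qed
  qed
  also have "\<dots> = (\<integral>x. (\<Sum>l\<le>CARD('n). indicator (subT v l) x * ?F l x) \<partial>lborel)"
    using bbs_sum[of "{..CARD('n)}" "\<lambda>l x. indicator (subT v l) x * ?F l x", OF bF]
    by (intro integral_completion) (simp add: bbs_def)
  also have "\<dots> = (\<Sum>l\<le>CARD('n). (\<integral>x. indicator (subT v l) x * ?F l x \<partial>lborel))"
    by (rule Bochner_Integration.integral_sum) (simp add: bbs_integrable[OF bF])
  also have "\<dots> = - (\<Sum>l\<le>CARD('n). FI l (\<lambda>x. indicator (facet l) x * (\<phi> x \<bullet> (field u l x *v grad l))))"
    by (rule gauss_split[OF field_nice conf_field \<phi>])
  finally show ?thesis .
qed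

lemma gauss_asm_zero:
  assumes "smooth \<phi>" "\<And>l x. l \<le> CARD('n) \<Longrightarrow> x \<in> facet l \<Longrightarrow> \<phi> x \<bullet> (field u l x *v grad l) = 0"
  shows "(LINT x:simplex_hull v|lebesgue. asm (field u) x \<bullet> jacobian \<phi> (at x)) = - (LINT x:simplex_hull v|lebesgue. dv u x \<bullet> \<phi> x)"
proof -
  have "FI l (\<lambda>x. indicator (facet l) x * (\<phi> x \<bullet> (field u l x *v grad l))) = 0" if "l \<le> CARD('n)" for l
  proof -
    have "(\<lambda>x. indicator (facet l) x * (\<phi> x \<bullet> (field u l x *v grad l))) = (\<lambda>x. 0)"
      using assms(2)[OF that] by (auto simp: indicator_def)
    then show ?thesis by (simp only: FI_def Fint_def) simp
  qed
  then show ?thesis using gauss_asm[OF smooth_C1[OF assms(1)], of u] by simp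
qed

text \<open>A cutoff times \<open>\<phi>\<close> is a test field supported inside the simplex;
  tested with it, \<open>gg\<close> and the piecewise divergence both equal minus the same integral
  of \<open>\<tau>\<close> against the Jacobian. The limit is taken only in the two divergence
  integrals, where no derivative of the cutoff occurs. The lemma plays the part of uniqueness of the
  weak divergence.\<close>

lemma weak_div_local:
  assumes D: "interior (simplex_hull v) \<subseteq> interior D" "D \<in> sets lebesgue"
    and \<tau>: "L2_on D \<tau>" "AE x in lebesgue. x \<in> interior (simplex_hull v) \<longrightarrow> \<tau> x = asm (field u) x"
    and gg: "L2_on D gg" "is_weak_div D \<tau> gg" and \<phi>: "smooth \<phi>"
  shows "(LINT x:interior (simplex_hull v)|lebesgue. gg x \<bullet> \<phi> x) = (LINT x:simplex_hull v|lebesgue. dv u x \<bullet> \<phi> x)"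
proof -
  let ?I = "interior (simplex_hull v)"
  have ID: "?I \<subseteq> D" using D(1) interior_subset by blast
  have Im: "?I \<in> sets lebesgue" by simp
  have Ib: "bounded ?I" using hull_bounded bounded_interior by blast
  have "(LINT x:simplex_hull v|lebesgue. cutoff m x * (indicat_real ?I x * (gg x \<bullet> \<phi> x))) =
      (LINT x:simplex_hull v|lebesgue. cutoff m x * (dv u x \<bullet> \<phi> x))" for m
  proof -
    define \<psi> where "\<psi> x = cutoff m x *\<^sub>R \<phi> x" for x
    have test: "test_fun D \<psi>"
      unfolding \<psi>_def[abs_def]
      by (rule test_fun_cutoff[OF cutoff_nice \<phi> core_compact cutoff_support]) (use core_interior D in blast)
    have sm: "smooth \<psi>" using test by (simp add: test_fun_def)
    have \<psi>0: "\<psi> x = 0" if "x \<notin> core m" for x using that cutoff_support by (auto simp: \<psi>_def)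
    have J0: "jacobian \<psi> (at x) = 0" if "x \<notin> core m" for x
      by (rule jacobian_zero_open[OF sm, of "- core m"])
        (use that \<psi>0 compact_imp_closed[OF core_compact] in auto)
    have out: "x \<notin> core m" if "x \<notin> ?I" for x using that core_interior by blast
    have eq: "(LINT x:D|lebesgue. \<tau> x \<bullet> jacobian \<psi> (at x)) = - (LINT x:D|lebesgue. gg x \<bullet> \<psi> x)"
      using gg(2) test by (simp add: is_weak_div_def)
    have "(LINT x:D|lebesgue. gg x \<bullet> \<psi> x) = (LINT x:?I|lebesgue. gg x \<bullet> \<psi> x)"
      by (rule set_integral_restrict[OF _ ID]) (simp add: \<psi>0 out)
    also have "\<dots> = (LINT x:simplex_hull v|lebesgue. cutoff m x * (indicat_real ?I x * (gg x \<bullet> \<phi> x)))"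
      unfolding set_lebesgue_integral_def
      by (rule Bochner_Integration.integral_cong) (use interior_subset[of "simplex_hull v"] in \<open>auto simp: indicator_def \<psi>_def\<close>)
    finally have 1: "(LINT x:D|lebesgue. gg x \<bullet> \<psi> x) = (LINT x:simplex_hull v|lebesgue. cutoff m x * (indicat_real ?I x * (gg x \<bullet> \<phi> x)))" .
    have "(LINT x:D|lebesgue. \<tau> x \<bullet> jacobian \<psi> (at x)) = (LINT x:?I|lebesgue. \<tau> x \<bullet> jacobian \<psi> (at x))"
      by (rule set_integral_restrict[OF _ ID]) (simp add: J0 out)
    also have "\<dots> = (LINT x:?I|lebesgue. asm (field u) x \<bullet> jacobian \<psi> (at x))"
      unfolding set_lebesgue_integral_def
    proof (rule integral_cong_AE)
      show "(\<lambda>x. indicat_real ?I x *\<^sub>R (\<tau> x \<bullet> jacobian \<psi> (at x))) \<in> borel_measurable lebesgue"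
        using L2_inner_integrable[OF \<tau>(1) jacobian_continuous[OF sm] ID Im Ib] by (auto simp: set_integrable_def)
      show "(\<lambda>x. indicat_real ?I x *\<^sub>R (asm (field u) x \<bullet> jacobian \<psi> (at x))) \<in> borel_measurable lebesgue"
        using bbs_set_integrable[OF bv_inner[OF asm_bv jacobian_continuous[OF sm]] Im] by (auto simp: set_integrable_def)
      show "AE x in lebesgue. indicat_real ?I x *\<^sub>R (\<tau> x \<bullet> jacobian \<psi> (at x)) = indicat_real ?I x *\<^sub>R (asm (field u) x \<bullet> jacobian \<psi> (at x))"
        using \<tau>(2) by eventually_elim (auto simp: indicator_def)
    qed
    also have "\<dots> = (LINT x:simplex_hull v|lebesgue. asm (field u) x \<bullet> jacobian \<psi> (at x))"
      by (rule set_integral_restrict[symmetric]) (auto simp: J0 out interior_subset[THEN subsetD])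
    also have "\<dots> = - (LINT x:simplex_hull v|lebesgue. dv u x \<bullet> \<psi> x)"
    proof (rule gauss_asm_zero[OF sm])
      fix l x assume "l \<le> CARD('n)" "x \<in> facet l"
      then have "x \<notin> interior (simplex_hull v)" by (auto simp: facet_def interior_eq)
      then have "x \<notin> core m" using core_interior by blast
      then show "\<psi> x \<bullet> (field u l x *v grad l) = 0" by (simp add: \<psi>0)
    qed
    also have "(LINT x:simplex_hull v|lebesgue. dv u x \<bullet> \<psi> x) = (LINT x:simplex_hull v|lebesgue. cutoff m x * (dv u x \<bullet> \<phi> x))"
      by (simp add: \<psi>_def)
    finally show ?thesis using eq 1 by simp
  qed
  moreover have "(\<lambda>m. LINT x:simplex_hull v|lebesgue. cutoff m x * (indicat_real ?I x * (gg x \<bullet> \<phi> x)))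
      \<longlonglongrightarrow> (LINT x:simplex_hull v|lebesgue. indicat_real ?I x * (gg x \<bullet> \<phi> x))"
  proof (rule cutoff_limit)
    have "(\<lambda>x. indicat_real (simplex_hull v) x *\<^sub>R (indicat_real ?I x * (gg x \<bullet> \<phi> x))) = (\<lambda>x. indicat_real ?I x *\<^sub>R (gg x \<bullet> \<phi> x))"
      using interior_subset[of "simplex_hull v"] by (auto simp: indicator_def fun_eq_iff)
    then show "set_integrable lebesgue (simplex_hull v) (\<lambda>x. indicat_real ?I x * (gg x \<bullet> \<phi> x))"
      using L2_inner_integrable[OF gg(1) smooth_continuous[OF \<phi>] ID Im Ib] by (simp add: set_integrable_def)
  qed
  moreover have "(\<lambda>m. LINT x:simplex_hull v|lebesgue. cutoff m x * (dv u x \<bullet> \<phi> x))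
      \<longlonglongrightarrow> (LINT x:simplex_hull v|lebesgue. dv u x \<bullet> \<phi> x)"
    by (rule cutoff_limit, rule bbs_set_integrable[OF bv_inner[OF dv_bv smooth_continuous[OF \<phi>]]]) simp
  ultimately have "(LINT x:simplex_hull v|lebesgue. indicat_real ?I x * (gg x \<bullet> \<phi> x)) = (LINT x:simplex_hull v|lebesgue. dv u x \<bullet> \<phi> x)"
    using LIMSEQ_unique by simp
  moreover have "(LINT x:simplex_hull v|lebesgue. indicat_real ?I x * (gg x \<bullet> \<phi> x)) = (LINT x:?I|lebesgue. gg x \<bullet> \<phi> x)"
    unfolding set_lebesgue_integral_def
    by (rule Bochner_Integration.integral_cong) (use interior_subset[of "simplex_hull v"] in \<open>auto simp: indicator_def\<close>)
  ultimately show ?thesis by simp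
qed

lemma asm_Hdiv: "asm (field u) \<in> Hdiv (simplex_hull v)" "is_weak_div (simplex_hull v) (asm (field u)) (dv u)"
proof -
  show w: "is_weak_div (simplex_hull v) (asm (field u)) (dv u)"
    unfolding is_weak_div_def
  proof (intro allI impI)
    fix \<phi> :: "real^'n \<Rightarrow> real^'n" assume "test_fun (simplex_hull v) \<phi>"
    then have \<phi>: "smooth \<phi>" "closure {x. \<phi> x \<noteq> 0} \<subseteq> interior (simplex_hull v)" by (auto simp: test_fun_def)
    show "(LINT x:simplex_hull v|lebesgue. asm (field u) x \<bullet> jacobian \<phi> (at x)) = - (LINT x:simplex_hull v|lebesgue. dv u x \<bullet> \<phi> x)"
    proof (rule gauss_asm_zero[OF \<phi>(1)])
      fix l x assume "l \<le> CARD('n)" "x \<in> facet l"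
      then have "x \<notin> interior (simplex_hull v)" by (auto simp: facet_def interior_eq)
      then have "\<phi> x = 0" using \<phi>(2) closure_subset[of "{x. \<phi> x \<noteq> 0}"] by blast
      then show "\<phi> x \<bullet> (field u l x *v grad l) = 0" by simp
    qed
  qed
  have "transpose (asm (field u) x) = asm (field u) x" for x
    by (simp add: asm_def transpose_sum transpose_scaleR transpose_field)
  then show "asm (field u) \<in> Hdiv (simplex_hull v)"
    unfolding Hdiv_def using w bv_L2[OF asm_bv] bv_L2[OF dv_bv]
    by (intro CollectI conjI exI[of _ "dv u"]) auto
qed

text \<open>The trace functional is the facet sum of \<open>gauss_asm\<close>. Testing with the
  normal component on facet i, weighted by the product of the other coordinates, removes all other
  facets and leaves the integral of a nonnegative function.\<close>

lemma Hdiv0_iff: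
  "asm (field u) \<in> Hdiv0 (simplex_hull v) \<longleftrightarrow> (\<forall>l\<le>CARD('n). \<forall>x\<in>ri l. field u l x *v grad l = 0)"
proof
  assume H: "asm (field u) \<in> Hdiv0 (simplex_hull v)"
  show "\<forall>l\<le>CARD('n). \<forall>x\<in>ri l. field u l x *v grad l = 0"
  proof (intro allI impI ballI)
    fix i x assume i: "i \<le> CARD('n)" and x: "x \<in> ri i"
    define b where "b x = (\<Prod>j\<in>{..CARD('n)} - {i}. bary v j x)" for x
    define \<phi> where "\<phi> x = b x *\<^sub>R (field u i x *v grad i)" for x
    have bn: "nice b" unfolding b_def[abs_def] by (intro nice_prod bary_nice) auto
    have \<phi>: "smooth \<phi>"
    proof (rule smooth_nice)
      fix j
      have "nice (\<lambda>x. b x * (\<Sum>m\<in>UNIV. field u i x $ j $ m * grad i $ m))"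
        using field_nice[OF i] unfolding nice_field_def
        by (intro nice_mult[OF bn] nice_sum nice_mult nice_const) auto
      then show "nice (\<lambda>x. \<phi> x $ j)" by (simp add: \<phi>_def matrix_vector_mult_def)
    qed
    have I: "set_integrable lebesgue (simplex_hull v) (\<lambda>x. asm (field u) x \<bullet> jacobian \<phi> (at x))"
      "set_integrable lebesgue (simplex_hull v) (\<lambda>x. dv u x \<bullet> \<phi> x)"
      by (intro bbs_set_integrable bv_inner asm_bv dv_bv jacobian_continuous smooth_continuous \<phi> hull_lebesgue)+
    have "(LINT x:simplex_hull v|lebesgue. asm (field u) x \<bullet> jacobian \<phi> (at x) + dv u x \<bullet> \<phi> x) = 0"
      using H asm_Hdiv(2) bv_L2[OF dv_bv hull_lebesgue] \<phi> unfolding Hdiv0_def by blast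
    then have "(\<Sum>l\<le>CARD('n). FI l (\<lambda>x. indicator (facet l) x * (\<phi> x \<bullet> (field u l x *v grad l)))) = 0"
      using gauss_asm[OF smooth_C1[OF \<phi>], of u] set_integral_add(2)[OF I] by simp
    moreover have "FI l (\<lambda>x. indicator (facet l) x * (\<phi> x \<bullet> (field u l x *v grad l))) = 0" if "l \<le> CARD('n)" "l \<noteq> i" for l
    proof -
      have "\<phi> x = 0" if "x \<in> facet l" for x
        using that \<open>l \<le> CARD('n)\<close> \<open>l \<noteq> i\<close> by (auto simp: \<phi>_def b_def facet_def intro!: prod_zero)
      then have "(\<lambda>x. indicator (facet l) x * (\<phi> x \<bullet> (field u l x *v grad l))) = (\<lambda>x. 0)" by (auto simp: indicator_def)
      then show ?thesis by (simp only: FI_def Fint_def) simp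
    qed
    moreover have "(\<Sum>l\<le>CARD('n). FI l (\<lambda>x. indicator (facet l) x * (\<phi> x \<bullet> (field u l x *v grad l))))
       = FI i (\<lambda>x. indicator (facet i) x * (\<phi> x \<bullet> (field u i x *v grad i)))
         + (\<Sum>l\<in>{..CARD('n)} - {i}. FI l (\<lambda>x. indicator (facet l) x * (\<phi> x \<bullet> (field u l x *v grad l))))"
      using i by (intro sum.remove) auto
    ultimately have z: "FI i (\<lambda>x. indicator (facet i) x * (\<phi> x \<bullet> (field u i x *v grad i))) = 0" by simp
    have "\<phi> x \<bullet> (field u i x *v grad i) = 0"
    proof (rule FI_zero[OF i _ _ z x])
      show "continuous_on UNIV (\<lambda>x. \<phi> x \<bullet> (field u i x *v grad i))"
        by (intro continuous_on_inner smooth_continuous \<phi> nice_field_mult_continuous field_nice i)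
      show "0 \<le> \<phi> y \<bullet> (field u i y *v grad i)" if "y \<in> facet i" for y
        using that by (auto simp: \<phi>_def b_def facet_def intro!: mult_nonneg_nonneg prod_nonneg)
    qed
    moreover have "0 < b x" unfolding b_def using x by (auto simp: ri_def intro!: prod_pos)
    ultimately show "field u i x *v grad i = 0" by (simp add: \<phi>_def)
  qed
next
  assume z: "\<forall>l\<le>CARD('n). \<forall>x\<in>ri l. field u l x *v grad l = 0"
  then have zf: "field u l x *v grad l = 0" if "l \<le> CARD('n)" "x \<in> facet l" for l x
    using facet_zero[OF that(1) _ nice_field_mult_continuous[OF field_nice[OF that(1)]] that(2)] that(1) by blast
  show "asm (field u) \<in> Hdiv0 (simplex_hull v)"
    unfolding Hdiv0_def
  proof (intro CollectI conjI asm_Hdiv(1) allI impI, elim conjE)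
    fix gg \<phi> :: "real^'n \<Rightarrow> real^'n" assume gg: "L2_on (simplex_hull v) gg" "is_weak_div (simplex_hull v) (asm (field u)) gg"
      and \<phi>: "smooth \<phi>"
    have I: "set_integrable lebesgue (simplex_hull v) (\<lambda>x. asm (field u) x \<bullet> jacobian \<phi> (at x))"
      by (intro bbs_set_integrable bv_inner asm_bv jacobian_continuous \<phi> hull_lebesgue)
    have G: "set_integrable lebesgue (simplex_hull v) (\<lambda>x. gg x \<bullet> \<phi> x)"
      by (rule L2_inner_integrable[OF gg(1) smooth_continuous[OF \<phi>]]) (auto simp: hull_bounded)
    have "(LINT x:simplex_hull v|lebesgue. gg x \<bullet> \<phi> x) = (LINT x:interior (simplex_hull v)|lebesgue. gg x \<bullet> \<phi> x)"
      unfolding set_lebesgue_integral_def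
    proof (rule integral_cong_AE)
      show "(\<lambda>x. indicat_real (simplex_hull v) x *\<^sub>R (gg x \<bullet> \<phi> x)) \<in> borel_measurable lebesgue"
        using G by (auto simp: set_integrable_def)
      show "(\<lambda>x. indicat_real (interior (simplex_hull v)) x *\<^sub>R (gg x \<bullet> \<phi> x)) \<in> borel_measurable lebesgue"
        using L2_inner_integrable[OF gg(1) smooth_continuous[OF \<phi>] interior_subset] hull_bounded
        by (auto simp: set_integrable_def bounded_interior)
      show "AE x in lebesgue. indicat_real (simplex_hull v) x *\<^sub>R (gg x \<bullet> \<phi> x) = indicat_real (interior (simplex_hull v)) x *\<^sub>R (gg x \<bullet> \<phi> x)"
        using AE_interior by eventually_elim (use interior_subset in \<open>auto simp: indicator_def\<close>)
    qed
    \<comment> \<open>\<open>Hdiv0\<close> quantifies over every weak divergence \<open>gg\<close>;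
      tested with \<open>\<phi>\<close>, each of them agrees with the piecewise one.\<close>
    also have "\<dots> = (LINT x:simplex_hull v|lebesgue. dv u x \<bullet> \<phi> x)"
      by (rule weak_div_local[OF subset_refl hull_lebesgue _ _ gg \<phi>, of u]) (auto simp: bv_L2[OF asm_bv])
    finally have "(LINT x:simplex_hull v|lebesgue. gg x \<bullet> \<phi> x) = (LINT x:simplex_hull v|lebesgue. dv u x \<bullet> \<phi> x)" .
    then show "(LINT x:simplex_hull v|lebesgue. asm (field u) x \<bullet> jacobian \<phi> (at x) + gg x \<bullet> \<phi> x) = 0"
      using set_integral_add(2)[OF I G] gauss_asm_zero[OF \<phi>, of u] zf by simp
  qed
qed

text \<open>Forwards by \<open>kernel\<close>. Backwards, the exponents in \<open>IBB\<close>
  contain both ends of the edge, so on each facet either the monomial or the coefficient of the edge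
  vanishes.\<close>

lemma zero_trace_iff:
  "(\<forall>l\<le>CARD('n). \<forall>x\<in>ri l. field u l x *v grad l = 0) \<longleftrightarrow> (\<forall>z\<in>(IB \<union> IP) - IBB. u z = 0)"
proof
  assume "\<forall>l\<le>CARD('n). \<forall>x\<in>ri l. field u l x *v grad l = 0"
  then have tr0: "tr i b (field u) x = 0" if "i \<le> CARD('n)" "b \<le> CARD('n)" "i \<noteq> b" "x \<in> ri i" for i b x
    using that by (simp add: tr_def)
  have k1: "u z = 0" if "z \<in> IP" for z
    by (rule kernel(1)[OF _ that]) (rule tr0)
  have k2: "u (Inl (p, \<alpha>)) = 0"
    if "p \<in> pairs" "\<alpha> \<in> MI {..CARD('n)} k" "\<alpha> (fst p) = 0 \<or> \<alpha> (snd p) = 0" for p \<alpha>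
    by (rule kernel(2)[OF _ that]) (rule tr0)
  show "\<forall>z\<in>(IB \<union> IP) - IBB. u z = 0"
  proof
    fix z assume z: "z \<in> (IB \<union> IP) - IBB"
    show "u z = 0"
    proof (cases "z \<in> IP")
      case False
      then obtain p \<alpha> where p: "z = Inl (p, \<alpha>)" "p \<in> pairs" "\<alpha> \<in> MI {..CARD('n)} k" using z by (auto simp: IB_def)
      then have "\<alpha> (fst p) = 0 \<or> \<alpha> (snd p) = 0" using z by (auto simp: IBB_def image_iff)
      then show ?thesis using k2[OF p(2,3)] p(1) by simp
    qed (rule k1)
  qed
next
  assume u: "\<forall>z\<in>(IB \<union> IP) - IBB. u z = 0"
  show "\<forall>l\<le>CARD('n). \<forall>x\<in>ri l. field u l x *v grad l = 0"
  proof (intro allI impI ballI)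
    fix i x assume i: "i \<le> CARD('n)" and x: "x \<in> ri i"
    have "u z * tr i b (gen z) x = 0" if b: "b \<le> CARD('n)" "b \<noteq> i" and z: "z \<in> IB \<union> IP" for b z
    proof (cases "z \<in> IBB")
      case True
      then obtain p \<alpha> where p: "z = Inl (p, \<alpha>)" "p \<in> pairs" "\<alpha> (fst p) \<noteq> 0" "\<alpha> (snd p) \<noteq> 0" by (auto simp: IBB_def)
      then have "{fst p, snd p} = {i, b} \<Longrightarrow> \<alpha> i \<noteq> 0" by (auto simp: doubleton_eq_iff)
      then show ?thesis using p tr_gen_Inl[OF p(2) i b(1), of \<alpha> x] b(2) facet_mono_zero[OF _ i, of x \<alpha>] x
        by (auto simp: ri_def)
    qed (use u z in auto)
    then have "tr i b (field u) x = 0" if "b \<le> CARD('n)" "b \<noteq> i" for b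
      unfolding tr_field using that by (intro sum.neutral) auto
    then show "field u i x *v grad i = 0"
      by (intro grad_eqI[OF i]) (auto simp: tr_def)
  qed
qed

text \<open>Polynomial fields are those without bubble coefficients; among them
  \<open>Hdiv0_iff\<close> and \<open>zero_trace_iff\<close> leave exactly the coefficients in
  \<open>IBB\<close>.\<close>

lemma bubble_div_eq: "bubble_div v k = span (g ` IBB)"
proof -
  have fin: "finite IBB" using finite_subset[OF IBB_sub finite_IB] .
  have ext: "(\<Sum>z\<in>S. c z *\<^sub>R g z) = asm (field (\<lambda>z. if z \<in> S then c z else 0))" if "S \<subseteq> IB \<union> IP" for S c
  proof -
    have "(\<Sum>z\<in>S. c z *\<^sub>R g z) = (\<Sum>z\<in>IB \<union> IP. (if z \<in> S then c z else 0) *\<^sub>R g z)"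
      by (rule sum.mono_neutral_cong_left[OF finite_Z that]) auto
    then show ?thesis by (simp only: asm_field)
  qed
  show ?thesis
  proof (intro equalityI subsetI)
    fix \<sigma> assume "\<sigma> \<in> bubble_div v k"
    then have s: "\<sigma> \<in> Hdiv0 (simplex_hull v)" "\<sigma> \<in> span (g ` IB)" by (auto simp: bubble_div_def poly_sym_IB)
    then obtain c where c: "\<sigma> = (\<Sum>z\<in>IB. c z *\<^sub>R g z)" unfolding span_image_finite[OF finite_IB] by blast
    define u where "u z = (if z \<in> IB then c z else 0)" for z
    have \<sigma>: "\<sigma> = asm (field u)" unfolding c u_def by (rule ext) auto
    then have "\<forall>z\<in>(IB \<union> IP) - IBB. u z = 0" using s(1) Hdiv0_iff zero_trace_iff by blast
    then have "(\<Sum>z\<in>IB \<union> IP. u z *\<^sub>R g z) = (\<Sum>z\<in>IBB. u z *\<^sub>R g z)"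
      by (intro sum.mono_neutral_right[OF finite_Z]) (use IBB_sub in auto)
    then show "\<sigma> \<in> span (g ` IBB)" unfolding \<sigma> asm_field by (auto intro!: span_sum span_scale intro: span_base)
  next
    fix \<sigma> assume s: "\<sigma> \<in> span (g ` IBB)"
    then obtain c where c: "\<sigma> = (\<Sum>z\<in>IBB. c z *\<^sub>R g z)" unfolding span_image_finite[OF fin] by blast
    define u where "u z = (if z \<in> IBB then c z else 0)" for z
    have \<sigma>: "\<sigma> = asm (field u)" unfolding c u_def by (rule ext) (use IBB_sub in auto)
    have "\<forall>z\<in>(IB \<union> IP) - IBB. u z = 0" by (simp add: u_def)
    then have "\<sigma> \<in> Hdiv0 (simplex_hull v)" unfolding \<sigma> using Hdiv0_iff zero_trace_iff by blast
    moreover have "\<sigma> \<in> poly_sym v k" unfolding poly_sym_IB using s span_mono[OF image_mono[OF IBB_sub], of g] by blast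
    ultimately show "\<sigma> \<in> bubble_div v k" by (simp add: bubble_div_def)
  qed
qed

end

section \<open>The mesh\<close>

text \<open>The coordinate of vertex i is 1 + f (x - v i), where f is linear and equal to -1 on the
  independent edges at \<open>v i\<close>.\<close>

lemma nsimplexI:
  fixes v :: "nat \<Rightarrow> real^'n"
  assumes inj: "inj_on v {..CARD('n)}" and ind: "\<not> affine_dependent (v ` {..CARD('n)})"
  shows "nsimplex v"
proof
  fix i assume i: "i \<le> CARD('n)"
  let ?B = "(\<lambda>x. - v i + x) ` (v ` {..CARD('n)} - {v i})"
  have "independent ?B"
    using ind i affine_dependent_iff_dependent2[of "v i" "v ` {..CARD('n)}"] by auto
  then obtain f :: "real^'n \<Rightarrow> real" where f: "linear f" "\<forall>x\<in>?B. f x = -1"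
    using linear_independent_extend[of ?B "\<lambda>_. -1"] by blast
  have "affine_fun (\<lambda>x. 1 + f (x - v i))"
  proof (rule affine_funI)
    show "1 + f (x - v i) = adjoint f 1 \<bullet> x + (1 - f (v i))" for x
      using adjoint_works[OF f(1), of x 1] by (simp add: linear_diff[OF f(1)] inner_commute)
  qed
  moreover have "1 + f (v j - v i) = (if j = i then 1 else 0)" if "j \<le> CARD('n)" for j
  proof (cases "j = i")
    case True
    then show ?thesis by (simp add: linear_0[OF f(1)])
  next
    case False
    then have "v j \<noteq> v i" using inj that i by (auto dest: inj_onD)
    then have "- v i + v j \<in> ?B" using that by blast
    then have "f (- v i + v j) = -1" using f(2) by blast
    then show ?thesis using False by simp
  qed
  ultimately show "\<exists>g. affine_fun g \<and> (\<forall>j\<le>CARD('n). g (v j) = (if j = i then 1 else 0))" by blast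
qed

context nsimplex
begin

lemma hull_face:
  assumes J: "J \<subseteq> {..CARD('n)}"
  shows "convex hull (v ` J) = {x \<in> simplex_hull v. \<forall>j\<le>CARD('n). j \<notin> J \<longrightarrow> bary v j x = 0}"
proof
  have "convex {x \<in> simplex_hull v. \<forall>j\<le>CARD('n). j \<notin> J \<longrightarrow> bary v j x = 0}"
    unfolding hull_eq by (rule convexI) (auto simp: bary_affine_combination)
  then show "convex hull (v ` J) \<subseteq> {x \<in> simplex_hull v. \<forall>j\<le>CARD('n). j \<notin> J \<longrightarrow> bary v j x = 0}"
    using J by (intro hull_minimal) (auto simp: bary_vertex vertex_in_hull)
  show "{x \<in> simplex_hull v. \<forall>j\<le>CARD('n). j \<notin> J \<longrightarrow> bary v j x = 0} \<subseteq> convex hull (v ` J)"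
  proof clarify
    fix x assume x: "x \<in> simplex_hull v" "\<forall>j\<le>CARD('n). j \<notin> J \<longrightarrow> bary v j x = 0"
    have fin: "finite J" using J finite_subset by blast
    have s: "(\<Sum>j\<in>J. f j) = (\<Sum>j\<le>CARD('n). f j)" if "\<And>j. j \<le> CARD('n) \<Longrightarrow> j \<notin> J \<Longrightarrow> f j = 0" for f :: "nat \<Rightarrow> 'x::comm_monoid_add"
      by (rule sum.mono_neutral_left) (use J that in auto)
    have "(\<Sum>j\<in>J. bary v j x *\<^sub>R v j) \<in> convex hull (v ` J)"
    proof (rule convex_sum[OF fin convex_convex_hull])
      show "(\<Sum>j\<in>J. bary v j x) = 1" using s[of "\<lambda>j. bary v j x"] x sum_bary by simp
      show "0 \<le> bary v j x" if "j \<in> J" for j using x that J by (auto simp: hull_eq)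
      show "v j \<in> convex hull (v ` J)" if "j \<in> J" for j using that by (intro hull_inc) auto
    qed
    moreover have "(\<Sum>j\<in>J. bary v j x *\<^sub>R v j) = x"
      using s[of "\<lambda>j. bary v j x *\<^sub>R v j"] x bary_expand[of x] by simp
    ultimately show "x \<in> convex hull (v ` J)" by simp
  qed
qed

lemma facet_hull: "i \<le> CARD('n) \<Longrightarrow> facet i = convex hull (v ` ({..CARD('n)} - {i}))"
  by (subst hull_face) (auto simp: facet_def hull_eq)

lemma facet_vertex: "i \<le> CARD('n) \<Longrightarrow> j \<le> CARD('n) \<Longrightarrow> j \<noteq> i \<Longrightarrow> v j \<in> facet i"
  by (auto simp: facet_def bary_vertex)

text \<open>Affine interpolation at the vertices, all of which except \<open>v i\<close> lie on the
  facet. This makes the coordinates of neighbours multiples of \<open>bary v i\<close> and unit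
  normals multiples of its gradient.\<close>

lemma bary_facet_scale:
  assumes "i \<le> CARD('n)" "affine_fun h" "\<And>y. y \<in> facet i \<Longrightarrow> h y = 0"
  shows "h y = h (v i) * bary v i y"
proof -
  have "h y = (\<Sum>j\<le>CARD('n). bary v j y * h (v j))" by (rule affine_expand[OF assms(2)])
  also have "\<dots> = (\<Sum>j\<le>CARD('n). if j = i then bary v i y * h (v i) else 0)"
    by (rule sum.cong) (use facet_vertex[OF assms(1)] assms(3) in auto)
  finally show ?thesis using assms(1) by simp
qed

lemma facet_inj: "i \<le> CARD('n) \<Longrightarrow> j \<le> CARD('n) \<Longrightarrow> facet i = facet j \<Longrightarrow> i = j"
proof (rule ccontr)
  assume "i \<le> CARD('n)" "j \<le> CARD('n)" "facet i = facet j" "i \<noteq> j"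
  then have "v i \<in> facet i" using facet_vertex[of j i] by simp
  then show False using \<open>i \<le> CARD('n)\<close> by (simp add: facet_def bary_vertex)
qed

lemma open_pos_others: "open {y. \<forall>j\<le>CARD('n). j \<noteq> i \<longrightarrow> 0 < bary v j y}"
proof -
  have "{y. \<forall>j\<le>CARD('n). j \<noteq> i \<longrightarrow> 0 < bary v j y} = (\<Inter>j\<in>{..CARD('n)} - {i}. {y. 0 < bary v j y})" by auto
  then show ?thesis
    by (auto intro!: open_INT open_Collect_less continuous_on_const bary_continuous)
qed

text \<open>At x coordinate i is 0 and the others are positive, so near x it is still the smallest,
  and the smallest coordinate names the piece.\<close>

lemma near_piece:
  assumes i: "i \<le> CARD('n)" and x: "x \<in> ri i"
  shows "\<exists>e>0. \<forall>y\<in>ball x e. y \<in> split_interior v \<longrightarrow> y \<in> interior (subT v i)"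
proof -
  have "open {y. \<forall>j\<in>{..CARD('n)} - {i}. bary v i y < bary v j y}"
  proof -
    have "{y. \<forall>j\<in>{..CARD('n)} - {i}. bary v i y < bary v j y} = (\<Inter>j\<in>{..CARD('n)} - {i}. {y. bary v i y < bary v j y})" by auto
    then show ?thesis
      by (auto intro!: open_INT open_Collect_less bary_continuous i)
  qed
  moreover have "x \<in> {y. \<forall>j\<in>{..CARD('n)} - {i}. bary v i y < bary v j y}" using x by (auto simp: ri_def)
  ultimately obtain e where e: "e > 0" "ball x e \<subseteq> {y. \<forall>j\<in>{..CARD('n)} - {i}. bary v i y < bary v j y}"
    using openE by blast
  have "y \<in> interior (subT v i)" if y: "y \<in> ball x e" "y \<in> split_interior v" for y
  proof -
    obtain l where l: "l \<le> CARD('n)" "y \<in> interior (subT v l)" using y(2) by (auto simp: split_interior_def)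
    have "l = i"
    proof (rule ccontr)
      assume "l \<noteq> i"
      then have "bary v i y < bary v l y" using e(2) y(1) l(1) by auto
      moreover have "bary v l y < bary v i y" using l i \<open>l \<noteq> i\<close> by (auto simp: sub_interior)
      ultimately show False by simp
    qed
    then show ?thesis using l by simp
  qed
  then show ?thesis using e(1) by blast
qed

end

section \<open>Neighbouring cells and one-sided traces\<close>

locale mesh =
  fixes \<Omega> :: "(real^('n::finite)) set" and \<T> :: "(real^'n) set set"
    and v :: "(real^'n) set \<Rightarrow> nat \<Rightarrow> real^'n" and base :: "(real^'n) set \<Rightarrow> nat set \<Rightarrow> nat"
    and n :: "(real^'n) set \<Rightarrow> real^'n" and k :: nat
  assumes d: "CARD('n) \<ge> 2" and k: "k \<ge> 2"
    and domain: "polyhedral_domain \<Omega>"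
    and mesh: "triangulates \<T> \<Omega>"
    and vertices: "\<forall>T\<in>\<T>. bij_betw (v T) {..CARD('n)} {x. x extreme_point_of T}"
    and base: "\<forall>T\<in>\<T>. \<forall>f. f \<subseteq> {..CARD('n)} \<and> f \<noteq> {} \<longrightarrow> base T f \<in> f"
    and normals: "\<forall>F\<in>mesh_facets \<T>. unit_normal F (n F)"
begin

abbreviation "Gr T \<equiv> nsimplex.grad (v T)"
abbreviation "RI T \<equiv> nsimplex.ri (v T)"
abbreviation "FC T \<equiv> nsimplex.facet (v T)"

lemma Omega: "open \<Omega>" "interior (closure \<Omega>) = \<Omega>" "\<Union>\<T> = closure \<Omega>" "finite \<T>"
  using domain mesh by (auto simp: polyhedral_domain_def triangulates_def triangulation_def)

lemma cell:
  assumes T: "T \<in> \<T>"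
  shows "element (v T) (base T) k" "simplex_hull (v T) = T" "\<not> affine_dependent (v T ` {..CARD('n)})"
    "inj_on (v T) {..CARD('n)}"
proof -
  have "int CARD('n) simplex T" using mesh T by (simp add: triangulates_def)
  then obtain C where C: "\<not> affine_dependent C" "T = convex hull C" unfolding simplex_def by blast
  have "{x. x extreme_point_of T} = C"
    using extreme_point_of_convex_hull_affine_independent[OF C(1)] C(2) by auto
  then have vC: "v T ` {..CARD('n)} = C" and i: "inj_on (v T) {..CARD('n)}"
    using vertices T by (auto simp: bij_betw_def)
  show "simplex_hull (v T) = T" by (simp only: simplex_hull_def vC C(2)[symmetric])
  show a: "\<not> affine_dependent (v T ` {..CARD('n)})" using C vC by simp
  show "inj_on (v T) {..CARD('n)}" by (rule i)
  show "element (v T) (base T) k"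
    by (intro element.intro element_axioms.intro nsimplexI i a) (use base T d k in auto)
qed

lemma nsimp: "T \<in> \<T> \<Longrightarrow> nsimplex (v T)"
  using cell(1) element.axioms(1) by blast

lemma cell_face: "T \<in> \<T> \<Longrightarrow> T' \<in> \<T> \<Longrightarrow> T \<inter> T' face_of T"
  using mesh by (simp add: triangulates_def triangulation_def)

lemma cell_subset: "T \<in> \<T> \<Longrightarrow> T \<subseteq> closure \<Omega>"
  using Omega(3) by blast

lemma cell_interior: "T \<in> \<T> \<Longrightarrow> interior T \<subseteq> \<Omega>"
  using cell_subset interior_mono Omega(2) by metis

lemma cell_dim: "T \<in> \<T> \<Longrightarrow> aff_dim T = int CARD('n)"
  using mesh by (auto simp: triangulates_def intro: aff_dim_simplex)

lemma cell_convex: "T \<in> \<T> \<Longrightarrow> convex T"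
  using cell(2) by (metis convex_convex_hull simplex_hull_def)

lemma cell_closed: "T \<in> \<T> \<Longrightarrow> closed T"
  using cell(2) nsimplex.hull_closed[OF nsimp] by metis

lemma cell_face_neq: assumes "T \<in> \<T>" "T' \<in> \<T>" "T \<noteq> T'" shows "T \<inter> T' \<noteq> T"
proof
  assume e: "T \<inter> T' = T"
  then have "T face_of T'" using cell_face[OF assms(2,1)] by (simp add: Int_commute)
  then have "aff_dim T < aff_dim T'" using face_of_aff_dim_lt[OF cell_convex[OF assms(2)]] assms(3) by blast
  then show False using cell_dim assms by simp
qed

lemma interior_disjoint:
  assumes "T \<in> \<T>" "T' \<in> \<T>" "T \<noteq> T'" "x \<in> interior T" shows "x \<notin> T'"
  using face_of_disjoint_interior[OF cell_face[OF assms(1,2)] cell_face_neq[OF assms(1-3)]] assms(4)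
    interior_subset by blast

lemma face_index:
  assumes T: "T \<in> \<T>" and U: "U face_of T"
  shows "\<exists>J\<subseteq>{..CARD('n)}. U = convex hull (v T ` J)"
proof -
  have "U face_of convex hull (v T ` {..CARD('n)})" using U cell(2)[OF T] by (simp add: simplex_hull_def)
  then obtain c where c: "c \<subseteq> v T ` {..CARD('n)}" "U = convex hull c"
    using face_of_convex_hull_affine_independent[OF cell(3)[OF T]] by blast
  then obtain J where "J \<subseteq> {..CARD('n)}" "c = v T ` J" by (meson subset_imageE)
  then show ?thesis using c by blast
qed

lemma ri_in_cell: "T \<in> \<T> \<Longrightarrow> i \<le> CARD('n) \<Longrightarrow> x \<in> RI T i \<Longrightarrow> x \<in> T"
  using nsimplex.ri_subset[OF nsimp] nsimplex.facet_subset[OF nsimp] cell(2) by fastforce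

text \<open>Conformity makes the intersection a face of both cells. It contains a point with a
  single vanishing coordinate, hence all vertices of T but the i-th, and it is not all of T; so it
  is facet i. Its hull determines its vertices, of which T' therefore also has exactly d.\<close>

lemma shared_facet:
  assumes T: "T \<in> \<T>" "T' \<in> \<T>" "T \<noteq> T'" and i: "i \<le> CARD('n)" and x: "x \<in> RI T i" "x \<in> T'"
  obtains i' where "i' \<le> CARD('n)" "FC T' i' = FC T i" "x \<in> RI T' i'"
proof -
  interpret S: nsimplex "v T" by (rule nsimp[OF T(1)])
  interpret S': nsimplex "v T'" by (rule nsimp[OF T(2)])
  have xT: "x \<in> T" by (rule ri_in_cell[OF T(1) i x(1)])
  obtain J where J: "J \<subseteq> {..CARD('n)}" "T \<inter> T' = convex hull (v T ` J)"
    using face_index[OF T(1) cell_face[OF T(1,2)]] by blast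
  have J1: "{..CARD('n)} - {i} \<subseteq> J"
  proof
    fix j assume j: "j \<in> {..CARD('n)} - {i}"
    then have "0 < bary (v T) j x" using x(1) by (auto simp: S.ri_def)
    moreover have "x \<in> convex hull (v T ` J)" using xT x(2) J by blast
    ultimately show "j \<in> J" using j unfolding S.hull_face[OF J(1)] by force
  qed
  have "i \<notin> J"
  proof
    assume "i \<in> J"
    then have "J = {..CARD('n)}" using J(1) J1 by blast
    then have "T \<inter> T' = T" using J(2) cell(2)[OF T(1)] by (simp add: simplex_hull_def)
    then show False using cell_face_neq[OF T] by blast
  qed
  then have Jeq: "J = {..CARD('n)} - {i}" using J(1) J1 by blast
  have F: "T \<inter> T' = FC T i" using J(2) Jeq S.facet_hull[OF i] by simp
  obtain J' where J': "J' \<subseteq> {..CARD('n)}" "T \<inter> T' = convex hull (v T' ` J')"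
    using face_index[OF T(2) cell_face[OF T(2,1)]] by (auto simp: Int_commute)
  have "v T ` J = v T' ` J'"
  proof -
    have "\<not> affine_dependent (v T ` J)" "\<not> affine_dependent (v T' ` J')"
      using affine_independent_subset[OF cell(3)[OF T(1)]] affine_independent_subset[OF cell(3)[OF T(2)]] J(1) J'(1)
      by (meson image_mono)+
    then show ?thesis
      using extreme_point_of_convex_hull_affine_independent J(2) J'(2) by (metis (no_types, lifting) subsetI subset_antisym)
  qed
  then have "card J' = card J"
    using card_image[OF inj_on_subset[OF cell(4)[OF T(1)] J(1)]] card_image[OF inj_on_subset[OF cell(4)[OF T(2)] J'(1)]]
    by simp
  also have "card J = CARD('n)" using Jeq i by simp
  finally have cJ: "card J' = CARD('n)" .
  have "J' \<noteq> {..CARD('n)}" using cJ by auto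
  then obtain i' where i': "i' \<le> CARD('n)" "i' \<notin> J'" using J'(1) by blast
  have "J' = {..CARD('n)} - {i'}"
  proof (rule card_subset_eq)
    show "J' \<subseteq> {..CARD('n)} - {i'}" using J'(1) i' by blast
    show "card J' = card ({..CARD('n)} - {i'})" using cJ i' by simp
  qed simp
  then have F': "FC T' i' = FC T i" using J'(2) S'.facet_hull[OF i'(1)] F by simp
  have xF: "x \<in> FC T' i'" using xT x(2) F F' by blast
  have "x \<in> RI T' i'"
    unfolding S'.ri_def
  proof (intro CollectI conjI allI impI)
    show "bary (v T') i' x = 0" using xF by (simp add: S'.facet_def)
    fix j assume j: "j \<le> CARD('n)" "j \<noteq> i'"
    have vF: "v T m \<in> T'" if "m \<le> CARD('n)" "m \<noteq> i" for m using S.facet_vertex[OF i that] F by blast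
    have "v T' j \<in> v T ` J" using \<open>v T ` J = v T' ` J'\<close> \<open>J' = {..CARD('n)} - {i'}\<close> j by auto
    then obtain m where m: "m \<le> CARD('n)" "m \<noteq> i" "v T' j = v T m" using Jeq by auto
    \<comment> \<open>Positivity survives the change of cell: the coordinate is affine, nonnegative
      at the shared vertices and 1 at one of them, and x has positive weight at each.\<close>
    have "bary (v T') j x = (\<Sum>l\<le>CARD('n). bary (v T) l x * bary (v T') j (v T l))"
      by (rule S.affine_expand[OF S'.bary_affine[OF j(1)]])
    also have "\<dots> > 0"
    proof (rule sum_pos2)
      show "0 < bary (v T) m x * bary (v T') j (v T m)"
        using m x(1) j by (simp add: S.ri_def m(3)[symmetric] S'.bary_vertex)
      show "0 \<le> bary (v T) l x * bary (v T') j (v T l)" if "l \<in> {..CARD('n)}" for l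
      proof (cases "l = i")
        case True
        then show ?thesis using x(1) by (simp add: S.ri_def)
      next
        case False
        then have "0 \<le> bary (v T') j (v T l)" using vF[of l] that j(1) cell(2)[OF T(2)] S'.hull_eq by auto
        moreover have "0 < bary (v T) l x" using False that x(1) by (simp add: S.ri_def)
        ultimately show ?thesis by simp
      qed
    qed (use m in auto)
    finally show "0 < bary (v T') j x" .
  qed
  then show ?thesis using that i'(1) F' by blast
qed

text \<open>Both coordinates vanish on the common facet, so they are proportional. Were the factor
  positive, a small step from the facet towards \<open>v T i\<close> would stay in T and enter the
  interior of T'.\<close>

lemma opposite:
  assumes T: "T \<in> \<T>" "T' \<in> \<T>" "T \<noteq> T'" and i: "i \<le> CARD('n)" "i' \<le> CARD('n)" and F: "FC T' i' = FC T i"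
  obtains c where "c < 0" "\<And>y. bary (v T') i' y = c * bary (v T) i y" "Gr T' i' = c *\<^sub>R Gr T i"
proof -
  interpret S: nsimplex "v T" by (rule nsimp[OF T(1)])
  interpret S': nsimplex "v T'" by (rule nsimp[OF T(2)])
  define c where "c = bary (v T') i' (v T i)"
  have c: "bary (v T') i' y = c * bary (v T) i y" for y
    unfolding c_def
    by (rule S.bary_facet_scale[OF i(1) S'.bary_affine[OF i(2)]]) (auto simp: F[symmetric] S'.facet_def)
  have "Gr T' i' = c *\<^sub>R Gr T i"
    by (simp add: S'.grad_def S.grad_def vec_eq_iff c right_diff_distrib)
  moreover have "c < 0"
  proof (rule ccontr)
    assume "\<not> c < 0"
    moreover have "c \<noteq> 0" using c[of "v T' i'"] S'.bary_vertex[of i' i'] i by auto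
    ultimately have cpos: "0 < c" by simp
    obtain x where x: "x \<in> RI T i" using S.ri_nonempty[OF i(1)] by blast
    have "x \<in> FC T' i'" using S.ri_subset[OF i(1)] x F by blast
    then have "x \<in> T'" using S'.facet_subset cell(2)[OF T(2)] by blast
    obtain i'' where i'': "i'' \<le> CARD('n)" "FC T' i'' = FC T i" "x \<in> RI T' i''"
      by (rule shared_facet[OF T i(1) x \<open>x \<in> T'\<close>])
    have "i'' = i'" using S'.facet_inj[OF i''(1) i(2)] i''(2) F by simp
    then have "x \<in> {y. \<forall>j\<le>CARD('n). j \<noteq> i' \<longrightarrow> 0 < bary (v T') j y}" using i''(3) by (auto simp: S'.ri_def)
    then obtain e where e: "e > 0" "ball x e \<subseteq> {y. \<forall>j\<le>CARD('n). j \<noteq> i' \<longrightarrow> 0 < bary (v T') j y}"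
      using S'.open_pos_others openE by blast
    \<comment> \<open>Small enough for a step shorter than e, and at most 1 so that y stays in T by
      convexity.\<close>
    define s where "s = min 1 (e / (2 * (norm (v T i - x) + 1)))"
    define y where "y = x + s *\<^sub>R (v T i - x)"
    have s: "0 < s" "s \<le> 1" using e(1) by (auto simp: s_def add_nonneg_pos)
    have "s * norm (v T i - x) \<le> e / (2 * (norm (v T i - x) + 1)) * norm (v T i - x)"
      unfolding s_def by (intro mult_right_mono) auto
    also have "\<dots> = e / 2 * (norm (v T i - x) / (norm (v T i - x) + 1))" by simp
    also have "\<dots> \<le> e / 2 * 1"
      using e(1) by (intro mult_left_mono) (simp_all add: divide_le_eq_1 add_nonneg_pos)
    finally have "dist x y < e" using e(1) s by (simp add: y_def dist_norm)
    then have p: "0 < bary (v T') j y" if "j \<le> CARD('n)" "j \<noteq> i'" for j using e(2) that by auto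
    have bry: "bary (v T) j y = (1 - s) * bary (v T) j x + s * (if i = j then 1 else 0)" if "j \<le> CARD('n)" for j
    proof -
      have gi: "Gr T j \<bullet> (v T i - x) = (if i = j then 1 else 0) - bary (v T) j x"
        using S.bary_diff[OF that, of "v T i" "v T i - x"] S.bary_vertex[OF that i(1)] by simp
      have "bary (v T) j y = bary (v T) j x + s * (Gr T j \<bullet> (v T i - x))"
        unfolding y_def S.bary_add[OF that] by simp
      then show ?thesis unfolding gi by (simp add: algebra_simps)
    qed
    have bi: "bary (v T) i y = s" using bry[OF i(1)] x by (simp add: S.ri_def)
    have "y \<in> T"
    proof -
      have "0 \<le> bary (v T) j y" if "j \<le> CARD('n)" for j
      proof -
        have "0 \<le> bary (v T) j x" using ri_in_cell[OF T(1) i(1) x] cell(2)[OF T(1)] S.hull_eq that by auto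
        then show ?thesis unfolding bry[OF that] using s by simp
      qed
      then show ?thesis using cell(2)[OF T(1)] S.hull_eq by auto
    qed
    have "0 < bary (v T') i' y" using c[of y] bi cpos s by simp
    then have "0 < bary (v T') j y" if "j \<le> CARD('n)" for j using p[OF that] by (cases "j = i'") auto
    then have "y \<in> interior T'" using S'.interior_eq cell(2)[OF T(2)] by auto
    then show False using interior_disjoint[OF T(2,1)] T(3) \<open>y \<in> T\<close> by blast
  qed
  ultimately show ?thesis using that c by blast
qed

text \<open>Three cells at one facet would lie pairwise on opposite sides of it: the factors would
  satisfy c' = c'' c with all three negative.\<close>

lemma partner_unique:
  assumes T: "T \<in> \<T>" "T' \<in> \<T>" "T'' \<in> \<T>" and i: "i \<le> CARD('n)" "i' \<le> CARD('n)" "i'' \<le> CARD('n)"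
    and F: "FC T' i' = FC T i" "FC T'' i'' = FC T i" and ne: "T \<noteq> T'" "T \<noteq> T''"
  shows "T' = T''"
proof (rule ccontr)
  assume "T' \<noteq> T''"
  interpret S: nsimplex "v T" by (rule nsimp[OF T(1)])
  obtain c where c: "c < 0" "\<And>y. bary (v T') i' y = c * bary (v T) i y"
    by (rule opposite[OF T(1,2) ne(1) i(1,2) F(1)]) (rule that)
  obtain c' where c': "c' < 0" "\<And>y. bary (v T'') i'' y = c' * bary (v T) i y"
    by (rule opposite[OF T(1,3) ne(2) i(1,3) F(2)]) (rule that)
  obtain c'' where c'': "c'' < 0" "\<And>y. bary (v T'') i'' y = c'' * bary (v T') i' y"
    by (rule opposite[OF T(2,3) \<open>T' \<noteq> T''\<close> i(2,3) trans[OF F(2) F(1)[symmetric]]]) (rule that)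
  have "c' * bary (v T) i (v T i) = c'' * (c * bary (v T) i (v T i))" using c c' c'' by metis
  then have "c' = c'' * c" using S.bary_vertex[OF i(1) i(1)] by simp
  moreover have "0 < c'' * c" using c(1) c''(1) by (simp add: mult_neg_neg)
  ultimately show False using c'(1) by simp
qed

text \<open>Leaving T through x by small steps inside \<Omega> ends in other cells; these are
  finitely many closed sets, so x lies in one. Conversely T and T' together fill a neighbourhood of
  x, and \<Omega> is the interior of its closure.\<close>

lemma ri_interior_iff:
  assumes T: "T \<in> \<T>" and i: "i \<le> CARD('n)" and x: "x \<in> RI T i"
  shows "x \<in> \<Omega> \<longleftrightarrow> (\<exists>T'\<in>\<T>. T' \<noteq> T \<and> x \<in> T')"
proof
  interpret S: nsimplex "v T" by (rule nsimp[OF T])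
  assume "x \<in> \<Omega>"
  then obtain e where e: "e > 0" "ball x e \<subseteq> \<Omega>" using Omega(1) openE by blast
  have cl: "closed (\<Union>(\<T> - {T}))" using Omega(4) cell_closed by (intro closed_Union) auto
  \<comment> \<open>Points beyond the facet, away from \<open>v T i\<close>: they lie outside T and
    converge to x.\<close>
  define s where "s m = x - (1 / real (Suc m)) *\<^sub>R (v T i - x)" for m
  have lim: "s \<longlonglongrightarrow> x"
  proof -
    have "(\<lambda>m. x - (1 / real (Suc m)) *\<^sub>R (v T i - x)) \<longlonglongrightarrow> x - 0 *\<^sub>R (v T i - x)"
      by (intro tendsto_intros LIMSEQ_Suc[OF lim_1_over_n])
    then show ?thesis by (simp add: s_def[abs_def])
  qed
  have "s m \<notin> T" for m
  proof -
    have "Gr T i \<bullet> (v T i - x) = 1"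
      using S.bary_diff[OF i, of "v T i" "v T i - x"] S.bary_vertex[OF i i] x by (simp add: S.ri_def)
    then have "bary (v T) i (s m) = - (1 / real (Suc m))"
      unfolding s_def S.bary_diff[OF i] using x by (simp add: S.ri_def)
    then have "bary (v T) i (s m) < 0" by simp
    then show ?thesis using S.hull_eq cell(2)[OF T] i by force
  qed
  moreover have "\<forall>\<^sub>F m in sequentially. s m \<in> ball x e"
    using topological_tendstoD[OF lim open_ball] e(1) by simp
  ultimately have "\<forall>\<^sub>F m in sequentially. s m \<in> \<Union>(\<T> - {T})"
  proof -
    assume a: "\<And>m. s m \<notin> T" and b: "\<forall>\<^sub>F m in sequentially. s m \<in> ball x e"
    show ?thesis
      using b
    proof eventually_elim
      case (elim m)
      then have "s m \<in> \<Union>\<T>" using e(2) Omega(3) closure_subset by blast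
      then show ?case using a by blast
    qed
  qed
  then have "x \<in> \<Union>(\<T> - {T})" by (rule Lim_in_closed_set[OF cl _ sequentially_bot lim])
  then show "\<exists>T'\<in>\<T>. T' \<noteq> T \<and> x \<in> T'" by blast
next
  assume "\<exists>T'\<in>\<T>. T' \<noteq> T \<and> x \<in> T'"
  then obtain T' where T': "T' \<in> \<T>" "T \<noteq> T'" "x \<in> T'" by blast
  interpret S: nsimplex "v T" by (rule nsimp[OF T])
  interpret S': nsimplex "v T'" by (rule nsimp[OF T'(1)])
  obtain i' where i': "i' \<le> CARD('n)" "FC T' i' = FC T i" "x \<in> RI T' i'"
    by (rule shared_facet[OF T T'(1,2) i x T'(3)])
  obtain c where c: "c < 0" "\<And>y. bary (v T') i' y = c * bary (v T) i y"
    by (rule opposite[OF T T'(1,2) i i'(1,2)]) (rule that)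
  let ?U = "{y. \<forall>j\<le>CARD('n). j \<noteq> i \<longrightarrow> 0 < bary (v T) j y} \<inter> {y. \<forall>j\<le>CARD('n). j \<noteq> i' \<longrightarrow> 0 < bary (v T') j y}"
  have "open ?U" using S.open_pos_others S'.open_pos_others by (intro open_Int)
  moreover have "x \<in> ?U" using x i'(3) by (auto simp: S.ri_def S'.ri_def)
  moreover have "?U \<subseteq> closure \<Omega>"
  proof
    fix y assume y: "y \<in> ?U"
    show "y \<in> closure \<Omega>"
    proof (cases "0 \<le> bary (v T) i y")
      case True
      then have "0 \<le> bary (v T) j y" if "j \<le> CARD('n)" for j using y that by (cases "j = i") (auto simp: less_imp_le)
      then have "y \<in> T" using S.hull_eq cell(2)[OF T] by auto
      then show ?thesis using cell_subset[OF T] by blast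
    next
      case False
      then have "0 \<le> bary (v T') i' y" using c by (simp add: mult_nonpos_nonpos)
      then have "0 \<le> bary (v T') j y" if "j \<le> CARD('n)" for j using y that by (cases "j = i'") (auto simp: less_imp_le)
      then have "y \<in> T'" using S'.hull_eq cell(2)[OF T'(1)] by auto
      then show ?thesis using cell_subset[OF T'(1)] by blast
    qed
  qed
  ultimately have "x \<in> interior (closure \<Omega>)" by (meson interior_maximal subsetD)
  then show "x \<in> \<Omega>" using Omega(2) by simp
qed

lemma ri_other:
  assumes T: "T \<in> \<T>" "T' \<in> \<T>" and i: "i \<le> CARD('n)" and x: "x \<in> RI T i" "x \<in> T'"
  shows "\<exists>i'\<le>CARD('n). FC T' i' = FC T i \<and> x \<in> RI T' i'"
proof (cases "T = T'")
  case True
  then show ?thesis using i x by blast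
next
  case False
  then show ?thesis using shared_facet[OF T False i x] by metis
qed

lemma ri_facet_eq:
  assumes T: "T \<in> \<T>" and i: "i \<le> CARD('n)" "j \<le> CARD('n)" and x: "x \<in> RI T i" "x \<in> FC T j"
  shows "j = i"
proof (rule ccontr)
  interpret S: nsimplex "v T" by (rule nsimp[OF T])
  assume "j \<noteq> i"
  then show False using x i by (auto simp: S.ri_def S.facet_def)
qed

text \<open>For the averages in the trace: up to null sets, near x only cells with x in the relative
  interior of a facet occur, each with a single piece of its split. The radius is a minimum over
  finitely many cells.\<close>

lemma near_cells:
  assumes T: "T \<in> \<T>" and i: "i \<le> CARD('n)" and x: "x \<in> RI T i"
  shows "\<exists>e>0. AE y in lebesgue. y \<in> ball x e \<and> y \<in> \<Omega> \<longrightarrow>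
    (\<exists>T'\<in>\<T>. \<exists>i'\<le>CARD('n). x \<in> RI T' i' \<and> y \<in> interior (subT (v T') i'))"
proof -
  have "\<exists>e>0. AE y in lebesgue. y \<in> ball x e \<and> y \<in> T' \<longrightarrow>
     (\<exists>i'\<le>CARD('n). x \<in> RI T' i' \<and> y \<in> interior (subT (v T') i'))" if T': "T' \<in> \<T>" for T'
  proof (cases "x \<in> T'")
    case True
    interpret S': nsimplex "v T'" by (rule nsimp[OF T'])
    obtain i' where i': "i' \<le> CARD('n)" "x \<in> RI T' i'" using ri_other[OF T T' i x True] by blast
    obtain e where e: "e > 0" "\<forall>y\<in>ball x e. y \<in> split_interior (v T') \<longrightarrow> y \<in> interior (subT (v T') i')"
      using S'.near_piece[OF i'] by blast
    have "AE y in lebesgue. y \<in> ball x e \<and> y \<in> T' \<longrightarrow> (\<exists>i'\<le>CARD('n). x \<in> RI T' i' \<and> y \<in> interior (subT (v T') i'))"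
      using S'.AE_split by eventually_elim (use e(2) i' cell(2)[OF T'] in blast)
    then show ?thesis using e(1) by blast
  next
    case False
    then obtain e where e: "e > 0" "ball x e \<subseteq> - T'"
      using cell_closed[OF T'] openE[of "- T'" x] by blast
    have "AE y in lebesgue. y \<in> ball x e \<and> y \<in> T' \<longrightarrow> (\<exists>i'\<le>CARD('n). x \<in> RI T' i' \<and> y \<in> interior (subT (v T') i'))"
      using e(2) by (intro AE_I2) blast
    then show ?thesis using e(1) by blast
  qed
  then have "\<forall>T'\<in>\<T>. \<exists>e>0. AE y in lebesgue. y \<in> ball x e \<and> y \<in> T' \<longrightarrow>
     (\<exists>i'\<le>CARD('n). x \<in> RI T' i' \<and> y \<in> interior (subT (v T') i'))" by blast
  from bchoice[OF this] obtain e where e': "\<forall>T'\<in>\<T>. 0 < e T' \<and> (AE y in lebesgue. y \<in> ball x (e T') \<and> y \<in> T' \<longrightarrow>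
     (\<exists>i'\<le>CARD('n). x \<in> RI T' i' \<and> y \<in> interior (subT (v T') i')))" ..
  then have e: "\<And>T'. T' \<in> \<T> \<Longrightarrow> 0 < e T'"
    "\<And>T'. T' \<in> \<T> \<Longrightarrow> AE y in lebesgue. y \<in> ball x (e T') \<and> y \<in> T' \<longrightarrow>
     (\<exists>i'\<le>CARD('n). x \<in> RI T' i' \<and> y \<in> interior (subT (v T') i'))" by simp_all
  define r where "r = Min (e ` \<T>)"
  have r: "0 < r" unfolding r_def using Omega(4) T e(1) by (subst Min_gr_iff) auto
  have rle: "r \<le> e T'" if "T' \<in> \<T>" for T' unfolding r_def using that Omega(4) by auto
  have "AE y in lebesgue. \<forall>T'\<in>\<T>. y \<in> ball x (e T') \<and> y \<in> T' \<longrightarrow>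
     (\<exists>i'\<le>CARD('n). x \<in> RI T' i' \<and> y \<in> interior (subT (v T') i'))"
    by (rule AE_finite_allI[OF Omega(4) e(2)])
  then have "AE y in lebesgue. y \<in> ball x r \<and> y \<in> \<Omega> \<longrightarrow>
    (\<exists>T'\<in>\<T>. \<exists>i'\<le>CARD('n). x \<in> RI T' i' \<and> y \<in> interior (subT (v T') i'))"
  proof eventually_elim
    case (elim y)
    show ?case
    proof
      assume y: "y \<in> ball x r \<and> y \<in> \<Omega>"
      then obtain T' where T': "T' \<in> \<T>" "y \<in> T'" using Omega(3) closure_subset by blast
      then have "y \<in> ball x (e T')" using y rle[OF T'(1)] by auto
      then show "\<exists>T'\<in>\<T>. \<exists>i'\<le>CARD('n). x \<in> RI T' i' \<and> y \<in> interior (subT (v T') i')" using elim T' by blast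
    qed
  qed
  then show ?thesis using r by blast
qed

text \<open>An essential limit at x from within \<Omega> carries over to the averages; since x is in
  the closure of \<Omega>, the sets over which the averages are taken have positive measure.\<close>

lemma normal_trace_eqI:
  assumes x: "x \<in> closure \<Omega>" and \<tau>: "set_borel_measurable lebesgue \<Omega> \<tau>"
    and lim: "\<And>e. e > 0 \<Longrightarrow> \<exists>\<delta>>0. AE y in lebesgue. y \<in> ball x \<delta> \<and> y \<in> \<Omega> \<longrightarrow> norm (\<tau> y *v a - W) \<le> e"
  shows "normal_trace \<Omega> \<tau> a x = W"
  unfolding normal_trace_def
proof (rule tendsto_Lim)
  show "at_right (0::real) \<noteq> bot" by simp
  show "((\<lambda>r. (1 / measure lebesgue (ball x r \<inter> \<Omega>)) *\<^sub>R (LINT y:ball x r \<inter> \<Omega>|lebesgue. \<tau> y *v a)) \<longlongrightarrow> W) (at_right 0)"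
  proof (rule tendstoI)
    fix e :: real assume "e > 0"
    then obtain \<delta> where \<delta>: "\<delta> > 0" "AE y in lebesgue. y \<in> ball x \<delta> \<and> y \<in> \<Omega> \<longrightarrow> norm (\<tau> y *v a - W) \<le> e / 2"
      using lim[of "e/2"] by auto
    have "dist ((1 / measure lebesgue (ball x r \<inter> \<Omega>)) *\<^sub>R (LINT y:ball x r \<inter> \<Omega>|lebesgue. \<tau> y *v a)) W < e"
      if r: "0 < r" "r < \<delta>" for r
    proof -
      let ?S = "ball x r \<inter> \<Omega>"
      have Sm: "?S \<in> sets lebesgue" using Omega(1) by (intro sets_completionI_sets) auto
      have Sf: "?S \<in> lmeasurable" by (rule bounded_set_imp_lmeasurable[OF bounded_subset[OF bounded_ball] Sm]) auto
      have Sne: "?S \<noteq> {}"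
      proof -
        have "ball x r \<inter> closure \<Omega> \<noteq> {}" using x r(1) centre_in_ball by blast
        then show ?thesis using open_Int_closure_eq_empty[of "ball x r" \<Omega>] by auto
      qed
      have "\<not> negligible ?S" using Omega(1) Sne by (intro open_not_negligible) auto
      then have mpos: "0 < measure lebesgue ?S"
        using Sf negligible_iff_measure measure_nonneg by (metis less_eq_real_def)
      define h where "h = (\<lambda>y. indicat_real ?S y *\<^sub>R (\<tau> y *v a))"
      have hm: "h \<in> borel_measurable lebesgue"
      proof -
        have "(\<lambda>y. (indicat_real \<Omega> y *\<^sub>R \<tau> y) *v a) \<in> borel_measurable lebesgue"
          using \<tau> unfolding set_borel_measurable_def
          by (rule measurable_compose) (intro borel_measurable_continuous_onI continuous_on_vec_nth_iff, simp add: matrix_vector_mult_def, intro continuous_intros)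
        then have "(\<lambda>y. indicat_real (ball x r) y *\<^sub>R ((indicat_real \<Omega> y *\<^sub>R \<tau> y) *v a)) \<in> borel_measurable lebesgue"
          by (intro borel_measurable_scaleR borel_measurable_indicator) auto
        moreover have "(\<lambda>y. indicat_real (ball x r) y *\<^sub>R ((indicat_real \<Omega> y *\<^sub>R \<tau> y) *v a)) = h"
          by (auto simp: h_def indicator_def fun_eq_iff matrix_vector_mult_scaleR_left)
        ultimately show ?thesis by simp
      qed
      have SI: "integrable lebesgue (indicat_real ?S)" using Sf lmeasurable_iff_integrable by blast
      have cI: "integrable lebesgue (\<lambda>y. indicat_real ?S y *\<^sub>R W)" using SI by (intro integrable_scaleR_left)
      have bound: "AE y in lebesgue. norm (h y - indicat_real ?S y *\<^sub>R W) \<le> e / 2 * indicat_real ?S y"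
        using \<delta>(2) by eventually_elim (use r in \<open>auto simp: h_def indicator_def\<close>)
      have dI: "integrable lebesgue (\<lambda>y. h y - indicat_real ?S y *\<^sub>R W)"
        by (rule Bochner_Integration.integrable_bound[of _ "\<lambda>y. e / 2 * indicat_real ?S y"])
          (use SI hm bound \<open>e > 0\<close> Sm in \<open>auto elim!: eventually_mono\<close>)
      have hI: "integrable lebesgue h" using Bochner_Integration.integrable_add[OF dI cI] by simp
      have "norm (integral\<^sup>L lebesgue h - measure lebesgue ?S *\<^sub>R W)
         = norm (\<integral>y. h y - indicat_real ?S y *\<^sub>R W \<partial>lebesgue)"
        using hI cI SI by (simp add: Bochner_Integration.integral_diff)
      also have "\<dots> \<le> (\<integral>y. norm (h y - indicat_real ?S y *\<^sub>R W) \<partial>lebesgue)" by (rule integral_norm_bound)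
      also have "\<dots> \<le> (\<integral>y. e / 2 * indicat_real ?S y \<partial>lebesgue)"
        by (rule integral_mono_AE) (use dI SI bound in auto)
      also have "\<dots> = e / 2 * measure lebesgue ?S" by simp
      finally have b: "norm (integral\<^sup>L lebesgue h - measure lebesgue ?S *\<^sub>R W) \<le> e / 2 * measure lebesgue ?S" .
      have "(1 / measure lebesgue ?S) *\<^sub>R integral\<^sup>L lebesgue h - W
         = (1 / measure lebesgue ?S) *\<^sub>R (integral\<^sup>L lebesgue h - measure lebesgue ?S *\<^sub>R W)"
        using mpos by (simp add: scaleR_diff_right)
      then have "norm ((1 / measure lebesgue ?S) *\<^sub>R integral\<^sup>L lebesgue h - W)
         = (1 / measure lebesgue ?S) * norm (integral\<^sup>L lebesgue h - measure lebesgue ?S *\<^sub>R W)" by simp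
      also have "\<dots> \<le> (1 / measure lebesgue ?S) * (e / 2 * measure lebesgue ?S)"
        using b mpos by (intro mult_left_mono) auto
      also have "\<dots> = e / 2" using mpos by simp
      finally show ?thesis using \<open>e > 0\<close> by (simp add: dist_norm h_def set_lebesgue_integral_def)
    qed
    then show "\<forall>\<^sub>F r in at_right 0. dist ((1 / measure lebesgue (ball x r \<inter> \<Omega>)) *\<^sub>R (LINT y:ball x r \<inter> \<Omega>|lebesgue. \<tau> y *v a)) W < e"
      using \<delta>(1) by (auto simp: eventually_at_right_field)
  qed
qed

end

section \<open>Interior moments\<close>

context element
begin

text \<open>A weighted Gram operator of the edge tensors. The weight of an edge is the product of
  its two end coordinates, exactly the factor that removes the normal trace, so test functions of
  degree k - 2 become bubbles of degree k.\<close>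

definition Aop :: "(real^'n \<Rightarrow> real^'n^'n) \<Rightarrow> real^'n \<Rightarrow> real^'n^'n"
  where "Aop q x = (\<Sum>p\<in>pairs. (bary v (fst p) x * bary v (snd p) x * (q x \<bullet> tt p)) *\<^sub>R tt p)"

lemma linear_Aop: "linear Aop"
  by (rule linearI)
    (auto simp: Aop_def fun_eq_iff inner_add_left distrib_left scaleR_add_left sum.distrib
      scaleR_sum_right mult.left_commute)

text \<open>The basis of the symmetric tensors dual to \<open>tt\<close>.\<close>

definition NN :: "nat \<times> nat \<Rightarrow> real^'n^'n"
  where "NN p = - sym_part (outer (grad (fst p)) (grad (snd p)))"

lemma NN_tt: "p \<in> pairs \<Longrightarrow> p' \<in> pairs \<Longrightarrow> NN p \<bullet> tt p' = (if p = p' then 1 else 0)"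
proof -
  assume p: "p \<in> pairs" "p' \<in> pairs"
  have "NN p \<bullet> tt p' = - (tt p' \<bullet> sym_part (outer (grad (fst p)) (grad (snd p))))"
    by (simp add: NN_def inner_commute[of "sym_part M" for M])
  also have "\<dots> = - ((grad (fst p) \<bullet> (v (snd p') - v (fst p'))) * (grad (snd p) \<bullet> (v (snd p') - v (fst p'))))"
    unfolding tt_def outer_inner_sym_part by (simp only: inner_commute)
  also have "\<dots> = (if p = p' then 1 else 0)"
    using p by (auto simp: grad_vertex pairs_def split: if_splits)
  finally show ?thesis .
qed

lemma transpose_NN: "transpose (NN p) = NN p"
  by (simp add: NN_def transpose_uminus transpose_sym_part)

definition up :: "nat \<times> nat \<Rightarrow> (nat \<Rightarrow> nat) \<Rightarrow> nat \<Rightarrow> nat"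
  where "up p \<alpha> = (\<lambda>m. \<alpha> m + ((if m = fst p then 1 else 0) + (if m = snd p then 1 else 0)))"

lemma bmono_up:
  "p \<in> pairs \<Longrightarrow> bmono (up p \<alpha>) x = bary v (fst p) x * bary v (snd p) x * bmono \<alpha> x"
  unfolding up_def bmono_mult[symmetric] by (simp add: bmono_single pairs_def split_beta)

lemma up_IBB:
  assumes "p \<in> pairs" "\<alpha> \<in> MI {..CARD('n)} (k - 2)" shows "Inl (p, up p \<alpha>) \<in> IBB"
proof -
  have "fst p \<le> CARD('n)" "snd p \<le> CARD('n)" using assms(1) by (auto simp: pairs_def)
  then have "(\<Sum>m\<le>CARD('n). up p \<alpha> m) = k" using assms(2) k2 by (simp add: up_def sum.distrib MI_def)
  moreover have "up p \<alpha> m = 0" if "m \<notin> {..CARD('n)}" for m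
    using that assms \<open>fst p \<le> CARD('n)\<close> \<open>snd p \<le> CARD('n)\<close> by (auto simp: up_def MI_def)
  ultimately show ?thesis using assms(1) by (auto simp: IBB_def MI_def up_def)
qed

lemma down_IBB:
  assumes "Inl (p, \<alpha>) \<in> IBB"
  obtains \<beta> where "\<beta> \<in> MI {..CARD('n)} (k - 2)" "\<alpha> = up p \<beta>"
proof -
  define \<beta> where "\<beta> m = \<alpha> m - ((if m = fst p then 1 else 0) + (if m = snd p then 1 else 0))" for m
  have p: "p \<in> pairs" "\<alpha> \<in> MI {..CARD('n)} k" "\<alpha> (fst p) \<noteq> 0" "\<alpha> (snd p) \<noteq> 0" using assms by (auto simp: IBB_def)
  have pd: "fst p \<le> CARD('n)" "snd p \<le> CARD('n)" "fst p \<noteq> snd p" using p(1) by (auto simp: pairs_def)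
  have e: "\<alpha> = up p \<beta>" using p(3,4) pd by (auto simp: up_def \<beta>_def fun_eq_iff)
  have "(\<Sum>m\<le>CARD('n). up p \<beta> m) = k" using p(2) e by (simp add: MI_def)
  then have "(\<Sum>m\<le>CARD('n). \<beta> m) = k - 2" using pd by (simp add: up_def sum.distrib)
  moreover have "\<beta> m = 0" if "m \<notin> {..CARD('n)}" for m using that p(2) by (auto simp: \<beta>_def MI_def)
  ultimately have "\<beta> \<in> MI {..CARD('n)} (k - 2)" by (simp add: MI_def)
  then show ?thesis using that e by blast
qed

lemma poly_symE:
  assumes "q \<in> poly_sym v r"
  obtains h where "q = on_split v h" "continuous_on UNIV h" "\<And>x. transpose (h x) = h x"
proof -
  obtain p where p: "q = on_split v p" "\<forall>i j. (\<lambda>x. p x $ i $ j) \<in> polys r" "\<forall>x. transpose (p x) = p x"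
    using assms unfolding poly_sym_def by blast
  have "continuous_on UNIV p"
    by (rule nice_field_continuous) (use p(2) nice_polys in \<open>auto simp: nice_field_def\<close>)
  then show ?thesis using that p by blast
qed

lemma Aop_on_split: "Aop (on_split v h) x = indicat_real (split_interior v) x *\<^sub>R Aop h x"
  by (simp add: Aop_def on_split_def scaleR_sum_right mult.left_commute mult.commute)

lemma Aop_genB:
  "Aop (asm (\<lambda>l x. bmono \<alpha> x *\<^sub>R M)) = (\<Sum>p\<in>pairs. (M \<bullet> tt p) *\<^sub>R asm (genB p (up p \<alpha>)))"
proof
  fix x
  show "Aop (asm (\<lambda>l x. bmono \<alpha> x *\<^sub>R M)) x = (\<Sum>p\<in>pairs. (M \<bullet> tt p) *\<^sub>R asm (genB p (up p \<alpha>))) x"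
    unfolding on_split_eq[symmetric] Aop_on_split sum_fun_apply scaleR_fun_apply
    by (simp add: Aop_def genB_def on_split_eq[symmetric] on_split_def bmono_up scaleR_sum_right
        mult.commute mult.left_commute)
qed

text \<open>As the tensors \<open>NN p\<close> are dual to the edge tensors, a monomial times
  \<open>NN p\<close> is sent to a single generator in \<open>IBB\<close>, with the exponents at
  both ends of p raised by one.\<close>

lemma Aop_image: "Aop ` poly_sym v (k - 2) = span (g ` IBB)"
proof
  have "Aop ` poly_sym v (k - 2) = span (Aop ` (\<lambda>(p, \<alpha>). asm (genB p \<alpha>)) ` (pairs \<times> MI {..CARD('n)} (k - 2)))"
    unfolding poly_sym_eq by (rule linear_span_image[OF linear_Aop, symmetric])
  also have "\<dots> \<subseteq> span (g ` IBB)"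
  proof (rule span_minimal)
    show "Aop ` (\<lambda>(p, \<alpha>). asm (genB p \<alpha>)) ` (pairs \<times> MI {..CARD('n)} (k - 2)) \<subseteq> span (g ` IBB)"
    proof clarify
      fix a b \<alpha> assume "(a, b) \<in> pairs" and \<alpha>: "\<alpha> \<in> MI {..CARD('n)} (k - 2)"
      have "asm (genB p (up p \<alpha>)) \<in> span (g ` IBB)" if "p \<in> pairs" for p
        using up_IBB[OF that \<alpha>] by (intro span_base) (auto simp: gen_def intro!: image_eqI)
      then show "Aop (asm (genB (a, b) \<alpha>)) \<in> span (g ` IBB)"
        unfolding genB_def[of "(a, b)"] Aop_genB by (intro span_sum span_scale)
    qed
  qed simp
  finally show "Aop ` poly_sym v (k - 2) \<subseteq> span (g ` IBB)" .
  show "span (g ` IBB) \<subseteq> Aop ` poly_sym v (k - 2)"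
  proof (rule span_minimal)
    show "subspace (Aop ` poly_sym v (k - 2))"
      unfolding poly_sym_eq by (intro linear_subspace_image linear_Aop) simp
    show "g ` IBB \<subseteq> Aop ` poly_sym v (k - 2)"
    proof (rule image_subsetI)
      fix z assume z: "z \<in> IBB"
      then obtain p \<alpha> where za: "z = Inl (p, \<alpha>)" "p \<in> pairs" by (auto simp: IBB_def)
      obtain \<beta> where \<beta>: "\<beta> \<in> MI {..CARD('n)} (k - 2)" "\<alpha> = up p \<beta>" using down_IBB z za by blast
      let ?q = "asm (\<lambda>l x. bmono \<beta> x *\<^sub>R NN p)"
      have "?q \<in> poly_sym v (k - 2)"
        unfolding poly_sym_def on_split_eq[symmetric]
        using scaled_polys[OF bmono_polys[OF \<beta>(1)]]
        by (intro CollectI exI[of _ "\<lambda>x. bmono \<beta> x *\<^sub>R NN p"])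
          (auto simp: transpose_scaleR transpose_NN)
      moreover have "Aop ?q = g z"
      proof -
        have "Aop ?q = (\<Sum>p'\<in>pairs. if p' = p then asm (genB p (up p \<beta>)) else 0)"
          unfolding Aop_genB by (rule sum.cong) (auto simp: NN_tt za(2))
        then show ?thesis using za finite_pairs \<beta>(2) by (simp add: gen_def)
      qed
      ultimately show "g z \<in> Aop ` poly_sym v (k - 2)" by (metis imageI)
    qed
  qed
qed

definition mom where "mom q q' = (LINT x:simplex_hull v|lebesgue. Aop q x \<bullet> q' x)"

lemma split_interior_borel: "split_interior v \<in> sets borel"
  unfolding split_interior_def by (intro borel_open open_UN) auto

lemma Aop_continuous: "continuous_on UNIV h \<Longrightarrow> continuous_on UNIV (Aop h)"
  unfolding Aop_def[abs_def]
  by (intro continuous_on_sum continuous_on_scaleR continuous_on_mult continuous_on_inner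
      continuous_on_const bary_continuous) (auto simp: pairs_def)

lemma mom_integrable:
  assumes "q \<in> poly_sym v r" "q' \<in> poly_sym v r'"
  shows "set_integrable lebesgue (simplex_hull v) (\<lambda>x. Aop q x \<bullet> q' x)"
proof -
  obtain h where h: "q = on_split v h" "continuous_on UNIV h" by (rule poly_symE[OF assms(1)]) (rule that)
  obtain h' where h': "q' = on_split v h'" "continuous_on UNIV h'" by (rule poly_symE[OF assms(2)]) (rule that)
  have "bbs (\<lambda>x. indicator (split_interior v) x * (Aop h x \<bullet> h' x))"
    by (intro bbs_indicator_continuous split_interior_borel continuous_on_inner Aop_continuous h h'
        bounded_subset[OF hull_bounded]) (use split_interior_sub interior_subset in blast)
  moreover have "(\<lambda>x. indicator (split_interior v) x * (Aop h x \<bullet> h' x)) = (\<lambda>x. Aop q x \<bullet> q' x)"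
    unfolding h(1) Aop_on_split h'(1) by (auto simp: on_split_def indicator_def fun_eq_iff)
  ultimately show ?thesis using bbs_set_integrable[OF _ hull_lebesgue] by metis
qed

text \<open>The integrand is a sum of squares of the products with the edge tensors, with weights
  that are nonnegative on T and positive inside. If the integral is 0, all these products vanish,
  and by \<open>tensor_expand\<close> a symmetric tensor orthogonal to all edge tensors is
  0.\<close>

lemma mom_definite:
  assumes q: "q \<in> poly_sym v r" and z: "mom q q = 0" shows "q = 0"
proof -
  obtain h where h: "q = on_split v h" "continuous_on UNIV h" "\<And>x. transpose (h x) = h x"
    by (rule poly_symE[OF q]) (rule that)
  define G where "G x = (\<Sum>p\<in>pairs. bary v (fst p) x * bary v (snd p) x * (h x \<bullet> tt p)\<^sup>2)" for x
  have GA: "Aop h x \<bullet> h x = G x" for x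
    by (simp add: G_def Aop_def inner_sum_left inner_commute[of "tt p" for p] power2_eq_square mult.assoc)
  have Gc: "continuous_on UNIV G" using h(2) GA
    by (metis (mono_tags, lifting) Aop_continuous continuous_on_cong continuous_on_inner)
  have "(\<integral>x. indicator (simplex_hull v) x * G x \<partial>lborel) = (\<integral>x. indicator (simplex_hull v) x * G x \<partial>lebesgue)"
    using bbs_hull[OF Gc] by (intro integral_completion[symmetric]) (simp add: bbs_def)
  also have "\<dots> = mom q q"
    unfolding mom_def set_lebesgue_integral_def
  proof (rule integral_cong_AE)
    show "(\<lambda>x. indicator (simplex_hull v) x * G x) \<in> borel_measurable lebesgue"
      using bbs_hull[OF Gc] by (intro measurable_completion) (simp add: bbs_def)
    show "(\<lambda>x. indicat_real (simplex_hull v) x *\<^sub>R (Aop q x \<bullet> q x)) \<in> borel_measurable lebesgue"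
      using mom_integrable[OF q q] by (auto simp: set_integrable_def)
    show "AE x in lebesgue. indicator (simplex_hull v) x * G x = indicat_real (simplex_hull v) x *\<^sub>R (Aop q x \<bullet> q x)"
    proof -
      have oa: "on_split v h x = indicat_real (split_interior v) x *\<^sub>R h x" for x by (simp add: on_split_def)
      show ?thesis using AE_split by eventually_elim (auto simp: h(1) Aop_on_split oa indicator_def GA)
    qed
  qed
  finally have z': "(\<integral>x. indicator (simplex_hull v) x * G x \<partial>lborel) = 0" using z by simp
  have "h x = 0" if x: "x \<in> interior (simplex_hull v)" for x
  proof -
    have "G x = 0"
    proof (rule vol_zero[OF Gc _ z' x])
      fix y assume "y \<in> simplex_hull v"
      then have "0 \<le> bary v i y" if "i \<le> CARD('n)" for i using that by (simp add: hull_eq)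
      then show "0 \<le> G y" unfolding G_def by (intro sum_nonneg mult_nonneg_nonneg) (auto simp: pairs_def)
    qed
    moreover have pos: "0 < bary v (fst p) x" "0 < bary v (snd p) x" if "p \<in> pairs" for p
      using that x by (auto simp: interior_eq pairs_def)
    ultimately have "bary v (fst p) x * bary v (snd p) x * (h x \<bullet> tt p)\<^sup>2 = 0" if "p \<in> pairs" for p
      using sum_nonneg_eq_0_iff[OF finite_pairs, of "\<lambda>p. bary v (fst p) x * bary v (snd p) x * (h x \<bullet> tt p)\<^sup>2"] that
      by (force simp: G_def less_imp_le)
    then have ht: "h x \<bullet> tt p = 0" if "p \<in> pairs" for p
      using pos[OF that] that by (metis less_irrefl mult_eq_0_iff zero_eq_power2)
    have "h x \<bullet> h x = h x \<bullet> (\<Sum>p\<in>pairs. (- (grad (snd p) \<bullet> (h x *v grad (fst p)))) *\<^sub>R tt p)"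
      using tensor_expand[OF h(3)[of x]] by simp
    also have "\<dots> = 0" by (simp add: inner_sum_right ht)
    finally show ?thesis by simp
  qed
  then show ?thesis unfolding h(1) on_split_def using split_interior_sub by (auto simp: fun_eq_iff indicator_def)
qed

lemma bubble_field:
  assumes "\<sigma> \<in> span (g ` IBB)"
  obtains u where "\<sigma> = asm (field u)" "\<forall>z\<in>(IB \<union> IP) - IBB. u z = 0"
proof -
  obtain c where c: "\<sigma> = (\<Sum>z\<in>IBB. c z *\<^sub>R g z)"
    using assms unfolding span_image_finite[OF finite_subset[OF IBB_sub finite_IB]] by blast
  have "\<sigma> = (\<Sum>z\<in>IB \<union> IP. (if z \<in> IBB then c z else 0) *\<^sub>R g z)"
    unfolding c by (rule sum.mono_neutral_cong_left[OF finite_Z]) (use IBB_sub in auto)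
  then show ?thesis by (intro that[of "\<lambda>z. if z \<in> IBB then c z else 0"]) (simp_all only: asm_field, auto)
qed

text \<open>The definite form \<open>mom\<close> represents the functional by some w of degree k -
  2, and \<open>Aop w\<close> is a bubble with the prescribed moments.\<close>

lemma moment_solve:
  assumes \<mu>: "lin_on (poly_sym v (k - 2)) \<mu>"
  shows "\<exists>u. (\<forall>z\<in>(IB \<union> IP) - IBB. u z = 0) \<and>
    (\<forall>q\<in>poly_sym v (k - 2). (LINT x:simplex_hull v|lebesgue. asm (field u) x \<bullet> q x) = \<mu> q)"
proof -
  let ?B = "(\<lambda>(p, \<alpha>). asm (genB p \<alpha>)) ` (pairs \<times> MI {..CARD('n)} (k - 2))"
  have "\<exists>w\<in>span ?B. \<forall>q\<in>span ?B. mom w q = \<mu> q"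
  proof (rule riesz_span)
    show "finite ?B" using finite_pairs finite_MI_all by simp
    show "lin_on (span ?B) \<mu>" using \<mu> by (simp add: poly_sym_eq)
    show "x = 0" if "x \<in> span ?B" "mom x x = 0" for x using mom_definite that by (simp add: poly_sym_eq[symmetric])
    show "lin_on (span ?B) (mom x)" if "x \<in> span ?B" for x
      using that mom_integrable unfolding lin_on_def poly_sym_eq[symmetric]
      by (auto simp: mom_def inner_add_right intro!: set_integral_add(2))
    show "lin_on (span ?B) (\<lambda>x. mom x y)" if "y \<in> span ?B" for y
      using that mom_integrable unfolding lin_on_def poly_sym_eq[symmetric]
      by (auto simp: mom_def inner_add_left linear_add[OF linear_Aop] linear_cmul[OF linear_Aop] intro!: set_integral_add(2))
  qed
  then obtain w where w: "w \<in> poly_sym v (k - 2)" "\<forall>q\<in>poly_sym v (k - 2). mom w q = \<mu> q"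
    unfolding poly_sym_eq by blast
  have "Aop w \<in> span (g ` IBB)" using w(1) Aop_image by blast
  then obtain u where "Aop w = asm (field u)" "\<forall>z\<in>(IB \<union> IP) - IBB. u z = 0" by (rule bubble_field)
  then show ?thesis using w(2) by (intro exI[of _ u]) (simp add: mom_def)
qed

text \<open>The bubble is \<open>Aop q\<close> for some q of degree k - 2, and testing with this q
  gives \<open>mom q q = 0\<close>.\<close>

lemma moment_unique:
  assumes u: "\<forall>z\<in>(IB \<union> IP) - IBB. u z = 0"
    and z: "\<And>q. q \<in> poly_sym v (k - 2) \<Longrightarrow> (LINT x:simplex_hull v|lebesgue. asm (field u) x \<bullet> q x) = 0"
  shows "asm (field u) = 0"
proof -
  have "asm (field u) = (\<Sum>z\<in>IBB. u z *\<^sub>R g z)"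
    unfolding asm_field using u IBB_sub by (intro sum.mono_neutral_right[OF finite_Z]) auto
  also have "\<dots> \<in> span (g ` IBB)" by (intro span_sum span_scale) (auto intro: span_base)
  finally obtain q where q: "q \<in> poly_sym v (k - 2)" "asm (field u) = Aop q" using Aop_image by blast
  have "mom q q = 0" using z[OF q(1)] q(2) by (simp add: mom_def)
  then have "q = 0" by (rule mom_definite[OF q(1)])
  then show ?thesis using q(2) linear_0[OF linear_Aop] by simp
qed

end

section \<open>Membership in H(div) and matching normal traces\<close>

context mesh
begin

abbreviation "PF u T \<equiv> element.field (v T) (base T) k (u T)"
abbreviation "AS u T \<equiv> nsimplex.asm (v T) (PF u T)"
abbreviation "DV u T \<equiv> element.dv (v T) (base T) k (u T)"

definition "pieces \<tau> u \<longleftrightarrow> (\<forall>T\<in>\<T>. AE x in lebesgue. x \<in> T \<longrightarrow> \<tau> x = AS u T x)"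

text \<open>The boundary term of facet i in \<open>gauss_asm\<close> on the cell T.\<close>

definition fterm where
  "fterm u \<phi> T i = nsimplex.FI (v T) i (\<lambda>x. indicator (FC T i) x * (\<phi> x \<bullet> (PF u T i x *v Gr T i)))"

text \<open>The neighbour's gradient is c times that of T with c < 0; the integrand contributes the
  factor c and the normalisation of \<open>Fint\<close> the factor 1 / |c|.\<close>

lemma FI_opposite:
  fixes \<phi> :: "real^'n \<Rightarrow> real^'n" and M :: "real^'n \<Rightarrow> real^'n^'n"
  assumes T: "T \<in> \<T>" "T' \<in> \<T>" "T \<noteq> T'" and i: "i \<le> CARD('n)" "i' \<le> CARD('n)" and F: "FC T' i' = FC T i"
    and h: "continuous_on UNIV (\<lambda>x. \<phi> x \<bullet> (M x *v Gr T i))"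
  shows "nsimplex.FI (v T') i' (\<lambda>x. indicator (FC T' i') x * (\<phi> x \<bullet> (M x *v Gr T' i')))
    = - nsimplex.FI (v T) i (\<lambda>x. indicator (FC T i) x * (\<phi> x \<bullet> (M x *v Gr T i)))"
proof -
  interpret S: nsimplex "v T" by (rule nsimp[OF T(1)])
  interpret S': nsimplex "v T'" by (rule nsimp[OF T(2)])
  obtain c where c: "c < 0" "\<And>y. bary (v T') i' y = c * bary (v T) i y" "Gr T' i' = c *\<^sub>R Gr T i"
    by (rule opposite[OF T i F]) (rule that)
  let ?G = "\<lambda>x. indicator (FC T i) x * (\<phi> x \<bullet> (M x *v Gr T i))"
  have "S'.FI i' (\<lambda>x. indicator (FC T' i') x * (\<phi> x \<bullet> (M x *v Gr T' i')))
     = Fint (c *\<^sub>R Gr T i) (c * bary (v T) i 0) (\<lambda>x. c * ?G x)"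
    by (simp add: S'.FI_def c F matrix_vector_mult_scaleR mult.left_commute)
  also have "\<dots> = c * (Fint (Gr T i) (bary (v T) i 0) ?G / \<bar>c\<bar>)"
    unfolding Fint_cmult by (subst Fint_scale[OF S.bbs_facet[OF i(1) h] S.grad_nonzero[OF i(1)]]) (use c in auto)
  also have "\<dots> = - S.FI i ?G" using c(1) by (simp add: S.FI_def)
  finally show ?thesis .
qed

lemma fterm_cont:
  assumes "T \<in> \<T>" "i \<le> CARD('n)" "continuous_on UNIV \<phi>"
  shows "continuous_on UNIV (\<lambda>x. \<phi> x \<bullet> (PF u T i x *v a))"
proof -
  interpret E: element "v T" "base T" k by (rule cell(1)[OF assms(1)])
  show ?thesis by (intro continuous_on_inner assms(3) nice_field_mult_continuous E.field_nice assms(2))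
qed

lemma fterm_zero: assumes "T \<in> \<T>" "\<And>x. x \<in> FC T i \<Longrightarrow> \<phi> x = 0" shows "fterm u \<phi> T i = 0"
proof -
  have "(\<lambda>x. indicator (FC T i) x * (\<phi> x \<bullet> (PF u T i x *v Gr T i))) = (\<lambda>x. 0)"
    using assms(2) by (auto simp: indicator_def)
  then show ?thesis by (simp only: fterm_def nsimplex.FI_def[OF nsimp[OF assms(1)]] Fint_def) simp
qed

text \<open>Without a second cell, points of the relative interior are not in \<Omega>. The distance
  to the complement of \<Omega> is continuous and vanishes there, hence on the whole facet by
  \<open>facet_zero\<close>.\<close>

lemma boundary_facet:
  assumes T: "T \<in> \<T>" and i: "i \<le> CARD('n)" and no: "\<And>T' i'. T' \<in> \<T> \<Longrightarrow> i' \<le> CARD('n) \<Longrightarrow> FC T' i' = FC T i \<Longrightarrow> T' = T"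
  shows "FC T i \<inter> \<Omega> = {}"
proof -
  interpret S: nsimplex "v T" by (rule nsimp[OF T])
  have out: "y \<notin> \<Omega>" if "y \<in> RI T i" for y
    using ri_interior_iff[OF T i that] ri_other[OF T _ i that] no by metis
  have ne: "- \<Omega> \<noteq> {}" using out S.ri_nonempty[OF i] by blast
  have cl: "closed (- \<Omega>)" using Omega(1) by auto
  have "infdist x (- \<Omega>) = 0" if "x \<in> FC T i" for x
  proof (rule S.facet_zero[OF i _ _ that])
    show "infdist y (- \<Omega>) = 0" if "y \<in> RI T i" for y using out[OF that] by simp
    show "continuous_on UNIV (\<lambda>x. infdist x (- \<Omega>))" by (intro continuous_intros)
  qed
  then show ?thesis using in_closed_iff_infdist_zero[OF cl ne] by blast
qed

text \<open>Grouping by facets: a facet of two cells contributes opposite terms, by the matching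
  traces and \<open>FI_opposite\<close>; a facet of one cell does not meet \<Omega>, and
  \<open>\<phi>\<close> vanishes outside \<Omega>.\<close>

lemma facet_sum_zero:
  assumes \<phi>: "continuous_on UNIV \<phi>" "\<And>x. x \<notin> \<Omega> \<Longrightarrow> \<phi> x = 0"
    and c: "\<And>T T' i i' x. T \<in> \<T> \<Longrightarrow> T' \<in> \<T> \<Longrightarrow> T \<noteq> T' \<Longrightarrow> i \<le> CARD('n) \<Longrightarrow> i' \<le> CARD('n) \<Longrightarrow> FC T' i' = FC T i \<Longrightarrow> x \<in> FC T i \<Longrightarrow>
      PF u T i x *v Gr T i = PF u T' i' x *v Gr T i"
  shows "(\<Sum>T\<in>\<T>. \<Sum>i\<le>CARD('n). fterm u \<phi> T i) = 0"
proof -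
  let ?X = "\<T> \<times> {..CARD('n)}" and ?f = "\<lambda>p. fterm u \<phi> (fst p) (snd p)" and ?key = "\<lambda>p. FC (fst p) (snd p)"
  have "(\<Sum>T\<in>\<T>. \<Sum>i\<le>CARD('n). fterm u \<phi> T i) = (\<Sum>p\<in>?X. ?f p)"
    by (simp add: sum.cartesian_product split_beta)
  also have "\<dots> = (\<Sum>F\<in>?key ` ?X. \<Sum>p\<in>{p\<in>?X. ?key p = F}. ?f p)"
    using Omega(4) by (intro sum.image_gen) auto
  also have "\<dots> = 0"
  proof (rule sum.neutral, rule ballI)
    fix F assume "F \<in> ?key ` ?X"
    then obtain T i where T: "T \<in> \<T>" "i \<le> CARD('n)" "F = FC T i" by auto
    show "(\<Sum>p\<in>{p\<in>?X. ?key p = F}. ?f p) = 0"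
    proof (cases "\<exists>T'\<in>\<T>. \<exists>i'\<le>CARD('n). FC T' i' = FC T i \<and> T' \<noteq> T")
      case True
      then obtain T' i' where T': "T' \<in> \<T>" "i' \<le> CARD('n)" "FC T' i' = FC T i" "T \<noteq> T'" by auto
      have "{p\<in>?X. ?key p = F} = {(T, i), (T', i')}"
      proof (intro equalityI subsetI)
        fix p assume "p \<in> {p\<in>?X. ?key p = F}"
        then obtain S j where p: "p = (S, j)" "S \<in> \<T>" "j \<le> CARD('n)" "FC S j = FC T i" using T by auto
        show "p \<in> {(T, i), (T', i')}"
        proof (cases "S = T")
          case True
          then show ?thesis using p T nsimplex.facet_inj[OF nsimp[OF T(1)]] by auto
        next
          case False
          then have "S = T'" using partner_unique[OF T(1) T'(1) p(2) T(2) T'(2) p(3) T'(3) p(4) T'(4)] by auto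
          then show ?thesis using p T' nsimplex.facet_inj[OF nsimp[OF T'(1)]] by auto
        qed
      next
        fix p assume "p \<in> {(T, i), (T', i')}"
        then have "p = (T, i) \<or> p = (T', i')" by simp
        then show "p \<in> {p\<in>?X. ?key p = F}" using T(1,2) T(3)[symmetric] T'(1,2) trans[OF T'(3) T(3)[symmetric]]
          by (elim disjE) simp_all
      qed
      moreover have "(T, i) \<noteq> (T', i')" using T'(4) by simp
      ultimately have "(\<Sum>p\<in>{p\<in>?X. ?key p = F}. ?f p) = fterm u \<phi> T i + fterm u \<phi> T' i'" by simp
      also have "fterm u \<phi> T' i' = - fterm u \<phi> T i"
      proof -
        have "fterm u \<phi> T' i' = - nsimplex.FI (v T) i (\<lambda>x. indicator (FC T i) x * (\<phi> x \<bullet> (PF u T' i' x *v Gr T i)))"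
          unfolding fterm_def by (rule FI_opposite[OF T(1) T'(1,4) T(2) T'(2,3) fterm_cont[OF T'(1,2) \<phi>(1)]])
        also have "(\<lambda>x. indicator (FC T i) x * (\<phi> x \<bullet> (PF u T' i' x *v Gr T i))) =
            (\<lambda>x. indicator (FC T i) x * (\<phi> x \<bullet> (PF u T i x *v Gr T i)))"
          using c[OF T(1) T'(1,4) T(2) T'(2,3)] by (auto simp: indicator_def)
        finally show ?thesis by (simp add: fterm_def)
      qed
      finally show ?thesis by simp
    next
      case False
      then have "FC T i \<inter> \<Omega> = {}" by (intro boundary_facet T) blast
      then have z: "\<phi> x = 0" if "x \<in> F" for x using \<phi>(2) that T(3) by blast
      show ?thesis
        by (rule sum.neutral) (use z in \<open>auto intro!: fterm_zero\<close>)
    qed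
  qed
  finally show ?thesis .
qed

lemma AE_cells: "AE x in lebesgue. x \<in> \<Omega> \<longrightarrow> (\<exists>T\<in>\<T>. x \<in> interior T)"
proof -
  have "AE x in lebesgue. \<forall>T\<in>\<T>. x \<in> T \<longrightarrow> x \<in> interior T"
    using nsimplex.AE_interior[OF nsimp] cell(2) by (intro AE_finite_allI[OF Omega(4)]) metis
  then show ?thesis by eventually_elim (use Omega(3) closure_subset in blast)
qed

lemma Omega_bounded: "bounded \<Omega>"
proof -
  have "bounded (\<Union>\<T>)"
    using Omega(4) nsimplex.hull_bounded[OF nsimp] cell(2) by (intro bounded_Union) auto
  then show ?thesis using Omega(3) closure_subset bounded_subset by metis
qed

lemma Omega_lebesgue: "\<Omega> \<in> sets lebesgue" using Omega(1) by auto

lemma Omega_split: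
  fixes f :: "real^'n \<Rightarrow> 'b::euclidean_space"
  assumes f: "L2_on \<Omega> f" and h: "continuous_on UNIV h"
  shows "(LINT x:\<Omega>|lebesgue. f x \<bullet> h x) = (\<Sum>T\<in>\<T>. LINT x:interior T|lebesgue. f x \<bullet> h x)"
proof -
  have I: "integrable lebesgue (\<lambda>x. indicat_real S x *\<^sub>R (f x \<bullet> h x))" if "S \<subseteq> \<Omega>" "open S" for S
    using L2_inner_integrable[OF f h that(1)] bounded_subset[OF Omega_bounded that(1)] that(2)
    by (simp add: set_integrable_def)
  have "(LINT x:\<Omega>|lebesgue. f x \<bullet> h x) = (\<integral>x. (\<Sum>T\<in>\<T>. indicat_real (interior T) x *\<^sub>R (f x \<bullet> h x)) \<partial>lebesgue)"
    unfolding set_lebesgue_integral_def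
  proof (rule integral_cong_AE)
    show "(\<lambda>x. indicat_real \<Omega> x *\<^sub>R (f x \<bullet> h x)) \<in> borel_measurable lebesgue"
      using I[OF subset_refl Omega(1)] by auto
    show "(\<lambda>x. \<Sum>T\<in>\<T>. indicat_real (interior T) x *\<^sub>R (f x \<bullet> h x)) \<in> borel_measurable lebesgue"
      using I[OF cell_interior open_interior] by (intro borel_measurable_sum) auto
    show "AE x in lebesgue. indicat_real \<Omega> x *\<^sub>R (f x \<bullet> h x) = (\<Sum>T\<in>\<T>. indicat_real (interior T) x *\<^sub>R (f x \<bullet> h x))"
      using AE_cells
    proof eventually_elim
      case (elim x)
      show ?case
      proof (cases "x \<in> \<Omega>")
        case True
        then obtain T where T: "T \<in> \<T>" "x \<in> interior T" using elim by blast
        have "x \<notin> interior S" if "S \<in> \<T>" "S \<noteq> T" for S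
          using interior_disjoint[OF T(1) that(1) _ T(2)] that(2) interior_subset by blast
        then have "(\<Sum>S\<in>\<T>. indicat_real (interior S) x *\<^sub>R (f x \<bullet> h x)) = (\<Sum>S\<in>\<T>. if S = T then f x \<bullet> h x else 0)"
          using T by (intro sum.cong) (auto simp: indicator_def)
        then show ?thesis using True T Omega(4) by simp
      next
        case False
        then have "x \<notin> interior T" if "T \<in> \<T>" for T using cell_interior[OF that] by blast
        then show ?thesis using False by simp
      qed
    qed
  qed
  also have "\<dots> = (\<Sum>T\<in>\<T>. LINT x:interior T|lebesgue. f x \<bullet> h x)"
    unfolding set_lebesgue_integral_def
    by (rule Bochner_Integration.integral_sum) (rule I[OF cell_interior open_interior])
  finally show ?thesis .
qed

lemma cell_integral:
  assumes \<tau>: "L2_on \<Omega> \<tau>" "pieces \<tau> u" and h: "continuous_on UNIV h" and T: "T \<in> \<T>"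
  shows "(LINT x:interior T|lebesgue. \<tau> x \<bullet> h x) = (LINT x:T|lebesgue. AS u T x \<bullet> h x)"
proof -
  interpret E: element "v T" "base T" k by (rule cell(1)[OF T])
  have b: "bounded (interior T)" using cell_interior[OF T] Omega_bounded bounded_subset by blast
  show ?thesis
    unfolding set_lebesgue_integral_def
  proof (rule integral_cong_AE)
    show "(\<lambda>x. indicat_real (interior T) x *\<^sub>R (\<tau> x \<bullet> h x)) \<in> borel_measurable lebesgue"
      using L2_inner_integrable[OF \<tau>(1) h cell_interior[OF T] _ b] by (auto simp: set_integrable_def)
    show "(\<lambda>x. indicat_real T x *\<^sub>R (AS u T x \<bullet> h x)) \<in> borel_measurable lebesgue"
      using bbs_set_integrable[OF bv_inner[OF E.asm_bv h] E.hull_lebesgue] cell(2)[OF T]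
      by (auto simp: set_integrable_def)
    have "AE x in lebesgue. x \<in> T \<longrightarrow> \<tau> x = AS u T x" using \<tau>(2) T by (simp add: pieces_def)
    moreover have "AE x in lebesgue. x \<in> T \<longrightarrow> x \<in> interior T" using E.AE_interior cell(2)[OF T] by simp
    ultimately show "AE x in lebesgue. indicat_real (interior T) x *\<^sub>R (\<tau> x \<bullet> h x) = indicat_real T x *\<^sub>R (AS u T x \<bullet> h x)"
      by eventually_elim (use interior_subset[of T] in \<open>auto simp: indicator_def\<close>)
  qed
qed

lemma cell_gauss:
  assumes "smooth \<phi>" "T \<in> \<T>"
  shows "(LINT x:T|lebesgue. AS u T x \<bullet> jacobian \<phi> (at x)) + (LINT x:T|lebesgue. DV u T x \<bullet> \<phi> x) = - (\<Sum>i\<le>CARD('n). fterm u \<phi> T i)"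
proof -
  interpret E: element "v T" "base T" k by (rule cell(1)[OF assms(2)])
  show ?thesis using E.gauss_asm[OF smooth_C1[OF assms(1)], of "u T"] cell(2)[OF assms(2)]
    by (simp add: fterm_def)
qed

lemma test_fun_off: "test_fun \<Omega> \<phi> \<Longrightarrow> x \<notin> \<Omega> \<Longrightarrow> \<phi> x = 0"
proof (rule ccontr)
  assume \<phi>: "test_fun \<Omega> \<phi>" and x: "x \<notin> \<Omega>" and "\<phi> x \<noteq> 0"
  then have "x \<in> closure {x. \<phi> x \<noteq> 0}" using closure_subset[of "{x. \<phi> x \<noteq> 0}"] by blast
  moreover have "closure {x. \<phi> x \<noteq> 0} \<subseteq> interior \<Omega>" using \<phi> by (simp add: test_fun_def)
  ultimately show False using x interior_subset by blast
qed

text \<open>On each cell the weak divergence tests like the piecewise one by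
  \<open>weak_div_local\<close>, which also admits \<open>\<phi>\<close> nonzero on the boundary of
  the cell; what Gauss then leaves over is the facet sum.\<close>

lemma test_sum_zero:
  assumes \<tau>: "\<tau> \<in> Hdiv \<Omega>" "pieces \<tau> u" and \<phi>: "test_fun \<Omega> \<phi>"
  shows "(\<Sum>T\<in>\<T>. \<Sum>i\<le>CARD('n). fterm u \<phi> T i) = 0"
proof -
  have sm: "smooth \<phi>" using \<phi> by (simp add: test_fun_def)
  have L: "L2_on \<Omega> \<tau>" using \<tau>(1) by (simp add: Hdiv_def)
  obtain gg where gg: "L2_on \<Omega> gg" "is_weak_div \<Omega> \<tau> gg" using \<tau>(1) by (auto simp: Hdiv_def)
  have e: "(LINT x:interior T|lebesgue. gg x \<bullet> \<phi> x) = (LINT x:T|lebesgue. DV u T x \<bullet> \<phi> x)" if T: "T \<in> \<T>" for T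
  proof -
    interpret E: element "v T" "base T" k by (rule cell(1)[OF T])
    have "AE x in lebesgue. x \<in> T \<longrightarrow> \<tau> x = AS u T x" using \<tau>(2) T by (simp add: pieces_def)
    then have "AE x in lebesgue. x \<in> interior T \<longrightarrow> \<tau> x = AS u T x"
      by eventually_elim (use interior_subset in blast)
    then show ?thesis
      using E.weak_div_local[OF _ Omega_lebesgue L _ gg sm, of "u T"] cell(2)[OF T] cell_interior[OF T] Omega(1)
      by (simp add: interior_open)
  qed
  have "(\<Sum>T\<in>\<T>. LINT x:interior T|lebesgue. \<tau> x \<bullet> jacobian \<phi> (at x)) = - (\<Sum>T\<in>\<T>. LINT x:interior T|lebesgue. gg x \<bullet> \<phi> x)"
    using gg(2) \<phi> Omega_split[OF L jacobian_continuous[OF sm]] Omega_split[OF gg(1) smooth_continuous[OF sm]]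
    by (simp add: is_weak_div_def)
  then have "(\<Sum>T\<in>\<T>. LINT x:T|lebesgue. AS u T x \<bullet> jacobian \<phi> (at x)) = - (\<Sum>T\<in>\<T>. LINT x:T|lebesgue. DV u T x \<bullet> \<phi> x)"
    by (simp add: e cell_integral[OF L \<tau>(2) jacobian_continuous[OF sm]] cong: sum.cong)
  then have "(\<Sum>T\<in>\<T>. (LINT x:T|lebesgue. AS u T x \<bullet> jacobian \<phi> (at x)) + (LINT x:T|lebesgue. DV u T x \<bullet> \<phi> x)) = 0"
    by (simp add: sum.distrib)
  then show ?thesis by (simp add: cell_gauss[OF sm] sum_negf cong: sum.cong)
qed

text \<open>Test with the jump times a bump around a point y of the relative interior. The other
  facets stay away from y, so only the two terms of the common facet remain, and they combine to the
  integral of the bump times the squared jump.\<close>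

lemma jump_free:
  assumes \<tau>: "\<tau> \<in> Hdiv \<Omega>" "pieces \<tau> u"
    and T: "T \<in> \<T>" "T' \<in> \<T>" "T \<noteq> T'" and i: "i \<le> CARD('n)" "i' \<le> CARD('n)" and F: "FC T' i' = FC T i" and x: "x \<in> FC T i"
  shows "PF u T i x *v Gr T i = PF u T' i' x *v Gr T i"
proof -
  interpret E: element "v T" "base T" k by (rule cell(1)[OF T(1)])
  interpret E': element "v T'" "base T'" k by (rule cell(1)[OF T(2)])
  define J where "J y = PF u T i y *v Gr T i - PF u T' i' y *v Gr T i" for y
  have Jc: "continuous_on UNIV J" unfolding J_def[abs_def]
    by (intro continuous_intros nice_field_mult_continuous E.field_nice E'.field_nice i)
  have Jn: "nice (\<lambda>y. J y $ m)" for m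
    using E.field_nice[OF i(1), of "u T"] E'.field_nice[OF i(2), of "u T'"]
    unfolding J_def nice_field_def matrix_vector_mult_def
    by (auto intro!: nice_diff nice_sum nice_mult nice_const)
  have "J y = 0" if y: "y \<in> RI T i" for y
  proof -
    have yF: "y \<in> FC T i" using E.ri_subset[OF i(1)] y by blast
    have yT': "y \<in> T'" using yF F E'.facet_subset cell(2)[OF T(2)] by blast
    have yO: "y \<in> \<Omega>" using ri_interior_iff[OF T(1) i(1) y] T yT' by blast
    \<comment> \<open>All cell facets other than the common one. In every cell that contains y, the
      common facet is the only one through y.\<close>
    let ?K = "\<Union>p\<in>{p\<in>\<T> \<times> {..CARD('n)}. FC (fst p) (snd p) \<noteq> FC T i}. FC (fst p) (snd p)"
    have cl: "closed ?K" using Omega(4) nsimplex.facet_closed[OF nsimp] by (intro closed_UN) auto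
    have "y \<notin> ?K"
    proof
      assume "y \<in> ?K"
      then obtain S j where S: "S \<in> \<T>" "j \<le> CARD('n)" "FC S j \<noteq> FC T i" "y \<in> FC S j" by auto
      then have "y \<in> S" using nsimplex.facet_subset[OF nsimp[OF S(1)]] cell(2)[OF S(1)] by blast
      then obtain j' where "j' \<le> CARD('n)" "FC S j' = FC T i" "y \<in> RI S j'" using ri_other[OF T(1) S(1) i(1) y] by blast
      then show False using ri_facet_eq[OF S(1) _ S(2) _ S(4), of j'] S(3) by blast
    qed
    then have "y \<in> \<Omega> \<inter> - ?K" using yO by blast
    moreover have "open (\<Omega> \<inter> - ?K)" by (rule open_Int[OF Omega(1) open_Compl[OF cl]])
    ultimately obtain r where r: "r > 0" "cball y r \<subseteq> \<Omega> \<inter> - ?K" by (meson open_contains_cball)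
    \<comment> \<open>Positive exactly on the open ball of radius r, and nice because the squared
      distance is a polynomial.\<close>
    define b where "b z = flat 0 (r\<^sup>2 - (z - y) \<bullet> (z - y))" for z
    have bn: "nice b"
    proof -
      have "nice (\<lambda>z. flat 0 (r\<^sup>2 - (\<Sum>m\<in>UNIV. (z $ m - y $ m) * (z $ m - y $ m))))"
        by (intro nice_flat nice_diff nice_const nice_sum nice_mult nice_coord)
      then show ?thesis by (simp add: b_def[abs_def] inner_vec_def)
    qed
    have bs: "{z. b z \<noteq> 0} \<subseteq> cball y r"
    proof clarify
      fix z assume "b z \<noteq> 0"
      then have "(norm (z - y))\<^sup>2 < r\<^sup>2" using flat_nonpos[of "r\<^sup>2 - (z - y) \<bullet> (z - y)" 0]
        by (force simp: b_def power2_norm_eq_inner)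
      then have "norm (z - y) < r" using r(1) by (simp add: power_less_imp_less_base)
      then show "z \<in> cball y r" by (simp add: dist_norm norm_minus_commute)
    qed
    define \<phi> where "\<phi> z = b z *\<^sub>R J z" for z
    have "smooth J" by (rule smooth_nice[OF Jn])
    then have test: "test_fun \<Omega> \<phi>" unfolding \<phi>_def[abs_def]
      by (intro test_fun_cutoff[OF bn _ compact_cball bs]) (use r(2) Omega(1) in \<open>auto simp: interior_open\<close>)
    then have \<phi>c: "continuous_on UNIV \<phi>" using smooth_continuous by (auto simp: test_fun_def)
    have off: "fterm u \<phi> S j = 0" if S: "S \<in> \<T>" "j \<le> CARD('n)" "FC S j \<noteq> FC T i" for S j
    proof (rule fterm_zero[OF S(1)])
      fix z assume "z \<in> FC S j"
      then have "z \<in> ?K" using S by (intro UN_I[of "(S, j)"]) auto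
      then have "z \<notin> cball y r" using r(2) by blast
      then show "\<phi> z = 0" using bs by (auto simp: \<phi>_def)
    qed
    have "(\<Sum>S\<in>\<T>. \<Sum>j\<le>CARD('n). fterm u \<phi> S j) = (\<Sum>p\<in>\<T> \<times> {..CARD('n)}. fterm u \<phi> (fst p) (snd p))"
      by (simp add: sum.cartesian_product split_beta)
    also have "\<dots> = (\<Sum>p\<in>{(T, i), (T', i')}. fterm u \<phi> (fst p) (snd p))"
    proof (rule sum.mono_neutral_right)
      show "finite (\<T> \<times> {..CARD('n)})" using Omega(4) by simp
      show "{(T, i), (T', i')} \<subseteq> \<T> \<times> {..CARD('n)}" using T i by simp
      show "\<forall>p\<in>\<T> \<times> {..CARD('n)} - {(T, i), (T', i')}. fterm u \<phi> (fst p) (snd p) = 0"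
      proof
        fix p assume p: "p \<in> \<T> \<times> {..CARD('n)} - {(T, i), (T', i')}"
        then obtain S j where S: "p = (S, j)" "S \<in> \<T>" "j \<le> CARD('n)" by auto
        have "FC S j \<noteq> FC T i"
        proof
          assume e: "FC S j = FC T i"
          show False
          proof (cases "S = T")
            case True
            then show False using e p S E.facet_inj[OF _ i(1)] by auto
          next
            case False
            then have "S = T'" using partner_unique[OF T(1,2) S(2) i S(3) F e T(3)] by auto
            then show False using e F p S E'.facet_inj[OF _ i(2)] by auto
          qed
        qed
        then show "fterm u \<phi> (fst p) (snd p) = 0" using off S by simp
      qed
    qed
    also have "\<dots> = fterm u \<phi> T i + fterm u \<phi> T' i'" using T(3) by simp
    also have "fterm u \<phi> T' i' = - nsimplex.FI (v T) i (\<lambda>x. indicator (FC T i) x * (\<phi> x \<bullet> (PF u T' i' x *v Gr T i)))"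
      unfolding fterm_def by (rule FI_opposite[OF T i F fterm_cont[OF T(2) i(2) \<phi>c]])
    finally have "E.FI i (\<lambda>x. indicator (FC T i) x * (\<phi> x \<bullet> (PF u T i x *v Gr T i))) =
        E.FI i (\<lambda>x. indicator (FC T i) x * (\<phi> x \<bullet> (PF u T' i' x *v Gr T i)))"
      using test_sum_zero[OF \<tau> test] by (simp add: fterm_def)
    moreover have "E.FI i (\<lambda>x. indicator (FC T i) x * (\<phi> x \<bullet> (PF u T i x *v Gr T i)) +
        (-1) * (indicator (FC T i) x * (\<phi> x \<bullet> (PF u T' i' x *v Gr T i)))) =
      E.FI i (\<lambda>x. indicator (FC T i) x * (\<phi> x \<bullet> (PF u T i x *v Gr T i))) +
      (-1) * E.FI i (\<lambda>x. indicator (FC T i) x * (\<phi> x \<bullet> (PF u T' i' x *v Gr T i)))"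
      unfolding E.FI_cmult[symmetric]
      by (intro E.FI_add i bbs_cmult E.bbs_facet fterm_cont T \<phi>c)
    moreover have "(\<lambda>x. indicator (FC T i) x * (\<phi> x \<bullet> (PF u T i x *v Gr T i)) +
        (-1) * (indicator (FC T i) x * (\<phi> x \<bullet> (PF u T' i' x *v Gr T i)))) = (\<lambda>x. indicator (FC T i) x * (\<phi> x \<bullet> J x))"
      by (auto simp: J_def inner_diff_right algebra_simps)
    ultimately have z: "E.FI i (\<lambda>x. indicator (FC T i) x * (\<phi> x \<bullet> J x)) = 0" by simp
    have "\<phi> y \<bullet> J y = 0"
    proof (rule E.FI_zero[OF i(1) _ _ z y])
      show "continuous_on UNIV (\<lambda>x. \<phi> x \<bullet> J x)" by (intro continuous_on_inner \<phi>c Jc)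
    qed (auto simp: \<phi>_def b_def flat_nonneg)
    moreover have "0 < b y" using r(1) by (simp add: b_def flat_pos)
    ultimately show ?thesis by (simp add: \<phi>_def)
  qed
  then have "J x = 0" by (rule E.facet_zero[OF i(1) _ Jc x])
  then show ?thesis by (simp add: J_def)
qed

text \<open>Each summand vanishes outside its cell, and cells overlap only in null sets. The sum of
  the piecewise divergences is a weak divergence because the facet terms cancel by
  \<open>facet_sum_zero\<close>.\<close>

lemma glob_Hdiv:
  assumes c: "\<And>T T' i i' x. T \<in> \<T> \<Longrightarrow> T' \<in> \<T> \<Longrightarrow> T \<noteq> T' \<Longrightarrow> i \<le> CARD('n) \<Longrightarrow> i' \<le> CARD('n) \<Longrightarrow> FC T' i' = FC T i \<Longrightarrow> x \<in> FC T i \<Longrightarrow>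
      PF u T i x *v Gr T i = PF u T' i' x *v Gr T i"
  defines "\<tau> \<equiv> \<lambda>x. \<Sum>T\<in>\<T>. AS u T x"
  shows "\<tau> \<in> Hdiv \<Omega>" "pieces \<tau> u"
proof -
  have E: "element (v T) (base T) k" if "T \<in> \<T>" for T by (rule cell(1)[OF that])
  define dg where "dg x = (\<Sum>T\<in>\<T>. DV u T x)" for x
  have supp: "AS u S x = 0" "DV u S x = 0" if "S \<in> \<T>" "T \<in> \<T>" "S \<noteq> T" "x \<in> interior T" for S T x
  proof -
    have "x \<notin> simplex_hull (v S)" using interior_disjoint[OF that(2,1) _ that(4)] that(3) cell(2)[OF that(1)] by blast
    then show "AS u S x = 0" "DV u S x = 0"
      using element.asm_support[OF E[OF that(1)]] element.dv_support[OF E[OF that(1)]] by auto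
  qed
  have on: "\<tau> x = AS u T x" "dg x = DV u T x" if "T \<in> \<T>" "x \<in> interior T" for T x
  proof -
    have "\<tau> x = (\<Sum>S\<in>\<T>. if S = T then AS u T x else 0)"
      unfolding \<tau>_def by (rule sum.cong) (use supp(1)[OF _ that(1) _ that(2)] in auto)
    then show "\<tau> x = AS u T x" using that(1) Omega(4) by simp
    have "dg x = (\<Sum>S\<in>\<T>. if S = T then DV u T x else 0)"
      unfolding dg_def by (rule sum.cong) (use supp(2)[OF _ that(1) _ that(2)] in auto)
    then show "dg x = DV u T x" using that(1) Omega(4) by simp
  qed
  show p: "pieces \<tau> u" unfolding pieces_def
  proof
    fix T assume T: "T \<in> \<T>"
    have "AE x in lebesgue. x \<in> T \<longrightarrow> x \<in> interior T" using nsimplex.AE_interior[OF nsimp[OF T]] cell(2)[OF T] by simp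
    then show "AE x in lebesgue. x \<in> T \<longrightarrow> \<tau> x = AS u T x" by eventually_elim (use on T in auto)
  qed
  have b: "bv \<tau>" "bv dg"
    unfolding \<tau>_def dg_def[abs_def] by (auto intro!: bv_sum element.asm_bv element.dv_bv E)
  note L = bv_L2[OF b(1) Omega_lebesgue] bv_L2[OF b(2) Omega_lebesgue]
  have "is_weak_div \<Omega> \<tau> dg"
    unfolding is_weak_div_def
  proof (intro allI impI)
    fix \<phi> :: "real^'n \<Rightarrow> real^'n" assume \<phi>: "test_fun \<Omega> \<phi>"
    then have sm: "smooth \<phi>" by (simp add: test_fun_def)
    have dT: "(LINT x:interior T|lebesgue. dg x \<bullet> \<phi> x) = (LINT x:T|lebesgue. DV u T x \<bullet> \<phi> x)" if T: "T \<in> \<T>" for T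
    proof -
      interpret E: element "v T" "base T" k by (rule E[OF T])
      show ?thesis
        unfolding set_lebesgue_integral_def
      proof (rule integral_cong_AE)
        show "(\<lambda>x. indicat_real (interior T) x *\<^sub>R (dg x \<bullet> \<phi> x)) \<in> borel_measurable lebesgue"
          using bbs_set_integrable[OF bv_inner[OF b(2) smooth_continuous[OF sm]], of "interior T"]
          by (auto simp: set_integrable_def)
        show "(\<lambda>x. indicat_real T x *\<^sub>R (DV u T x \<bullet> \<phi> x)) \<in> borel_measurable lebesgue"
          using bbs_set_integrable[OF bv_inner[OF E.dv_bv smooth_continuous[OF sm]] E.hull_lebesgue] cell(2)[OF T]
          by (auto simp: set_integrable_def)
        have "AE x in lebesgue. x \<in> T \<longrightarrow> x \<in> interior T" using E.AE_interior cell(2)[OF T] by simp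
        then show "AE x in lebesgue. indicat_real (interior T) x *\<^sub>R (dg x \<bullet> \<phi> x) = indicat_real T x *\<^sub>R (DV u T x \<bullet> \<phi> x)"
          by eventually_elim (use interior_subset[of T] on(2)[OF T] in \<open>auto simp: indicator_def\<close>)
      qed
    qed
    have "(LINT x:\<Omega>|lebesgue. \<tau> x \<bullet> jacobian \<phi> (at x)) + (LINT x:\<Omega>|lebesgue. dg x \<bullet> \<phi> x)
       = (\<Sum>T\<in>\<T>. (LINT x:T|lebesgue. AS u T x \<bullet> jacobian \<phi> (at x)) + (LINT x:T|lebesgue. DV u T x \<bullet> \<phi> x))"
      by (simp add: Omega_split[OF L(1) jacobian_continuous[OF sm]] Omega_split[OF L(2) smooth_continuous[OF sm]]
          cell_integral[OF L(1) p jacobian_continuous[OF sm]] dT sum.distrib cong: sum.cong)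
    also have "\<dots> = - (\<Sum>T\<in>\<T>. \<Sum>i\<le>CARD('n). fterm u \<phi> T i)"
      by (simp add: cell_gauss[OF sm] sum_negf cong: sum.cong)
    also have "(\<Sum>T\<in>\<T>. \<Sum>i\<le>CARD('n). fterm u \<phi> T i) = 0"
      by (rule facet_sum_zero[OF smooth_continuous[OF sm]]) (rule test_fun_off[OF \<phi>], assumption, rule c)
    finally show "(LINT x:\<Omega>|lebesgue. \<tau> x \<bullet> jacobian \<phi> (at x)) = - (LINT x:\<Omega>|lebesgue. dg x \<bullet> \<phi> x)" by simp
  qed
  moreover have "transpose (\<tau> x) = \<tau> x" for x
    unfolding \<tau>_def transpose_sum
  proof (rule sum.cong[OF refl])
    fix T assume T: "T \<in> \<T>"
    interpret E: element "v T" "base T" k by (rule E[OF T])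
    show "transpose (AS u T x) = AS u T x"
      by (simp add: E.asm_def transpose_sum transpose_scaleR E.transpose_field)
  qed
  ultimately show "\<tau> \<in> Hdiv \<Omega>" unfolding Hdiv_def using L
    by (intro CollectI conjI exI[of _ dg] AE_I2 impI)
qed

end

section \<open>Degrees of freedom\<close>

context mesh
begin

lemma mesh_facets_iff: "F \<in> mesh_facets \<T> \<longleftrightarrow> (\<exists>T\<in>\<T>. \<exists>i\<le>CARD('n). F = FC T i)"
proof -
  have "F facet_of T \<longleftrightarrow> (\<exists>i\<le>CARD('n). F = FC T i)" if T: "T \<in> \<T>" for T
  proof -
    interpret S: nsimplex "v T" by (rule nsimp[OF T])
    have Th: "T = convex hull (v T ` {..CARD('n)})" using cell(2)[OF T] by (simp add: simplex_hull_def)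
    have e: "v T ` {..CARD('n)} - {v T i} = v T ` ({..CARD('n)} - {i})" if "i \<le> CARD('n)" for i
      using that cell(4)[OF T] by (auto dest: inj_onD)
    have ne: "FC T i \<noteq> {}" if "i \<le> CARD('n)" for i using S.ri_nonempty[OF that] S.ri_subset[OF that] by blast
    have "F facet_of T \<longleftrightarrow> F \<noteq> {} \<and> (\<exists>i\<le>CARD('n). F = convex hull (v T ` {..CARD('n)} - {v T i}))"
      using facet_of_convex_hull_affine_independent[OF cell(3)[OF T], of F] Th by auto
    also have "\<dots> \<longleftrightarrow> (\<exists>i\<le>CARD('n). F = FC T i)"
      using ne by (auto simp: e S.facet_hull)
    finally show ?thesis .
  qed
  then show ?thesis by (auto simp: mesh_facets_def)
qed

text \<open>The product of the unit normal with y - p, for p on the facet, is affine in y and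
  vanishes on the facet, so it is a multiple of coordinate i.\<close>

lemma normal_scale:
  assumes T: "T \<in> \<T>" and i: "i \<le> CARD('n)"
  obtains s where "s \<noteq> 0" "n (FC T i) = s *\<^sub>R Gr T i" "norm (n (FC T i)) = 1"
proof -
  interpret S: nsimplex "v T" by (rule nsimp[OF T])
  let ?n = "n (FC T i)"
  have un: "norm ?n = 1" "\<And>x y. x \<in> FC T i \<Longrightarrow> y \<in> FC T i \<Longrightarrow> ?n \<bullet> (x - y) = 0"
    using normals mesh_facets_iff T i by (auto simp: unit_normal_def)
  obtain p where p: "p \<in> FC T i" using S.ri_nonempty[OF i] S.ri_subset[OF i] by blast
  define s where "s = ?n \<bullet> (v T i - p)"
  have h: "?n \<bullet> (y - p) = s * bary (v T) i y" for y
    unfolding s_def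
  proof (rule S.bary_facet_scale[OF i])
    show "affine_fun (\<lambda>y. ?n \<bullet> (y - p))" by (rule affine_funI[of _ ?n "- (?n \<bullet> p)"]) (simp add: inner_diff_right)
  qed (use un(2) p in blast)
  have "?n \<bullet> z = (s *\<^sub>R Gr T i) \<bullet> z" for z
    using h[of "p + z"] S.bary_add[OF i, of p z] p by (simp add: S.facet_def)
  then have e: "?n = s *\<^sub>R Gr T i" by (metis vector_eq_rdot)
  then have "s \<noteq> 0" using un(1) by auto
  then show ?thesis using that e un(1) by blast
qed

text \<open>The prism over the facet is the part of the slab of \<open>a\<close> that projects into
  it, so the surface integral is \<open>Fint\<close> for the unit normal, and rescaling to the
  gradient gives the factor 1 / |s|. The integrand is prescribed only on the relative interior,
  which suffices by \<open>ae_facet_ri\<close>.\<close>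

lemma facet_integral_eq:
  assumes T: "T \<in> \<T>" and i: "i \<le> CARD('n)" and s: "s \<noteq> 0" "a = s *\<^sub>R Gr T i" "norm a = 1"
    and h: "continuous_on UNIV h" and f: "\<And>x. x \<in> RI T i \<Longrightarrow> f x = h x"
  shows "facet_integral (FC T i) a f = nsimplex.FI (v T) i (\<lambda>x. indicator (FC T i) x * h x) / \<bar>s\<bar>"
proof -
  interpret S: nsimplex "v T" by (rule nsimp[OF T])
  let ?F = "FC T i"
  have aa: "a \<bullet> a = 1" using s(3) by (simp add: dot_square_norm)
  define p where "p = (SOME p. p \<in> ?F)"
  have "\<exists>p. p \<in> ?F" using S.ri_nonempty[OF i] S.ri_subset[OF i] by blast
  then have p: "p \<in> ?F" unfolding p_def by (rule someI_ex)
  have sb: "(x - p) \<bullet> a = s * bary (v T) i x" for x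
    using S.bary_diff[OF i, of x "x - p"] p by (simp add: s(2) S.facet_def inner_commute)
  have ax: "a \<bullet> x + s * bary (v T) i 0 = s * bary (v T) i x" for x
    using S.bary_eq[OF i, of x] by (simp add: s(2) algebra_simps)
  define P where "P x = x - (s * bary (v T) i x) *\<^sub>R a" for x
  have Pe: "P x = x - bary (v T) i x *\<^sub>R (s *\<^sub>R a)" for x by (simp add: P_def mult.commute)
  have ge: "Gr T i \<bullet> (s *\<^sub>R a) = 1" using aa by (simp add: s(2) inner_commute mult.assoc)
  have A: "x \<in> {y + t *\<^sub>R a | y t. y \<in> ?F \<and> 0 \<le> t \<and> t \<le> 1} \<longleftrightarrow> x \<in> slab a (s * bary (v T) i 0) \<and> P x \<in> ?F" for x
  proof
    assume "x \<in> {y + t *\<^sub>R a | y t. y \<in> ?F \<and> 0 \<le> t \<and> t \<le> 1}"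
    then obtain y t where y: "x = y + t *\<^sub>R a" "y \<in> ?F" "0 \<le> t" "t \<le> 1" by blast
    have "s * bary (v T) i x = t"
      using y(2) ge by (simp add: y(1) S.bary_add[OF i] S.facet_def mult.left_commute)
    then show "x \<in> slab a (s * bary (v T) i 0) \<and> P x \<in> ?F" using y by (simp add: ax P_def)
  next
    assume "x \<in> slab a (s * bary (v T) i 0) \<and> P x \<in> ?F"
    then show "x \<in> {y + t *\<^sub>R a | y t. y \<in> ?F \<and> 0 \<le> t \<and> t \<le> 1}"
      by (intro CollectI exI[of _ "P x"] exI[of _ "s * bary (v T) i x"]) (simp add: ax P_def)
  qed
  let ?G = "\<lambda>x. indicator ?F x * h x"
  let ?H = "\<lambda>x. indicat_real (slab a (s * bary (v T) i 0)) x * ?G (x - (a \<bullet> x + s * bary (v T) i 0) *\<^sub>R a)"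
  have bG: "bbs ?G" by (rule S.bbs_facet[OF i h])
  have bH: "bbs ?H" by (rule bbs_slab[OF bG aa])
  have Hm: "?H \<in> borel_measurable lebesgue" using bH by (intro measurable_completion) (simp only: bbs_def measurable_lborel2)
  let ?f = "\<lambda>x. indicat_real {y + t *\<^sub>R a | y t. y \<in> ?F \<and> 0 \<le> t \<and> t \<le> 1} x *\<^sub>R f (x - ((x - p) \<bullet> a) *\<^sub>R a)"
  have ae: "AE x in lebesgue. ?H x = ?f x"
    using S.ae_facet_ri[OF d i ge]
  proof eventually_elim
    case (elim x)
    have "?f x = (if x \<in> slab a (s * bary (v T) i 0) \<and> P x \<in> ?F then f (P x) else 0)"
      unfolding indicator_def of_bool_def A sb by (simp add: P_def)
    also have "\<dots> = ?H x"
      using elim f[of "P x"] unfolding Pe[symmetric] by (auto simp: indicator_def ax P_def)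
    finally show ?case by simp
  qed
  have "facet_integral ?F a f = integral\<^sup>L lebesgue ?f"
    by (simp add: facet_integral_def p_def[symmetric] Let_def set_lebesgue_integral_def)
  also have "\<dots> = integral\<^sup>L lebesgue ?H"
    by (rule integral_cong_AE[OF borel_measurable_AE[OF Hm ae] Hm]) (use ae in eventually_elim, erule sym)
  also have "\<dots> = integral\<^sup>L lborel ?H" using bH by (intro integral_completion) (simp only: bbs_def measurable_lborel2)
  also have "\<dots> = Fint a (s * bary (v T) i 0) ?G" by (simp add: Fint_def aa)
  also have "\<dots> = S.FI i ?G / \<bar>s\<bar>"
    unfolding s(2) S.FI_def by (rule Fint_scale[OF bG S.grad_nonzero[OF i] s(1)])
  finally show ?thesis .
qed

text \<open>By \<open>jump_free\<close> all pieces meeting at x have the same normal component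
  there. Each piece is continuous, and finitely many of them give one common radius for
  \<open>normal_trace_eqI\<close>.\<close>

lemma trace_eq:
  assumes \<tau>: "\<tau> \<in> Hdiv \<Omega>" "pieces \<tau> u" and T: "T \<in> \<T>" and i: "i \<le> CARD('n)" and x: "x \<in> RI T i"
    and a: "a = s *\<^sub>R Gr T i"
  shows "normal_trace \<Omega> \<tau> a x = PF u T i x *v a"
proof (rule normal_trace_eqI)
  have xT: "x \<in> T" by (rule ri_in_cell[OF T i x])
  show "x \<in> closure \<Omega>" using xT cell_subset[OF T] by blast
  show "set_borel_measurable lebesgue \<Omega> \<tau>" using \<tau>(1) by (simp add: Hdiv_def L2_on_def)
  fix e :: real assume e: "e > 0"
  let ?Q = "{q \<in> \<T> \<times> {..CARD('n)}. x \<in> RI (fst q) (snd q)}"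
  have same: "PF u (fst q) (snd q) x *v a = PF u T i x *v a" if q: "q \<in> ?Q" for q
  proof -
    obtain S j where S: "q = (S, j)" "S \<in> \<T>" "j \<le> CARD('n)" "x \<in> RI S j" using q by auto
    interpret S': nsimplex "v S" by (rule nsimp[OF S(2)])
    obtain j' where j': "j' \<le> CARD('n)" "FC S j' = FC T i" "x \<in> RI S j'"
      using ri_other[OF T S(2) i x ri_in_cell[OF S(2-4)]] by blast
    have jj: "j = j'" using ri_facet_eq[OF S(2) j'(1) S(3) j'(3)] S'.ri_subset[OF S(3)] S(4) by blast
    have xF: "x \<in> FC T i" using nsimplex.ri_subset[OF nsimp[OF T] i] x by blast
    show ?thesis
    proof (cases "S = T")
      case True
      then show ?thesis using S(1) jj S'.facet_inj[OF j'(1), of i] i j'(2) by simp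
    next
      case False
      then have "PF u T i x *v Gr T i = PF u S j x *v Gr T i"
        using jump_free[OF \<tau> T S(2) _ i S(3) _ xF] jj j'(2) by auto
      then show ?thesis by (simp add: a S(1) matrix_vector_mult_scaleR)
    qed
  qed
  have "\<forall>\<^sub>F y in nhds x. \<forall>q\<in>?Q. norm (PF u (fst q) (snd q) y *v a - PF u T i x *v a) < e"
  proof (rule eventually_ball_finite)
    show "finite ?Q" using Omega(4) by simp
    show "\<forall>q\<in>?Q. \<forall>\<^sub>F y in nhds x. norm (PF u (fst q) (snd q) y *v a - PF u T i x *v a) < e"
    proof
      fix q assume q: "q \<in> ?Q"
      then obtain S j where S: "q = (S, j)" "S \<in> \<T>" "j \<le> CARD('n)" by auto
      interpret E: element "v S" "base S" k by (rule cell(1)[OF S(2)])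
      have "isCont (\<lambda>y. PF u S j y *v a) x"
        using nice_field_mult_continuous[OF E.field_nice[OF S(3), of "u S"], of UNIV a]
        by (simp add: continuous_on_eq_continuous_at)
      then have "((\<lambda>y. PF u S j y *v a) \<longlongrightarrow> PF u S j x *v a) (nhds x)"
        unfolding isCont_def by (rule tendsto_at_iff_tendsto_nhds[where g = "\<lambda>y. PF u S j y *v a", THEN iffD1])
      then have "\<forall>\<^sub>F y in nhds x. dist (PF u S j y *v a) (PF u S j x *v a) < e" using e by (rule tendstoD)
      then show "\<forall>\<^sub>F y in nhds x. norm (PF u (fst q) (snd q) y *v a - PF u T i x *v a) < e"
        using same[OF q] by (simp add: S(1) dist_norm)
    qed
  qed
  then obtain \<delta> where \<delta>: "\<delta> > 0" "\<And>y q. dist y x < \<delta> \<Longrightarrow> q \<in> ?Q \<Longrightarrow> norm (PF u (fst q) (snd q) y *v a - PF u T i x *v a) < e"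
    unfolding eventually_nhds_metric by blast
  obtain r where r: "r > 0" "AE y in lebesgue. y \<in> ball x r \<and> y \<in> \<Omega> \<longrightarrow>
    (\<exists>T'\<in>\<T>. \<exists>i'\<le>CARD('n). x \<in> RI T' i' \<and> y \<in> interior (subT (v T') i'))" using near_cells[OF T i x] by blast
  have "AE y in lebesgue. \<forall>S\<in>\<T>. y \<in> S \<longrightarrow> \<tau> y = AS u S y"
    using \<tau>(2) by (intro AE_finite_allI[OF Omega(4)]) (simp add: pieces_def)
  with r(2) have "AE y in lebesgue. y \<in> ball x (min r \<delta>) \<and> y \<in> \<Omega> \<longrightarrow> norm (\<tau> y *v a - PF u T i x *v a) \<le> e"
  proof eventually_elim
    case (elim y)
    show ?case
    proof
      assume y: "y \<in> ball x (min r \<delta>) \<and> y \<in> \<Omega>"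
      then obtain S j where S: "S \<in> \<T>" "j \<le> CARD('n)" "x \<in> RI S j" "y \<in> interior (subT (v S) j)" using elim(1) by auto
      interpret E: element "v S" "base S" k by (rule cell(1)[OF S(1)])
      have "y \<in> S" using S(2,4) interior_subset E.hull_sub cell(2)[OF S(1)] by blast
      then have "\<tau> y = PF u S j y" using elim(2) S E.asm_on[OF S(2,4)] by simp
      then show "norm (\<tau> y *v a - PF u T i x *v a) \<le> e"
        using \<delta>(2)[of y "(S, j)"] y S by (simp add: dist_commute)
    qed
  qed
  then show "\<exists>\<delta>>0. AE y in lebesgue. y \<in> ball x \<delta> \<and> y \<in> \<Omega> \<longrightarrow> norm (\<tau> y *v a - PF u T i x *v a) \<le> e"
    using r(1) \<delta>(1) by (intro exI[of _ "min r \<delta>"]) simp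
qed

lemma facet_dof:
  assumes \<tau>: "\<tau> \<in> Hdiv \<Omega>" "pieces \<tau> u" and T: "T \<in> \<T>" and i: "i \<le> CARD('n)"
    and s: "s \<noteq> 0" "n (FC T i) = s *\<^sub>R Gr T i" "norm (n (FC T i)) = 1" and q: "continuous_on UNIV q"
  shows "facet_integral (FC T i) (n (FC T i)) (\<lambda>x. normal_trace \<Omega> \<tau> (n (FC T i)) x \<bullet> (indicat_real (FC T i) x *\<^sub>R q x))
    = nsimplex.FI (v T) i (\<lambda>x. indicator (FC T i) x * ((PF u T i x *v n (FC T i)) \<bullet> q x)) / \<bar>s\<bar>"
proof (rule facet_integral_eq[OF T i s])
  show "continuous_on UNIV (\<lambda>x. (PF u T i x *v n (FC T i)) \<bullet> q x)"
    using fterm_cont[OF T i q] by (simp add: inner_commute)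
  show "normal_trace \<Omega> \<tau> (n (FC T i)) x \<bullet> (indicat_real (FC T i) x *\<^sub>R q x) = (PF u T i x *v n (FC T i)) \<bullet> q x"
    if "x \<in> RI T i" for x
    using trace_eq[OF \<tau> T i that s(2)] nsimplex.ri_subset[OF nsimp[OF T] i] that by auto
qed

lemma polys_vec_continuous:
  assumes "\<forall>j. (\<lambda>x. q x $ j) \<in> polys r" shows "continuous_on UNIV q"
  by (rule continuous_on_vec_nth_iff, rule nice_continuous, rule nice_polys) (use assms in blast)

text \<open>Supplies the finite spanning set for \<open>riesz_span\<close> on a facet.\<close>

lemma poly_vec_on_span:
  fixes F :: "(real^'n) set"
  shows "\<exists>B. finite B \<and> poly_vec_on F r = span B"
proof -
  obtain T where "T \<in> \<T>"
    using domain Omega(3) closure_eq_empty[of \<Omega>] by (fastforce simp: polyhedral_domain_def)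
  then interpret S: nsimplex "v T" by (rule nsimp)
  define b where "b t = (\<lambda>x. indicat_real F x *\<^sub>R (S.bmono (snd t) x *\<^sub>R (axis (fst t) 1 :: real^'n)))" for t
  let ?I = "(UNIV :: 'n set) \<times> MI {..CARD('n)} r"
  have fin: "finite ?I" using S.finite_MI_all by simp
  have "poly_vec_on F r = span (b ` ?I)"
  proof (intro equalityI subsetI)
    fix w assume "w \<in> poly_vec_on F r"
    then obtain q where q: "w = (\<lambda>x. indicat_real F x *\<^sub>R q x)" "\<forall>j. (\<lambda>x. q x $ j) \<in> polys r"
      unfolding poly_vec_on_def by blast
    have "\<forall>j. \<exists>c. \<forall>x. q x $ j = (\<Sum>\<alpha>\<in>MI {..CARD('n)} r. c \<alpha> * S.bmono \<alpha> x)"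
    proof
      fix j
      obtain c where "\<And>x. q x $ j = (\<Sum>\<alpha>\<in>MI {..CARD('n)} r. c \<alpha> * S.bmono \<alpha> x)"
        by (rule S.polys_expand[OF q(2)[rule_format, of j]]) (rule that)
      then show "\<exists>c. \<forall>x. q x $ j = (\<Sum>\<alpha>\<in>MI {..CARD('n)} r. c \<alpha> * S.bmono \<alpha> x)" by blast
    qed
    then obtain c where c: "\<And>j x. q x $ j = (\<Sum>\<alpha>\<in>MI {..CARD('n)} r. c j \<alpha> * S.bmono \<alpha> x)" by metis
    have "q x = (\<Sum>t\<in>?I. c (fst t) (snd t) *\<^sub>R (S.bmono (snd t) x *\<^sub>R axis (fst t) 1))" for x
    proof -
      have "q x = (\<Sum>j\<in>UNIV. q x $ j *\<^sub>R axis j 1)"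
        using basis_expansion[of "q x"] by (simp add: scalar_mult_eq_scaleR)
      then show ?thesis by (simp add: c scaleR_sum_left sum.cartesian_product split_beta)
    qed
    then have "w = (\<Sum>t\<in>?I. c (fst t) (snd t) *\<^sub>R b t)"
      by (simp add: q(1) b_def fun_eq_iff sum_fun_apply scaleR_sum_right mult.left_commute)
    also have "\<dots> \<in> span (b ` ?I)" by (intro span_sum span_scale) (auto intro: span_base)
    finally show "w \<in> span (b ` ?I)" .
  next
    fix w assume "w \<in> span (b ` ?I)"
    then obtain c where "w = (\<Sum>t\<in>?I. c t *\<^sub>R b t)" unfolding span_image_finite[OF fin] by blast
    then have w: "w = (\<lambda>x. indicat_real F x *\<^sub>R (\<Sum>t\<in>?I. (c t * S.bmono (snd t) x) *\<^sub>R axis (fst t) 1))"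
      by (simp add: b_def fun_eq_iff sum_fun_apply scaleR_sum_right mult.left_commute)
    have "(\<lambda>x. (\<Sum>t\<in>?I. (c t * S.bmono (snd t) x) *\<^sub>R (axis (fst t) 1 :: real^'n)) $ j) \<in> polys r" for j
    proof -
      have "(\<lambda>x. \<Sum>t\<in>?I. (c t * (axis (fst t) 1 :: real^'n) $ j) * S.bmono (snd t) x) \<in> polys r"
        by (intro polys_sum polys_cmult S.bmono_polys) auto
      then show ?thesis by (simp add: mult.commute mult.left_commute)
    qed
    then show "w \<in> poly_vec_on F r" unfolding poly_vec_on_def w by fast
  qed
  then show ?thesis using fin by blast
qed

text \<open>The L2 product on the facet is definite on restricted polynomials, since continuity
  turns a zero integral of the square into vanishing on the facet. The functional is therefore
  represented by a polynomial w, the normal trace to be realised.\<close>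

lemma facet_riesz:
  assumes T: "T \<in> \<T>" and i: "i \<le> CARD('n)" and \<nu>: "linear (\<nu> :: (real^'n \<Rightarrow> real^'n) \<Rightarrow> real)"
  shows "\<exists>w. (\<forall>j. (\<lambda>x. w x $ j) \<in> polys k) \<and> (\<forall>q. (\<forall>j. (\<lambda>x. q x $ j) \<in> polys k) \<longrightarrow>
    facet_integral (FC T i) (n (FC T i)) (\<lambda>x. w x \<bullet> q x) = \<nu> (\<lambda>x. indicat_real (FC T i) x *\<^sub>R q x))"
proof -
  interpret S: nsimplex "v T" by (rule nsimp[OF T])
  obtain s where s: "s \<noteq> 0" "n (FC T i) = s *\<^sub>R Gr T i" "norm (n (FC T i)) = 1" by (rule normal_scale[OF T i])
  define a where "a w q = facet_integral (FC T i) (n (FC T i)) (\<lambda>x. w x \<bullet> q x)" for w q :: "real^'n \<Rightarrow> real^'n"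
  have aF: "a w q = S.FI i (\<lambda>x. indicator (FC T i) x * (w' x \<bullet> q' x)) / \<bar>s\<bar>"
    if "\<And>x. x \<in> RI T i \<Longrightarrow> w x = w' x" "\<And>x. x \<in> RI T i \<Longrightarrow> q x = q' x" "continuous_on UNIV w'" "continuous_on UNIV q'"
    for w q w' q'
    unfolding a_def by (rule facet_integral_eq[OF T i s continuous_on_inner[OF that(3,4)]]) (simp add: that)
  have on: "x \<in> RI T i \<Longrightarrow> indicat_real (FC T i) x *\<^sub>R z = z" for x and z :: "real^'n"
    using S.ri_subset[OF i] by auto
  \<comment> \<open>Cutting off at the facet may destroy continuity; this keeps a continuous
    extension at hand that agrees on the relative interior.\<close>
  have hat: "\<exists>q'. q = (\<lambda>x. indicat_real (FC T i) x *\<^sub>R q' x) \<and> continuous_on UNIV q' \<and> (\<forall>x\<in>RI T i. q x = q' x)"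
    if "q \<in> poly_vec_on (FC T i) k" for q
    using that polys_vec_continuous on unfolding poly_vec_on_def by blast
  have add: "a (x + y) q = a x q + a y q" "a q (x + y) = a q x + a q y" "a (c *\<^sub>R x) q = c * a x q" "a q (c *\<^sub>R x) = c * a q x"
    if x: "x \<in> poly_vec_on (FC T i) k" and y: "y \<in> poly_vec_on (FC T i) k" and q: "q \<in> poly_vec_on (FC T i) k" for x y q c
  proof -
    obtain x' where x': "continuous_on UNIV x'" "\<forall>z\<in>RI T i. x z = x' z" using hat[OF x] by blast
    obtain y' where y': "continuous_on UNIV y'" "\<forall>z\<in>RI T i. y z = y' z" using hat[OF y] by blast
    obtain q' where q': "continuous_on UNIV q'" "\<forall>z\<in>RI T i. q z = q' z" using hat[OF q] by blast
    have b: "bbs (\<lambda>z. indicator (FC T i) z * (x' z \<bullet> q' z))" "bbs (\<lambda>z. indicator (FC T i) z * (y' z \<bullet> q' z))"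
      by (intro S.bbs_facet i continuous_on_inner x'(1) y'(1) q'(1))+
    have e: "a x q = S.FI i (\<lambda>z. indicator (FC T i) z * (x' z \<bullet> q' z)) / \<bar>s\<bar>"
       "a y q = S.FI i (\<lambda>z. indicator (FC T i) z * (y' z \<bullet> q' z)) / \<bar>s\<bar>"
       "a (x + y) q = S.FI i (\<lambda>z. indicator (FC T i) z * ((x' z + y' z) \<bullet> q' z)) / \<bar>s\<bar>"
       "a (c *\<^sub>R x) q = S.FI i (\<lambda>z. indicator (FC T i) z * ((c *\<^sub>R x' z) \<bullet> q' z)) / \<bar>s\<bar>"
      by (rule aF; use x' y' q' in \<open>auto intro!: continuous_intros\<close>)+
    have comm: "a q z = a z q" for z by (simp add: a_def inner_commute)
    show 1: "a (x + y) q = a x q + a y q"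
      unfolding e using S.FI_add[OF i b] by (simp add: inner_add_left distrib_left add_divide_distrib)
    show 2: "a (c *\<^sub>R x) q = c * a x q"
      unfolding e using S.FI_cmult[of i c "\<lambda>z. indicator (FC T i) z * (x' z \<bullet> q' z)"] by (simp add: mult.left_commute)
    show "a q (x + y) = a q x + a q y" "a q (c *\<^sub>R x) = c * a q x" unfolding comm by (fact 1, fact 2)
  qed
  obtain B where B: "finite B" "poly_vec_on (FC T i) k = span B" using poly_vec_on_span by blast
  have "\<exists>w\<in>span B. \<forall>q\<in>span B. a w q = \<nu> q"
  proof (rule riesz_span[OF B(1)])
    show "lin_on (span B) (a x)" "lin_on (span B) (\<lambda>y. a y x)" if "x \<in> span B" for x
      using add that unfolding lin_on_def B(2) by blast+
    show "lin_on (span B) \<nu>" unfolding lin_on_def using linear_add[OF \<nu>] linear_cmul[OF \<nu>] by simp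
    show "x = 0" if x: "x \<in> span B" "a x x = 0" for x
    proof -
      obtain x' where x': "x = (\<lambda>z. indicat_real (FC T i) z *\<^sub>R x' z)" "continuous_on UNIV x'" "\<forall>z\<in>RI T i. x z = x' z"
        using hat x(1) B(2) by blast
      have "S.FI i (\<lambda>z. indicator (FC T i) z * (x' z \<bullet> x' z)) = 0"
        using aF[of x x' x x'] x' x(2) s(1) by simp
      then have "x' z \<bullet> x' z = 0" if "z \<in> RI T i" for z
        by (rule S.FI_zero[OF i _ _ _ that, rotated 2]) (auto intro!: continuous_intros x'(2))
      then have "x' z = 0" if "z \<in> FC T i" for z using S.facet_zero[OF i _ x'(2) that] by simp
      then show ?thesis by (auto simp: x'(1) indicator_def fun_eq_iff)
    qed
  qed
  then obtain w where w: "w \<in> poly_vec_on (FC T i) k" "\<forall>q\<in>poly_vec_on (FC T i) k. a w q = \<nu> q" using B(2) by blast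
  obtain w' where w': "w = (\<lambda>x. indicat_real (FC T i) x *\<^sub>R w' x)" "\<forall>j. (\<lambda>x. w' x $ j) \<in> polys k"
    using w(1) unfolding poly_vec_on_def by blast
  have "facet_integral (FC T i) (n (FC T i)) (\<lambda>x. w' x \<bullet> q x) = \<nu> (\<lambda>x. indicat_real (FC T i) x *\<^sub>R q x)"
    if q: "\<forall>j. (\<lambda>x. q x $ j) \<in> polys k" for q
  proof -
    note c = polys_vec_continuous[OF w'(2)] polys_vec_continuous[OF q]
    have "(\<lambda>x. indicat_real (FC T i) x *\<^sub>R q x) \<in> poly_vec_on (FC T i) k" using q unfolding poly_vec_on_def by blast
    then have "a w (\<lambda>x. indicat_real (FC T i) x *\<^sub>R q x) = \<nu> (\<lambda>x. indicat_real (FC T i) x *\<^sub>R q x)" using w(2) by blast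
    moreover have "a w (\<lambda>x. indicat_real (FC T i) x *\<^sub>R q x) = a w' q"
      by (subst (1 2) aF[of _ w' _ q, OF _ _ c]) (auto simp: w'(1) on)
    ultimately show ?thesis by (simp add: a_def)
  qed
  then show ?thesis using w'(2) by blast
qed

lemma moment_integrable:
  assumes T: "T \<in> \<T>" and q: "q \<in> poly_sym (v T) r"
  shows "set_integrable lebesgue T (\<lambda>x. AS u T x \<bullet> q x)"
proof -
  interpret E: element "v T" "base T" k by (rule cell(1)[OF T])
  obtain h where h: "q = on_split (v T) h" "continuous_on UNIV h" by (rule E.poly_symE[OF q]) (rule that)
  have "AS u T x \<bullet> q x = AS u T x \<bullet> h x" for x
    using E.asm_off[of x "PF u T"] by (auto simp: h(1) on_split_def indicator_def)
  then show ?thesis using bbs_set_integrable[OF bv_inner[OF E.asm_bv h(2)] E.hull_lebesgue] cell(2)[OF T] by simp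
qed

lemma moment_eq:
  assumes \<tau>: "pieces \<tau> u" and T: "T \<in> \<T>" and q: "q \<in> poly_sym (v T) r"
  shows "(LINT x:T|lebesgue. \<tau> x \<bullet> q x) = (LINT x:T|lebesgue. AS u T x \<bullet> q x)"
proof -
  have m: "(\<lambda>x. indicat_real T x *\<^sub>R (AS u T x \<bullet> q x)) \<in> borel_measurable lebesgue"
    using moment_integrable[OF T q, of u] by (auto simp: set_integrable_def)
  have "AE x in lebesgue. x \<in> T \<longrightarrow> \<tau> x = AS u T x" using \<tau> T by (simp add: pieces_def)
  then have ae: "AE x in lebesgue. indicat_real T x *\<^sub>R (AS u T x \<bullet> q x) = indicat_real T x *\<^sub>R (\<tau> x \<bullet> q x)"
    by eventually_elim (auto simp: indicator_def)
  show ?thesis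
    unfolding set_lebesgue_integral_def
    by (rule integral_cong_AE[OF borel_measurable_AE[OF m ae] m]) (use ae in eventually_elim, fastforce)
qed

lemma Sigma_glob_pieces:
  assumes "\<tau> \<in> Sigma_glob \<Omega> \<T> v base k" obtains u where "\<tau> \<in> Hdiv \<Omega>" "pieces \<tau> u"
proof -
  have "\<exists>w. AE x in lebesgue. x \<in> T \<longrightarrow> \<tau> x = nsimplex.asm (v T) (element.field (v T) (base T) k w) x" if T: "T \<in> \<T>" for T
  proof -
    interpret E: element "v T" "base T" k by (rule cell(1)[OF T])
    obtain \<sigma> where \<sigma>: "\<sigma> \<in> Sigma_loc (v T) (base T) k" "AE x in lebesgue. x \<in> T \<longrightarrow> \<tau> x = \<sigma> x"
      using assms T unfolding Sigma_glob_def by blast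
    show ?thesis using \<sigma>(2) \<sigma>(1)[unfolded E.Sigma_loc_field] by blast
  qed
  then have "\<forall>T\<in>\<T>. \<exists>w. AE x in lebesgue. x \<in> T \<longrightarrow> \<tau> x = nsimplex.asm (v T) (element.field (v T) (base T) k w) x" by blast
  from bchoice[OF this] have "\<exists>u. \<forall>T\<in>\<T>. AE x in lebesgue. x \<in> T \<longrightarrow> \<tau> x = AS u T x" .
  then show ?thesis using that assms by (auto simp: Sigma_glob_def pieces_def)
qed

text \<open>On each facet the difference of the normal components is itself an admissible test
  polynomial, hence orthogonal to itself and 0. The difference is then a bubble on every cell, and
  \<open>moment_unique\<close> applies.\<close>

lemma uniqueness:
  assumes \<tau>: "\<tau> \<in> Sigma_glob \<Omega> \<T> v base k" "has_dofs \<Omega> \<T> v n k \<nu> \<mu> \<tau>"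
    and \<tau>': "\<tau>' \<in> Sigma_glob \<Omega> \<T> v base k" "has_dofs \<Omega> \<T> v n k \<nu> \<mu> \<tau>'"
  shows "AE x in lebesgue. x \<in> \<Omega> \<longrightarrow> \<tau>' x = \<tau> x"
proof -
  obtain u where u: "\<tau> \<in> Hdiv \<Omega>" "pieces \<tau> u" by (rule Sigma_glob_pieces[OF \<tau>(1)])
  obtain u' where u': "\<tau>' \<in> Hdiv \<Omega>" "pieces \<tau>' u'" by (rule Sigma_glob_pieces[OF \<tau>'(1)])
  have eq: "AS u T = AS u' T" if T: "T \<in> \<T>" for T
  proof -
    interpret E: element "v T" "base T" k by (rule cell(1)[OF T])
    define \<delta> where "\<delta> z = u T z - u' T z" for z
    have dz: "E.field \<delta> i x *v Gr T i = 0" if i: "i \<le> CARD('n)" and x: "x \<in> RI T i" for i x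
    proof -
      obtain s where s: "s \<noteq> 0" "n (FC T i) = s *\<^sub>R Gr T i" "norm (n (FC T i)) = 1" by (rule normal_scale[OF T i])
      let ?a = "n (FC T i)"
      define q where "q x = E.field \<delta> i x *v ?a" for x
      have qp: "\<forall>j. (\<lambda>x. q x $ j) \<in> polys k"
      proof
        fix j
        have "(\<lambda>x. \<Sum>m\<in>UNIV. ?a $ m * E.field \<delta> i x $ j $ m) \<in> polys k"
          by (intro polys_sum polys_cmult E.field_polys i)
        then show "(\<lambda>x. q x $ j) \<in> polys k" by (simp add: q_def matrix_vector_mult_def mult.commute)
      qed
      note qc = polys_vec_continuous[OF qp]
      let ?q = "\<lambda>x. indicat_real (FC T i) x *\<^sub>R q x"
      have F: "FC T i \<in> mesh_facets \<T>" using T i mesh_facets_iff by blast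
      have "?q \<in> poly_vec_on (FC T i) k" using qp unfolding poly_vec_on_def by blast
      note qq = F this
      have "facet_integral (FC T i) ?a (\<lambda>x. normal_trace \<Omega> \<tau> ?a x \<bullet> ?q x)
          = facet_integral (FC T i) ?a (\<lambda>x. normal_trace \<Omega> \<tau>' ?a x \<bullet> ?q x)"
        by (rule trans[OF \<tau>(2)[unfolded has_dofs_def, THEN conjunct1, rule_format, OF qq]
          \<tau>'(2)[unfolded has_dofs_def, THEN conjunct1, rule_format, OF qq, symmetric]])
      then have e: "E.FI i (\<lambda>x. indicator (FC T i) x * ((PF u T i x *v ?a) \<bullet> q x)) =
          E.FI i (\<lambda>x. indicator (FC T i) x * ((PF u' T i x *v ?a) \<bullet> q x))"
        using facet_dof[OF u T i s qc] facet_dof[OF u' T i s qc] s(1) by simp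
      have c: "continuous_on UNIV (\<lambda>x. (PF w T i x *v ?a) \<bullet> q x)" for w
        using fterm_cont[OF T i qc] by (simp add: inner_commute)
      have "E.FI i (\<lambda>x. indicator (FC T i) x * ((PF u T i x *v ?a) \<bullet> q x) +
          (-1) * (indicator (FC T i) x * ((PF u' T i x *v ?a) \<bullet> q x))) =
        E.FI i (\<lambda>x. indicator (FC T i) x * ((PF u T i x *v ?a) \<bullet> q x)) +
        (-1) * E.FI i (\<lambda>x. indicator (FC T i) x * ((PF u' T i x *v ?a) \<bullet> q x))"
        unfolding E.FI_cmult[symmetric] by (intro E.FI_add i bbs_cmult E.bbs_facet c)
      moreover have "(\<lambda>x. indicator (FC T i) x * ((PF u T i x *v ?a) \<bullet> q x) +
          (-1) * (indicator (FC T i) x * ((PF u' T i x *v ?a) \<bullet> q x))) = (\<lambda>x. indicator (FC T i) x * (q x \<bullet> q x))"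
      proof
        fix x
        have "q x = PF u T i x *v ?a - PF u' T i x *v ?a"
          by (simp add: q_def \<delta>_def[abs_def] E.field_diff matrix_vector_mult_diff_rdistrib)
        then have "q x \<bullet> q x = (PF u T i x *v ?a) \<bullet> q x - (PF u' T i x *v ?a) \<bullet> q x" by (simp add: inner_diff_left)
        then show "indicator (FC T i) x * ((PF u T i x *v ?a) \<bullet> q x) +
          (-1) * (indicator (FC T i) x * ((PF u' T i x *v ?a) \<bullet> q x)) = indicator (FC T i) x * (q x \<bullet> q x)"
          by (simp add: right_diff_distrib)
      qed
      ultimately have "E.FI i (\<lambda>x. indicator (FC T i) x * (q x \<bullet> q x)) = 0" using e by simp
      then have "q x \<bullet> q x = 0"
        by (rule E.FI_zero[OF i _ _ _ x, rotated 2]) (auto intro!: continuous_intros qc)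
      then show ?thesis using s(1) by (simp add: q_def s(2) matrix_vector_mult_scaleR)
    qed
    have asm_d: "E.asm (E.field \<delta>) x = AS u T x - AS u' T x" for x
      by (simp add: E.asm_def \<delta>_def[abs_def] E.field_diff scaleR_diff_right sum_subtractf)
    have "E.asm (E.field \<delta>) = 0"
    proof (rule E.moment_unique)
      show "\<forall>z\<in>(E.IB \<union> E.IP) - E.IBB. \<delta> z = 0" using dz E.zero_trace_iff by blast
      fix q assume q: "q \<in> poly_sym (v T) (k - 2)"
      have "(LINT x:T|lebesgue. AS u T x \<bullet> q x) = (LINT x:T|lebesgue. AS u' T x \<bullet> q x)"
        unfolding moment_eq[OF u(2) T q, symmetric] moment_eq[OF u'(2) T q, symmetric]
        by (rule trans[OF \<tau>(2)[unfolded has_dofs_def, THEN conjunct2, rule_format, OF T q]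
          \<tau>'(2)[unfolded has_dofs_def, THEN conjunct2, rule_format, OF T q, symmetric]])
      then show "(LINT x:simplex_hull (v T)|lebesgue. E.asm (E.field \<delta>) x \<bullet> q x) = 0"
        using set_integral_diff(2)[OF moment_integrable[OF T q, of u] moment_integrable[OF T q, of u']]
        by (simp add: cell(2)[OF T] asm_d inner_diff_left)
    qed
    then show ?thesis using asm_d by (auto simp: fun_eq_iff)
  qed
  have "AE x in lebesgue. \<forall>T\<in>\<T>. (x \<in> T \<longrightarrow> \<tau> x = AS u T x) \<and> (x \<in> T \<longrightarrow> \<tau>' x = AS u' T x)"
    using u(2) u'(2) by (intro AE_finite_allI[OF Omega(4)] AE_conjI) (auto simp: pieces_def)
  then show ?thesis
  proof eventually_elim
    case (elim x)
    show ?case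
    proof
      assume "x \<in> \<Omega>"
      then obtain T where "T \<in> \<T>" "x \<in> T" using Omega(3) closure_subset by blast
      then show "\<tau>' x = \<tau> x" using elim eq by auto
    qed
  qed
qed

text \<open>The facet traces are fixed first by \<open>facet_solve\<close>; a bubble then corrects
  the moments and leaves the traces unchanged.\<close>

lemma local_solve:
  assumes T: "T \<in> \<T>" and w: "\<And>i j. (\<lambda>x. w i x $ j) \<in> polys k" and \<mu>: "linear \<mu>"
  shows "\<exists>u. (\<forall>i\<le>CARD('n). \<forall>x\<in>FC T i. element.field (v T) (base T) k u i x *v n (FC T i) = w i x) \<and>
    (\<forall>q\<in>poly_sym (v T) (k - 2). (LINT x:T|lebesgue. nsimplex.asm (v T) (element.field (v T) (base T) k u) x \<bullet> q x) = \<mu> q)"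
proof -
  interpret E: element "v T" "base T" k by (rule cell(1)[OF T])
  have "\<forall>i. \<exists>s. i \<le> CARD('n) \<longrightarrow> s \<noteq> 0 \<and> n (FC T i) = s *\<^sub>R Gr T i"
    using normal_scale[OF T] by metis
  then obtain s where s: "\<And>i. i \<le> CARD('n) \<Longrightarrow> s i \<noteq> 0" "\<And>i. i \<le> CARD('n) \<Longrightarrow> n (FC T i) = s i *\<^sub>R Gr T i" by metis
  have "(\<lambda>x. ((1 / s i) *\<^sub>R w i x) $ j) \<in> polys k" for i j
    using polys_cmult[OF w, of "1 / s i"] by simp
  then obtain u0 where u0: "\<forall>i\<le>CARD('n). \<forall>x\<in>FC T i. E.field u0 i x *v Gr T i = (1 / s i) *\<^sub>R w i x"
    using E.facet_solve[of "\<lambda>i x. (1 / s i) *\<^sub>R w i x"] by blast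
  have I: "set_integrable lebesgue T (\<lambda>x. E.asm (E.field u) x \<bullet> q x)" if "q \<in> poly_sym (v T) (k - 2)" for u q
    using moment_integrable[OF T that, of "\<lambda>_. u"] by simp
  have "lin_on (poly_sym (v T) (k - 2)) (\<lambda>q. \<mu> q - (LINT x:T|lebesgue. E.asm (E.field u0) x \<bullet> q x))"
    unfolding lin_on_def using I[of _ u0]
    by (auto simp: inner_add_right set_integral_add(2) linear_add[OF \<mu>] linear_cmul[OF \<mu>] algebra_simps)
  then obtain u1 where u1: "\<forall>z\<in>(E.IB \<union> E.IP) - E.IBB. u1 z = 0"
    "\<forall>q\<in>poly_sym (v T) (k - 2). (LINT x:T|lebesgue. E.asm (E.field u1) x \<bullet> q x) = \<mu> q - (LINT x:T|lebesgue. E.asm (E.field u0) x \<bullet> q x)"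
    using E.moment_solve unfolding cell(2)[OF T] by blast
  have z1: "E.field u1 i x *v Gr T i = 0" if "i \<le> CARD('n)" "x \<in> FC T i" for i x
    using E.facet_zero[OF that(1) _ nice_field_mult_continuous[OF E.field_nice[OF that(1)]] that(2)]
      E.zero_trace_iff[of u1] u1(1) that(1) by blast
  define u where "u z = u0 z + u1 z" for z
  have f: "E.field u i x = E.field u0 i x + E.field u1 i x" for i x by (simp add: u_def[abs_def] E.field_add)
  have "E.field u i x *v n (FC T i) = w i x" if "i \<le> CARD('n)" "x \<in> FC T i" for i x
    using u0 z1[OF that] that s by (simp add: f matrix_vector_mult_add_rdistrib matrix_vector_mult_scaleR)
  moreover have "(LINT x:T|lebesgue. E.asm (E.field u) x \<bullet> q x) = \<mu> q" if q: "q \<in> poly_sym (v T) (k - 2)" for q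
  proof -
    have "E.asm (E.field u) x = E.asm (E.field u0) x + E.asm (E.field u1) x" for x
      by (simp add: E.asm_def f scaleR_add_right sum.distrib)
    then show ?thesis using set_integral_add(2)[OF I[OF q, of u0] I[OF q, of u1]] u1(2) q by (simp add: inner_add_left)
  qed
  ultimately show ?thesis by blast
qed

text \<open>Each facet receives one polynomial, shared by the adjacent cells and referring to the
  one normal \<open>n F\<close>. The cells can then be solved independently, and their traces match
  by construction, which is what \<open>glob_Hdiv\<close> asks for.\<close>

lemma existence:
  assumes \<nu>: "\<forall>F\<in>mesh_facets \<T>. linear (\<nu> F)" and \<mu>: "\<forall>T\<in>\<T>. linear (\<mu> T)"
  shows "\<exists>\<tau>\<in>Sigma_glob \<Omega> \<T> v base k. has_dofs \<Omega> \<T> v n k \<nu> \<mu> \<tau>"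
proof -
  have "\<forall>F. \<exists>w. F \<in> mesh_facets \<T> \<longrightarrow> (\<forall>j. (\<lambda>x. w x $ j) \<in> polys k) \<and> (\<forall>q. (\<forall>j. (\<lambda>x. q x $ j) \<in> polys k) \<longrightarrow>
    facet_integral F (n F) (\<lambda>x. w x \<bullet> q x) = \<nu> F (\<lambda>x. indicat_real F x *\<^sub>R q x))"
  proof
    fix F
    show "\<exists>w. F \<in> mesh_facets \<T> \<longrightarrow> (\<forall>j. (\<lambda>x. w x $ j) \<in> polys k) \<and> (\<forall>q. (\<forall>j. (\<lambda>x. q x $ j) \<in> polys k) \<longrightarrow>
      facet_integral F (n F) (\<lambda>x. w x \<bullet> q x) = \<nu> F (\<lambda>x. indicat_real F x *\<^sub>R q x))"
    proof (cases "F \<in> mesh_facets \<T>")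
      case True
      then obtain T i where "T \<in> \<T>" "i \<le> CARD('n)" "F = FC T i" using mesh_facets_iff by blast
      then show ?thesis using facet_riesz[of T i "\<nu> F"] \<nu> True by auto
    qed simp
  qed
  from choice[OF this] obtain w where w: "\<And>F j. F \<in> mesh_facets \<T> \<Longrightarrow> (\<lambda>x. w F x $ j) \<in> polys k"
    "\<And>F q. F \<in> mesh_facets \<T> \<Longrightarrow> (\<forall>j. (\<lambda>x. q x $ j) \<in> polys k) \<Longrightarrow>
      facet_integral F (n F) (\<lambda>x. w F x \<bullet> q x) = \<nu> F (\<lambda>x. indicat_real F x *\<^sub>R q x)" by blast
  have "\<forall>T\<in>\<T>. \<exists>u. (\<forall>i\<le>CARD('n). \<forall>x\<in>FC T i. element.field (v T) (base T) k u i x *v n (FC T i) = w (FC T i) x) \<and>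
    (\<forall>q\<in>poly_sym (v T) (k - 2). (LINT x:T|lebesgue. nsimplex.asm (v T) (element.field (v T) (base T) k u) x \<bullet> q x) = \<mu> T q)"
  proof
    fix T assume T: "T \<in> \<T>"
    \<comment> \<open>The value 0 beyond index d is a default: \<open>local_solve\<close> asks for a
      polynomial at every natural number.\<close>
    define w' where "w' i = (if i \<le> CARD('n) then w (FC T i) else (\<lambda>x. 0))" for i
    have "(\<lambda>x. w' i x $ j) \<in> polys k" for i j
      using w(1)[of "FC T i" j] mesh_facets_iff T by (auto simp: w'_def polys_zero)
    from local_solve[of T w' "\<mu> T", OF T this] \<mu> T
    show "\<exists>u. (\<forall>i\<le>CARD('n). \<forall>x\<in>FC T i. element.field (v T) (base T) k u i x *v n (FC T i) = w (FC T i) x) \<and>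
      (\<forall>q\<in>poly_sym (v T) (k - 2). (LINT x:T|lebesgue. nsimplex.asm (v T) (element.field (v T) (base T) k u) x \<bullet> q x) = \<mu> T q)"
      by (auto simp: w'_def)
  qed
  from bchoice[OF this] obtain u where u: "\<And>T i x. T \<in> \<T> \<Longrightarrow> i \<le> CARD('n) \<Longrightarrow> x \<in> FC T i \<Longrightarrow> PF u T i x *v n (FC T i) = w (FC T i) x"
    "\<And>T q. T \<in> \<T> \<Longrightarrow> q \<in> poly_sym (v T) (k - 2) \<Longrightarrow> (LINT x:T|lebesgue. AS u T x \<bullet> q x) = \<mu> T q" by blast
  have c: "PF u T i x *v Gr T i = PF u T' i' x *v Gr T i"
    if h: "T \<in> \<T>" "T' \<in> \<T>" "T \<noteq> T'" "i \<le> CARD('n)" "i' \<le> CARD('n)" "FC T' i' = FC T i" "x \<in> FC T i" for T T' i i' x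
  proof -
    obtain s where s: "s \<noteq> 0" "n (FC T i) = s *\<^sub>R Gr T i" by (rule normal_scale[OF h(1,4)]) (rule that)
    have "PF u T i x *v n (FC T i) = PF u T' i' x *v n (FC T i)"
      using u(1)[OF h(1,4,7)] u(1)[OF h(2,5), of x] h(6,7) by simp
    then show ?thesis using s by (simp add: matrix_vector_mult_scaleR)
  qed
  define \<tau> where "\<tau> = (\<lambda>x. \<Sum>T\<in>\<T>. AS u T x)"
  have \<tau>: "\<tau> \<in> Hdiv \<Omega>" "pieces \<tau> u"
    unfolding \<tau>_def by (rule glob_Hdiv; rule c; assumption)+
  have "\<tau> \<in> Sigma_glob \<Omega> \<T> v base k"
    unfolding Sigma_glob_def
  proof (intro CollectI conjI ballI \<tau>(1))
    fix T assume T: "T \<in> \<T>"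
    interpret E: element "v T" "base T" k by (rule cell(1)[OF T])
    show "\<exists>\<sigma>\<in>Sigma_loc (v T) (base T) k. AE x in lebesgue. x \<in> T \<longrightarrow> \<tau> x = \<sigma> x"
      using \<tau>(2) T E.Sigma_loc_field unfolding pieces_def by blast
  qed
  moreover have "has_dofs \<Omega> \<T> v n k \<nu> \<mu> \<tau>"
    unfolding has_dofs_def
  proof (intro conjI ballI)
    fix F q assume F: "F \<in> mesh_facets \<T>" and "q \<in> poly_vec_on F k"
    then obtain q' where q: "q = (\<lambda>x. indicat_real F x *\<^sub>R q' x)" "\<forall>j. (\<lambda>x. q' x $ j) \<in> polys k"
      unfolding poly_vec_on_def by blast
    obtain T i where T: "T \<in> \<T>" "i \<le> CARD('n)" "F = FC T i" using F mesh_facets_iff by blast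
    obtain s where s: "s \<noteq> 0" "n (FC T i) = s *\<^sub>R Gr T i" "norm (n (FC T i)) = 1" by (rule normal_scale[OF T(1,2)])
    note qc = polys_vec_continuous[OF q(2)]
    have wc: "continuous_on UNIV (w F)" using w(1)[OF F] by (intro polys_vec_continuous) blast
    have "facet_integral F (n F) (\<lambda>x. normal_trace \<Omega> \<tau> (n F) x \<bullet> q x)
      = nsimplex.FI (v T) i (\<lambda>x. indicator F x * ((PF u T i x *v n F) \<bullet> q' x)) / \<bar>s\<bar>"
      unfolding q(1) T(3) by (rule facet_dof[OF \<tau> T(1,2) s qc])
    also have "(\<lambda>x. indicator F x * ((PF u T i x *v n F) \<bullet> q' x)) = (\<lambda>x. indicator F x * (w F x \<bullet> q' x))"
      using u(1)[OF T(1,2)] T(3) by (auto simp: indicator_def)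
    also have "nsimplex.FI (v T) i \<dots> / \<bar>s\<bar> = facet_integral F (n F) (\<lambda>x. w F x \<bullet> q' x)"
      unfolding T(3) by (rule facet_integral_eq[OF T(1,2) s continuous_on_inner[OF wc[unfolded T(3)] qc] refl, symmetric])
    also have "\<dots> = \<nu> F q" unfolding q(1) by (rule w(2)[OF F q(2)])
    finally show "facet_integral F (n F) (\<lambda>x. normal_trace \<Omega> \<tau> (n F) x \<bullet> q x) = \<nu> F q" .
  next
    fix T q assume T: "T \<in> \<T>" and q: "q \<in> poly_sym (v T) (k - 2)"
    show "(LINT x:T|lebesgue. \<tau> x \<bullet> q x) = \<mu> T q"
      using moment_eq[OF \<tau>(2) T q] u(2)[OF T q] by simp
  qed
  ultimately show ?thesis by blast
qed

end

theorem corollary4p9: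
  fixes \<Omega> :: "(real^'n) set"
    and \<T> :: "(real^'n) set set"
    and v :: "(real^'n) set \<Rightarrow> nat \<Rightarrow> real^'n"
    and base :: "(real^'n) set \<Rightarrow> nat set \<Rightarrow> nat"
    and n :: "(real^'n) set \<Rightarrow> real^'n"
    and k :: nat
  assumes d: "CARD('n) \<ge> 2" and k: "k \<ge> 2"
    and domain: "polyhedral_domain \<Omega>"
    and mesh: "triangulates \<T> \<Omega>"
    and vertices: "\<forall>T\<in>\<T>. bij_betw (v T) {..CARD('n)} {x. x extreme_point_of T}"
    and base: "\<forall>T\<in>\<T>. \<forall>f. f \<subseteq> {..CARD('n)} \<and> f \<noteq> {} \<longrightarrow> base T f \<in> f"
    and normals: "\<forall>F\<in>mesh_facets \<T>. unit_normal F (n F)"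
  shows "(\<forall>T\<in>\<T>.
      internal_direct_sum (Sigma_loc (v T) (base T) k)
        (insert Bulk (Phi ` (\<Union>l\<in>{0..CARD('n) - 2}. subsimplices CARD('n) l)))
        (\<lambda>s. case s of Bulk \<Rightarrow> poly_sym (v T) k
           | Normal f \<Rightarrow> bubble_normal (v T) k f
           | Phi f \<Rightarrow> bubble_phi (v T) (base T) k f) \<and>
      internal_direct_sum (Sigma_loc (v T) (base T) k)
        (insert Bulk (\<Union>l\<in>{0..CARD('n) - 1}.
           Normal ` subsimplices CARD('n) l \<union> Phi ` subsimplices CARD('n) l))
        (\<lambda>s. case s of Bulk \<Rightarrow> bubble_div (v T) k
           | Normal f \<Rightarrow> bubble_normal (v T) k f
           | Phi f \<Rightarrow> bubble_phi (v T) (base T) k f) \<and>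
      real (dim (Sigma_loc (v T) (base T) k)) =
        1/2 * real CARD('n) * (real CARD('n) + 1) * real ((k + CARD('n)) choose CARD('n)) +
        1/2 * real CARD('n) * (real CARD('n) + 1) *
          real ((k + CARD('n) - 2) choose (CARD('n) - 2))) \<and>
    (\<forall>\<nu> \<mu>.
      (\<forall>F\<in>mesh_facets \<T>. linear (\<nu> F)) \<and> (\<forall>T\<in>\<T>. linear (\<mu> T)) \<longrightarrow>
      (\<exists>\<tau>\<in>Sigma_glob \<Omega> \<T> v base k. has_dofs \<Omega> \<T> v n k \<nu> \<mu> \<tau> \<and>
        (\<forall>\<tau>'\<in>Sigma_glob \<Omega> \<T> v base k. has_dofs \<Omega> \<T> v n k \<nu> \<mu> \<tau>' \<longrightarrow>
          (AE x in lebesgue. x \<in> \<Omega> \<longrightarrow> \<tau>' x = \<tau> x))))"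
proof -
  interpret mesh \<Omega> \<T> v base n k by (rule mesh.intro) (fact assms)+
  show ?thesis
  proof (intro conjI ballI allI impI)
    fix T assume "T \<in> \<T>"
    then interpret E: element "v T" "base T" k by (rule cell(1))
    show "internal_direct_sum (Sigma_loc (v T) (base T) k)
        (insert Bulk (Phi ` (\<Union>l\<in>{0..CARD('n) - 2}. subsimplices CARD('n) l)))
        (\<lambda>s. case s of Bulk \<Rightarrow> poly_sym (v T) k
           | Normal f \<Rightarrow> bubble_normal (v T) k f
           | Phi f \<Rightarrow> bubble_phi (v T) (base T) k f)"
      by (rule E.direct_sum_split)
    show "internal_direct_sum (Sigma_loc (v T) (base T) k)
        (insert Bulk (\<Union>l\<in>{0..CARD('n) - 1}.
           Normal ` subsimplices CARD('n) l \<union> Phi ` subsimplices CARD('n) l))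
        (\<lambda>s. case s of Bulk \<Rightarrow> bubble_div (v T) k
           | Normal f \<Rightarrow> bubble_normal (v T) k f
           | Phi f \<Rightarrow> bubble_phi (v T) (base T) k f)"
      by (rule E.direct_sum_normal[OF E.bubble_div_eq])
    show "real (dim (Sigma_loc (v T) (base T) k)) =
        1/2 * real CARD('n) * (real CARD('n) + 1) * real ((k + CARD('n)) choose CARD('n)) +
        1/2 * real CARD('n) * (real CARD('n) + 1) *
          real ((k + CARD('n) - 2) choose (CARD('n) - 2))"
      by (rule E.dim_Sigma_loc)
  next
    fix \<nu> :: "(real^'n) set \<Rightarrow> (real^'n \<Rightarrow> real^'n) \<Rightarrow> real"
      and \<mu> :: "(real^'n) set \<Rightarrow> (real^'n \<Rightarrow> real^'n^'n) \<Rightarrow> real"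
    assume "(\<forall>F\<in>mesh_facets \<T>. linear (\<nu> F)) \<and> (\<forall>T\<in>\<T>. linear (\<mu> T))"
    then obtain \<tau> where \<tau>: "\<tau> \<in> Sigma_glob \<Omega> \<T> v base k" "has_dofs \<Omega> \<T> v n k \<nu> \<mu> \<tau>"
      using existence by blast
    show "\<exists>\<tau>\<in>Sigma_glob \<Omega> \<T> v base k. has_dofs \<Omega> \<T> v n k \<nu> \<mu> \<tau> \<and>
        (\<forall>\<tau>'\<in>Sigma_glob \<Omega> \<T> v base k. has_dofs \<Omega> \<T> v n k \<nu> \<mu> \<tau>' \<longrightarrow>
          (AE x in lebesgue. x \<in> \<Omega> \<longrightarrow> \<tau>' x = \<tau> x))"
      using \<tau> uniqueness[OF \<tau>] by blast
  qed
qed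

end
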